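(* Let $X$ be a $\mu$-symmetric Hunt process on $E$ with semigroup $\{p_t\}_{t>0}$. Assume that $X$ satisfies the following three conditions: I. (Semigroup strong Feller) for any $t>0$, $p_t(\mathcal{B}_b(E))\subset C_b(E)$; II. (Tightness property) $\lim_{x\to\partial}R_1\mathbf{1}_E(x)=0$; III. (Local $L^\infty$-compactness) for any $t>0$ and any open subset $U\subset E$ with $\mu(U)<\infty$, $p_t^U$ is a compact operator on $L^\infty(U,\mu)$. For $1\le p\le\infty$ let $(\mathcal{L}^p,D(\mathcal{L}^p))$ be the generator of $\{p_t\}_{t>0}$ on $L^p(E,\mu)$. Then: (i) for any $1\le p\le\infty$ and $t>0$, $p_t$ is a compact operator on $L^p(E,\mu)$; (ii) the spectra of $(\mathcal{L}^p,D(\mathcal{L}^p))$ are independent of $p\in[1,\infty]$, and the eigenfunctions of $(\mathcal{L}^2,D(\mathcal{L}^2))$ belong to $L^p(E,\mu)$ for any $1\le p\le\infty$.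
   Context: $E$ is a locally compact separable metric space, $\mu$ is a positive Radon measure on $E$ with full topological support, and $E_\partial=E\cup\{\partial\}$ is the one-point compactification of $E$; functions $u$ on $E$ are extended to $E_\partial$ by $u(\partial)=0$. $X=(\{X_t\}_{t\ge0},\{P_x\}_{x\in E},\zeta)$ is a $\mu$-symmetric Hunt process on $E$ with life time $\zeta$; $E_x$ is expectation with respect to $P_x$. $\mathcal{B}_b(E)$ is the space of bounded Borel measurable functions on $E$, $C_b(E)$ the space of bounded continuous functions on $E$, and $\mathbf{1}_E$ the indicator function of $E$. For $f\in\mathcal{B}_b(E)$ and $x\in E$, $p_tf(x)=E_x[f(X_t)]=E_x[f(X_t):t<\zeta]$ and $R_\alpha f(x)=E_x[\int_0^\zeta e^{-\alpha t}f(X_t)\,dt]$. By the symmetry and the Markov property of $\{p_t\}_{t>0}$, $\{p_t\}_{t>0}$ and $\{R_\alpha\}_{\alpha>0}$ extend canonically to operators on $L^p(E,\mu)$ for any $1\le p\le\infty$, denoted by the same symbols; by symmetry, $p_t$ on $L^\infty(E,\mu)$ is regarded as the dual operator of $p_t$ on $L^1(E,\mu)$. For an open set $U\subset E$, $\tau_U=\inf\{t>0\mid X_t\notin U\}$ (with $\inf\emptyset=\infty$), and $p_t^Uf(x)=E_x[f(X_t):t<\tau_U]$ is the semigroup of the part process of $X$ on $U$ (the process equal to $X_t$ for $t<\tau_U$ and to $\partial$ for $t\ge\tau_U$); it is symmetric with respect to $\mu$ restricted to $U$ and likewise extends to operators on $L^p(U,\mu)$, $1\le p\le\infty$, denoted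 by the same symbols. *)

theory Defs
  imports "HOL-Probability.Probability"
begin

text \<open>
  The state space is a type \<open>'a\<close>.  Its one-point compactification lives on \<open>'a option\<close>,
  with \<open>None\<close> in the role of the cemetery point; if \<open>'a\<close> is already compact, \<open>None\<close> is isolated.
\<close>

abbreviation cemetery_topology :: "'a::topological_space option topology" where
  "cemetery_topology \<equiv> Alexandroff_compactification euclidean"

definition cemetery_borel :: "'a::topological_space option measure" where
  "cemetery_borel = sigma UNIV {U. openin cemetery_topology U}"

definition extend_zero :: "('a \<Rightarrow> 'b::zero) \<Rightarrow> 'a option \<Rightarrow> 'b" where
  "extend_zero u y = (case y of None \<Rightarrow> 0 | Some x \<Rightarrow> u x)"

definition radon_measure :: "'a::topological_space measure \<Rightarrow> bool" where
  "radon_measure \<mu> \<longleftrightarrow> sets \<mu> = sets borel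
     \<and> (\<forall>K. compact K \<longrightarrow> emeasure \<mu> K < \<infinity>)
     \<and> (\<forall>A\<in>sets borel. emeasure \<mu> A = (SUP K\<in>{K. compact K \<and> K \<subseteq> A \<and> K \<in> sets borel}. emeasure \<mu> K))"

definition full_support :: "'a::topological_space measure \<Rightarrow> bool" where
  "full_support \<mu> \<longleftrightarrow> (\<forall>U. open U \<longrightarrow> U \<noteq> {} \<longrightarrow> emeasure \<mu> U > 0)"


section \<open>Hunt processes\<close>

text \<open>
  Time runs through \<open>[0,\<infinity>]\<close>, with \<open>X\<^sub>\<infinity> = \<partial>\<close>.  This lets stopping times be \<open>ennreal\<close>-valued and
  makes \<open>X\<^sub>\<sigma>\<close> meaningful on \<open>{\<sigma> = \<infinity>}\<close>.
\<close>

definition lifetime :: "(ennreal \<Rightarrow> 'w \<Rightarrow> 'a option) \<Rightarrow> 'w \<Rightarrow> ennreal" where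
  "lifetime X \<omega> = Inf {t. X t \<omega> = None}"

definition admissible_filtration ::
    "'w measure \<Rightarrow> (ennreal \<Rightarrow> 'w \<Rightarrow> 'a::topological_space option) \<Rightarrow> (ennreal \<Rightarrow> 'w measure) \<Rightarrow> bool" where
  "admissible_filtration M X F \<longleftrightarrow>
     filtration (space M) F \<and>
     (\<forall>t. sets (F t) \<subseteq> sets M) \<and>
     (\<forall>s t. s \<le> t \<longrightarrow> X s \<in> F t \<rightarrow>\<^sub>M cemetery_borel) \<and>
     (\<forall>t<\<infinity>. sets (F t) = (\<Inter>u\<in>{t<..}. sets (F u)))"

text \<open>The simple Markov property is the case of a constant \<open>\<sigma>\<close>.\<close>

definition strong_markov ::
    "'w measure \<Rightarrow> (ennreal \<Rightarrow> 'w \<Rightarrow> 'a::topological_space option) \<Rightarrow> ('a option \<Rightarrow> 'w measure)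
      \<Rightarrow> (ennreal \<Rightarrow> 'w measure) \<Rightarrow> bool" where
  "strong_markov M X P F \<longleftrightarrow>
     (\<forall>\<sigma> y s B. stopping_time F \<sigma> \<longrightarrow> B \<in> sets cemetery_borel \<longrightarrow>
        (AE \<omega> in P y.
           real_cond_exp (P y) (filtration.pre_sigma (space M) F \<sigma>) (\<lambda>\<omega>'. indicator B (X (\<sigma> \<omega>' + s) \<omega>')) \<omega>
             = measure (P (X (\<sigma> \<omega>) \<omega>)) {\<omega>'\<in>space M. X s \<omega>' \<in> B}))"

definition quasi_left_continuous ::
    "'w measure \<Rightarrow> (ennreal \<Rightarrow> 'w \<Rightarrow> 'a::topological_space option) \<Rightarrow> ('a option \<Rightarrow> 'w measure)
      \<Rightarrow> (ennreal \<Rightarrow> 'w measure) \<Rightarrow> bool" where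
  "quasi_left_continuous M X P F \<longleftrightarrow>
     (\<forall>\<sigma> y. (\<forall>n::nat. stopping_time F (\<sigma> n)) \<longrightarrow> (\<forall>\<omega>\<in>space M. incseq (\<lambda>n. \<sigma> n \<omega>)) \<longrightarrow>
        (AE \<omega> in P y. (SUP n. \<sigma> n \<omega>) < \<infinity> \<longrightarrow>
           limitin cemetery_topology (\<lambda>n. X (\<sigma> n \<omega>) \<omega>) (X (SUP n. \<sigma> n \<omega>) \<omega>) sequentially))"

text \<open>
  Only the \<open>\<sigma>\<close>-algebra of \<open>M\<close> matters; the laws \<open>P y\<close> are probability measures on it, for starting
  points \<open>y\<close> in the compactified state space.
\<close>

locale hunt_process =
  fixes M :: "'w measure"
    and X :: "ennreal \<Rightarrow> 'w \<Rightarrow> 'a::{metric_space, second_countable_topology} option"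
    and P :: "'a option \<Rightarrow> 'w measure"
  assumes prob_space_P: "\<And>y. prob_space (P y)"
    and sets_P: "\<And>y. sets (P y) = sets M"
    and X_measurable: "\<And>t. X t \<in> M \<rightarrow>\<^sub>M cemetery_borel"
    and X_infinity: "\<And>\<omega>. \<omega> \<in> space M \<Longrightarrow> X \<infinity> \<omega> = None"
    and transition_measurable:
      "\<And>t B. B \<in> sets borel \<Longrightarrow>
         (\<lambda>x. measure (P (Some x)) {\<omega>\<in>space M. X t \<omega> \<in> Some ` B}) \<in> borel_measurable borel"
    and normal: "\<And>x. AE \<omega> in P (Some x). X 0 \<omega> = Some x"
    and cemetery_trap: "\<And>t. AE \<omega> in P None. X t \<omega> = None"
    and dead_after_lifetime: "\<And>\<omega> t. \<omega> \<in> space M \<Longrightarrow> lifetime X \<omega> \<le> t \<Longrightarrow> X t \<omega> = None"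
    and shift: "\<exists>\<theta>. \<forall>t. \<forall>\<omega>\<in>space M. \<theta> t \<omega> \<in> space M \<and> (\<forall>s. X s (\<theta> t \<omega>) = X (s + t) \<omega>)"
    and right_continuous: "\<And>\<omega> t. \<omega> \<in> space M \<Longrightarrow> t < \<infinity> \<Longrightarrow>
      limitin cemetery_topology (\<lambda>s. X s \<omega>) (X t \<omega>) (at_right t)"
    and left_limits: "\<And>\<omega> t. \<omega> \<in> space M \<Longrightarrow> 0 < t \<Longrightarrow> t < \<infinity> \<Longrightarrow>
      \<exists>y. limitin cemetery_topology (\<lambda>s. X s \<omega>) y (at_left t)"
    and strong_markov_quasi_left_continuous:
      "\<exists>F. admissible_filtration M X F \<and> strong_markov M X P F \<and> quasi_left_continuous M X P F"


section \<open>Semigroup, resolvent and part semigroup\<close>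

text \<open>
  The same formula gives the extension of the semigroup to \<open>L\<^sup>p\<close>: for \<open>f\<close> in \<open>L\<^sup>p(\<mu>)\<close>, symmetry makes
  the integral converge for \<open>\<mu>\<close>-almost every \<open>x\<close> and the result independent, up to a null set, of
  the representative of \<open>f\<close>.
\<close>

definition transition_op ::
    "(ennreal \<Rightarrow> 'w \<Rightarrow> 'a option) \<Rightarrow> ('a option \<Rightarrow> 'w measure) \<Rightarrow> real
      \<Rightarrow> ('a \<Rightarrow> 'b::{banach, second_countable_topology}) \<Rightarrow> 'a \<Rightarrow> 'b" where
  "transition_op X P t f x = (LINT \<omega>|P (Some x). extend_zero f (X (ennreal t) \<omega>))"

definition resolvent_op ::
    "(ennreal \<Rightarrow> 'w \<Rightarrow> 'a option) \<Rightarrow> ('a option \<Rightarrow> 'w measure) \<Rightarrow> real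
      \<Rightarrow> ('a \<Rightarrow> real) \<Rightarrow> 'a \<Rightarrow> real" where
  "resolvent_op X P \<alpha> f x =
     (LINT \<omega>|P (Some x). (LINT t:{t. 0 \<le> t \<and> ennreal t < lifetime X \<omega>}|lborel.
        exp (- \<alpha> * t) * extend_zero f (X (ennreal t) \<omega>)))"

definition exit_time :: "(ennreal \<Rightarrow> 'w \<Rightarrow> 'a option) \<Rightarrow> 'a set \<Rightarrow> 'w \<Rightarrow> ennreal" where
  "exit_time X U \<omega> = Inf {t. 0 < t \<and> X t \<omega> \<notin> Some ` U}"

text \<open>
  The event \<open>{t < \<tau>\<^sub>U}\<close> is in general measurable only up to null sets of \<open>P\<^sub>x\<close>,
  hence the completion.
\<close>

definition part_transition_op ::
    "(ennreal \<Rightarrow> 'w \<Rightarrow> 'a option) \<Rightarrow> ('a option \<Rightarrow> 'w measure) \<Rightarrow> 'a set \<Rightarrow> real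
      \<Rightarrow> ('a \<Rightarrow> 'b::{banach, second_countable_topology}) \<Rightarrow> 'a \<Rightarrow> 'b" where
  "part_transition_op X P U t f x =
     (LINT \<omega>:{\<omega>. ennreal t < exit_time X U \<omega>}|completion (P (Some x)). extend_zero f (X (ennreal t) \<omega>))"

definition symmetric_process ::
    "'a::topological_space measure \<Rightarrow> (ennreal \<Rightarrow> 'w \<Rightarrow> 'a option) \<Rightarrow> ('a option \<Rightarrow> 'w measure) \<Rightarrow> bool" where
  "symmetric_process \<mu> X P \<longleftrightarrow>
     (\<forall>t>0. \<forall>f\<in>borel_measurable borel. \<forall>g\<in>borel_measurable borel.
        (\<integral>\<^sup>+x. (\<integral>\<^sup>+\<omega>. extend_zero f (X (ennreal t) \<omega>) \<partial>P (Some x)) * g x \<partial>\<mu>)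
          = (\<integral>\<^sup>+x. f x * (\<integral>\<^sup>+\<omega>. extend_zero g (X (ennreal t) \<omega>) \<partial>P (Some x)) \<partial>\<mu>))"


section \<open>Complex \<open>L\<^sup>p\<close> spaces and operators on them\<close>

text \<open>
  Elements of \<open>L\<^sup>p\<close> are handled through representatives, with equality \<open>M\<close>-almost everywhere;
  the exponent ranges over \<open>1 \<le> p \<le> \<infinity>\<close>.
\<close>

definition Lp_space :: "ennreal \<Rightarrow> 'a measure \<Rightarrow> ('a \<Rightarrow> complex) set" where
  "Lp_space p M = {f \<in> borel_measurable M.
     if p = \<infinity> then esssup M (\<lambda>x. ennreal (norm (f x))) < \<infinity>
     else integrable M (\<lambda>x. norm (f x) powr enn2real p)}"

definition Lp_norm :: "ennreal \<Rightarrow> 'a measure \<Rightarrow> ('a \<Rightarrow> complex) \<Rightarrow> real" where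
  "Lp_norm p M f =
     (if p = \<infinity> then enn2real (esssup M (\<lambda>x. ennreal (norm (f x))))
      else (LINT x|M. norm (f x) powr enn2real p) powr (1 / enn2real p))"

definition Lp_operator :: "ennreal \<Rightarrow> 'a measure \<Rightarrow> (('a \<Rightarrow> complex) \<Rightarrow> 'a \<Rightarrow> complex) \<Rightarrow> bool" where
  "Lp_operator p M T \<longleftrightarrow>
     (\<forall>f\<in>Lp_space p M. T f \<in> Lp_space p M) \<and>
     (\<forall>f\<in>Lp_space p M. \<forall>g\<in>Lp_space p M. (AE x in M. f x = g x) \<longrightarrow> (AE x in M. T f x = T g x)) \<and>
     (\<forall>f\<in>Lp_space p M. \<forall>g\<in>Lp_space p M. AE x in M. T (\<lambda>y. f y + g y) x = T f x + T g x) \<and>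
     (\<forall>c. \<forall>f\<in>Lp_space p M. AE x in M. T (\<lambda>y. c * f y) x = c * T f x)"

definition Lp_compact_operator ::
    "ennreal \<Rightarrow> 'a measure \<Rightarrow> (('a \<Rightarrow> complex) \<Rightarrow> 'a \<Rightarrow> complex) \<Rightarrow> bool" where
  "Lp_compact_operator p M T \<longleftrightarrow> Lp_operator p M T \<and>
     (\<forall>f. (\<forall>n::nat. f n \<in> Lp_space p M \<and> Lp_norm p M (f n) \<le> 1) \<longrightarrow>
        (\<exists>g\<in>Lp_space p M. \<exists>r::nat \<Rightarrow> nat. strict_mono r \<and>
           (\<lambda>n. Lp_norm p M (\<lambda>x. T (f (r n)) x - g x)) \<longlonglongrightarrow> 0))"

text \<open>
  Graph of the generator of a semigroup on \<open>L\<^sup>p\<close>.  For \<open>p < \<infinity>\<close> it is the usual norm limit.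
  On \<open>L\<^sup>\<infinity>\<close> the semigroup is the dual of the one on \<open>L\<^sup>1\<close> and is in general not strongly
  continuous, so the limit is taken in the weak-* topology; this is the standard generator of a
  dual semigroup, and it coincides with the adjoint of the generator on \<open>L\<^sup>1\<close>.
\<close>

definition Lp_generator ::
    "ennreal \<Rightarrow> 'a measure \<Rightarrow> (real \<Rightarrow> ('a \<Rightarrow> complex) \<Rightarrow> 'a \<Rightarrow> complex)
      \<Rightarrow> (('a \<Rightarrow> complex) \<times> ('a \<Rightarrow> complex)) set" where
  "Lp_generator p M T = {(u, v). u \<in> Lp_space p M \<and> v \<in> Lp_space p M \<and>
     (if p = \<infinity> then
        \<forall>g\<in>Lp_space 1 M.
          ((\<lambda>t. LINT x|M. (T t u x - u x) / of_real t * g x) \<longlongrightarrow> (LINT x|M. v x * g x)) (at_right 0)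
      else
        ((\<lambda>t. Lp_norm p M (\<lambda>x. (T t u x - u x) / of_real t - v x)) \<longlongrightarrow> 0) (at_right 0))}"

text \<open>For an operator given by its graph \<open>A\<close>: \<open>z - A\<close> is injective and onto with bounded inverse.\<close>

definition Lp_resolvent_set ::
    "ennreal \<Rightarrow> 'a measure \<Rightarrow> (('a \<Rightarrow> complex) \<times> ('a \<Rightarrow> complex)) set \<Rightarrow> complex set" where
  "Lp_resolvent_set p M A = {z.
     (\<forall>(u, v)\<in>A. (AE x in M. z * u x - v x = 0) \<longrightarrow> (AE x in M. u x = 0)) \<and>
     (\<forall>f\<in>Lp_space p M. \<exists>(u, v)\<in>A. AE x in M. z * u x - v x = f x) \<and>
     (\<exists>C. \<forall>(u, v)\<in>A. Lp_norm p M u \<le> C * Lp_norm p M (\<lambda>x. z * u x - v x))}"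

definition Lp_spectrum ::
    "ennreal \<Rightarrow> 'a measure \<Rightarrow> (('a \<Rightarrow> complex) \<times> ('a \<Rightarrow> complex)) set \<Rightarrow> complex set" where
  "Lp_spectrum p M A = - Lp_resolvent_set p M A"

definition Lp_eigenfunction ::
    "'a measure \<Rightarrow> (('a \<Rightarrow> complex) \<times> ('a \<Rightarrow> complex)) set \<Rightarrow> ('a \<Rightarrow> complex) \<Rightarrow> bool" where
  "Lp_eigenfunction M A u \<longleftrightarrow> \<not> (AE x in M. u x = 0) \<and>
     (\<exists>z v. (u, v) \<in> A \<and> (AE x in M. v x = z * u x))"


section \<open>The three conditions\<close>

definition strong_feller ::
    "(ennreal \<Rightarrow> 'w \<Rightarrow> 'a::topological_space option) \<Rightarrow> ('a option \<Rightarrow> 'w measure) \<Rightarrow> bool" where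
  "strong_feller X P \<longleftrightarrow>
     (\<forall>t>0. \<forall>f::'a \<Rightarrow> real. f \<in> borel_measurable borel \<longrightarrow> bounded (range f) \<longrightarrow>
        continuous_on UNIV (transition_op X P t f) \<and> bounded (range (transition_op X P t f)))"

definition tightness_property ::
    "(ennreal \<Rightarrow> 'w \<Rightarrow> 'a::topological_space option) \<Rightarrow> ('a option \<Rightarrow> 'w measure) \<Rightarrow> bool" where
  "tightness_property X P \<longleftrightarrow>
     (extend_zero (resolvent_op X P 1 (\<lambda>_. 1)) \<longlongrightarrow> 0) (atin cemetery_topology None)"

definition local_Linfty_compactness ::
    "'a::topological_space measure \<Rightarrow> (ennreal \<Rightarrow> 'w \<Rightarrow> 'a option) \<Rightarrow> ('a option \<Rightarrow> 'w measure) \<Rightarrow> bool" where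
  "local_Linfty_compactness \<mu> X P \<longleftrightarrow>
     (\<forall>t>0. \<forall>U. open U \<longrightarrow> emeasure \<mu> U < \<infinity> \<longrightarrow>
        Lp_compact_operator \<infinity> (restrict_space \<mu> U) (part_transition_op X P U t))"

end

theory Submission
  imports Defs "HOL-Library.Function_Algebras" "HOL-Library.Diagonal_Subsequence"
begin

text \<open>
  By tightness the process rarely survives for a time \<open>t\<close> after leaving a large compact set \<open>C\<close>, so
  \<open>p\<^sub>2\<^sub>t\<close> is a uniform limit of the operators \<open>p\<^sub>t\<^sup>U p\<^sub>t\<close> with \<open>U\<close> a neighbourhood of \<open>C\<close> of finite
  measure, and hence compact on \<open>L\<^sup>\<infinity>\<close>. Duality transfers compactness to \<open>L\<^sup>1\<close>, and a truncation
  argument together with Jensen's inequality transfers it to every \<open>L\<^sup>p\<close>.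

  The resolvent \<open>R = R\<^sub>1\<close> satisfies \<open>R = h A\<^sub>h + e\<^sup>-\<^sup>h R p\<^sub>h\<close> with a contraction \<open>A\<^sub>h\<close>, so it is
  compact as well, and \<open>(u, v)\<close> lies in the graph of the generator iff \<open>u = R (u - v)\<close>. By the
  Fredholm alternative, \<open>z\<close> is in the resolvent set iff \<open>w = (1 - z) R w\<close> has only the trivial
  solution in \<open>L\<^sup>p\<close>. All such solutions lie in \<open>L\<^sup>1 \<inter> L\<^sup>\<infinity>\<close>, which makes this condition independent of \<open>p\<close>.
\<close>

text \<open>The semigroup at a fixed time, its short-time averages and the resolvent are all treated
  as symmetric sub-Markov kernels acting on representatives. Linearity then holds only almost
  everywhere, which is why the Fredholm theory is built for a seminorm. Tightness is a statement
  about the resolvent of 1; it controls survival at a fixed time through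
  \<open>t * exp (- t) * P(t < \<zeta>) \<le> R\<^sub>1 1\<close>. The obstacle is
  \<open>L\<^sup>\<infinity>\<close>, where the semigroup is in general not strongly continuous and
  the generator is a weak-* limit. Difference quotients are therefore expressed through the averages
  \<open>A\<^sub>h\<close>, and on \<open>L\<^sup>\<infinity>\<close> symmetry moves
  \<open>A\<^sub>h\<close> onto the \<open>L\<^sup>1\<close> test function, where it converges in
  norm. The measure may be infinite, so the spaces \<open>L\<^sup>p\<close> are not nested and
  eigenspaces for different exponents cannot be compared directly. Functions that are both
  integrable and bounded are the common ground: they lie in every \<open>L\<^sup>p\<close>, are
  preserved by the kernels, and separate the elements of each \<open>L\<^sup>p\<close> by
  duality.\<close>

lemma tendsto_zero_squeeze:
  fixes f g :: "nat \<Rightarrow> real"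
  assumes "g \<longlonglongrightarrow> 0" "\<And>n. 0 \<le> f n" "\<And>n. f n \<le> g n"
  shows "f \<longlonglongrightarrow> 0"
  by (rule real_tendsto_sandwich[OF _ _ tendsto_const assms(1)]) (use assms in auto)

section \<open>The Fredholm alternative\<close>

text \<open>\<open>q\<close> is only a seminorm and \<open>K\<close> is linear only up to \<open>q\<close>-null vectors, so that representatives of
  elements of \<open>L\<^sup>p\<close> can be used directly.\<close>

locale compact_operator_on =
  fixes S :: "'v::real_vector set" and q :: "'v \<Rightarrow> real" and K :: "'v \<Rightarrow> 'v"
  assumes S_subspace: "subspace S"
    and q_triangle: "\<And>x y. x \<in> S \<Longrightarrow> y \<in> S \<Longrightarrow> q (x + y) \<le> q x + q y"
    and q_scale: "\<And>x c. x \<in> S \<Longrightarrow> q (c *\<^sub>R x) = \<bar>c\<bar> * q x"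
    and K_S: "\<And>x. x \<in> S \<Longrightarrow> K x \<in> S"
    and K_add: "\<And>x y. x \<in> S \<Longrightarrow> y \<in> S \<Longrightarrow> q (K (x + y) - (K x + K y)) = 0"
    and K_scale: "\<And>x c. x \<in> S \<Longrightarrow> q (K (c *\<^sub>R x) - c *\<^sub>R K x) = 0"
    and K_compact: "\<And>f. (\<And>n::nat. f n \<in> S) \<Longrightarrow> (\<And>n. q (f n) \<le> 1) \<Longrightarrow>
      \<exists>g\<in>S. \<exists>r::nat \<Rightarrow> nat. strict_mono r \<and> (\<lambda>n. q (K (f (r n)) - g)) \<longlonglongrightarrow> 0"
begin

lemma K_compactE:
  assumes "\<And>n::nat. f n \<in> S" "\<And>n. q (f n) \<le> 1"
  obtains g r where "g \<in> S" "strict_mono (r::nat \<Rightarrow> nat)" "(\<lambda>n. q (K (f (r n)) - g)) \<longlonglongrightarrow> 0"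
proof -
  from K_compact[OF assms] obtain g where
    g: "g \<in> S" "\<exists>r::nat \<Rightarrow> nat. strict_mono r \<and> (\<lambda>n. q (K (f (r n)) - g)) \<longlonglongrightarrow> 0" ..
  from g(2) obtain r :: "nat \<Rightarrow> nat" where
    "strict_mono r \<and> (\<lambda>n. q (K (f (r n)) - g)) \<longlonglongrightarrow> 0" ..
  with g(1) that[of g r] show thesis by simp
qed

lemma S_simps [simp, intro]:
  "x \<in> S \<Longrightarrow> y \<in> S \<Longrightarrow> x + y \<in> S"
  "x \<in> S \<Longrightarrow> y \<in> S \<Longrightarrow> x - y \<in> S"
  "x \<in> S \<Longrightarrow> c *\<^sub>R x \<in> S"
  "0 \<in> S"
  using S_subspace by (auto simp: subspace_add subspace_diff subspace_scale subspace_0)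

lemma q_minus: "x \<in> S \<Longrightarrow> q (- x) = q x"
  using q_scale[of x "-1"] by simp

lemma q_0: "q 0 = 0"
  using q_scale[of 0 0] by simp

lemma q_nonneg: "x \<in> S \<Longrightarrow> 0 \<le> q x"
  using q_triangle[of x "- x"] q_minus[of x] S_simps(3)[of x "-1"] q_0 by simp

lemma q_commute: "x \<in> S \<Longrightarrow> y \<in> S \<Longrightarrow> q (x - y) = q (y - x)"
  using q_minus[of "x - y"] by simp

lemma q_diff_triangle: "x \<in> S \<Longrightarrow> y \<in> S \<Longrightarrow> z \<in> S \<Longrightarrow> q (x - z) \<le> q (x - y) + q (y - z)"
  using q_triangle[of "x - y" "y - z"] by simp

lemma q_le_diff: "x \<in> S \<Longrightarrow> y \<in> S \<Longrightarrow> q x \<le> q (x - y) + q y"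
  using q_triangle[of "x - y" y] by simp

lemma q_eqI: "x \<in> S \<Longrightarrow> y \<in> S \<Longrightarrow> q (x - y) = 0 \<Longrightarrow> q x = q y"
  using q_le_diff[of x y] q_le_diff[of y x] q_commute[of x y] by simp

text \<open>An unbounded image of the unit ball would contain vectors \<open>K (x n)\<close> with
  \<open>q (K (x n)) > n\<close>, and no subsequence of these converges. Scaling passes from the
  unit ball to all of \<open>S\<close>, with a separate case for vectors of seminorm 0.\<close>

lemma K_bounded: "\<exists>C\<ge>0. \<forall>x\<in>S. q (K x) \<le> C * q x"
proof -
  have "\<exists>C. \<forall>x\<in>S. q x \<le> 1 \<longrightarrow> q (K x) \<le> C"
  proof (rule ccontr)
    assume "\<not> ?thesis"
    then have "\<forall>n::nat. \<exists>x\<in>S. q x \<le> 1 \<and> q (K x) > real n"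
      by (meson not_le)
    then obtain x where x: "\<And>n. x n \<in> S" "\<And>n. q (x n) \<le> 1" "\<And>n::nat. q (K (x n)) > real n"
      by metis
    obtain g r where g: "g \<in> S" and r: "strict_mono r" and
      lim: "(\<lambda>n. q (K (x (r n)) - g)) \<longlonglongrightarrow> 0"
      by (rule K_compactE[OF x(1,2)])
    from lim have "eventually (\<lambda>n. q (K (x (r n)) - g) < 1) sequentially"
      by (rule order_tendstoD) simp
    then obtain N where N: "\<And>n. n \<ge> N \<Longrightarrow> q (K (x (r n)) - g) < 1"
      by (auto simp: eventually_sequentially)
    obtain k :: nat where "1 + q g < real k" using reals_Archimedean2 by blast
    then obtain n where n: "n \<ge> N" "real n > 1 + q g"
      by (intro that[of "max N k"]) auto
    have "real n \<le> real (r n)" using seq_suble[OF r] by simp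
    moreover have "q (K (x (r n))) \<le> q (K (x (r n)) - g) + q g"
      by (rule q_le_diff) (use K_S x(1) g in auto)
    ultimately show False using x(3)[of "r n"] N[OF n(1)] n(2) by linarith
  qed
  then obtain C where C: "\<And>x. x \<in> S \<Longrightarrow> q x \<le> 1 \<Longrightarrow> q (K x) \<le> C" by blast
  have sc: "q (K (c *\<^sub>R x)) = \<bar>c\<bar> * q (K x)" if "x \<in> S" for c x
  proof -
    have "q (K (c *\<^sub>R x)) = q (c *\<^sub>R K x)"
      by (rule q_eqI) (use that K_S K_scale in auto)
    then show ?thesis using q_scale K_S that by simp
  qed
  have C0: "C \<ge> 0" using C[of 0] q_nonneg[OF K_S[of 0]] q_0 by simp
  have "q (K x) \<le> C * q x" if x: "x \<in> S" for x
  proof (cases "q x = 0")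
    case True
    have "q (K x) \<le> 0"
    proof (rule ccontr)
      assume "\<not> ?thesis"
      then have p: "q (K x) > 0" by simp
      \<comment> \<open>Every multiple of a null vector lies in the unit ball; the factor is chosen
        so that the image has seminorm \<open>C + 1\<close>.\<close>
      have "q (K (((C + 1) / q (K x)) *\<^sub>R x)) \<le> C"
        using C[of "((C + 1) / q (K x)) *\<^sub>R x"] x True q_scale by simp
      with sc[OF x, of "(C + 1) / q (K x)"] p C0 show False by simp
    qed
    with True show ?thesis by simp
  next
    case False
    then have p: "q x > 0" using q_nonneg[OF x] by simp
    have "q (K ((1 / q x) *\<^sub>R x)) \<le> C"
      using C[of "(1 / q x) *\<^sub>R x"] x p q_scale by simp
    with sc[OF x, of "1 / q x"] p have "q (K x) / q x \<le> C" by simp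
    with p show ?thesis by (simp add: pos_divide_le_eq)
  qed
  with C0 show ?thesis by blast
qed

definition A :: "'v \<Rightarrow> 'v" where "A x = x - K x"

lemma A_S [simp, intro]: "x \<in> S \<Longrightarrow> A x \<in> S"
  by (simp add: A_def K_S)

lemma q_null_add: "x \<in> S \<Longrightarrow> y \<in> S \<Longrightarrow> q x = 0 \<Longrightarrow> q y = 0 \<Longrightarrow> q (x + y) = 0"
  using q_triangle[of x y] q_nonneg[of "x + y"] by simp

lemma A_add: assumes "x \<in> S" "y \<in> S" shows "q (A (x + y) - (A x + A y)) = 0"
proof -
  have "A (x + y) - (A x + A y) = - (K (x + y) - (K x + K y))" by (simp add: A_def)
  then show ?thesis using K_add[OF assms] q_minus[of "K (x + y) - (K x + K y)"] K_S assms by simp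
qed

lemma A_scale: assumes "x \<in> S" shows "q (A (c *\<^sub>R x) - c *\<^sub>R A x) = 0"
proof -
  have "A (c *\<^sub>R x) - c *\<^sub>R A x = - (K (c *\<^sub>R x) - c *\<^sub>R K x)" by (simp add: A_def algebra_simps)
  then show ?thesis using K_scale[OF assms] q_minus[of "K (c *\<^sub>R x) - c *\<^sub>R K x"] K_S assms by simp
qed

lemma A_diff: assumes x: "x \<in> S" and y: "y \<in> S" shows "q (A (x - y) - (A x - A y)) = 0"
proof -
  have "q ((A (x + (-1) *\<^sub>R y) - (A x + A ((-1) *\<^sub>R y))) + (A ((-1) *\<^sub>R y) - (-1) *\<^sub>R A y)) = 0"
    by (intro q_null_add A_add A_scale S_simps A_S x y)
  then show ?thesis by (simp add: algebra_simps)
qed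

lemma q_A_diff: "x \<in> S \<Longrightarrow> y \<in> S \<Longrightarrow> q (A (x - y)) = q (A x - A y)"
  by (rule q_eqI) (use A_diff in auto)

lemma q_A_scale: assumes "x \<in> S" shows "q (A (c *\<^sub>R x)) = \<bar>c\<bar> * q (A x)"
proof -
  have "q (A (c *\<^sub>R x)) = q (c *\<^sub>R A x)"
    by (rule q_eqI) (use A_scale assms in auto)
  then show ?thesis using q_scale assms by simp
qed

lemma A_bounded: "\<exists>C\<ge>0. \<forall>x\<in>S. q (A x) \<le> C * q x"
proof -
  obtain C where C: "C \<ge> 0" "\<And>x. x \<in> S \<Longrightarrow> q (K x) \<le> C * q x" using K_bounded by blast
  have "q (A x) \<le> (1 + C) * q x" if "x \<in> S" for x
    using q_triangle[of x "- K x"] q_minus[of "K x"] K_S[OF that] C(2)[OF that] that S_simps(3)[of "K x" "-1"]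
    by (simp add: A_def algebra_simps)
  with C(1) show ?thesis by (intro exI[of _ "1 + C"]) auto
qed

lemma A_tendsto:
  assumes f: "\<And>n. f n \<in> S" and y: "y \<in> S" and lim: "(\<lambda>n. q (f n - y)) \<longlonglongrightarrow> 0"
  shows "(\<lambda>n. q (A (f n) - A y)) \<longlonglongrightarrow> 0"
proof -
  obtain C where C: "C \<ge> 0" "\<And>x. x \<in> S \<Longrightarrow> q (A x) \<le> C * q x" using A_bounded by blast
  show ?thesis
  proof (rule real_tendsto_sandwich[OF _ _ tendsto_const])
    show "eventually (\<lambda>n. 0 \<le> q (A (f n) - A y)) sequentially"
      using f y q_nonneg by auto
    show "eventually (\<lambda>n. q (A (f n) - A y) \<le> C * q (f n - y)) sequentially"
    proof (intro always_eventually allI)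
      fix n
      have "q (A (f n) - A y) = q (A (f n - y))" using f y by (simp add: q_A_diff)
      also have "\<dots> \<le> C * q (f n - y)" using f y by (intro C(2)) simp
      finally show "q (A (f n) - A y) \<le> C * q (f n - y)" .
    qed
    show "(\<lambda>n. C * q (f n - y)) \<longlonglongrightarrow> 0"
      using tendsto_mult_left[OF lim, of C] by simp
  qed
qed

lemma q_limit_unique:
  assumes "\<And>n. f n \<in> S" "x \<in> S" "y \<in> S"
    and "(\<lambda>n. q (f n - x)) \<longlonglongrightarrow> 0" "(\<lambda>n. q (f n - y)) \<longlonglongrightarrow> 0"
  shows "q (x - y) = 0"
proof -
  have "(\<lambda>n. q (f n - x) + q (f n - y)) \<longlonglongrightarrow> 0"
    using tendsto_add[OF assms(4,5)] by simp
  then have "q (x - y) \<le> 0"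
  proof (rule tendsto_lowerbound)
    have "q (x - y) \<le> q (f n - x) + q (f n - y)" for n
      using q_diff_triangle[of x "f n" y] q_commute[of x "f n"] assms(1-3) by simp
    then show "eventually (\<lambda>n. q (x - y) \<le> q (f n - x) + q (f n - y)) sequentially" by simp
  qed simp
  with q_nonneg[of "x - y"] assms show ?thesis by simp
qed

text \<open>Limits with respect to \<open>q\<close> are unique only up to null vectors, so a set
  closed in this sense contains every element of \<open>S\<close> that differs from one of its
  members by a null vector.\<close>

definition qclosed :: "'v set \<Rightarrow> bool" where
  "qclosed R \<longleftrightarrow> (\<forall>f y. (\<forall>n::nat. f n \<in> R) \<longrightarrow> y \<in> S \<longrightarrow> (\<lambda>n. q (f n - y)) \<longlonglongrightarrow> 0 \<longrightarrow> y \<in> R)"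

lemma qclosed_saturated: "qclosed R \<Longrightarrow> x \<in> R \<Longrightarrow> y \<in> S \<Longrightarrow> q (x - y) = 0 \<Longrightarrow> y \<in> R"
  unfolding qclosed_def by (elim allE[of _ "\<lambda>_. x"]) simp

text \<open>\<open>A\<close> is additive only up to null vectors, so the plain image of a subspace
  need not be a subspace. Saturating it by null vectors repairs this.\<close>

definition img :: "'v set \<Rightarrow> 'v set" where
  "img R = {y \<in> S. \<exists>x\<in>R. q (A x - y) = 0}"

section \<open>Injective \<open>A\<close>: lower bound and surjectivity\<close>

context
  assumes A_inj: "\<And>x. x \<in> S \<Longrightarrow> q (A x) = 0 \<Longrightarrow> q x = 0"
begin

text \<open>Normalising a violating sequence gives unit vectors \<open>y n\<close> with
  \<open>A (y n)\<close> tending to 0. Along a subsequence \<open>K (y n)\<close> converges to some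
  \<open>g\<close>, hence so does \<open>y n = A (y n) + K (y n)\<close>. Then \<open>A g\<close> is
  null, so \<open>g\<close> is null by injectivity, although it is a limit of unit vectors.\<close>

lemma A_bounded_below: "\<exists>c\<ge>0. \<forall>x\<in>S. q x \<le> c * q (A x)"
proof (rule ccontr)
  assume "\<not> ?thesis"
  then have "\<forall>n::nat. \<exists>x\<in>S. real n * q (A x) < q x"
    by (metis of_nat_0_le_iff not_le)
  then obtain x where x: "\<And>n. x n \<in> S" "\<And>n::nat. real n * q (A (x n)) < q (x n)" by metis
  have px: "q (x n) > 0" for n
    using x(2)[of n] q_nonneg[of "A (x n)"] x(1)[of n] by (meson A_S less_le_trans mult_nonneg_nonneg not_le of_nat_0_le_iff)
  define y where "y n = (1 / q (x n)) *\<^sub>R x n" for n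
  have yS: "y n \<in> S" for n using x by (simp add: y_def)
  have q1: "q (y n) = 1" for n using px[of n] x(1) by (simp add: y_def q_scale)
  \<comment> \<open>\<open>2 / (n + 1)\<close> is a weakening of \<open>1 / n\<close> that fits the
    standard null sequence.\<close>
  have "q (A (y n)) \<le> inverse (real (Suc n)) * 2" if "n \<ge> 1" for n
  proof -
    have "q (A (y n)) * n < 1"
      using x(2)[of n] px[of n] by (simp add: y_def q_A_scale x(1) field_simps)
    then have "q (A (y n)) < 1 / n" using that by (simp add: field_simps)
    also have "1 / real n \<le> inverse (real (Suc n)) * 2" using that by (simp add: field_simps)
    finally show ?thesis by simp
  qed
  then have "eventually (\<lambda>n. q (A (y n)) \<le> inverse (real (Suc n)) * 2) sequentially"
    by (auto simp: eventually_sequentially)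
  moreover have "(\<lambda>n. inverse (real (Suc n)) * 2) \<longlonglongrightarrow> 0"
    using tendsto_mult_left[OF LIMSEQ_inverse_real_of_nat, of 2] by (simp add: mult.commute)
  ultimately have Ay: "(\<lambda>n. q (A (y n))) \<longlonglongrightarrow> 0"
    by (rule real_tendsto_sandwich[OF _ _ tendsto_const, rotated]) (use yS q_nonneg in auto)
  obtain g r where g: "g \<in> S" and r: "strict_mono r" and
    lim: "(\<lambda>n. q (K (y (r n)) - g)) \<longlonglongrightarrow> 0"
    by (rule K_compactE[OF yS]) (use q1 in auto)
  have "(\<lambda>n. q (A (y (r n))) + q (K (y (r n)) - g)) \<longlonglongrightarrow> 0"
    using tendsto_add[OF LIMSEQ_subseq_LIMSEQ[OF Ay r] lim] by (simp add: o_def)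
  then have yg: "(\<lambda>n. q (y (r n) - g)) \<longlonglongrightarrow> 0"
  proof (rule tendsto_zero_squeeze)
    show "q (y (r n) - g) \<le> q (A (y (r n))) + q (K (y (r n)) - g)" for n
      using q_triangle[of "A (y (r n))" "K (y (r n)) - g"] yS g K_S by (simp add: A_def)
  qed (use yS g q_nonneg in auto)
  have "(\<lambda>n. q (A (y (r n)) - A g)) \<longlonglongrightarrow> 0"
    by (rule A_tendsto[OF _ g yg]) (use yS in auto)
  moreover have "(\<lambda>n. q (A (y (r n)) - 0)) \<longlonglongrightarrow> 0"
    using LIMSEQ_subseq_LIMSEQ[OF Ay r] by (simp add: o_def)
  ultimately have "q (A g - 0) = 0"
    by (rule q_limit_unique[rotated 3]) (use yS g in auto)
  then have "q g = 0" using A_inj g by simp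
  have "1 \<le> q (y (r n) - g)" for n
    using q_le_diff[of "y (r n)" g] q1[of "r n"] \<open>q g = 0\<close> yS g by simp
  with yg have "(1::real) \<le> 0"
    by (intro tendsto_lowerbound[OF yg]) auto
  then show False by simp
qed

text \<open>Only closedness has content. The lower bound for \<open>A\<close> keeps the preimages
  \<open>x n\<close> of a convergent sequence bounded, compactness makes \<open>K (x n)\<close>
  converge along a subsequence, and then \<open>x n = A (x n) + K (x n)\<close> converges inside the
  closed set \<open>R\<close>.\<close>

lemma img_closed:
  assumes R: "subspace R" "R \<subseteq> S" "qclosed R"
  shows "subspace (img R)" "img R \<subseteq> S" "qclosed (img R)"
proof -
  note RS = subsetD[OF R(2)]
  show "img R \<subseteq> S" by (auto simp: img_def)
  show "subspace (img R)"
  proof (rule subspaceI)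
    show "0 \<in> img R"
      using subspace_0[OF R(1)] A_scale[of 0 0] by (auto simp: img_def intro!: bexI[of _ 0])
  next
    fix y z assume "y \<in> img R" "z \<in> img R"
    then obtain a b where ab: "a \<in> R" "b \<in> R" "q (A a - y) = 0" "q (A b - z) = 0" "y \<in> S" "z \<in> S"
      by (auto simp: img_def)
    have "q ((A (a + b) - (A a + A b)) + ((A a - y) + (A b - z))) = 0"
      by (intro q_null_add A_add ab S_simps A_S RS)
    then have "q (A (a + b) - (y + z)) = 0" by (simp add: algebra_simps)
    then show "y + z \<in> img R" using ab subspace_add[OF R(1)] by (auto simp: img_def)
  next
    fix y c assume "y \<in> img R"
    then obtain a where a: "a \<in> R" "q (A a - y) = 0" "y \<in> S" by (auto simp: img_def)
    have "q (c *\<^sub>R (A a - y)) = 0" using a RS by (subst q_scale) auto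
    then have "q ((A (c *\<^sub>R a) - c *\<^sub>R A a) + c *\<^sub>R (A a - y)) = 0"
      using a RS by (intro q_null_add A_scale) auto
    then have "q (A (c *\<^sub>R a) - c *\<^sub>R y) = 0" by (simp add: algebra_simps)
    then show "c *\<^sub>R y \<in> img R" using a subspace_scale[OF R(1)] by (auto simp: img_def)
  qed
  obtain c where c: "c \<ge> 0" "\<And>x. x \<in> S \<Longrightarrow> q x \<le> c * q (A x)" using A_bounded_below by blast
  show "qclosed (img R)"
    unfolding qclosed_def
  proof (intro allI impI)
    fix f y assume f: "\<forall>n::nat. f n \<in> img R" and y: "y \<in> S" and lim: "(\<lambda>n. q (f n - y)) \<longlonglongrightarrow> 0"
    have fS: "f n \<in> S" for n using f by (auto simp: img_def)
    from f have "\<forall>n. \<exists>x\<in>R. q (A x - f n) = 0" by (auto simp: img_def)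
    then obtain x where x: "\<And>n. x n \<in> R" "\<And>n. q (A (x n) - f n) = 0" by metis
    have xS: "x n \<in> S" for n using x RS by auto
    have "Bseq (\<lambda>n. q (f n - y))" using lim by (intro convergent_imp_Bseq) (auto simp: convergent_def)
    then obtain D where D: "\<And>n. q (f n - y) \<le> D" by (auto simp: Bseq_def) (meson abs_ge_self dual_order.trans)
    \<comment> \<open>\<open>c * (D + q y)\<close> bounds the preimages; the added 1 makes
      \<open>B\<close> positive, so that division by \<open>B\<close> brings them into the unit
      ball.\<close>
    define B where "B = c * (D + q y) + 1"
    have "D \<ge> 0" using D[of 0] q_nonneg[of "f 0 - y"] fS y by (meson S_simps(2) order_trans)
    then have B: "B > 0" using c(1) q_nonneg[OF y] by (auto simp: B_def add_nonneg_pos)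
    have xB: "q (x n) \<le> B" for n
    proof -
      have "q (A (x n)) = q (f n)" using q_eqI[OF _ _ x(2)] xS fS by simp
      also have "\<dots> \<le> D + q y" using q_le_diff[OF fS[of n] y] D[of n] by linarith
      finally have "c * q (A (x n)) \<le> c * (D + q y)" using c(1) by (rule mult_left_mono)
      with c(2)[OF xS, of n] show ?thesis by (simp add: B_def)
    qed
    obtain g r where g: "g \<in> S" and r: "strict_mono r" and
      K: "(\<lambda>n. q (K ((1/B) *\<^sub>R x (r n)) - g)) \<longlonglongrightarrow> 0"
    proof (rule K_compactE)
      show "(1/B) *\<^sub>R x n \<in> S" for n using xS by simp
      show "q ((1/B) *\<^sub>R x n) \<le> 1" for n using xB[of n] B xS by (simp add: q_scale)
    qed
    \<comment> \<open>The expected limit of \<open>x = A x + K x\<close>: the first summand tends to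
      \<open>y\<close>, the second to \<open>B *\<^sub>R g\<close>, because \<open>g\<close> is the
      limit of \<open>K\<close> at the rescaled vectors.\<close>
    define w where "w = y + B *\<^sub>R g"
    have wS: "w \<in> S" using y g by (simp add: w_def)
    have bd: "q (x (r n) - w) \<le> B * q (K ((1/B) *\<^sub>R x (r n)) - g) + q (f (r n) - y)" for n
    proof -
      let ?x = "x (r n)" let ?k = "K ((1/B) *\<^sub>R ?x)"
      have [simp]: "?x \<in> S" "f (r n) \<in> S" "?k \<in> S" "K ?x \<in> S" using xS fS K_S by auto
      have e: "q (K ?x - B *\<^sub>R ?k) = 0"
      proof -
        have "q (?k - (1/B) *\<^sub>R K ?x) = 0" by (rule K_scale) simp
        then have "q (B *\<^sub>R (?k - (1/B) *\<^sub>R K ?x)) = 0" by (subst q_scale) auto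
        then have "q (B *\<^sub>R ?k - K ?x) = 0" using B by (simp add: algebra_simps)
        then show ?thesis by (subst q_commute) auto
      qed
      have "?x - w = (A ?x - f (r n)) + ((f (r n) - y) + ((K ?x - B *\<^sub>R ?k) + B *\<^sub>R (?k - g)))"
        by (simp add: w_def A_def algebra_simps)
      also have "q \<dots> \<le> q (A ?x - f (r n)) + (q (f (r n) - y) + (q (K ?x - B *\<^sub>R ?k) + q (B *\<^sub>R (?k - g))))"
        using y g by (intro order_trans[OF q_triangle] add_mono order_refl) auto
      also have "\<dots> = B * q (?k - g) + q (f (r n) - y)"
        using B g by (simp add: x(2) e q_scale)
      finally show ?thesis .
    qed
    have "(\<lambda>n. B * q (K ((1/B) *\<^sub>R x (r n)) - g) + q (f (r n) - y)) \<longlonglongrightarrow> 0"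
      using tendsto_add[OF tendsto_mult_left[OF K, of B] LIMSEQ_subseq_LIMSEQ[OF lim r]] by (simp add: o_def)
    then have xw: "(\<lambda>n. q (x (r n) - w)) \<longlonglongrightarrow> 0"
      by (rule tendsto_zero_squeeze) (use bd xS wS q_nonneg in auto)
    have "w \<in> R" using R(3)[unfolded qclosed_def, rule_format, of "\<lambda>n. x (r n)" w] xw wS x(1) by simp
    moreover have "q (A w - y) = 0"
    proof (rule q_limit_unique)
      show "(\<lambda>n. q (A (x (r n)) - A w)) \<longlonglongrightarrow> 0" by (rule A_tendsto[OF _ wS xw]) (use xS in auto)
      have "q (A (x (r n)) - y) \<le> q (f (r n) - y)" for n
        using q_diff_triangle[of "A (x (r n))" "f (r n)" y] x(2) xS fS y by simp
      then show "(\<lambda>n. q (A (x (r n)) - y)) \<longlonglongrightarrow> 0"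
        by (intro real_tendsto_sandwich[OF _ _ tendsto_const LIMSEQ_subseq_LIMSEQ[OF lim r]])
          (use xS fS y q_nonneg in \<open>auto simp: o_def\<close>)
    qed (use xS wS y in auto)
    ultimately show "y \<in> img R" using y by (auto simp: img_def)
  qed
qed

text \<open>Riesz's lemma. A closed \<open>R'\<close> has positive distance \<open>d\<close> from
  \<open>z\<close>; choose \<open>w\<close> in \<open>R'\<close> with
  \<open>q (z - w) < 2 * d\<close> and normalise \<open>z - w\<close>. The factor 2 is the source of
  the 1/2.\<close>

lemma almost_orthogonal:
  assumes R: "subspace R" "R \<subseteq> S" and R': "subspace R'" "R' \<subseteq> R" "qclosed R'"
    and z: "z \<in> R" "z \<notin> R'"
  shows "\<exists>y\<in>R. q y \<le> 1 \<and> (\<forall>v\<in>R'. 1/2 \<le> q (y - v))"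
proof -
  note RS = subsetD[OF R(2)] and R'R = subsetD[OF R'(2)]
  define d where "d = (INF v\<in>R'. q (z - v))"
  have bdd: "bdd_below ((\<lambda>v. q (z - v)) ` R')"
    using RS R'R z q_nonneg by (intro bdd_belowI[of _ 0]) auto
  have ne: "R' \<noteq> {}" using subspace_0[OF R'(1)] by auto
  have dle: "d \<le> q (z - v)" if "v \<in> R'" for v
    unfolding d_def using bdd that by (rule cINF_lower)
  have "d > 0"
  proof (rule ccontr)
    assume "\<not> d > 0"
    have "\<exists>v\<in>R'. q (z - v) < inverse (real (Suc n))" for n
    proof -
      have "(INF v\<in>R'. q (z - v)) < inverse (real (Suc n))"
        using \<open>\<not> d > 0\<close> unfolding d_def by (smt (verit) inverse_positive_iff_positive of_nat_0_less_iff zero_less_Suc)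
      then show ?thesis using cINF_less_iff[OF ne bdd] by auto
    qed
    then obtain v where v: "\<And>n. v n \<in> R'" "\<And>n. q (z - v n) < inverse (real (Suc n))" by metis
    have "(\<lambda>n. q (v n - z)) \<longlonglongrightarrow> 0"
    proof (rule real_tendsto_sandwich[OF _ _ tendsto_const LIMSEQ_inverse_real_of_nat])
      show "eventually (\<lambda>n. q (v n - z) \<le> inverse (real (Suc n))) sequentially"
        using v R'R RS z by (auto intro!: always_eventually less_imp_le simp: q_commute[of "v _" z])
    qed (use v R'R RS z q_nonneg in auto)
    then have "z \<in> R'" using R'(3) v(1) z RS unfolding qclosed_def by blast
    with z show False by simp
  qed
  have "d < 2 * d" using \<open>d > 0\<close> by simp
  then obtain w where w: "w \<in> R'" "q (z - w) < 2 * d"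
    using cINF_less_iff[OF ne bdd] by (auto simp: d_def)
  have p: "q (z - w) > 0" using dle[OF w(1)] \<open>d > 0\<close> by simp
  define y where "y = (1 / q (z - w)) *\<^sub>R (z - w)"
  have "y \<in> R" unfolding y_def using w z R'R by (intro subspace_scale[OF R(1)] subspace_diff[OF R(1)])
  moreover have "q y \<le> 1" using p w z R'R RS by (simp add: y_def q_scale)
  moreover have "1/2 \<le> q (y - v)" if v: "v \<in> R'" for v
  proof -
    have "w + q (z - w) *\<^sub>R v \<in> R'" using w v by (intro subspace_add subspace_scale R'(1))
    then have "d \<le> q (z - (w + q (z - w) *\<^sub>R v))" by (rule dle)
    also have "z - (w + q (z - w) *\<^sub>R v) = q (z - w) *\<^sub>R (y - v)"
      using p by (simp add: y_def algebra_simps)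
    also have "q \<dots> = q (z - w) * q (y - v)"
      using p \<open>y \<in> R\<close> v RS R'R by (subst q_scale) auto
    finally have "1 / 2 * q (z - w) \<le> q (z - w) * q (y - v)" using w(2) by simp
    then show ?thesis using p by simp
  qed
  ultimately show ?thesis by blast
qed

text \<open>If \<open>y\<close> were missed, the iterated images of \<open>S\<close> would decrease
  strictly, injectivity carrying a gap from one stage to the next. Riesz's lemma then picks vectors
  \<open>x n\<close> of the unit ball whose images under \<open>K\<close> keep mutual distance 1/2,
  which compactness forbids.\<close>

lemma A_surj: assumes "y \<in> S" shows "\<exists>x\<in>S. q (A x - y) = 0"
proof (rule ccontr)
  assume no: "\<not> ?thesis"
  define R where "R n = (img ^^ n) S" for n
  have R0: "R 0 = S" and RSuc: "R (Suc n) = img (R n)" for n by (simp_all add: R_def)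
  have R: "subspace (R n) \<and> R n \<subseteq> S \<and> qclosed (R n)" for n
  proof (induction n)
    case 0 show ?case using S_subspace by (auto simp: R0 qclosed_def)
  next
    case (Suc n) then show ?case unfolding RSuc using img_closed[of "R n"] by blast
  qed
  have mono1: "R (Suc n) \<subseteq> R n" for n
  proof (induction n)
    case 0 show ?case using R[of 1] by (simp add: R0)
  next
    case (Suc n) then show ?case unfolding RSuc[of n] RSuc[of "Suc n"] by (auto simp: img_def)
  qed
  have mono: "R n \<subseteq> R m" if "m \<le> n" for m n
    using that by (rule lift_Suc_antimono_le[of R, OF mono1])
  have A_R: "A x \<in> R (Suc n)" if "x \<in> R n" for x n
    using that R[of n] q_0 by (auto simp: RSuc img_def intro!: bexI[of _ x])
  have "\<exists>z. z \<in> R n \<and> z \<notin> R (Suc n)" for n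
  proof (induction n)
    case 0
    show ?case using assms no by (auto simp: RSuc R0 img_def intro!: exI[of _ y])
  next
    case (Suc n)
    then obtain z where z: "z \<in> R n" "z \<notin> R (Suc n)" by blast
    have zS: "z \<in> S" using z R by blast
    have "A z \<notin> R (Suc (Suc n))"
    proof
      assume "A z \<in> R (Suc (Suc n))"
      then obtain x where x: "x \<in> R (Suc n)" "q (A x - A z) = 0"
        unfolding RSuc[of "Suc n"] by (auto simp: img_def)
      have xS: "x \<in> S" using x R by blast
      \<comment> \<open>Injectivity identifies \<open>x\<close> and \<open>z\<close> only up to a
        null vector; closedness of \<open>R (Suc n)\<close> then puts \<open>z\<close> itself into
        it.\<close>
      have "q (x - z) = 0" using A_inj[of "x - z"] x(2) xS zS by (simp add: q_A_diff)
      then have "z \<in> R (Suc n)" using qclosed_saturated[of "R (Suc n)" x z] R x zS by blast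
      with z show False by simp
    qed
    with A_R[OF z(1)] show ?case by blast
  qed
  then have "\<forall>n. \<exists>y\<in>R n. q y \<le> 1 \<and> (\<forall>v\<in>R (Suc n). 1/2 \<le> q (y - v))"
    using almost_orthogonal R mono1 by metis
  then obtain x where x: "\<And>n. x n \<in> R n" "\<And>n. q (x n) \<le> 1"
    "\<And>n v. v \<in> R (Suc n) \<Longrightarrow> 1/2 \<le> q (x n - v)" by metis
  have xS: "x n \<in> S" for n using x(1) R by blast
  have sep: "1/2 \<le> q (K (x n) - K (x m))" if "n < m" for n m
  proof -
    have sub: "subspace (R (Suc n))" using R by blast
    have "x m \<in> R (Suc n)" using x(1)[of m] mono[of "Suc n" m] that by auto
    moreover have "A (x m) \<in> R (Suc n)"
      using A_R[OF x(1)[of m]] mono[of "Suc n" "Suc m"] that by auto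
    \<comment> \<open>This vector is designed so that subtracting it from \<open>x n\<close> leaves
      \<open>K (x n) - K (x m)\<close>.\<close>
    ultimately have "A (x n) + x m - A (x m) \<in> R (Suc n)"
      using A_R[OF x(1)[of n]] sub by (intro subspace_diff subspace_add)
    from x(3)[OF this] have "1/2 \<le> q (x n - (A (x n) + x m - A (x m)))" .
    also have "x n - (A (x n) + x m - A (x m)) = K (x n) - K (x m)" by (simp add: A_def)
    finally show ?thesis .
  qed
  obtain g r where g: "g \<in> S" and r: "strict_mono r" and
    lim: "(\<lambda>n. q (K (x (r n)) - g)) \<longlonglongrightarrow> 0"
    by (rule K_compactE[OF xS x(2)])
  from lim have "eventually (\<lambda>n. q (K (x (r n)) - g) < 1/4) sequentially"
    by (rule order_tendstoD) simp
  then obtain N where N: "\<And>n. n \<ge> N \<Longrightarrow> q (K (x (r n)) - g) < 1/4"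
    by (auto simp: eventually_sequentially)
  have "q (K (x (r N)) - K (x (r (Suc N)))) \<le> q (K (x (r N)) - g) + q (g - K (x (r (Suc N))))"
    by (rule q_diff_triangle) (use K_S xS g in auto)
  also have "q (g - K (x (r (Suc N)))) = q (K (x (r (Suc N))) - g)"
    by (rule q_commute) (use K_S xS g in auto)
  finally have "q (K (x (r N)) - K (x (r (Suc N)))) < 1/2" using N[of N] N[of "Suc N"] by simp
  with sep[of "r N" "r (Suc N)"] r show False by (auto simp: strict_mono_def)
qed

end

theorem fredholm_alternative:
  assumes "\<And>x. x \<in> S \<Longrightarrow> q (x - K x) = 0 \<Longrightarrow> q x = 0"
  shows "\<exists>c\<ge>0. \<forall>x\<in>S. q x \<le> c * q (x - K x)"
    and "y \<in> S \<Longrightarrow> \<exists>x\<in>S. q (x - K x - y) = 0"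
  using A_bounded_below A_surj[of y] assms unfolding A_def by auto

end

section \<open>Subsequences\<close>

text \<open>Reduces a Cauchy subsequence to the task of finding, for one fixed \<open>e\<close>, a
  further subsequence that is eventually \<open>e\<close>-close; the diagonal over
  \<open>e = 1 / (k + 1)\<close> does the rest. No limit occurs, so the same statement serves
  \<open>L^1\<close> and \<open>L^\<infinity>\<close>.\<close>

lemma diagonal_cauchy:
  fixes D :: "nat \<Rightarrow> nat \<Rightarrow> real"
  assumes "\<And>e r. 0 < e \<Longrightarrow> strict_mono r \<Longrightarrow>
    \<exists>s::nat \<Rightarrow> nat. strict_mono s \<and> (\<exists>N. \<forall>i\<ge>N. \<forall>j\<ge>N. D (r (s i)) (r (s j)) \<le> e)"
  obtains r :: "nat \<Rightarrow> nat" where "strict_mono r"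
    "\<And>e. 0 < e \<Longrightarrow> \<exists>N. \<forall>i\<ge>N. \<forall>j\<ge>N. D (r i) (r j) \<le> e"
proof -
  define Q where "Q n s \<longleftrightarrow> (\<exists>N. \<forall>i\<ge>N. \<forall>j\<ge>N. D (s i) (s j) \<le> inverse (real (Suc n)))"
    for n and s :: "nat \<Rightarrow> nat"
  interpret subseqs Q
  proof
    fix n and s :: "nat \<Rightarrow> nat" assume "strict_mono s"
    from assms[OF _ this, of "inverse (real (Suc n))"]
    show "\<exists>r'. strict_mono r' \<and> Q n (s \<circ> r')" by (simp add: Q_def)
  qed
  \<comment> \<open>The diagonal sequence is a subsequence of the one chosen at stage
    \<open>k\<close> only from index \<open>Suc k\<close> on.\<close>
  have hold: "Q k (diagseq \<circ> ((+) (Suc k)))" for k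
  proof (rule diagseq_holds)
    fix r s :: "nat \<Rightarrow> nat" and n assume r: "strict_mono r" and "Q n s"
    then obtain N where N: "\<And>i j. i \<ge> N \<Longrightarrow> j \<ge> N \<Longrightarrow> D (s i) (s j) \<le> inverse (real (Suc n))"
      by (auto simp: Q_def)
    have "r i \<ge> N" if "i \<ge> N" for i using seq_suble[OF r, of i] that by simp
    then show "Q n (s \<circ> r)" unfolding Q_def o_def by (intro exI[of _ N] allI impI N)
  qed
  show thesis
  proof (rule that[OF subseq_diagseq])
    fix e :: real assume "0 < e"
    then obtain k where k: "inverse (real (Suc k)) < e" using reals_Archimedean by blast
    from hold[of k] obtain N where N: "\<And>i j. i \<ge> N \<Longrightarrow> j \<ge> N \<Longrightarrow>
        D (diagseq (Suc k + i)) (diagseq (Suc k + j)) \<le> inverse (real (Suc k))"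
      by (auto simp: Q_def)
    have "D (diagseq i) (diagseq j) \<le> e" if "i \<ge> Suc k + N" "j \<ge> Suc k + N" for i j
    proof -
      have "N \<le> i - Suc k" "N \<le> j - Suc k" using that by auto
      from N[OF this] that k show ?thesis by simp
    qed
    then show "\<exists>N. \<forall>i\<ge>N. \<forall>j\<ge>N. D (diagseq i) (diagseq j) \<le> e" by blast
  qed
qed

text \<open>Dependent choice in which each new element must be related to all earlier ones, not just
  to the last. \<open>\<Phi>\<close> is an invariant of the finite set of earlier choices: trivial
  when separated sequences are built, pairwise orthogonality for eigenfunctions.\<close>

lemma infinite_chain:
  assumes "\<Phi> {}"
    and "\<And>F. finite F \<Longrightarrow> F \<subseteq> A \<Longrightarrow> \<Phi> F \<Longrightarrow> \<exists>a\<in>A. (\<forall>b\<in>F. R b a) \<and> \<Phi> (insert a F)"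
  obtains s :: "nat \<Rightarrow> 'a" where "\<And>n. s n \<in> A" "\<And>i j. i < j \<Longrightarrow> R (s i) (s j)"
proof -
  define c where "c F = (SOME a. a \<in> A \<and> (\<forall>b\<in>F. R b a) \<and> \<Phi> (insert a F))" for F
  have c: "c F \<in> A \<and> (\<forall>b\<in>F. R b (c F)) \<and> \<Phi> (insert (c F) F)" if "finite F" "F \<subseteq> A" "\<Phi> F" for F
    unfolding c_def by (rule someI_ex) (use assms(2)[OF that] in auto)
  define S where "S = rec_nat {} (\<lambda>_ F. insert (c F) F)"
  have S0: "S 0 = {}" and SSuc: "S (Suc n) = insert (c (S n)) (S n)" for n
    by (simp_all add: S_def)
  have fin: "finite (S n) \<and> S n \<subseteq> A \<and> \<Phi> (S n)" for n
    by (induction n) (auto simp: S0 SSuc c assms(1))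
  have mem: "c (S i) \<in> S j" if "i < j" for i j
    using that by (induction j) (auto simp: SSuc less_Suc_eq)
  show thesis
  proof (rule that[of "\<lambda>n. c (S n)"])
    show "c (S n) \<in> A" for n using c fin by simp
    show "R (c (S i)) (c (S j))" if "i < j" for i j using c fin[of j] mem[OF that] by simp
  qed
qed

lemma cauchy_subseq_summable:
  fixes D :: "nat \<Rightarrow> nat \<Rightarrow> real"
  assumes "\<And>e. 0 < e \<Longrightarrow> \<exists>N. \<forall>i\<ge>N. \<forall>j\<ge>N. D i j \<le> e"
  obtains r :: "nat \<Rightarrow> nat" where "strict_mono r" "\<And>k. D (r (Suc k)) (r k) \<le> (1/2) ^ k"
proof -
  have "\<forall>k. \<exists>N. \<forall>i\<ge>N. \<forall>j\<ge>N. D i j \<le> (1/2) ^ k"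
    using assms by simp
  then obtain N where N: "\<And>k i j. i \<ge> N k \<Longrightarrow> j \<ge> N k \<Longrightarrow> D i j \<le> (1/2) ^ k"
    by metis
  \<comment> \<open>The sum dominates every \<open>N k\<close>, and the summand \<open>k\<close>
    makes \<open>r\<close> strictly increasing.\<close>
  define r where "r k = (\<Sum>i\<le>k. N i) + k" for k
  have rN: "N k \<le> r k" for k
    unfolding r_def by (intro trans_le_add1 member_le_sum) auto
  have "strict_mono r" by (auto simp: strict_mono_Suc_iff r_def)
  moreover have "D (r (Suc k)) (r k) \<le> (1/2) ^ k" for k
    using \<open>strict_mono r\<close> rN[of k] by (intro N) (auto simp: strict_mono_Suc_iff less_imp_le intro: le_trans)
  ultimately show thesis by (rule that)
qed

section \<open>Power inequalities\<close>

text \<open>Divided by \<open>a powr r\<close> this is Bernoulli's inequality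
  \<open>1 + r * (x - 1) \<le> x powr r\<close> for \<open>x = b / a\<close>, which is Young's
  inequality for the product \<open>x * 1\<close> with exponents \<open>r\<close> and
  \<open>r / (r - 1)\<close>.\<close>

lemma powr_above_tangent:
  fixes a b r :: real
  assumes "1 \<le> r" "0 \<le> a" "0 \<le> b"
  shows "a powr r + r * a powr (r - 1) * (b - a) \<le> b powr r"
proof (cases "r = 1 \<or> a = 0")
  case True
  then show ?thesis using assms by auto
next
  case False
  with assms have r: "r > 1" and a: "a > 0" by auto
  define x where "x = b / a"
  have x: "0 \<le> x" using assms a by (simp add: x_def)
  have "x * 1 \<le> x powr r / r + 1 powr (r / (r - 1)) / (r / (r - 1))"
    using r x by (intro Youngs_inequality) (auto simp: field_simps)
  then have "r * x \<le> x powr r + (r - 1)"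
  proof -
    assume "x * 1 \<le> x powr r / r + 1 powr (r / (r - 1)) / (r / (r - 1))"
    then have "r * x \<le> r * (x powr r / r + (r - 1) / r)"
      using r by (intro mult_left_mono) (auto simp: field_simps)
    then show ?thesis using r by (simp add: distrib_left)
  qed
  then have *: "1 + r * (x - 1) \<le> x powr r" by (simp add: algebra_simps)
  have "a powr r + r * a powr (r - 1) * (b - a) = a powr r * (1 + r * (x - 1))"
    using a by (simp add: x_def powr_diff field_simps)
  also have "\<dots> \<le> a powr r * x powr r" using * by (intro mult_left_mono) auto
  also have "\<dots> = b powr r" using a assms by (simp add: x_def flip: powr_mult)
  finally show ?thesis .
qed

text \<open>Average the two tangent inequalities at the mean \<open>m\<close> with weights
  \<open>t\<close> and \<open>1 - t\<close>: the linear terms cancel.\<close>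

lemma powr_convex:
  fixes x y t r :: real
  assumes "1 \<le> r" "0 \<le> x" "0 \<le> y" "0 \<le> t" "t \<le> 1"
  shows "(t * x + (1 - t) * y) powr r \<le> t * x powr r + (1 - t) * y powr r"
proof -
  define m where "m = t * x + (1 - t) * y"
  have m: "0 \<le> m" using assms by (simp add: m_def)
  define s where "s = r * m powr (r - 1)"
  have "t * (m powr r + s * (x - m)) + (1 - t) * (m powr r + s * (y - m))
      \<le> t * x powr r + (1 - t) * y powr r"
    using powr_above_tangent[OF assms(1) m] assms by (intro add_mono mult_left_mono) (auto simp: s_def)
  also have "t * (m powr r + s * (x - m)) + (1 - t) * (m powr r + s * (y - m)) = m powr r"
    by (simp add: m_def algebra_simps)
  finally show ?thesis by (simp add: m_def)
qed

lemma add_powr_le: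
  fixes a b r :: real
  assumes "1 \<le> r" "0 \<le> a" "0 \<le> b"
  shows "(a + b) powr r \<le> 2 powr r * (a powr r + b powr r)"
proof -
  have "(a + b) powr r \<le> (2 * max a b) powr r" using assms by (intro powr_mono2) auto
  also have "\<dots> = 2 powr r * (max a b) powr r" using assms by (simp add: powr_mult)
  also have "(max a b) powr r \<le> a powr r + b powr r" by (simp add: max_def)
  finally show ?thesis by simp
qed

lemma le_one_plus_powr:
  fixes a r :: real
  assumes "1 \<le> r" "0 \<le> a"
  shows "a \<le> 1 + a powr r"
proof (cases "a \<le> 1")
  case False
  then have "a powr 1 \<le> a powr r" using assms by (intro powr_mono) auto
  with False show ?thesis by simp
qed (use assms in \<open>auto intro: order_trans\<close>)

section \<open>Lebesgue spaces\<close>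

lemma Lp_space_infinity_iff:
  "f \<in> Lp_space top M \<longleftrightarrow> f \<in> borel_measurable M \<and> (\<exists>C\<ge>0. AE x in M. norm (f x) \<le> C)"
proof
  assume f: "f \<in> Lp_space top M"
  then have "f \<in> borel_measurable M" "esssup M (\<lambda>x. ennreal (norm (f x))) < top"
    by (auto simp: Lp_space_def)
  moreover have "AE x in M. norm (f x) \<le> enn2real (esssup M (\<lambda>x. ennreal (norm (f x))))"
    using esssup_AE[of "\<lambda>x. ennreal (norm (f x))" M]
  proof eventually_elim
    case (elim x)
    then show ?case using calculation(2) enn2real_mono[OF elim] by simp
  qed
  ultimately show "f \<in> borel_measurable M \<and> (\<exists>C\<ge>0. AE x in M. norm (f x) \<le> C)"
    using enn2real_nonneg by blast
next
  assume "f \<in> borel_measurable M \<and> (\<exists>C\<ge>0. AE x in M. norm (f x) \<le> C)"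
  then obtain C where [measurable]: "f \<in> borel_measurable M" and C: "AE x in M. norm (f x) \<le> C" by blast
  have "esssup M (\<lambda>x. ennreal (norm (f x))) \<le> ennreal C"
    using C by (intro esssup_I) (auto simp: ennreal_leI)
  also have "\<dots> < top" by simp
  finally show "f \<in> Lp_space top M" by (simp add: Lp_space_def)
qed

lemma Lp_norm_infinity_AE:
  assumes "f \<in> Lp_space top M"
  shows "AE x in M. norm (f x) \<le> Lp_norm top M f"
proof -
  have "esssup M (\<lambda>x. ennreal (norm (f x))) < top" using assms by (auto simp: Lp_space_def)
  note fin = this
  show ?thesis
    using esssup_AE[of "\<lambda>x. ennreal (norm (f x))" M]
  proof eventually_elim
    case (elim x)
    then show ?case using fin enn2real_mono[OF elim] by (simp add: Lp_norm_def)
  qed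
qed

lemma Lp_norm_infinity_le:
  assumes [measurable]: "f \<in> borel_measurable M" and C: "0 \<le> C" "AE x in M. norm (f x) \<le> C"
  shows "Lp_norm top M f \<le> C"
proof -
  have "esssup M (\<lambda>x. ennreal (norm (f x))) \<le> ennreal C"
    using C by (intro esssup_I) (auto simp: ennreal_leI)
  then have "enn2real (esssup M (\<lambda>x. ennreal (norm (f x)))) \<le> enn2real (ennreal C)"
    by (intro enn2real_mono) auto
  then show ?thesis using C by (simp add: Lp_norm_def)
qed

lemma enn2real_ge_1: "1 \<le> p \<Longrightarrow> p \<noteq> top \<Longrightarrow> 1 \<le> enn2real p"
  by (metis enn2real_1 enn2real_mono infinity_ennreal_def top.not_eq_extremum)

lemma Lp_space_finite_iff:
  "p \<noteq> top \<Longrightarrow> f \<in> Lp_space p M \<longleftrightarrow>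
    f \<in> borel_measurable M \<and> integrable M (\<lambda>x. norm (f x) powr enn2real p)"
  by (simp add: Lp_space_def)

lemma Lp_space_1_iff: "f \<in> Lp_space 1 M \<longleftrightarrow> integrable M f"
  by (auto simp: Lp_space_def integrable_norm_iff)

lemma Lp_norm_1: "Lp_norm 1 M f = (LINT x|M. norm (f x))"
  by (simp add: Lp_norm_def integral_nonneg)

lemma Lp_space_measurable: "f \<in> Lp_space p M \<Longrightarrow> f \<in> borel_measurable M"
  by (simp add: Lp_space_def)

lemma Lp_norm_nonneg: "0 \<le> Lp_norm p M f"
  by (simp add: Lp_norm_def)

lemma Lp_norm_powr:
  assumes "1 \<le> p" "p \<noteq> top"
  shows "Lp_norm p M f powr enn2real p = (LINT x|M. norm (f x) powr enn2real p)"
  using enn2real_ge_1[OF assms] assms(2) by (simp add: Lp_norm_def powr_powr integral_nonneg)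

lemma Lp_norm_le_iff:
  assumes "1 \<le> p" "p \<noteq> top" "0 \<le> C"
  shows "Lp_norm p M f \<le> C \<longleftrightarrow> (LINT x|M. norm (f x) powr enn2real p) \<le> C powr enn2real p"
proof -
  note r = enn2real_ge_1[OF assms(1,2)]
  have "Lp_norm p M f powr enn2real p \<le> C powr enn2real p \<longleftrightarrow> Lp_norm p M f \<le> C"
    using r assms Lp_norm_nonneg[of p M f] powr_less_mono2[of "enn2real p" C "Lp_norm p M f"]
      powr_mono2[of "enn2real p" "Lp_norm p M f" C] by fastforce
  then show ?thesis using Lp_norm_powr[OF assms(1,2), of M f] by simp
qed

lemma Lp_space_mono:
  assumes p: "1 \<le> p" and g: "g \<in> Lp_space p M" and [measurable]: "f \<in> borel_measurable M"
    and le: "AE x in M. norm (f x) \<le> norm (g x)"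
  shows "f \<in> Lp_space p M" and "Lp_norm p M f \<le> Lp_norm p M g"
proof -
  have "f \<in> Lp_space p M \<and> Lp_norm p M f \<le> Lp_norm p M g"
  proof (cases "p = top")
    case True
    then have "AE x in M. norm (f x) \<le> Lp_norm p M g"
      using le Lp_norm_infinity_AE[of g M] g by auto
    with True show ?thesis
      using Lp_norm_nonneg[of p M g] Lp_norm_infinity_le[of f M "Lp_norm p M g"]
      by (auto simp: Lp_space_infinity_iff)
  next
    case False
    note r = enn2real_ge_1[OF p False]
    have [measurable]: "g \<in> borel_measurable M" and ig: "integrable M (\<lambda>x. norm (g x) powr enn2real p)"
      using g False by (auto simp: Lp_space_finite_iff)
    have le': "AE x in M. norm (f x) powr enn2real p \<le> norm (g x) powr enn2real p"
      using le by eventually_elim (use r in \<open>auto intro!: powr_mono2\<close>)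
    have i: "integrable M (\<lambda>x. norm (f x) powr enn2real p)"
      by (rule Bochner_Integration.integrable_bound[OF ig]) (use le' in auto)
    moreover have "Lp_norm p M f \<le> Lp_norm p M g"
      using False r integral_mono_AE[OF i ig le']
      by (simp add: Lp_norm_def) (intro powr_mono2, auto intro: integral_nonneg)
    ultimately show ?thesis using False by (simp add: Lp_space_finite_iff)
  qed
  then show "f \<in> Lp_space p M" and "Lp_norm p M f \<le> Lp_norm p M g" by auto
qed

lemma Lp_space_cong_AE:
  assumes "1 \<le> p" "g \<in> Lp_space p M" "f \<in> borel_measurable M" "AE x in M. f x = g x"
  shows "f \<in> Lp_space p M" and "Lp_norm p M f = Lp_norm p M g"
proof -
  have 1: "AE x in M. norm (f x) \<le> norm (g x)" and 2: "AE x in M. norm (g x) \<le> norm (f x)"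
    using assms(4) by auto
  show f: "f \<in> Lp_space p M" using Lp_space_mono(1)[OF assms(1-3) 1] .
  show "Lp_norm p M f = Lp_norm p M g"
    using Lp_space_mono(2)[OF assms(1-3) 1] Lp_space_mono(2)[OF assms(1) f Lp_space_measurable[OF assms(2)] 2]
    by simp
qed

lemma Lp_space_add:
  assumes p: "1 \<le> p" and f: "f \<in> Lp_space p M" and g: "g \<in> Lp_space p M"
  shows "(\<lambda>x. f x + g x) \<in> Lp_space p M"
proof -
  note [measurable] = Lp_space_measurable[OF f] Lp_space_measurable[OF g]
  show ?thesis
  proof (cases "p = top")
    case True
    have "AE x in M. norm (f x + g x) \<le> Lp_norm top M f + Lp_norm top M g"
      using Lp_norm_infinity_AE[of f M] Lp_norm_infinity_AE[of g M] f g True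
      by (auto elim!: eventually_elim2 intro: norm_triangle_le add_mono)
    then show ?thesis unfolding True Lp_space_infinity_iff
      by (auto intro!: exI[of _ "Lp_norm top M f + Lp_norm top M g"] simp: Lp_norm_nonneg)
  next
    case False
    note r = enn2real_ge_1[OF p False]
    have i: "integrable M (\<lambda>x. 2 powr enn2real p * (norm (f x) powr enn2real p + norm (g x) powr enn2real p))"
      using f g False by (simp add: Lp_space_finite_iff)
    have "integrable M (\<lambda>x. norm (f x + g x) powr enn2real p)"
    proof (rule Bochner_Integration.integrable_bound[OF i])
      show "AE x in M. norm (norm (f x + g x) powr enn2real p)
        \<le> norm (2 powr enn2real p * (norm (f x) powr enn2real p + norm (g x) powr enn2real p))"
      proof (intro always_eventually allI)
        fix x
        have "norm (f x + g x) powr enn2real p \<le> (norm (f x) + norm (g x)) powr enn2real p"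
          using r by (intro powr_mono2 norm_triangle_ineq) auto
        also have "\<dots> \<le> 2 powr enn2real p * (norm (f x) powr enn2real p + norm (g x) powr enn2real p)"
          using r by (intro add_powr_le) auto
        finally show "norm (norm (f x + g x) powr enn2real p)
          \<le> norm (2 powr enn2real p * (norm (f x) powr enn2real p + norm (g x) powr enn2real p))" by simp
      qed
    qed measurable
    with False show ?thesis by (simp add: Lp_space_finite_iff)
  qed
qed

lemma Lp_space_scale:
  assumes f: "f \<in> Lp_space p M"
  shows "(\<lambda>x. c * f x) \<in> Lp_space p M"
proof (cases "p = top")
  case True
  with f obtain C where "f \<in> borel_measurable M" "C \<ge> 0" "AE x in M. norm (f x) \<le> C"
    by (auto simp: Lp_space_infinity_iff)
  then have "AE x in M. norm (c * f x) \<le> norm c * C"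
    by (auto elim!: eventually_mono simp: norm_mult intro!: mult_left_mono)
  with \<open>C \<ge> 0\<close> \<open>f \<in> borel_measurable M\<close> True show ?thesis
    by (auto simp: Lp_space_infinity_iff intro!: exI[of _ "norm c * C"])
qed (use f in \<open>auto simp: Lp_space_finite_iff norm_mult powr_mult\<close>)

lemma Lp_space_diff:
  assumes "1 \<le> p" "f \<in> Lp_space p M" "g \<in> Lp_space p M"
  shows "(\<lambda>x. f x - g x) \<in> Lp_space p M"
  using Lp_space_add[OF assms(1,2) Lp_space_scale[OF assms(3), of "-1"]] by simp

lemma Lp_space_zero: "(\<lambda>x. 0) \<in> Lp_space p M"
  by (auto simp: Lp_space_def esssup_def intro: Limsup_bounded[THEN le_less_trans])

lemma Lp_norm_scale:
  assumes p: "1 \<le> p" and f: "f \<in> Lp_space p M"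
  shows "Lp_norm p M (\<lambda>x. c * f x) = norm c * Lp_norm p M f"
proof (cases "p = top")
  case True
  note [measurable] = Lp_space_measurable[OF f]
  have le: "Lp_norm top M (\<lambda>x. c * f x) \<le> norm c * Lp_norm top M f"
    if "f \<in> Lp_space top M" for c and f :: "'a \<Rightarrow> complex"
    using Lp_norm_infinity_AE[OF that] Lp_space_measurable[OF that]
    by (intro Lp_norm_infinity_le) (auto simp: Lp_norm_nonneg norm_mult elim!: eventually_mono intro!: mult_left_mono)
  show ?thesis
  proof (cases "c = 0")
    case True
    then show ?thesis using le[of f 0] f \<open>p = top\<close> Lp_norm_nonneg[of top M "\<lambda>x. 0 * f x"] by simp
  next
    case False
    have cf: "(\<lambda>x. c * f x) \<in> Lp_space top M" using Lp_space_scale f True by blast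
    have "Lp_norm top M f \<le> norm (1/c) * Lp_norm top M (\<lambda>x. c * f x)"
      using le[OF cf, of "1/c"] False by simp
    then have "norm c * Lp_norm top M f \<le> norm c * (norm (1/c) * Lp_norm top M (\<lambda>x. c * f x))"
      by (rule mult_left_mono) simp
    then show ?thesis using le[of f c] f True False by (simp add: norm_divide)
  qed
next
  case False
  then show ?thesis using enn2real_ge_1[OF p False]
    by (simp add: Lp_norm_def norm_mult powr_mult powr_powr integral_nonneg)
qed

lemma Lp_norm_eq_0_iff:
  assumes p: "1 \<le> p" and f: "f \<in> Lp_space p M"
  shows "Lp_norm p M f = 0 \<longleftrightarrow> (AE x in M. f x = 0)"
proof (cases "p = top")
  case True
  note [measurable] = Lp_space_measurable[OF f]
  show ?thesis
  proof
    assume "Lp_norm p M f = 0"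
    then show "AE x in M. f x = 0" using Lp_norm_infinity_AE[of f M] f True by simp
  next
    assume "AE x in M. f x = 0"
    then have "Lp_norm top M f \<le> 0" by (intro Lp_norm_infinity_le) auto
    with True show "Lp_norm p M f = 0" using Lp_norm_nonneg[of p M f] by simp
  qed
next
  case False
  have "Lp_norm p M f = 0 \<longleftrightarrow> (LINT x|M. norm (f x) powr enn2real p) = 0"
    using False enn2real_ge_1[OF p False] by (simp add: Lp_norm_def integral_nonneg)
  also have "\<dots> \<longleftrightarrow> (AE x in M. norm (f x) powr enn2real p = 0)"
    using f False by (intro integral_nonneg_eq_0_iff_AE) (auto simp: Lp_space_finite_iff)
  finally show ?thesis by simp
qed

text \<open>By convexity applied to \<open>(|f| + |g|) / (a + b)\<close> as a convex combination
  of \<open>|f| / a\<close> and \<open>|g| / b\<close>.\<close>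

lemma Lp_norm_triangle:
  assumes p: "1 \<le> p" and f: "f \<in> Lp_space p M" and g: "g \<in> Lp_space p M"
  shows "Lp_norm p M (\<lambda>x. f x + g x) \<le> Lp_norm p M f + Lp_norm p M g"
proof -
  note [measurable] = Lp_space_measurable[OF f] Lp_space_measurable[OF g]
  define a b where "a = Lp_norm p M f" and "b = Lp_norm p M g"
  have ab: "0 \<le> a" "0 \<le> b" by (simp_all add: a_def b_def Lp_norm_nonneg)
  consider "p = top" | "a = 0" | "b = 0" | "p \<noteq> top" "0 < a" "0 < b" using ab by fastforce
  then show ?thesis
  proof cases
    case 1
    have "AE x in M. norm (f x + g x) \<le> Lp_norm top M f + Lp_norm top M g"
      using Lp_norm_infinity_AE[of f M] Lp_norm_infinity_AE[of g M] f g 1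
      by (auto elim!: eventually_elim2 intro: norm_triangle_le add_mono)
    then show ?thesis unfolding 1 by (intro Lp_norm_infinity_le) (auto simp: Lp_norm_nonneg)
  next
    case 2
    then have "AE x in M. f x + g x = g x" using Lp_norm_eq_0_iff[OF p f] by (simp add: a_def)
    then have "Lp_norm p M (\<lambda>x. f x + g x) = b" unfolding b_def
      by (intro Lp_space_cong_AE(2)[OF p g]) auto
    then show ?thesis using ab by (simp add: a_def b_def)
  next
    case 3
    then have "AE x in M. f x + g x = f x" using Lp_norm_eq_0_iff[OF p g] by (simp add: b_def)
    then have "Lp_norm p M (\<lambda>x. f x + g x) = a" unfolding a_def
      by (intro Lp_space_cong_AE(2)[OF p f]) auto
    then show ?thesis using ab by (simp add: a_def b_def)
  next
    case 4
    define r where "r = enn2real p"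
    have r: "1 \<le> r" using enn2real_ge_1[OF p 4(1)] by (simp add: r_def)
    have i: "integrable M (\<lambda>x. norm (f x) powr r)" "integrable M (\<lambda>x. norm (g x) powr r)"
      "integrable M (\<lambda>x. norm (f x + g x) powr r)"
      using f g Lp_space_add[OF p f g] 4 by (auto simp: Lp_space_finite_iff r_def)
    define t where "t = a / (a + b)"
    have t: "0 \<le> t" "t \<le> 1" "1 - t = b / (a + b)" using 4 by (auto simp: t_def field_simps)
    have bound: "norm (f x + g x) powr r
        \<le> (a + b) powr r * (t * (norm (f x) powr r / a powr r) + (1 - t) * (norm (g x) powr r / b powr r))" for x
    proof -
      have "norm (f x + g x) powr r \<le> ((a + b) * (t * (norm (f x) / a) + (1 - t) * (norm (g x) / b))) powr r"
      proof (rule powr_mono2)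
        have "(a + b) * (t * (norm (f x) / a) + (1 - t) * (norm (g x) / b)) = norm (f x) + norm (g x)"
          unfolding t(3) unfolding t_def using 4 by (simp add: distrib_left)
        then show "norm (f x + g x) \<le> (a + b) * (t * (norm (f x) / a) + (1 - t) * (norm (g x) / b))"
          using norm_triangle_ineq[of "f x" "g x"] by simp
      qed (use r in auto)
      also have "\<dots> = (a + b) powr r * (t * (norm (f x) / a) + (1 - t) * (norm (g x) / b)) powr r"
        by (rule powr_mult)
      also have "\<dots> \<le> (a + b) powr r * (t * (norm (f x) / a) powr r + (1 - t) * (norm (g x) / b) powr r)"
        using 4 t r by (intro mult_left_mono powr_convex) auto
      finally show ?thesis using 4 by (simp add: powr_divide)
    qed
    have "(LINT x|M. norm (f x + g x) powr r)
        \<le> (LINT x|M. (a + b) powr r * (t * (norm (f x) powr r / a powr r) + (1 - t) * (norm (g x) powr r / b powr r)))"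
      using bound i by (intro integral_mono) auto
    also have "\<dots> = (a + b) powr r * (t * ((LINT x|M. norm (f x) powr r) / a powr r)
        + (1 - t) * ((LINT x|M. norm (g x) powr r) / b powr r))"
      using i by simp
    also have "(LINT x|M. norm (f x) powr r) = a powr r"
      using Lp_norm_powr[OF p 4(1), of M f] by (simp add: a_def r_def)
    also have "(LINT x|M. norm (g x) powr r) = b powr r"
      using Lp_norm_powr[OF p 4(1), of M g] by (simp add: b_def r_def)
    finally have "(LINT x|M. norm (f x + g x) powr r) \<le> (a + b) powr r" using 4 by simp
    then show ?thesis
      using Lp_norm_le_iff[OF p 4(1), of "a + b" M] ab by (simp add: r_def a_def b_def)
  qed
qed

lemma Lp_norm_minus_commute: "Lp_norm p M (\<lambda>x. f x - g x) = Lp_norm p M (\<lambda>x. g x - f x)"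
  by (simp add: Lp_norm_def norm_minus_commute)

lemma Lp_norm_diff_triangle:
  assumes "1 \<le> p" "f \<in> Lp_space p M" "g \<in> Lp_space p M" "h \<in> Lp_space p M"
  shows "Lp_norm p M (\<lambda>x. f x - h x) \<le> Lp_norm p M (\<lambda>x. f x - g x) + Lp_norm p M (\<lambda>x. g x - h x)"
  using Lp_norm_triangle[OF assms(1) Lp_space_diff[OF assms(1,2,3)] Lp_space_diff[OF assms(1,3,4)]]
  by simp

text \<open>Off a single null set all the countably many bounds on \<open>u i x - u j x\<close> hold
  at once; there the values are uniformly Cauchy, and the bounds survive the limit in
  \<open>j\<close>.\<close>

lemma Linfty_complete:
  assumes u: "\<And>n. u n \<in> Lp_space top M"
    and cauchy: "\<And>e. 0 < e \<Longrightarrow> \<exists>N. \<forall>i\<ge>N. \<forall>j\<ge>N. Lp_norm top M (\<lambda>x. u i x - u j x) \<le> e"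
  obtains g where "g \<in> Lp_space top M" "(\<lambda>n. Lp_norm top M (\<lambda>x. u n x - g x)) \<longlonglongrightarrow> 0"
proof -
  note [measurable] = Lp_space_measurable[OF u]
  define g where "g x = lim (\<lambda>n. u n x)" for x
  have [measurable]: "g \<in> borel_measurable M" unfolding g_def by measurable
  have "AE x in M. norm (u i x - u j x) \<le> Lp_norm top M (\<lambda>x. u i x - u j x)" for i j
    by (rule Lp_norm_infinity_AE) (intro Lp_space_diff u, simp)
  then have ae: "AE x in M. \<forall>i j. norm (u i x - u j x) \<le> Lp_norm top M (\<lambda>x. u i x - u j x)"
    by (simp add: AE_all_countable)
  have lim: "AE x in M. (\<lambda>n. u n x) \<longlonglongrightarrow> g x"
    using ae
  proof eventually_elim
    case (elim x)
    have "Cauchy (\<lambda>n. u n x)"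
    proof (rule metric_CauchyI)
      fix e :: real assume "0 < e"
      with cauchy[of "e/2"] obtain N where N: "\<And>i j. i \<ge> N \<Longrightarrow> j \<ge> N \<Longrightarrow> Lp_norm top M (\<lambda>x. u i x - u j x) \<le> e/2"
        by auto
      have "dist (u i x) (u j x) < e" if "i \<ge> N" "j \<ge> N" for i j
      proof -
        have "norm (u i x - u j x) \<le> e/2" using elim N[OF that] order_trans by blast
        with \<open>0 < e\<close> show ?thesis by (simp add: dist_norm)
      qed
      then have "\<forall>i\<ge>N. \<forall>j\<ge>N. dist (u i x) (u j x) < e" by blast
      then show "\<exists>N. \<forall>i\<ge>N. \<forall>j\<ge>N. dist (u i x) (u j x) < e" by blast
    qed
    then show ?case unfolding g_def by (simp add: Cauchy_convergent_iff convergent_LIMSEQ_iff)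
  qed
  have tail: "AE x in M. norm (u i x - g x) \<le> e"
    if N: "\<And>i j. i \<ge> N \<Longrightarrow> j \<ge> N \<Longrightarrow> Lp_norm top M (\<lambda>x. u i x - u j x) \<le> e" and i: "i \<ge> N" for e N i
    using ae lim
  proof eventually_elim
    case (elim x)
    show ?case
    proof (rule tendsto_upperbound)
      show "(\<lambda>j. norm (u i x - u j x)) \<longlonglongrightarrow> norm (u i x - g x)"
        using elim(2) by (intro tendsto_intros)
      show "eventually (\<lambda>j. norm (u i x - u j x) \<le> e) sequentially"
        using N[OF i] elim(1) by (auto simp: eventually_sequentially intro!: exI[of _ N] intro: order_trans)
    qed simp
  qed
  from cauchy[of 1] obtain N where N: "\<And>i j. i \<ge> N \<Longrightarrow> j \<ge> N \<Longrightarrow> Lp_norm top M (\<lambda>x. u i x - u j x) \<le> 1"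
    by auto
  have "(\<lambda>x. u N x - g x) \<in> Lp_space top M"
    using tail[OF N order_refl] by (auto simp: Lp_space_infinity_iff intro!: exI[of _ 1])
  from Lp_space_diff[OF _ u[of N] this] have g: "g \<in> Lp_space top M" by simp
  have "(\<lambda>n. Lp_norm top M (\<lambda>x. u n x - g x)) \<longlonglongrightarrow> 0"
  proof (rule LIMSEQ_I)
    fix e :: real assume e: "0 < e"
    with cauchy[of "e/2"] obtain N where "\<And>i j. i \<ge> N \<Longrightarrow> j \<ge> N \<Longrightarrow> Lp_norm top M (\<lambda>x. u i x - u j x) \<le> e/2"
      by auto
    from tail[OF this] have "Lp_norm top M (\<lambda>x. u i x - g x) \<le> e/2" if "i \<ge> N" for i
      using e that by (intro Lp_norm_infinity_le) auto
    then have "norm (Lp_norm top M (\<lambda>x. u i x - g x) - 0) < e" if "i \<ge> N" for i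
      using e that Lp_norm_nonneg[of top M "\<lambda>x. u i x - g x"] by fastforce
    then show "\<exists>N. \<forall>n\<ge>N. norm (Lp_norm top M (\<lambda>x. u n x - g x) - 0) < e" by blast
  qed
  with g show thesis by (rule that)
qed

text \<open>The Riesz-Fischer argument: along a fast subsequence the increments \<open>v k\<close>
  have summable norms, so the telescoping series converges absolutely almost everywhere. Besides the
  limit it yields the integrable majorant \<open>h\<close>, on which the passage to general
  exponents relies.\<close>

lemma L1_cauchy_subseq:
  fixes u :: "nat \<Rightarrow> 'a \<Rightarrow> 'b::{banach, second_countable_topology}"
  assumes u: "\<And>n. integrable M (u n)"
    and cauchy: "\<And>e. 0 < e \<Longrightarrow> \<exists>N. \<forall>i\<ge>N. \<forall>j\<ge>N. (LINT x|M. norm (u i x - u j x)) \<le> e"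
  obtains r :: "nat \<Rightarrow> nat" and g h where "strict_mono r" "integrable M g" "integrable M h"
    "\<And>n. AE x in M. norm (u (r n) x) \<le> h x" "AE x in M. (\<lambda>n. u (r n) x) \<longlonglongrightarrow> g x"
    "(\<lambda>n. LINT x|M. norm (u (r n) x - g x)) \<longlonglongrightarrow> 0"
proof -
  obtain r :: "nat \<Rightarrow> nat" where r: "strict_mono r" and
    le: "\<And>k. (LINT x|M. norm (u (r (Suc k)) x - u (r k) x)) \<le> (1/2)^k"
  proof (rule cauchy_subseq_summable)
    fix e :: real assume "0 < e"
    then show "\<exists>N. \<forall>i\<ge>N. \<forall>j\<ge>N. (LINT x|M. norm (u i x - u j x)) \<le> e" by (rule cauchy)
  next
    fix r :: "nat \<Rightarrow> nat"
    assume "strict_mono r" "\<And>k. (LINT x|M. norm (u (r (Suc k)) x - u (r k) x)) \<le> (1/2)^k"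
    then show thesis by (rule that)
  qed
  define v where "v k x = u (r (Suc k)) x - u (r k) x" for k x
  have v: "integrable M (v k)" for k unfolding v_def using u by auto
  note [measurable] = borel_measurable_integrable[OF u] borel_measurable_integrable[OF v]
  have sm: "summable (\<lambda>k. LINT x|M. norm (v k x))"
    by (rule summable_comparison_test'[of "\<lambda>k. (1/2)^k" 0]) (use le in \<open>auto simp: v_def integral_nonneg\<close>)
  have "(\<integral>\<^sup>+x. (\<Sum>k. ennreal (norm (v k x))) \<partial>M) = (\<Sum>k. ennreal (LINT x|M. norm (v k x)))"
    using v by (simp add: nn_integral_suminf nn_integral_eq_integral)
  also have "\<dots> \<noteq> top"
    by (rule ennreal_suminf_neq_top[OF sm]) simp
  finally have fin: "(\<integral>\<^sup>+x. (\<Sum>k. ennreal (norm (v k x))) \<partial>M) \<noteq> \<infinity>" by simp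
  have "AE x in M. (\<Sum>k. ennreal (norm (v k x))) \<noteq> \<infinity>"
    by (rule nn_integral_PInf_AE[OF _ fin]) measurable
  then have ae: "AE x in M. summable (\<lambda>k. norm (v k x))"
  proof eventually_elim
    case (elim x)
    then show ?case by (intro summable_suminf_not_top) auto
  qed
  have iv: "integrable M (\<lambda>x. \<Sum>k. norm (v k x))"
    by (rule integrable_suminf) (use v ae sm in auto)
  define h where "h x = norm (u (r 0) x) + (\<Sum>k. norm (v k x))" for x
  define g where "g x = u (r 0) x + (\<Sum>k. v k x)" for x
  have h: "integrable M h" unfolding h_def using iv u by auto
  have "integrable M (\<lambda>x. \<Sum>k. v k x)"
    by (rule integrable_suminf) (use v ae sm in auto)
  then have g: "integrable M g" unfolding g_def using u by auto
  have tele: "u (r n) x = u (r 0) x + (\<Sum>k<n. v k x)" for n x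
    unfolding v_def by (induction n) auto
  have dom: "AE x in M. norm (u (r n) x) \<le> h x" for n
    using ae
  proof eventually_elim
    case (elim x)
    have "norm (u (r n) x) \<le> norm (u (r 0) x) + (\<Sum>k<n. norm (v k x))"
      by (subst tele) (intro norm_triangle_le add_mono norm_sum order_refl)
    also have "(\<Sum>k<n. norm (v k x)) \<le> (\<Sum>k. norm (v k x))" by (intro sum_le_suminf elim) auto
    finally show ?case by (simp add: h_def)
  qed
  have lim: "AE x in M. (\<lambda>n. u (r n) x) \<longlonglongrightarrow> g x"
    using ae
  proof eventually_elim
    case (elim x)
    have "(\<lambda>n. \<Sum>k<n. v k x) \<longlonglongrightarrow> (\<Sum>k. v k x)"
      using summable_norm_cancel[OF elim] by (rule summable_LIMSEQ)
    then have "(\<lambda>n. u (r 0) x + (\<Sum>k<n. v k x)) \<longlonglongrightarrow> g x"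
      unfolding g_def by (intro tendsto_intros)
    then show ?case by (simp flip: tele)
  qed
  note [measurable] = borel_measurable_integrable[OF g] borel_measurable_integrable[OF h]
  have "(\<lambda>n. LINT x|M. norm (u (r n) x - g x)) \<longlonglongrightarrow> (LINT x|M. 0)"
  proof (rule integral_dominated_convergence[where w="\<lambda>x. h x + norm (g x)"])
    show "AE x in M. (\<lambda>n. norm (u (r n) x - g x)) \<longlonglongrightarrow> 0"
      using lim by eventually_elim (simp add: LIM_zero tendsto_norm_zero)
    show "AE x in M. norm (norm (u (r n) x - g x)) \<le> h x + norm (g x)" for n
      using dom[of n] by eventually_elim (simp add: order_trans[OF norm_triangle_ineq4])
  qed (use g h in auto)
  then have "(\<lambda>n. LINT x|M. norm (u (r n) x - g x)) \<longlonglongrightarrow> 0" by simp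
  with r g h dom lim show thesis by (rule that)
qed

section \<open>Symmetric sub-Markov kernels\<close>

text \<open>Where \<open>f\<close> is not integrable against \<open>Q x\<close> the value is 0 by
  convention of the Bochner integral; additivity in \<open>f\<close> can therefore hold only almost
  everywhere.\<close>

definition kernel_op :: "('a \<Rightarrow> 'a measure) \<Rightarrow> ('a \<Rightarrow> complex) \<Rightarrow> 'a \<Rightarrow> complex" where
  "kernel_op Q f x = (LINT y|Q x. f y)"

text \<open>Shared by the semigroup at a fixed time, its time averages and the resolvent. Symmetry
  is stated for functions with values in \<open>ennreal\<close>, where no integrability question
  arises.\<close>

locale symmetric_kernel = sigma_finite_measure M for M :: "'a measure" +
  fixes Q :: "'a \<Rightarrow> 'a measure"
  assumes Q_measurable [measurable]: "Q \<in> M \<rightarrow>\<^sub>M subprob_algebra M"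
    and Q_symmetric: "\<And>f g. f \<in> borel_measurable M \<Longrightarrow> g \<in> borel_measurable M \<Longrightarrow>
      (\<integral>\<^sup>+x. (\<integral>\<^sup>+y. f y \<partial>Q x) * g x \<partial>M) = (\<integral>\<^sup>+x. f x * (\<integral>\<^sup>+y. g y \<partial>Q x) \<partial>M)"
begin

abbreviation T :: "('a \<Rightarrow> complex) \<Rightarrow> 'a \<Rightarrow> complex" where "T \<equiv> kernel_op Q"

lemma subprob_Q: "x \<in> space M \<Longrightarrow> subprob_space (Q x)"
  using subprob_space_kernel[OF Q_measurable] .

lemma sets_Q: "x \<in> space M \<Longrightarrow> sets (Q x) = sets M"
  using sets_kernel[OF Q_measurable] .

lemma measurable_Q: "x \<in> space M \<Longrightarrow> borel_measurable (Q x) = borel_measurable M"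
  by (rule measurable_cong_sets) (auto simp: sets_Q)

lemma T_measurable [measurable]:
  "f \<in> borel_measurable M \<Longrightarrow> T f \<in> borel_measurable M"
  unfolding kernel_op_def
  by (rule measurable_compose[OF Q_measurable integral_measurable_subprob_algebra])

text \<open>Symmetry against the constant 1 moves the kernel off \<open>f\<close>; what remains is
  its total mass, which is at most 1.\<close>

lemma nn_contraction:
  assumes [measurable]: "f \<in> borel_measurable M"
  shows "(\<integral>\<^sup>+x. (\<integral>\<^sup>+y. f y \<partial>Q x) \<partial>M) \<le> (\<integral>\<^sup>+x. f x \<partial>M)"
proof -
  have "(\<integral>\<^sup>+x. (\<integral>\<^sup>+y. f y \<partial>Q x) \<partial>M) = (\<integral>\<^sup>+x. f x * (\<integral>\<^sup>+y. 1 \<partial>Q x) \<partial>M)"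
    using Q_symmetric[of f "\<lambda>_. 1"] by simp
  also have "\<dots> \<le> (\<integral>\<^sup>+x. f x * 1 \<partial>M)"
    using subprob_space.subprob_emeasure_le_1[OF subprob_Q]
    by (intro nn_integral_mono mult_left_mono) auto
  finally show ?thesis by simp
qed

text \<open>Contractivity applied to the indicator of a null set. This is what makes the operator
  independent of representatives.\<close>

lemma AE_kernel:
  assumes "AE y in M. P y"
  shows "AE x in M. AE y in Q x. P y"
proof -
  from assms obtain N where N: "{y \<in> space M. \<not> P y} \<subseteq> N" "emeasure M N = 0" "N \<in> sets M"
    by (rule AE_E)
  have "(\<integral>\<^sup>+x. (\<integral>\<^sup>+y. indicator N y \<partial>Q x) \<partial>M) \<le> (\<integral>\<^sup>+x. indicator N x \<partial>M)"
    using N(3) by (intro nn_contraction) auto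
  then have "(\<integral>\<^sup>+x. (\<integral>\<^sup>+y. indicator N y \<partial>Q x) \<partial>M) = 0" using N by simp
  then have "AE x in M. (\<integral>\<^sup>+y. indicator N y \<partial>Q x) = 0"
    using N(3) by (subst (asm) nn_integral_0_iff_AE) auto
  then show ?thesis
    using AE_space
  proof eventually_elim
    case (elim x)
    then have "emeasure (Q x) N = 0" using N(3) by (simp add: sets_Q)
    then show ?case
      using N elim sets_eq_imp_space_eq[OF sets_Q] by (intro AE_I[of _ _ N]) (auto simp: sets_Q)
  qed
qed

lemma T_cong_AE:
  assumes "AE y in Q x. f y = g y" "x \<in> space M" "f \<in> borel_measurable M" "g \<in> borel_measurable M"
  shows "T f x = T g x"
  unfolding kernel_op_def using assms by (intro integral_cong_AE) (auto simp: measurable_Q)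

lemma T_bound:
  assumes x: "x \<in> space M" and C: "0 \<le> C" "AE y in Q x. norm (f y) \<le> C"
  shows "norm (T f x) \<le> C"
proof (cases "integrable (Q x) f")
  case True
  interpret Qx: subprob_space "Q x" using subprob_Q[OF x] .
  have "norm (T f x) \<le> (LINT y|Q x. norm (f y))" unfolding kernel_op_def by (rule integral_norm_bound)
  also have "\<dots> \<le> (LINT y|Q x. C)" using C True by (intro integral_mono_AE) auto
  also have "\<dots> = C * measure (Q x) (space (Q x))" by simp
  also have "\<dots> \<le> C * 1" using C Qx.subprob_measure_le_1 by (intro mult_left_mono) auto
  finally show ?thesis by simp
qed (use C in \<open>simp add: kernel_op_def not_integrable_integral_eq\<close>)

lemma integrable_kernel_powr:
  fixes f :: "'a \<Rightarrow> complex"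
  assumes x: "x \<in> space M" and [measurable]: "f \<in> borel_measurable M" and r: "1 \<le> r"
    and i: "integrable (Q x) (\<lambda>y. norm (f y) powr r)"
  shows "integrable (Q x) f"
proof -
  interpret Qx: subprob_space "Q x" using subprob_Q[OF x] .
  have "integrable (Q x) (\<lambda>y. 1 + norm (f y) powr r)" using i by auto
  then show ?thesis
    by (rule Bochner_Integration.integrable_bound) (use r le_one_plus_powr[of r] in \<open>auto simp: measurable_Q[OF x]\<close>)
qed

text \<open>Integrate the tangent at the mean.\<close>

lemma T_jensen:
  assumes x: "x \<in> space M" and [measurable]: "f \<in> borel_measurable M" and r: "1 \<le> r"
    and i: "integrable (Q x) (\<lambda>y. norm (f y) powr r)"
  shows "norm (T f x) powr r \<le> (LINT y|Q x. norm (f y) powr r)"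
proof -
  interpret Qx: subprob_space "Q x" using subprob_Q[OF x] .
  have f: "integrable (Q x) f" using integrable_kernel_powr[OF x _ r i] by simp
  define a where "a = (LINT y|Q x. norm (f y))"
  define m where "m = measure (Q x) (space (Q x))"
  have a: "0 \<le> a" by (simp add: a_def)
  have m: "m \<le> 1" unfolding m_def by (rule Qx.subprob_measure_le_1)
  have "norm (T f x) \<le> a" unfolding kernel_op_def a_def by (rule integral_norm_bound)
  then have "norm (T f x) powr r \<le> a powr r" using r by (intro powr_mono2) auto
  \<comment> \<open>For total mass \<open>m\<close> the integrated tangent at \<open>a\<close>
    equals \<open>m * a powr r + r * (1 - m) * a powr r\<close>, which exceeds
    \<open>a powr r\<close> by exactly this nonnegative term.\<close>
  also have "\<dots> \<le> a powr r + (r - 1) * (1 - m) * a powr r" using r m by simp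
  also have "\<dots> = m * a powr r + r * (a powr (r - 1) * a - a powr (r - 1) * a * m)"
  proof -
    have "a powr (r - 1) * a = a powr r"
      using a by (cases "a = 0") (simp_all add: powr_diff)
    then show ?thesis by (simp add: algebra_simps)
  qed
  also have "\<dots> = (LINT y|Q x. a powr r + r * a powr (r - 1) * (norm (f y) - a))"
    using f by (simp add: m_def a_def[symmetric] algebra_simps)
  also have "\<dots> \<le> (LINT y|Q x. norm (f y) powr r)"
    using f i powr_above_tangent[OF r a] by (intro integral_mono) auto
  finally show ?thesis .
qed

lemma nn_norm_kernel_finite:
  assumes f: "integrable M (f :: 'a \<Rightarrow> 'b::{banach, second_countable_topology})"
  shows "AE x in M. integrable (Q x) f"
    and "integrable M (\<lambda>x. LINT y|Q x. norm (f y))"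
    and "(LINT x|M. LINT y|Q x. norm (f y)) \<le> (LINT x|M. norm (f x))"
proof -
  have [measurable]: "f \<in> borel_measurable M" using f by auto
  have nn: "(\<integral>\<^sup>+x. (\<integral>\<^sup>+y. norm (f y) \<partial>Q x) \<partial>M) \<le> ennreal (LINT x|M. norm (f x))"
    using nn_contraction[of "\<lambda>x. norm (f x)"] nn_integral_eq_integral[OF integrable_norm[OF f]] by simp
  also have "\<dots> < \<infinity>" by simp
  finally have fin: "(\<integral>\<^sup>+x. (\<integral>\<^sup>+y. norm (f y) \<partial>Q x) \<partial>M) \<noteq> \<infinity>" by simp
  have "AE x in M. (\<integral>\<^sup>+y. norm (f y) \<partial>Q x) \<noteq> \<infinity>"
    by (rule nn_integral_PInf_AE[OF _ fin]) measurable
  then show ae: "AE x in M. integrable (Q x) f"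
    using AE_space by eventually_elim (auto simp: integrable_iff_bounded measurable_Q less_top)
  have meas: "(\<lambda>x. LINT y|Q x. norm (f y)) \<in> borel_measurable M"
    by (rule measurable_compose[OF Q_measurable integral_measurable_subprob_algebra]) simp
  have eq: "(\<integral>\<^sup>+x. ennreal (LINT y|Q x. norm (f y)) \<partial>M) = (\<integral>\<^sup>+x. (\<integral>\<^sup>+y. norm (f y) \<partial>Q x) \<partial>M)"
    using ae by (intro nn_integral_cong_AE) (auto elim!: eventually_mono simp: nn_integral_eq_integral)
  show i: "integrable M (\<lambda>x. LINT y|Q x. norm (f y))"
    using fin eq meas by (intro integrableI_nonneg) (auto simp: less_top)
  have "ennreal (LINT x|M. LINT y|Q x. norm (f y)) \<le> ennreal (LINT x|M. norm (f x))"
    using nn eq nn_integral_eq_integral[OF i] by simp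
  then show "(LINT x|M. LINT y|Q x. norm (f y)) \<le> (LINT x|M. norm (f x))"
    by (simp add: ennreal_le_iff)
qed

lemma Lp_kernel_integrable:
  assumes p: "1 \<le> p" and f: "f \<in> Lp_space p M"
  shows "AE x in M. integrable (Q x) f"
proof (cases "p = top")
  case True
  then obtain C where [measurable]: "f \<in> borel_measurable M" and C: "AE x in M. norm (f x) \<le> C"
    using f by (auto simp: Lp_space_infinity_iff)
  show ?thesis
    using AE_kernel[OF C] AE_space
  proof eventually_elim
    case (elim x)
    interpret Qx: subprob_space "Q x" using subprob_Q elim by simp
    show ?case using elim by (intro Qx.integrable_const_bound) (auto simp: measurable_Q)
  qed
next
  case False
  then have [measurable]: "f \<in> borel_measurable M" and i: "integrable M (\<lambda>x. norm (f x) powr enn2real p)"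
    using f by (auto simp: Lp_space_finite_iff)
  show ?thesis
    using nn_norm_kernel_finite(1)[OF i] AE_space
    by eventually_elim (rule integrable_kernel_powr[OF _ _ enn2real_ge_1[OF p]], use False in auto)
qed

text \<open>For \<open>p = \<infinity>\<close> the pointwise bound is transported by
  \<open>AE_kernel\<close>; for finite \<open>p\<close>, Jensen's inequality bounds the power of
  \<open>T f\<close> by the kernel integral of the power of \<open>f\<close>, and contraction on
  \<open>L^1\<close> finishes.\<close>

lemma T_Lp:
  assumes p: "1 \<le> p" and f: "f \<in> Lp_space p M"
  shows "T f \<in> Lp_space p M" and "Lp_norm p M (T f) \<le> Lp_norm p M f"
proof -
  note [measurable] = Lp_space_measurable[OF f]
  have "T f \<in> Lp_space p M \<and> Lp_norm p M (T f) \<le> Lp_norm p M f"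
  proof (cases "p = top")
    case True
    have "AE x in M. norm (T f x) \<le> Lp_norm top M f"
      using AE_kernel[OF Lp_norm_infinity_AE[of f M]] f True AE_space
      by (auto elim!: eventually_elim2 intro!: T_bound Lp_norm_nonneg)
    then show ?thesis unfolding True Lp_space_infinity_iff
      using Lp_norm_nonneg[of top M f] by (auto intro!: Lp_norm_infinity_le)
  next
    case False
    define r where "r = enn2real p"
    have r: "1 \<le> r" using enn2real_ge_1[OF p] False by (simp add: r_def)
    have i: "integrable M (\<lambda>x. norm (f x) powr r)"
      using f False by (auto simp: Lp_space_finite_iff r_def)
    note k = nn_norm_kernel_finite[OF i]
    have k2: "integrable M (\<lambda>x. LINT y|Q x. norm (f y) powr r)" using k(2) by simp
    have le: "AE x in M. norm (T f x) powr r \<le> (LINT y|Q x. norm (f y) powr r)"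
      using k(1) AE_space by eventually_elim (intro T_jensen r, auto)
    have i2: "integrable M (\<lambda>x. norm (T f x) powr r)"
      by (rule Bochner_Integration.integrable_bound[OF k2]) (use le in \<open>auto elim!: eventually_mono\<close>)
    have "(LINT x|M. norm (T f x) powr r) \<le> (LINT x|M. norm (f x) powr r)"
      using integral_mono_AE[OF i2 k2 le] k(3) by simp
    also have "\<dots> = Lp_norm p M f powr r"
      using Lp_norm_powr[OF p, of M f] False by (simp add: r_def)
    finally have "Lp_norm p M (T f) \<le> Lp_norm p M f"
      using Lp_norm_le_iff[OF p _ Lp_norm_nonneg[of p M f], of M "T f"] False by (simp add: r_def)
    with i2 False show ?thesis by (simp add: Lp_space_finite_iff r_def)
  qed
  then show "T f \<in> Lp_space p M" and "Lp_norm p M (T f) \<le> Lp_norm p M f" by auto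
qed

lemma T_scale: "T (\<lambda>y. c * f y) x = c * T f x"
  by (simp add: kernel_op_def)

lemma T_add:
  assumes "1 \<le> p" "f \<in> Lp_space p M" "g \<in> Lp_space p M"
  shows "AE x in M. T (\<lambda>y. f y + g y) x = T f x + T g x"
  using Lp_kernel_integrable[OF assms(1,2)] Lp_kernel_integrable[OF assms(1,3)]
  by eventually_elim (simp add: kernel_op_def)

lemma T_diff:
  assumes "1 \<le> p" "f \<in> Lp_space p M" "g \<in> Lp_space p M"
  shows "AE x in M. T (\<lambda>y. f y - g y) x = T f x - T g x"
  using Lp_kernel_integrable[OF assms(1,2)] Lp_kernel_integrable[OF assms(1,3)]
  by eventually_elim (simp add: kernel_op_def)

lemma T_cong:
  assumes "f \<in> borel_measurable M" "g \<in> borel_measurable M" "AE x in M. f x = g x"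
  shows "AE x in M. T f x = T g x"
  using AE_kernel[OF assms(3)] AE_space by eventually_elim (rule T_cong_AE, use assms in auto)

lemma Lp_operator_T: "1 \<le> p \<Longrightarrow> Lp_operator p M T"
  unfolding Lp_operator_def
  by (intro conjI ballI allI impI T_Lp T_add T_cong) (simp_all add: T_scale Lp_space_measurable)

lemma T_diff_Lp_norm:
  assumes "1 \<le> p" "f \<in> Lp_space p M" "g \<in> Lp_space p M"
  shows "Lp_norm p M (\<lambda>x. T f x - T g x) \<le> Lp_norm p M (\<lambda>x. f x - g x)"
proof -
  note d = Lp_space_diff[OF assms]
  note [measurable] = Lp_space_measurable[OF assms(2)] Lp_space_measurable[OF assms(3)]
  have "Lp_norm p M (\<lambda>x. T f x - T g x) = Lp_norm p M (T (\<lambda>y. f y - g y))"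
  proof (rule Lp_space_cong_AE(2)[OF assms(1) T_Lp(1)[OF assms(1) d]])
    show "AE x in M. T f x - T g x = T (\<lambda>y. f y - g y) x"
      using T_diff[OF assms] by eventually_elim simp
  qed measurable
  with T_Lp(2)[OF assms(1) d] show ?thesis by simp
qed

subsection \<open>Symmetry of the complex pairing\<close>

lemma pairing_nonneg:
  fixes f g :: "'a \<Rightarrow> real"
  assumes [measurable]: "f \<in> borel_measurable M" "g \<in> borel_measurable M"
    and nn: "\<And>x. 0 \<le> f x" "\<And>x. 0 \<le> g x"
    and fin: "(\<integral>\<^sup>+x. (\<integral>\<^sup>+y. f y \<partial>Q x) * g x \<partial>M) < \<infinity>"
  shows "integrable M (\<lambda>x. (LINT y|Q x. f y) * g x)" and "integrable M (\<lambda>x. f x * (LINT y|Q x. g y))"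
    and "(LINT x|M. (LINT y|Q x. f y) * g x) = (LINT x|M. f x * (LINT y|Q x. g y))"
proof -
  have meas [measurable]: "(\<lambda>x. LINT y|Q x. h y) \<in> borel_measurable M"
    if "h \<in> borel_measurable M" for h :: "'a \<Rightarrow> real"
    by (rule measurable_compose[OF Q_measurable integral_measurable_subprob_algebra[OF that]])
  have fin': "(\<integral>\<^sup>+x. f x * (\<integral>\<^sup>+y. g y \<partial>Q x) \<partial>M) < \<infinity>"
    using fin Q_symmetric[of f g] by simp
  have key: "AE x in M. (\<integral>\<^sup>+y. h y \<partial>Q x) * ennreal (k x) = ennreal ((LINT y|Q x. h y) * k x)"
    if [measurable]: "h \<in> borel_measurable M" "k \<in> borel_measurable M"
      and nn: "\<And>x. 0 \<le> h x" "\<And>x. 0 \<le> k x"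
      and fin: "(\<integral>\<^sup>+x. (\<integral>\<^sup>+y. h y \<partial>Q x) * k x \<partial>M) < \<infinity>" for h k :: "'a \<Rightarrow> real"
  proof -
    have "AE x in M. (\<integral>\<^sup>+y. h y \<partial>Q x) * ennreal (k x) \<noteq> \<infinity>"
      by (rule nn_integral_PInf_AE) (use fin in \<open>auto simp: less_top\<close>)
    then show ?thesis using AE_space
    proof eventually_elim
      case (elim x)
      show ?case
      \<comment> \<open>Where \<open>k x = 0\<close> the inner integral may be infinite, but both
        sides are 0; elsewhere finiteness of the product makes \<open>h\<close> integrable against
        \<open>Q x\<close>.\<close>
      proof (cases "k x = 0")
        case False
        then have "(\<integral>\<^sup>+y. h y \<partial>Q x) < \<infinity>"
          using elim nn(2)[of x] by (auto simp: ennreal_mult_eq_top_iff less_top)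
        then have "integrable (Q x) h" using elim nn(1) by (intro integrableI_nonneg) (auto simp: measurable_Q)
        then show ?thesis using nn by (simp add: nn_integral_eq_integral ennreal_mult)
      qed simp
    qed
  qed
  note k1 = key[of f g, OF _ _ nn fin]
  have k2: "AE x in M. (\<integral>\<^sup>+y. g y \<partial>Q x) * ennreal (f x) = ennreal ((LINT y|Q x. g y) * f x)"
    using fin' nn by (intro key) (auto simp: mult.commute)
  have e1: "(\<integral>\<^sup>+x. ennreal ((LINT y|Q x. f y) * g x) \<partial>M) = (\<integral>\<^sup>+x. (\<integral>\<^sup>+y. f y \<partial>Q x) * g x \<partial>M)"
    using k1 by (intro nn_integral_cong_AE) auto
  have e2: "(\<integral>\<^sup>+x. ennreal (f x * (LINT y|Q x. g y)) \<partial>M) = (\<integral>\<^sup>+x. f x * (\<integral>\<^sup>+y. g y \<partial>Q x) \<partial>M)"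
    using k2 by (intro nn_integral_cong_AE) (auto simp: mult.commute)
  show i1: "integrable M (\<lambda>x. (LINT y|Q x. f y) * g x)"
    by (rule integrableI_nonneg) (use e1 fin nn in auto)
  show i2: "integrable M (\<lambda>x. f x * (LINT y|Q x. g y))"
    by (rule integrableI_nonneg) (use e2 fin' nn in auto)
  have "ennreal (LINT x|M. (LINT y|Q x. f y) * g x) = ennreal (LINT x|M. f x * (LINT y|Q x. g y))"
    using e1 e2 Q_symmetric[of f g] nn i1 i2 by (simp add: nn_integral_eq_integral[symmetric])
  then show "(LINT x|M. (LINT y|Q x. f y) * g x) = (LINT x|M. f x * (LINT y|Q x. g y))"
    using nn by (subst (asm) ennreal_inj) auto
qed

end

text \<open>The directions of the positive and negative real and imaginary parts. Every
  \<open>z\<close> is the sum of \<open>c * quadrant_part c z\<close> over these units, which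
  reduces identities between complex integrals to nonnegative functions.\<close>

definition unit4 :: "complex set" where "unit4 = {1, -1, \<i>, -\<i>}"

definition quadrant_part :: "complex \<Rightarrow> complex \<Rightarrow> real" where
  "quadrant_part c z = max 0 (Re (cnj c * z))"

lemma sum_unit4: "(\<Sum>c\<in>unit4. h c) = h 1 + h (-1) + h \<i> + h (- \<i>)"
  by (simp add: unit4_def complex_eq_iff add.assoc)

lemma quadrant_decomp: "z = (\<Sum>c\<in>unit4. c * of_real (quadrant_part c z))"
  by (simp add: sum_unit4 quadrant_part_def complex_eq_iff max_def)

lemma quadrant_part_bound: "c \<in> unit4 \<Longrightarrow> quadrant_part c z \<le> norm z"
  using abs_Re_le_cmod[of z] abs_Im_le_cmod[of z] norm_ge_zero[of z]
  by (auto simp: unit4_def quadrant_part_def)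

lemma quadrant_part_nonneg: "0 \<le> quadrant_part c z"
  by (simp add: quadrant_part_def)

lemma quadrant_part_measurable [measurable]: "quadrant_part c \<in> borel_measurable borel"
  unfolding quadrant_part_def by measurable

context symmetric_kernel
begin

text \<open>Both functions split into four nonnegative parts; the finiteness premise bounds each of
  the sixteen mixed pairings, so the nonnegative case applies to every one of them.\<close>

lemma pairing:
  assumes [measurable]: "f \<in> borel_measurable M" "g \<in> borel_measurable M"
    and fin: "(\<integral>\<^sup>+x. (\<integral>\<^sup>+y. norm (f y) \<partial>Q x) * norm (g x) \<partial>M) < \<infinity>"
  shows "integrable M (\<lambda>x. T f x * g x)" and "integrable M (\<lambda>x. f x * T g x)"
    and "(LINT x|M. T f x * g x) = (LINT x|M. f x * T g x)"
proof -
  define F where "F c x = quadrant_part c (f x)" for c x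
  define G where "G c x = quadrant_part c (g x)" for c x
  have [measurable]: "F c \<in> borel_measurable M" "G c \<in> borel_measurable M" for c
    by (simp_all add: F_def[abs_def] G_def[abs_def])
  have nn: "0 \<le> F c x" "0 \<le> G c x" for c x by (simp_all add: F_def G_def quadrant_part_nonneg)
  have FG: "(\<integral>\<^sup>+x. (\<integral>\<^sup>+y. F c y \<partial>Q x) * G d x \<partial>M) < \<infinity>" if "c \<in> unit4" "d \<in> unit4" for c d
  proof -
    have "(\<integral>\<^sup>+x. (\<integral>\<^sup>+y. F c y \<partial>Q x) * G d x \<partial>M) \<le> (\<integral>\<^sup>+x. (\<integral>\<^sup>+y. norm (f y) \<partial>Q x) * norm (g x) \<partial>M)"
      using quadrant_part_bound that
      by (intro nn_integral_mono mult_mono) (auto simp: F_def G_def ennreal_leI)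
    with fin show ?thesis by simp
  qed
  have expand: "AE x in M. T h x * k x = (\<Sum>c\<in>unit4. \<Sum>d\<in>unit4. c * d *
        of_real ((LINT y|Q x. quadrant_part c (h y)) * quadrant_part d (k x)))"
    if [measurable]: "h \<in> borel_measurable M" "k \<in> borel_measurable M"
      and fin: "(\<integral>\<^sup>+x. (\<integral>\<^sup>+y. norm (h y) \<partial>Q x) * norm (k x) \<partial>M) < \<infinity>" for h k
  proof -
    have "AE x in M. (\<integral>\<^sup>+y. norm (h y) \<partial>Q x) * ennreal (norm (k x)) \<noteq> \<infinity>"
      by (rule nn_integral_PInf_AE) (use fin in \<open>auto simp: less_top\<close>)
    then show ?thesis using AE_space
    proof eventually_elim
      case (elim x)
      show ?case
      proof (cases "k x = 0")
        case True
        then show ?thesis by (simp add: quadrant_part_def)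
      next
        case False
        then have "(\<integral>\<^sup>+y. norm (h y) \<partial>Q x) < \<infinity>"
          using elim by (auto simp: ennreal_mult_eq_top_iff less_top)
        then have ih: "integrable (Q x) h" using elim by (simp add: integrable_iff_bounded measurable_Q)
        have iq: "integrable (Q x) (\<lambda>y. quadrant_part c (h y))" if "c \<in> unit4" for c
          by (rule Bochner_Integration.integrable_bound[OF ih])
            (use quadrant_part_bound[OF that] elim in \<open>auto simp: measurable_Q quadrant_part_nonneg\<close>)
        have "T h x = (LINT y|Q x. (\<Sum>c\<in>unit4. c * of_real (quadrant_part c (h y))))"
          unfolding kernel_op_def by (intro Bochner_Integration.integral_cong refl quadrant_decomp)
        also have "\<dots> = (\<Sum>c\<in>unit4. LINT y|Q x. c * of_real (quadrant_part c (h y)))"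
          using iq by (intro Bochner_Integration.integral_sum) auto
        also have "\<dots> = (\<Sum>c\<in>unit4. c * of_real (LINT y|Q x. quadrant_part c (h y)))"
          by simp
        finally have Th: "T h x = \<dots>" .
        have "T h x * k x = (\<Sum>c\<in>unit4. c * of_real (LINT y|Q x. quadrant_part c (h y)))
            * (\<Sum>d\<in>unit4. d * of_real (quadrant_part d (k x)))"
          unfolding Th quadrant_decomp[of "k x", symmetric] ..
        moreover have "(c * of_real A) * (d * of_real B) = c * d * of_real (A * B)" for c d :: complex and A B :: real
          by simp
        ultimately show ?thesis by (simp only: sum_product)
      qed
    qed
  qed
  note k = pairing_nonneg[OF _ _ nn FG]
  note e1 = expand[OF _ _ fin, folded F_def G_def, simplified]
  have fin': "(\<integral>\<^sup>+x. (\<integral>\<^sup>+y. norm (g y) \<partial>Q x) * norm (f x) \<partial>M) < \<infinity>"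
    using fin Q_symmetric[of "\<lambda>x. norm (f x)" "\<lambda>x. norm (g x)"] by (simp add: mult.commute)
  have e2: "AE x in M. f x * T g x = (\<Sum>c\<in>unit4. \<Sum>d\<in>unit4. c * d * of_real (F c x * (LINT y|Q x. G d y)))"
    using expand[OF _ _ fin', folded F_def G_def, simplified]
    by (subst sum.swap) (auto simp: mult_ac)
  have i1: "integrable M (\<lambda>x. c * d * of_real ((LINT y|Q x. F c y) * G d x))"
    if "c \<in> unit4" "d \<in> unit4" for c d
    by (intro integrable_mult_right integrable_of_real) (use k(1)[OF _ _ that] in simp)
  have i2: "integrable M (\<lambda>x. c * d * of_real (F c x * (LINT y|Q x. G d y)))"
    if "c \<in> unit4" "d \<in> unit4" for c d
    by (intro integrable_mult_right integrable_of_real) (use k(2)[OF _ _ that] in simp)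
  have j1: "integrable M (\<lambda>x. \<Sum>c\<in>unit4. \<Sum>d\<in>unit4. c * d * of_real ((LINT y|Q x. F c y) * G d x))"
    by (intro Bochner_Integration.integrable_sum i1)
  have j2: "integrable M (\<lambda>x. \<Sum>c\<in>unit4. \<Sum>d\<in>unit4. c * d * of_real (F c x * (LINT y|Q x. G d y)))"
    by (intro Bochner_Integration.integrable_sum i2)
  have swap: "(LINT x|M. (\<Sum>c\<in>unit4. \<Sum>d\<in>unit4. h c d x)) = (\<Sum>c\<in>unit4. \<Sum>d\<in>unit4. (LINT x|M. h c d x))"
    if h: "\<And>c d. c \<in> unit4 \<Longrightarrow> d \<in> unit4 \<Longrightarrow> integrable M (h c d)"
    for h :: "complex \<Rightarrow> complex \<Rightarrow> 'a \<Rightarrow> complex"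
  proof -
    have "(LINT x|M. (\<Sum>c\<in>unit4. \<Sum>d\<in>unit4. h c d x)) = (\<Sum>c\<in>unit4. (LINT x|M. (\<Sum>d\<in>unit4. h c d x)))"
      by (intro Bochner_Integration.integral_sum Bochner_Integration.integrable_sum h)
    also have "\<dots> = (\<Sum>c\<in>unit4. \<Sum>d\<in>unit4. (LINT x|M. h c d x))"
      by (intro sum.cong refl Bochner_Integration.integral_sum h)
    finally show ?thesis .
  qed
  show I1: "integrable M (\<lambda>x. T f x * g x)"
    by (rule integrable_cong_AE_imp[OF j1]) (use e1 in auto)
  show I2: "integrable M (\<lambda>x. f x * T g x)"
    by (rule integrable_cong_AE_imp[OF j2]) (use e2 in auto)
  have "(LINT x|M. T f x * g x) = (LINT x|M. (\<Sum>c\<in>unit4. \<Sum>d\<in>unit4. c * d * of_real ((LINT y|Q x. F c y) * G d x)))"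
    by (rule integral_cong_AE) (use e1 I1 j1 in \<open>auto dest: borel_measurable_integrable\<close>)
  also have "\<dots> = (\<Sum>c\<in>unit4. \<Sum>d\<in>unit4. LINT x|M. c * d * of_real ((LINT y|Q x. F c y) * G d x))"
    by (rule swap) (rule i1)
  also have "\<dots> = (\<Sum>c\<in>unit4. \<Sum>d\<in>unit4. c * d * of_real (LINT x|M. (LINT y|Q x. F c y) * G d x))"
    by (simp del: of_real_mult)
  also have "\<dots> = (\<Sum>c\<in>unit4. \<Sum>d\<in>unit4. c * d * of_real (LINT x|M. F c x * (LINT y|Q x. G d y)))"
    by (intro sum.cong refl) (use k(3) in simp)
  also have "\<dots> = (\<Sum>c\<in>unit4. \<Sum>d\<in>unit4. LINT x|M. c * d * of_real (F c x * (LINT y|Q x. G d y)))"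
    by (simp del: of_real_mult)
  also have "\<dots> = (LINT x|M. (\<Sum>c\<in>unit4. \<Sum>d\<in>unit4. c * d * of_real (F c x * (LINT y|Q x. G d y))))"
    by (rule swap[symmetric]) (rule i2)
  also have "\<dots> = (LINT x|M. f x * T g x)"
    by (rule integral_cong_AE) (use e2 I2 j2 in \<open>auto dest: borel_measurable_integrable\<close>)
  finally show "(LINT x|M. T f x * g x) = (LINT x|M. f x * T g x)" .
qed

end

subsection \<open>Integrable bounded functions as test functions\<close>

text \<open>The test functions. Identities in any \<open>L^p\<close>, with
  \<open>p = \<infinity>\<close> included, are proved by pairing with them, since they lie in all
  these spaces and symmetric kernels preserve them.\<close>

definition L1_Linfty :: "'a measure \<Rightarrow> ('a \<Rightarrow> complex) set" where
  "L1_Linfty M = Lp_space 1 M \<inter> Lp_space top M"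

lemma L1_Linfty_subset_Lp:
  assumes p: "1 \<le> p" and f: "f \<in> L1_Linfty M"
  shows "f \<in> Lp_space p M"
proof (cases "p = top")
  case False
  define r where "r = enn2real p"
  have r: "1 \<le> r" using enn2real_ge_1[OF p] False by (simp add: r_def)
  from f obtain C where i: "integrable M f" and [measurable]: "f \<in> borel_measurable M"
    and C: "0 \<le> C" "AE x in M. norm (f x) \<le> C"
    by (auto simp: L1_Linfty_def Lp_space_1_iff Lp_space_infinity_iff)
  have i2: "integrable M (\<lambda>x. C powr (r - 1) * norm (f x))" using i by simp
  have "integrable M (\<lambda>x. norm (f x) powr r)"
  proof (rule Bochner_Integration.integrable_bound[OF i2])
    show "AE x in M. norm (norm (f x) powr r) \<le> norm (C powr (r - 1) * norm (f x))"
      using C(2)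
    proof eventually_elim
      case (elim x)
      have "norm (f x) powr r = norm (f x) powr (r - 1) * norm (f x)"
        by (cases "f x = 0") (simp_all add: powr_diff)
      also have "\<dots> \<le> C powr (r - 1) * norm (f x)"
        using elim r by (intro mult_right_mono powr_mono2) auto
      finally show ?case by simp
    qed
  qed measurable
  then show ?thesis using False by (simp add: Lp_space_finite_iff r_def)
qed (use f in \<open>simp add: L1_Linfty_def\<close>)

lemma L1_Linfty_iff:
  "f \<in> L1_Linfty M \<longleftrightarrow> integrable M f \<and> (\<exists>C\<ge>0. AE x in M. norm (f x) \<le> C)"
  by (auto simp: L1_Linfty_def Lp_space_1_iff Lp_space_infinity_iff)

lemma L1_Linfty_measurable: "f \<in> L1_Linfty M \<Longrightarrow> f \<in> borel_measurable M"
  by (auto simp: L1_Linfty_iff)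

lemma L1_Linfty_add: "f \<in> L1_Linfty M \<Longrightarrow> g \<in> L1_Linfty M \<Longrightarrow> (\<lambda>x. f x + g x) \<in> L1_Linfty M"
  by (auto simp: L1_Linfty_def intro: Lp_space_add)

lemma L1_Linfty_scale: "f \<in> L1_Linfty M \<Longrightarrow> (\<lambda>x. c * f x) \<in> L1_Linfty M"
  by (auto simp: L1_Linfty_def intro: Lp_space_scale)

lemma L1_Linfty_diff: "f \<in> L1_Linfty M \<Longrightarrow> g \<in> L1_Linfty M \<Longrightarrow> (\<lambda>x. f x - g x) \<in> L1_Linfty M"
  by (auto simp: L1_Linfty_def intro: Lp_space_diff)

lemma L1_Linfty_cnj: "f \<in> L1_Linfty M \<Longrightarrow> (\<lambda>x. cnj (f x)) \<in> L1_Linfty M"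
  by (auto simp: L1_Linfty_iff)

lemma L1_Linfty_sum:
  "(\<And>i. i \<in> I \<Longrightarrow> f i \<in> L1_Linfty M) \<Longrightarrow> (\<lambda>x. \<Sum>i\<in>I. f i x) \<in> L1_Linfty M"
proof (induction I rule: infinite_finite_induct)
  case (insert i I)
  then show ?case by (simp add: L1_Linfty_add)
qed (auto simp: L1_Linfty_def Lp_space_zero)

lemma integrable_L1_Linfty:
  assumes f: "f \<in> Lp_space 1 M" and g: "g \<in> Lp_space top M"
  shows "integrable M (\<lambda>x. f x * g x)"
    and "norm (LINT x|M. f x * g x) \<le> Lp_norm 1 M f * Lp_norm top M g"
proof -
  have i: "integrable M f" using f by (simp add: Lp_space_1_iff)
  note [measurable] = Lp_space_measurable[OF f] Lp_space_measurable[OF g]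
  have i2: "integrable M (\<lambda>x. norm (f x) * Lp_norm top M g)" using i by simp
  have le: "AE x in M. norm (f x * g x) \<le> norm (f x) * Lp_norm top M g"
    using Lp_norm_infinity_AE[OF g] by eventually_elim (simp add: norm_mult mult_left_mono)
  show i3: "integrable M (\<lambda>x. f x * g x)"
    by (rule Bochner_Integration.integrable_bound[OF i2])
      (use le in \<open>auto elim!: eventually_mono intro: order_trans\<close>)
  have "norm (LINT x|M. f x * g x) \<le> (LINT x|M. norm (f x * g x))" by (rule integral_norm_bound)
  also have "\<dots> \<le> (LINT x|M. norm (f x) * Lp_norm top M g)"
    by (rule integral_mono_AE) (use i2 i3 le in auto)
  finally show "norm (LINT x|M. f x * g x) \<le> Lp_norm 1 M f * Lp_norm top M g"
    by (simp add: Lp_norm_1)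
qed

text \<open>From \<open>norm (f x) \<le> 1 + norm (f x) powr r\<close> and
  \<open>norm (g x) \<le> C\<close> one gets the majorant
  \<open>norm (g x) + C * norm (f x) powr r\<close>, both summands of which are integrable.\<close>

lemma integrable_Lp_test:
  assumes p: "1 \<le> p" and f: "f \<in> Lp_space p M" and g: "g \<in> L1_Linfty M"
  shows "integrable M (\<lambda>x. f x * g x)"
proof (cases "p = top")
  case True
  with f g integrable_L1_Linfty(1)[of g M f] show ?thesis by (simp add: L1_Linfty_def mult.commute)
next
  case False
  define r where "r = enn2real p"
  have r: "1 \<le> r" using enn2real_ge_1[OF p] False by (simp add: r_def)
  from g obtain C where i: "integrable M g" and [measurable]: "g \<in> borel_measurable M"
    and C: "0 \<le> C" "AE x in M. norm (g x) \<le> C"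
    by (auto simp: L1_Linfty_iff)
  have [measurable]: "f \<in> borel_measurable M" and i2: "integrable M (\<lambda>x. norm (f x) powr r)"
    using f False by (auto simp: Lp_space_finite_iff r_def)
  have i3: "integrable M (\<lambda>x. norm (g x) + C * norm (f x) powr r)" using i i2 by simp
  show ?thesis
  proof (rule Bochner_Integration.integrable_bound[OF i3])
    show "AE x in M. norm (f x * g x) \<le> norm (norm (g x) + C * norm (f x) powr r)"
      using C(2)
    proof eventually_elim
      case (elim x)
      have "norm (f x * g x) \<le> (1 + norm (f x) powr r) * norm (g x)"
        using le_one_plus_powr[OF r, of "norm (f x)"] by (simp add: norm_mult mult_right_mono)
      also have "\<dots> \<le> norm (g x) + C * norm (f x) powr r"
        using mult_left_mono[OF elim, of "norm (f x) powr r"] by (simp add: algebra_simps)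
      finally show ?case using C by simp
    qed
  qed measurable
qed

lemma borel_measurable_cnj_sgn [measurable]:
  assumes [measurable]: "f \<in> borel_measurable M"
  shows "(\<lambda>x. cnj (sgn (f x))) \<in> borel_measurable M"
proof -
  have "cnj \<in> borel_measurable borel"
    by (intro borel_measurable_continuous_onI continuous_intros)
  moreover have "(\<lambda>x. sgn (f x)) \<in> borel_measurable M"
    unfolding sgn_div_norm by measurable
  ultimately show ?thesis by (rule measurable_compose[rotated])
qed

lemma mult_cnj_sgn: "z * cnj (sgn z) = of_real (norm z)" for z :: complex
proof (cases "z = 0")
  case False
  have "z * cnj (sgn z) = (z * cnj z) / of_real (norm z)" by (simp add: sgn_div_norm scaleR_conv_of_real field_simps)
  also have "\<dots> = of_real (norm z)" using False by (simp add: complex_norm_square[symmetric] power2_eq_square)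
  finally show ?thesis .
qed simp

text \<open>The functional that norms \<open>f\<close>: by \<open>mult_cnj_sgn\<close> its pairing
  with \<open>f\<close> is the \<open>L^1\<close> norm of \<open>f\<close>.\<close>

lemma cnj_sgn_test:
  assumes [measurable]: "f \<in> borel_measurable M"
  shows "(\<lambda>x. cnj (sgn (f x))) \<in> Lp_space top M" "Lp_norm top M (\<lambda>x. cnj (sgn (f x))) \<le> 1"
proof -
  have "AE x in M. norm (cnj (sgn (f x))) \<le> 1" by (simp add: norm_sgn)
  then show "(\<lambda>x. cnj (sgn (f x))) \<in> Lp_space top M" "Lp_norm top M (\<lambda>x. cnj (sgn (f x))) \<le> 1"
    by (auto simp: Lp_space_infinity_iff intro!: exI[of _ 1] Lp_norm_infinity_le)
qed

text \<open>On each member of a countable cover by sets of finite measure, test with the conjugate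
  phase of \<open>f\<close> cut off to that set: the integrand becomes the absolute value of
  \<open>f\<close>, whose integral can vanish only if \<open>f\<close> does.\<close>

lemma (in sigma_finite_measure) test_functions_separate:
  assumes p: "1 \<le> p" and f: "f \<in> Lp_space p M"
    and zero: "\<And>g. g \<in> L1_Linfty M \<Longrightarrow> (LINT x|M. f x * g x) = 0"
  shows "AE x in M. f x = 0"
proof -
  note [measurable] = Lp_space_measurable[OF f]
  obtain A :: "nat \<Rightarrow> 'a set" where A: "range A \<subseteq> sets M" "(\<Union>i. A i) = space M" "\<And>i. emeasure M (A i) \<noteq> \<infinity>"
    using sigma_finite by blast
  have [measurable]: "A i \<in> sets M" for i using A by auto
  have ae: "AE x in M. x \<in> A i \<longrightarrow> f x = 0" for i
  proof -
    define g where "g x = indicator (A i) x *\<^sub>R cnj (sgn (f x))" for x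
    have "integrable M (\<lambda>x. indicator (A i) x *\<^sub>R cnj (sgn (f x)))"
      by (rule integrableI_bounded_set_indicator[of _ _ _ 1]) (use A in \<open>auto simp: less_top norm_sgn\<close>)
    then have "integrable M g" by (simp add: g_def[abs_def])
    moreover have "norm (g x) \<le> 1" for x by (simp add: g_def norm_sgn indicator_def)
    ultimately have g: "g \<in> L1_Linfty M" by (auto simp: L1_Linfty_iff intro!: exI[of _ 1])
    have eq: "f x * g x = of_real (norm (f x) * indicator (A i) x)" for x
      using mult_cnj_sgn[of "f x"] by (simp add: g_def indicator_def)
    have i: "integrable M (\<lambda>x. norm (f x) * indicator (A i) x)"
      using integrable_norm[OF integrable_Lp_test[OF p f g]] by (simp add: eq norm_mult)
    have "(LINT x|M. norm (f x) * indicator (A i) x) = 0"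
      using zero[OF g] unfolding eq by (simp only: integral_complex_of_real of_real_eq_0_iff)
    then have "AE x in M. norm (f x) * indicator (A i) x = 0"
      using integral_nonneg_eq_0_iff_AE[OF i] by simp
    then show ?thesis by eventually_elim auto
  qed
  have "AE x in M. \<forall>i. x \<in> A i \<longrightarrow> f x = 0" unfolding AE_all_countable using ae by blast
  then show ?thesis using AE_space by eventually_elim (use A(2) in auto)
qed

context symmetric_kernel
begin

lemma T_test: "f \<in> L1_Linfty M \<Longrightarrow> T f \<in> L1_Linfty M"
  by (simp add: L1_Linfty_def T_Lp)

text \<open>Symmetry applied to absolute values moves the finiteness premise of
  \<open>pairing\<close> to the side of \<open>g\<close>. Integrability of \<open>g\<close> against
  almost every \<open>Q x\<close> turns the extended kernel integral of its norm into a value of the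
  operator.\<close>

lemma pairing_integrable:
  assumes [measurable]: "f \<in> borel_measurable M" "g \<in> borel_measurable M"
    and ae: "AE x in M. integrable (Q x) g"
    and i: "integrable M (\<lambda>x. f x * T (\<lambda>y. of_real (norm (g y))) x)"
  shows "integrable M (\<lambda>x. T f x * g x)" and "integrable M (\<lambda>x. f x * T g x)"
    and "(LINT x|M. T f x * g x) = (LINT x|M. f x * T g x)"
proof -
  have "(\<integral>\<^sup>+x. (\<integral>\<^sup>+y. norm (f y) \<partial>Q x) * norm (g x) \<partial>M) = (\<integral>\<^sup>+x. norm (f x) * (\<integral>\<^sup>+y. norm (g y) \<partial>Q x) \<partial>M)"
    by (rule Q_symmetric) auto
  also have "\<dots> = (\<integral>\<^sup>+x. norm (f x * T (\<lambda>y. of_real (norm (g y))) x) \<partial>M)"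
    using ae
    by (intro nn_integral_cong_AE)
      (auto elim!: eventually_mono simp: nn_integral_eq_integral kernel_op_def norm_mult ennreal_mult integral_nonneg)
  also have "\<dots> < \<infinity>" using i by (simp add: integrable_iff_bounded)
  finally have fin: "(\<integral>\<^sup>+x. (\<integral>\<^sup>+y. norm (f y) \<partial>Q x) * norm (g x) \<partial>M) < \<infinity>" .
  show "integrable M (\<lambda>x. T f x * g x)" "integrable M (\<lambda>x. f x * T g x)"
    "(LINT x|M. T f x * g x) = (LINT x|M. f x * T g x)"
    by (rule pairing[OF _ _ fin], measurable)+
qed

lemma pairing_Lp_test:
  assumes p: "1 \<le> p" and f: "f \<in> Lp_space p M" and g: "g \<in> L1_Linfty M"
  shows "(LINT x|M. T f x * g x) = (LINT x|M. f x * T g x)"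
proof (rule pairing_integrable(3))
  have "(\<lambda>y. complex_of_real (norm (g y))) \<in> L1_Linfty M" using g by (auto simp: L1_Linfty_iff)
  then show "integrable M (\<lambda>x. f x * T (\<lambda>y. of_real (norm (g y))) x)"
    by (intro integrable_Lp_test[OF p f] T_test)
  show "AE x in M. integrable (Q x) g"
    using Lp_kernel_integrable[of 1 g] g by (simp add: L1_Linfty_def)
qed (use f g Lp_space_measurable L1_Linfty_measurable in auto)

lemma pairing_L1_Linfty:
  assumes f: "f \<in> Lp_space 1 M" and g: "g \<in> Lp_space top M"
  shows "(LINT x|M. T f x * g x) = (LINT x|M. f x * T g x)"
proof (rule pairing_integrable(3))
  have "(\<lambda>y. complex_of_real (norm (g y))) \<in> Lp_space top M" using g by (auto simp: Lp_space_infinity_iff)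
  then show "integrable M (\<lambda>x. f x * T (\<lambda>y. of_real (norm (g y))) x)"
    by (intro integrable_L1_Linfty f T_Lp) auto
  show "AE x in M. integrable (Q x) g"
    using Lp_kernel_integrable[of top g] g by simp
qed (use f g Lp_space_measurable in auto)

end

subsection \<open>Compactness on all Lebesgue spaces\<close>

lemma Lp_compact_operatorE:
  assumes "Lp_compact_operator p M A" "\<And>n::nat. f n \<in> Lp_space p M" "\<And>n. Lp_norm p M (f n) \<le> 1"
  obtains g r where "g \<in> Lp_space p M" "strict_mono (r::nat \<Rightarrow> nat)"
    "(\<lambda>n. Lp_norm p M (\<lambda>x. A (f (r n)) x - g x)) \<longlonglongrightarrow> 0"
proof -
  from assms have "\<exists>g\<in>Lp_space p M. \<exists>r::nat \<Rightarrow> nat. strict_mono r \<and>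
        (\<lambda>n. Lp_norm p M (\<lambda>x. A (f (r n)) x - g x)) \<longlonglongrightarrow> 0"
    unfolding Lp_compact_operator_def by simp
  then obtain g where g: "g \<in> Lp_space p M" "\<exists>r::nat \<Rightarrow> nat. strict_mono r \<and>
        (\<lambda>n. Lp_norm p M (\<lambda>x. A (f (r n)) x - g x)) \<longlonglongrightarrow> 0" ..
  from g(2) obtain r :: "nat \<Rightarrow> nat" where
    "strict_mono r \<and> (\<lambda>n. Lp_norm p M (\<lambda>x. A (f (r n)) x - g x)) \<longlonglongrightarrow> 0" ..
  with g(1) that[of g r] show thesis by simp
qed

lemma Lp_compact_operatorI:
  assumes "Lp_operator p M A"
    and "\<And>f. (\<And>n::nat. f n \<in> Lp_space p M) \<Longrightarrow> (\<And>n. Lp_norm p M (f n) \<le> 1) \<Longrightarrow>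
      \<exists>g r. g \<in> Lp_space p M \<and> strict_mono (r::nat \<Rightarrow> nat) \<and>
        (\<lambda>n. Lp_norm p M (\<lambda>x. A (f (r n)) x - g x)) \<longlonglongrightarrow> 0"
  shows "Lp_compact_operator p M A"
  unfolding Lp_compact_operator_def
proof (intro conjI allI impI assms(1))
  fix f :: "nat \<Rightarrow> 'a \<Rightarrow> complex" assume "\<forall>n. f n \<in> Lp_space p M \<and> Lp_norm p M (f n) \<le> 1"
  with assms(2)[of f] obtain g r where "g \<in> Lp_space p M" "strict_mono (r::nat \<Rightarrow> nat)"
    "(\<lambda>n. Lp_norm p M (\<lambda>x. A (f (r n)) x - g x)) \<longlonglongrightarrow> 0" by auto
  then show "\<exists>g\<in>Lp_space p M. \<exists>r::nat \<Rightarrow> nat. strict_mono r \<and>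
        (\<lambda>n. Lp_norm p M (\<lambda>x. A (f (r n)) x - g x)) \<longlonglongrightarrow> 0"
    by (intro bexI[of _ g] exI[of _ r]) auto
qed

lemma finite_family_convergent_subseq:
  fixes c :: "'b \<Rightarrow> nat \<Rightarrow> complex"
  assumes "finite F" "\<And>b. b \<in> F \<Longrightarrow> \<exists>C. \<forall>n. norm (c b n) \<le> C"
  shows "\<exists>s::nat \<Rightarrow> nat. strict_mono s \<and> (\<forall>b\<in>F. convergent (\<lambda>n. c b (s n)))"
  using assms
proof (induction F)
  case empty
  show ?case by (intro exI[of _ id]) (auto simp: strict_mono_def)
next
  case (insert a F)
  then obtain s :: "nat \<Rightarrow> nat" where s: "strict_mono s" "\<forall>b\<in>F. convergent (\<lambda>n. c b (s n))"
    by (metis insertI2)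
  from insert.prems[of a] obtain C where "\<forall>n. norm (c a n) \<le> C" by auto
  then have "bounded (range (\<lambda>n. c a (s n)))" by (auto simp: bounded_iff)
  then obtain l and r :: "nat \<Rightarrow> nat" where r: "strict_mono r" "((\<lambda>n. c a (s n)) \<circ> r) \<longlonglongrightarrow> l"
    using bounded_imp_convergent_subsequence by blast
  have "convergent (\<lambda>n. c b ((s \<circ> r) n))" if "b \<in> insert a F" for b
  proof (cases "b = a")
    case True
    then show ?thesis using r(2) by (auto simp: convergent_def o_def)
  next
    case False
    then have "convergent (\<lambda>n. c b (s n))" using that s by auto
    from convergent_subseq_convergent[OF this r(1)] show ?thesis by (simp add: o_def)
  qed
  moreover have "strict_mono (s \<circ> r)" using s(1) r(1) by (rule strict_mono_o)
  ultimately show ?case by (intro exI[of _ "s \<circ> r"]) (simp only: simp_thms, blast)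
qed

context symmetric_kernel
begin

text \<open>Sequential compactness gives total boundedness: without a finite net one could pick an
  infinite sequence whose images are pairwise more than \<open>e\<close> apart.\<close>

lemma compact_net:
  assumes c: "Lp_compact_operator top M T" and e: "0 < e"
  obtains (net) F where "finite F" "F \<subseteq> {g \<in> Lp_space top M. Lp_norm top M g \<le> 1}"
    "\<And>g. g \<in> Lp_space top M \<Longrightarrow> Lp_norm top M g \<le> 1 \<Longrightarrow> \<exists>b\<in>F. Lp_norm top M (\<lambda>x. T g x - T b x) \<le> e"
proof (rule ccontr)
  assume no: "\<not> thesis"
  let ?B = "{g \<in> Lp_space top M. Lp_norm top M g \<le> 1}"
  have step: "\<exists>a\<in>?B. \<forall>b\<in>F. e < Lp_norm top M (\<lambda>x. T a x - T b x)" if "finite F" "F \<subseteq> ?B" for F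
  proof (rule ccontr)
    assume "\<not> ?thesis"
    then have "\<forall>a\<in>?B. \<exists>b\<in>F. Lp_norm top M (\<lambda>x. T a x - T b x) \<le> e" by (simp add: not_less)
    with net[OF that] no show False by blast
  qed
  obtain s where s: "\<And>n. s n \<in> ?B" "\<And>i j::nat. i < j \<Longrightarrow> e < Lp_norm top M (\<lambda>x. T (s j) x - T (s i) x)"
    by (rule infinite_chain[of "\<lambda>_. True" ?B "\<lambda>b a. e < Lp_norm top M (\<lambda>x. T a x - T b x)"]) (simp, use step in simp, rule that)
  have sL: "s n \<in> Lp_space top M" "Lp_norm top M (s n) \<le> 1" for n using s(1) by auto
  obtain g r where g: "g \<in> Lp_space top M" "strict_mono (r::nat \<Rightarrow> nat)"
    "(\<lambda>n. Lp_norm top M (\<lambda>x. T (s (r n)) x - g x)) \<longlonglongrightarrow> 0"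
    by (rule Lp_compact_operatorE[OF c sL])
  have "eventually (\<lambda>n. Lp_norm top M (\<lambda>x. T (s (r n)) x - g x) < e / 2) sequentially"
    using order_tendstoD(2)[OF g(3), of "e/2"] e by simp
  then obtain N where N: "\<And>n. n \<ge> N \<Longrightarrow> Lp_norm top M (\<lambda>x. T (s (r n)) x - g x) < e / 2"
    by (auto simp: eventually_sequentially)
  have "Lp_norm top M (\<lambda>x. T (s (r (Suc N))) x - T (s (r N)) x)
      \<le> Lp_norm top M (\<lambda>x. T (s (r (Suc N))) x - g x) + Lp_norm top M (\<lambda>x. g x - T (s (r N)) x)"
    by (intro Lp_norm_diff_triangle T_Lp g sL) auto
  also have "\<dots> < e" using N[of N] N[of "Suc N"] Lp_norm_minus_commute[of top M g] by simp
  finally show False using s(2)[of "r N" "r (Suc N)"] g(2) by (simp add: strict_mono_def)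
qed

text \<open>Schauder's theorem made explicit. The \<open>L^1\<close> distance of
  \<open>T (f i)\<close> and \<open>T (f j)\<close> is a pairing with some \<open>g\<close> in the
  unit ball of \<open>L^\<infinity>\<close>; by symmetry it is the pairing of
  \<open>f i - f j\<close> with \<open>T g\<close>, and \<open>T g\<close> is close to one of
  finitely many \<open>T b\<close>. The pairings with these are bounded, so a subsequence makes them
  all converge.\<close>

lemma L1_compact:
  assumes c: "Lp_compact_operator top M T"
  shows "Lp_compact_operator 1 M T"
proof (rule Lp_compact_operatorI)
  show "Lp_operator 1 M T" by (rule Lp_operator_T) simp
  fix f :: "nat \<Rightarrow> 'a \<Rightarrow> complex"
  assume f: "\<And>n. f n \<in> Lp_space 1 M" "\<And>n. Lp_norm 1 M (f n) \<le> 1"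
  have Tf: "T (f n) \<in> Lp_space 1 M" for n by (intro T_Lp f) simp
  note [measurable] = Lp_space_measurable[OF f(1)] Lp_space_measurable[OF Tf]
  define D where "D i j = (LINT x|M. norm (T (f i) x - T (f j) x))" for i j
  obtain r :: "nat \<Rightarrow> nat" where r: "strict_mono r" "\<And>e. 0 < e \<Longrightarrow> \<exists>N. \<forall>i\<ge>N. \<forall>j\<ge>N. D (r i) (r j) \<le> e"
  proof (rule diagonal_cauchy)
    fix e :: real and r :: "nat \<Rightarrow> nat" assume e: "0 < e" and r: "strict_mono r"
    \<comment> \<open>Budget: \<open>f i - f j\<close> has \<open>L^1\<close> norm at most 2, so the
      error of the net costs \<open>2 * (e/4)\<close>; the pairings with the finitely many
      \<open>T b\<close> take the other \<open>e/2\<close>.\<close>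
    have "0 < e/4" using e by simp
    obtain F where F: "finite F"
      "F \<subseteq> {g \<in> Lp_space top M. Lp_norm top M g \<le> 1}"
      "\<And>g. g \<in> Lp_space top M \<Longrightarrow> Lp_norm top M g \<le> 1 \<Longrightarrow> \<exists>b\<in>F. Lp_norm top M (\<lambda>x. T g x - T b x) \<le> e/4"
      by (rule compact_net[OF c \<open>0 < e/4\<close>]) (rule that)
    have FL: "b \<in> Lp_space top M" "T b \<in> Lp_space top M" if "b \<in> F" for b
      using F(2) that by (auto intro!: T_Lp)
    define \<phi> where "\<phi> b n = (LINT x|M. f n x * T b x)" for b n
    have \<phi>: "norm (\<phi> b n) \<le> 1 * Lp_norm top M (T b)" if "b \<in> F" for b n
      unfolding \<phi>_def using integrable_L1_Linfty(2)[OF f(1) FL(2)[OF that], of n]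
        mult_right_mono[OF f(2)[of n] Lp_norm_nonneg[of top M "T b"]] by linarith
    have "\<exists>s::nat \<Rightarrow> nat. strict_mono s \<and> (\<forall>b\<in>F. convergent (\<lambda>n. \<phi> b (r (s n))))"
      by (rule finite_family_convergent_subseq[OF F(1), of "\<lambda>b n. \<phi> b (r n)"]) (use \<phi> in blast)
    then obtain s :: "nat \<Rightarrow> nat" where s': "strict_mono s \<and> (\<forall>b\<in>F. convergent (\<lambda>n. \<phi> b (r (s n))))" ..
    then have s: "strict_mono s" "\<And>b. b \<in> F \<Longrightarrow> Cauchy (\<lambda>n. \<phi> b (r (s n)))"
      by (simp_all add: Cauchy_convergent_iff)
    have "\<forall>b\<in>F. \<exists>N. \<forall>i\<ge>N. \<forall>j\<ge>N. norm (\<phi> b (r (s i)) - \<phi> b (r (s j))) < e/2"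
    proof
      fix b assume "b \<in> F"
      from CauchyD[OF s(2)[OF this], of "e/2"] e
      show "\<exists>N. \<forall>i\<ge>N. \<forall>j\<ge>N. norm (\<phi> b (r (s i)) - \<phi> b (r (s j))) < e/2" by simp
    qed
    from bchoice[OF this] obtain N where
      N': "\<forall>b\<in>F. \<forall>i\<ge>N b. \<forall>j\<ge>N b. norm (\<phi> b (r (s i)) - \<phi> b (r (s j))) < e/2" ..
    have N: "norm (\<phi> b (r (s i)) - \<phi> b (r (s j))) < e/2" if "b \<in> F" "i \<ge> N b" "j \<ge> N b" for b i j
      using N' that by simp
    \<comment> \<open>The sum over the finite set \<open>F\<close> is a common threshold for all
      \<open>N b\<close>.\<close>
    define N0 where "N0 = (\<Sum>b\<in>F. N b)"
    have N0: "N b \<le> N0" if "b \<in> F" for b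
      unfolding N0_def using F(1) that by (intro member_le_sum) auto
    have "D (r (s i)) (r (s j)) \<le> e" if ij: "i \<ge> N0" "j \<ge> N0" for i j
    proof -
      let ?i = "r (s i)" and ?j = "r (s j)"
      define w where "w x = T (f ?i) x - T (f ?j) x" for x
      have [measurable]: "w \<in> borel_measurable M" by (simp add: w_def[abs_def])
      define g where "g x = cnj (sgn (w x))" for x
      have g: "g \<in> Lp_space top M" "Lp_norm top M g \<le> 1"
        using cnj_sgn_test[of w M] by (simp_all add: g_def[abs_def])
      have Tg: "T g \<in> Lp_space top M" using g by (intro T_Lp) auto
      obtain b where b: "b \<in> F" "Lp_norm top M (\<lambda>x. T g x - T b x) \<le> e/4" using F(3)[OF g] by blast
      have Tb: "T b \<in> Lp_space top M" by (rule FL(2)[OF b(1)])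
      have d: "(\<lambda>x. f ?i x - f ?j x) \<in> Lp_space 1 M" by (intro Lp_space_diff f) simp
      have d2: "Lp_norm 1 M (\<lambda>x. f ?i x - f ?j x) \<le> 2"
        using Lp_norm_triangle[OF _ f(1)[of ?i] Lp_space_scale[OF f(1)[of ?j], of "-1"]]
          Lp_norm_scale[OF _ f(1)[of ?j], of "-1"] f(2)[of ?i] f(2)[of ?j] by simp
      have h: "(\<lambda>x. T g x - T b x) \<in> Lp_space top M" by (intro Lp_space_diff Tg Tb) simp
      have "complex_of_real (D ?i ?j) = (LINT x|M. w x * g x)"
        unfolding D_def g_def mult_cnj_sgn w_def by simp
      also have "\<dots> = (LINT x|M. T (f ?i) x * g x) - (LINT x|M. T (f ?j) x * g x)"
        unfolding w_def left_diff_distrib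
        by (intro Bochner_Integration.integral_diff integrable_L1_Linfty Tf g)
      also have "\<dots> = (LINT x|M. f ?i x * T g x) - (LINT x|M. f ?j x * T g x)"
        by (simp add: pairing_L1_Linfty f g)
      also have "\<dots> = (LINT x|M. (f ?i x - f ?j x) * T g x)"
        unfolding left_diff_distrib
        by (intro Bochner_Integration.integral_diff[symmetric] integrable_L1_Linfty f Tg)
      also have "\<dots> = (LINT x|M. (f ?i x - f ?j x) * (T g x - T b x) + (f ?i x - f ?j x) * T b x)"
        by (simp add: algebra_simps)
      also have "\<dots> = (LINT x|M. (f ?i x - f ?j x) * (T g x - T b x)) + (LINT x|M. (f ?i x - f ?j x) * T b x)"
        by (intro Bochner_Integration.integral_add integrable_L1_Linfty d h Tb)
      also have "(LINT x|M. (f ?i x - f ?j x) * T b x) = \<phi> b ?i - \<phi> b ?j"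
        unfolding left_diff_distrib \<phi>_def
        by (intro Bochner_Integration.integral_diff integrable_L1_Linfty f Tb)
      finally have "norm (complex_of_real (D ?i ?j))
          \<le> norm (LINT x|M. (f ?i x - f ?j x) * (T g x - T b x)) + norm (\<phi> b ?i - \<phi> b ?j)"
        by (simp only: norm_triangle_ineq)
      then have "D ?i ?j \<le> norm (LINT x|M. (f ?i x - f ?j x) * (T g x - T b x)) + norm (\<phi> b ?i - \<phi> b ?j)"
        by simp
      also have "norm (LINT x|M. (f ?i x - f ?j x) * (T g x - T b x)) \<le> 2 * (e/4)"
        by (rule order_trans[OF integrable_L1_Linfty(2)[OF d h] mult_mono]) (use d2 b Lp_norm_nonneg in auto)
      also have "norm (\<phi> b ?i - \<phi> b ?j) \<le> e/2"
        using N[OF b(1), of i j] N0[OF b(1)] ij by fastforce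
      finally show ?thesis by simp
    qed
    then show "\<exists>s::nat \<Rightarrow> nat. strict_mono s \<and> (\<exists>N. \<forall>i\<ge>N. \<forall>j\<ge>N. D (r (s i)) (r (s j)) \<le> e)"
      using s(1) by (intro exI[of _ s]) auto
  next
    fix r :: "nat \<Rightarrow> nat"
    assume "strict_mono r" "\<And>e. 0 < e \<Longrightarrow> \<exists>N. \<forall>i\<ge>N. \<forall>j\<ge>N. D (r i) (r j) \<le> e"
    then show thesis by (rule that)
  qed
  obtain r' :: "nat \<Rightarrow> nat" and g h where r': "strict_mono r'" "integrable M g" "integrable M h"
    "\<And>n. AE x in M. norm (T (f (r (r' n))) x) \<le> h x" "AE x in M. (\<lambda>n. T (f (r (r' n))) x) \<longlonglongrightarrow> g x"
    "(\<lambda>n. LINT x|M. norm (T (f (r (r' n))) x - g x)) \<longlonglongrightarrow> 0"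
  proof (rule L1_cauchy_subseq[of M "\<lambda>n. T (f (r n))"])
    show "integrable M (T (f (r n)))" for n using Tf by (simp add: Lp_space_1_iff)
    show "\<exists>N. \<forall>i\<ge>N. \<forall>j\<ge>N. (LINT x|M. norm (T (f (r i)) x - T (f (r j)) x)) \<le> e" if "0 < e" for e
      using r(2)[OF that] by (simp add: D_def)
  qed (rule that)
  show "\<exists>g r. g \<in> Lp_space 1 M \<and> strict_mono (r::nat \<Rightarrow> nat) \<and> (\<lambda>n. Lp_norm 1 M (\<lambda>x. T (f (r n)) x - g x)) \<longlonglongrightarrow> 0"
    using strict_mono_o[OF r(1) r'(1)] r'(2,6)
    by (intro exI[of _ g] exI[of _ "r \<circ> r'"]) (simp add: Lp_space_1_iff Lp_norm_1)
qed

text \<open>\<open>L1_cauchy_subseq\<close> produces a limit \<open>k\<close> of its own; uniqueness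
  of limits in \<open>L^1\<close> identifies it with the given \<open>g\<close> almost
  everywhere.\<close>

lemma L1_convergent_subseq:
  assumes u: "\<And>n. u n \<in> Lp_space 1 M" and g: "g \<in> Lp_space 1 M"
    and lim: "(\<lambda>n. Lp_norm 1 M (\<lambda>x. u n x - g x)) \<longlonglongrightarrow> 0"
  obtains r :: "nat \<Rightarrow> nat" and h where "strict_mono r" "integrable M h"
    "\<And>n. AE x in M. norm (u (r n) x) \<le> h x" "AE x in M. (\<lambda>n. u (r n) x) \<longlonglongrightarrow> g x"
proof (rule L1_cauchy_subseq[of M u])
  show "integrable M (u n)" for n using u by (simp add: Lp_space_1_iff)
  fix e :: real assume e: "0 < e"
  then have "eventually (\<lambda>n. Lp_norm 1 M (\<lambda>x. u n x - g x) < e/2) sequentially"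
    using order_tendstoD(2)[OF lim, of "e/2"] by simp
  then obtain N where N: "\<And>n. n \<ge> N \<Longrightarrow> Lp_norm 1 M (\<lambda>x. u n x - g x) < e/2"
    by (auto simp: eventually_sequentially)
  have "(LINT x|M. norm (u i x - u j x)) \<le> e" if "i \<ge> N" "j \<ge> N" for i j
    using Lp_norm_diff_triangle[OF _ u[of i] g u[of j]] N[OF that(1)] N[OF that(2)]
      Lp_norm_minus_commute[of 1 M g "u j"] by (simp add: Lp_norm_1)
  then show "\<exists>N. \<forall>i\<ge>N. \<forall>j\<ge>N. (LINT x|M. norm (u i x - u j x)) \<le> e" by blast
next
  fix r :: "nat \<Rightarrow> nat" and k h
  assume "strict_mono r" "integrable M k" "integrable M h" "\<And>n. AE x in M. norm (u (r n) x) \<le> h x"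
    "AE x in M. (\<lambda>n. u (r n) x) \<longlonglongrightarrow> k x" "(\<lambda>n. LINT x|M. norm (u (r n) x - k x)) \<longlonglongrightarrow> 0"
  note k = this
  have kL: "k \<in> Lp_space 1 M" using k(2) by (simp add: Lp_space_1_iff)
  have d: "(\<lambda>x. k x - g x) \<in> Lp_space 1 M" by (intro Lp_space_diff kL g) simp
  have "(\<lambda>n. Lp_norm 1 M (\<lambda>x. u (r n) x - k x) + Lp_norm 1 M (\<lambda>x. u (r n) x - g x)) \<longlonglongrightarrow> 0"
    using tendsto_add[OF k(6) LIMSEQ_subseq_LIMSEQ[OF lim k(1)]] by (simp add: o_def Lp_norm_1)
  then have "Lp_norm 1 M (\<lambda>x. k x - g x) \<le> 0"
  proof (rule tendsto_lowerbound)
    have "Lp_norm 1 M (\<lambda>x. k x - g x) \<le> Lp_norm 1 M (\<lambda>x. u (r n) x - k x) + Lp_norm 1 M (\<lambda>x. u (r n) x - g x)" for n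
      using Lp_norm_diff_triangle[OF order_refl kL u[of "r n"] g] Lp_norm_minus_commute[of 1 M k "u (r n)"] by simp
    then show "eventually (\<lambda>n. Lp_norm 1 M (\<lambda>x. k x - g x) \<le> Lp_norm 1 M (\<lambda>x. u (r n) x - k x)
      + Lp_norm 1 M (\<lambda>x. u (r n) x - g x)) sequentially" by simp
  qed simp
  then have "Lp_norm 1 M (\<lambda>x. k x - g x) = 0" using Lp_norm_nonneg[of 1 M "\<lambda>x. k x - g x"] by linarith
  then have "AE x in M. k x - g x = 0" using Lp_norm_eq_0_iff[OF order_refl d] by blast
  with k(5) have "AE x in M. (\<lambda>n. u (r n) x) \<longlonglongrightarrow> g x" by eventually_elim simp
  with k(1,3,4) show thesis by (intro that[of r h])
qed

text \<open>Split \<open>f = f 1{|f| > 1} + f 1{|f| \<le> 1}\<close>: the two parts are bounded in \<open>L\<^sup>1\<close> and \<open>L\<^sup>\<infinity>\<close>, which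
  yields almost everywhere convergence along a subsequence, while \<open>|T f|\<^sup>p \<le> T |f|\<^sup>p\<close> and compactness
  on \<open>L\<^sup>1\<close> provide an integrable majorant.\<close>

lemma Lp_compact:
  assumes c: "Lp_compact_operator top M T" and p: "1 \<le> p"
  shows "Lp_compact_operator p M T"
proof (cases "p = top")
  case True
  with c show ?thesis by simp
next
  case False
  define s where "s = enn2real p"
  have s: "1 \<le> s" using enn2real_ge_1[OF p] False by (simp add: s_def)
  note c1 = L1_compact[OF c]
  show ?thesis
  proof (rule Lp_compact_operatorI)
    show "Lp_operator p M T" by (rule Lp_operator_T[OF p])
    fix f :: "nat \<Rightarrow> 'a \<Rightarrow> complex"
    assume f: "\<And>n. f n \<in> Lp_space p M" "\<And>n. Lp_norm p M (f n) \<le> 1"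
    note [measurable] = Lp_space_measurable[OF f(1)]
    have fi: "integrable M (\<lambda>x. norm (f n x) powr s)" for n
      using f(1) False by (auto simp: Lp_space_finite_iff s_def)
    have fle: "(LINT x|M. norm (f n x) powr s) \<le> 1" for n
      using Lp_norm_le_iff[OF p, of 1 M "f n"] f(2) False by (simp add: s_def)
    \<comment> \<open>The threshold 1 serves both parts: \<open>a\<close> is dominated by
      \<open>norm (f n x) powr s\<close>, hence has \<open>L^1\<close> norm at most 1, and
      \<open>b\<close> is bounded by 1.\<close>
    define a where "a n x = (if norm (f n x) \<le> 1 then 0 else f n x)" for n x
    define b where "b n x = (if norm (f n x) \<le> 1 then f n x else 0)" for n x
    define d where "d n x = complex_of_real (norm (f n x) powr s)" for n x
    have [measurable]: "a n \<in> borel_measurable M" "b n \<in> borel_measurable M" "d n \<in> borel_measurable M" for n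
      by (simp_all add: a_def[abs_def] b_def[abs_def] d_def[abs_def])
    have fab: "f n = (\<lambda>x. a n x + b n x)" for n by (auto simp: a_def b_def)
    have d: "d n \<in> Lp_space 1 M" "Lp_norm 1 M (d n) \<le> 1" for n
      using fi fle by (auto simp: Lp_space_1_iff Lp_norm_1 d_def[abs_def])
    have ad: "norm (a n x) \<le> norm (d n x)" for n x
    proof (cases "norm (f n x) \<le> 1")
      case False
      then have "norm (f n x) powr 1 \<le> norm (f n x) powr s" using s by (intro powr_mono) auto
      with False show ?thesis by (simp add: a_def d_def)
    qed (simp add: a_def)
    have a: "a n \<in> Lp_space 1 M" "Lp_norm 1 M (a n) \<le> 1" for n
      using Lp_space_mono[OF _ d(1)[of n], of "a n"] ad d(2)[of n] by auto
    have b: "b n \<in> Lp_space top M" "Lp_norm top M (b n) \<le> 1" for n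
    proof -
      have "AE x in M. norm (b n x) \<le> 1" by (simp add: b_def)
      then show "b n \<in> Lp_space top M" "Lp_norm top M (b n) \<le> 1"
        by (auto simp: Lp_space_infinity_iff intro!: exI[of _ 1] Lp_norm_infinity_le)
    qed
    have TL: "T (a n) \<in> Lp_space 1 M" "T (b n) \<in> Lp_space top M" "T (d n) \<in> Lp_space 1 M" for n
      by (intro T_Lp a b d; simp)+
    note [measurable] = Lp_space_measurable[OF TL(1)] Lp_space_measurable[OF TL(2)]
    obtain g1 and r1 :: "nat \<Rightarrow> nat" where r1: "g1 \<in> Lp_space 1 M" "strict_mono r1"
      "(\<lambda>n. Lp_norm 1 M (\<lambda>x. T (a (r1 n)) x - g1 x)) \<longlonglongrightarrow> 0"
      by (rule Lp_compact_operatorE[OF c1 a])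
    obtain r2 :: "nat \<Rightarrow> nat" and h2 where r2: "strict_mono r2"
      "integrable M h2" "\<And>n. AE x in M. norm (T (a (r1 (r2 n))) x) \<le> h2 x"
      "AE x in M. (\<lambda>n. T (a (r1 (r2 n))) x) \<longlonglongrightarrow> g1 x"
      by (rule L1_convergent_subseq[OF TL(1) r1(1,3)]) (rule that)
    obtain g3 and r3 :: "nat \<Rightarrow> nat" where r3: "g3 \<in> Lp_space 1 M" "strict_mono r3"
      "(\<lambda>n. Lp_norm 1 M (\<lambda>x. T (d (r1 (r2 (r3 n)))) x - g3 x)) \<longlonglongrightarrow> 0"
      by (rule Lp_compact_operatorE[OF c1 d])
    obtain r4 :: "nat \<Rightarrow> nat" and h where r4: "strict_mono r4" "integrable M h"
      "\<And>n. AE x in M. norm (T (d (r1 (r2 (r3 (r4 n))))) x) \<le> h x"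
      "AE x in M. (\<lambda>n. T (d (r1 (r2 (r3 (r4 n))))) x) \<longlonglongrightarrow> g3 x"
      by (rule L1_convergent_subseq[OF TL(3) r3(1,3)]) (rule that)
    obtain g5 and r5 :: "nat \<Rightarrow> nat" where r5: "g5 \<in> Lp_space top M" "strict_mono r5"
      "(\<lambda>n. Lp_norm top M (\<lambda>x. T (b (r1 (r2 (r3 (r4 (r5 n)))))) x - g5 x)) \<longlonglongrightarrow> 0"
      by (rule Lp_compact_operatorE[OF c b])
    \<comment> \<open>\<open>r1\<close> and \<open>r2\<close> make \<open>T (a n)\<close> converge
      in \<open>L^1\<close> and almost everywhere, \<open>r3\<close> and \<open>r4\<close> provide
      the majorant \<open>h\<close> of \<open>T (d n)\<close>, and \<open>r5\<close> makes
      \<open>T (b n)\<close> converge uniformly; passing to a further subsequence destroys none of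
      this.\<close>
    define r where "r = r1 \<circ> r2 \<circ> r3 \<circ> r4 \<circ> r5"
    have mono: "strict_mono r" unfolding r_def by (intro strict_mono_o r1(2) r2(1) r3(2) r4(1) r5(2))
    have mono': "strict_mono (r3 \<circ> r4 \<circ> r5)" by (intro strict_mono_o r3(2) r4(1) r5(2))
    define g where "g x = g1 x + g5 x" for x
    have [measurable]: "g \<in> borel_measurable M"
      unfolding g_def using Lp_space_measurable[OF r1(1)] Lp_space_measurable[OF r5(1)] by measurable
    have Tfab: "AE x in M. T (f n) x = T (a n) x + T (b n) x" for n
      unfolding fab[of n]
      using Lp_kernel_integrable[OF _ a(1)[of n]] Lp_kernel_integrable[OF _ b(1)[of n]]
      by (auto elim!: eventually_elim2 simp: kernel_op_def)
    have limb: "AE x in M. (\<lambda>n. T (b (r n)) x) \<longlonglongrightarrow> g5 x"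
    proof -
      have "AE x in M. norm (T (b (r n)) x - g5 x) \<le> Lp_norm top M (\<lambda>x. T (b (r n)) x - g5 x)" for n
        by (intro Lp_norm_infinity_AE Lp_space_diff TL r5) simp
      then have "AE x in M. \<forall>n. norm (T (b (r n)) x - g5 x) \<le> Lp_norm top M (\<lambda>x. T (b (r n)) x - g5 x)"
        by (simp add: AE_all_countable)
      then show ?thesis
      proof eventually_elim
        case (elim x)
        have "(\<lambda>n. norm (T (b (r n)) x - g5 x)) \<longlonglongrightarrow> 0"
          by (rule tendsto_zero_squeeze[OF r5(3)]) (use elim in \<open>auto simp: r_def\<close>)
        then show ?case by (simp add: tendsto_norm_zero_iff LIM_zero_iff)
      qed
    qed
    have lima: "AE x in M. (\<lambda>n. T (a (r n)) x) \<longlonglongrightarrow> g1 x"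
      using r2(4)
    proof eventually_elim
      case (elim x)
      from LIMSEQ_subseq_LIMSEQ[OF this mono'] show ?case by (simp add: r_def o_def)
    qed
    have "AE x in M. \<forall>n. T (f (r n)) x = T (a (r n)) x + T (b (r n)) x"
      using Tfab by (simp add: AE_all_countable)
    then have lim: "AE x in M. (\<lambda>n. T (f (r n)) x) \<longlonglongrightarrow> g x"
      using lima limb by eventually_elim (auto simp: g_def intro!: tendsto_add)
    have dom: "AE x in M. norm (T (f (r n)) x) powr s \<le> h x" for n
      using r4(3)[of "r5 n"] Lp_kernel_integrable[OF order_refl d(1)[of "r n"]] AE_space
    proof eventually_elim
      case (elim x)
      have di: "integrable (Q x) (\<lambda>y. norm (f (r n) y) powr s)"
        using integrable_norm[of "Q x" "d (r n)"] elim by (simp add: d_def)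
      have "norm (T (f (r n)) x) powr s \<le> (LINT y|Q x. norm (f (r n) y) powr s)"
        by (rule T_jensen[OF _ _ s di]) (use elim in auto)
      also have "\<dots> = norm (T (d (r n)) x)" by (simp add: kernel_op_def d_def[abs_def] integral_nonneg)
      finally show ?case using elim by (simp add: r_def)
    qed
    then have doma: "AE x in M. \<forall>n. norm (T (f (r n)) x) powr s \<le> h x" by (simp add: AE_all_countable)
    \<comment> \<open>The majorant survives the limit; this puts \<open>g\<close> into
      \<open>L^p\<close> and lets a multiple of \<open>h\<close> dominate the differences.\<close>
    have domg: "AE x in M. norm (g x) powr s \<le> h x"
      using doma lim
    proof eventually_elim
      case (elim x)
      have "(\<lambda>n. norm (T (f (r n)) x) powr s) \<longlonglongrightarrow> norm (g x) powr s"
        using elim(2) s by (intro tendsto_powr' tendsto_norm tendsto_const) auto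
      then show ?case by (rule tendsto_upperbound) (use elim in auto)
    qed
    have gi: "integrable M (\<lambda>x. norm (g x) powr s)"
      by (rule Bochner_Integration.integrable_bound[OF r4(2)])
        (use domg in \<open>auto elim!: eventually_mono\<close>)
    then have g: "g \<in> Lp_space p M" using False by (simp add: Lp_space_finite_iff s_def)
    have TfL: "T (f n) \<in> Lp_space p M" for n by (intro T_Lp p f)
    note [measurable] = Lp_space_measurable[OF TfL] borel_measurable_integrable[OF r4(2)]
    have "(\<lambda>n. LINT x|M. norm (T (f (r n)) x - g x) powr s) \<longlonglongrightarrow> (LINT x|M. 0)"
    proof (rule integral_dominated_convergence[where w="\<lambda>x. 2 powr s * (h x + h x)"])
      show "integrable M (\<lambda>x. 2 powr s * (h x + h x))" using r4(2) by simp
      show "AE x in M. (\<lambda>n. norm (T (f (r n)) x - g x) powr s) \<longlonglongrightarrow> 0"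
        using lim
      proof eventually_elim
        case (elim x)
        then have "(\<lambda>n. norm (T (f (r n)) x - g x)) \<longlonglongrightarrow> 0"
          by (simp add: tendsto_norm_zero_iff LIM_zero_iff)
        then have "(\<lambda>n. norm (T (f (r n)) x - g x) powr s) \<longlonglongrightarrow> 0 powr s"
          using s by (intro tendsto_powr' tendsto_const) auto
        then show ?case by simp
      qed
      show "AE x in M. norm (norm (T (f (r n)) x - g x) powr s) \<le> 2 powr s * (h x + h x)" for n
        using dom[of n] domg
      proof eventually_elim
        case (elim x)
        have "norm (T (f (r n)) x - g x) powr s \<le> (norm (T (f (r n)) x) + norm (g x)) powr s"
          using s by (intro powr_mono2 norm_triangle_ineq4) auto
        also have "\<dots> \<le> 2 powr s * (norm (T (f (r n)) x) powr s + norm (g x) powr s)"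
          using s by (intro add_powr_le) auto
        also have "\<dots> \<le> 2 powr s * (h x + h x)" using elim by (intro mult_left_mono add_mono) auto
        finally show ?case by simp
      qed
    qed auto
    then have "(\<lambda>n. (LINT x|M. norm (T (f (r n)) x - g x) powr s) powr (1/s)) \<longlonglongrightarrow> 0 powr (1/s)"
      using s by (intro tendsto_powr' tendsto_const) (auto simp: integral_nonneg)
    then have "(\<lambda>n. Lp_norm p M (\<lambda>x. T (f (r n)) x - g x)) \<longlonglongrightarrow> 0"
      using False s by (simp add: Lp_norm_def s_def)
    with g mono show "\<exists>g r. g \<in> Lp_space p M \<and> strict_mono (r::nat \<Rightarrow> nat) \<and>
        (\<lambda>n. Lp_norm p M (\<lambda>x. T (f (r n)) x - g x)) \<longlonglongrightarrow> 0"
      by (intro exI[of _ g] exI[of _ r]) auto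
  qed
qed

end

subsection \<open>Spectral theory independent of the exponent\<close>

text \<open>The Fredholm locale works inside a type of real vectors; with pointwise operations the
  sets \<open>Lp_space p M\<close> become subspaces of the space of all functions.\<close>

instantiation "fun" :: (type, real_vector) real_vector
begin

definition "scaleR_fun c f = (\<lambda>x. c *\<^sub>R f x)"

instance
  by standard (auto simp: scaleR_fun_def fun_eq_iff plus_fun_def scaleR_add_right scaleR_add_left)

end

lemmas fun_arith_defs = plus_fun_def zero_fun_def fun_diff_def scaleR_fun_def scaleR_conv_of_real

lemma L2_norm_sq: "(Lp_norm 2 M f)\<^sup>2 = (LINT x|M. (norm (f x))\<^sup>2)"
proof -
  have "(Lp_norm 2 M f)\<^sup>2 = Lp_norm 2 M f powr enn2real 2"
    by (simp add: Lp_norm_nonneg powr_numeral)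
  also have "\<dots> = (LINT x|M. norm (f x) powr enn2real 2)"
    by (rule Lp_norm_powr) auto
  finally show ?thesis by (simp add: powr_numeral)
qed

text \<open>Bilinear on purpose, matching the duality of \<open>L^1\<close> and
  \<open>L^\<infinity>\<close> and the symmetry of the kernels; conjugates are written out where the
  inner product of \<open>L^2\<close> is meant.\<close>

definition pair_int :: "'a measure \<Rightarrow> ('a \<Rightarrow> complex) \<Rightarrow> ('a \<Rightarrow> complex) \<Rightarrow> complex" where
  "pair_int M f g = (LINT x|M. f x * g x)"

lemma pair_int_linear:
  assumes "1 \<le> p" "u \<in> Lp_space p M" "f \<in> L1_Linfty M" "g \<in> L1_Linfty M"
  shows "pair_int M u (\<lambda>x. f x + g x) = pair_int M u f + pair_int M u g"
    and "pair_int M u (\<lambda>x. f x - g x) = pair_int M u f - pair_int M u g"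
    and "pair_int M u (\<lambda>x. c * f x) = c * pair_int M u f"
proof -
  note i = integrable_Lp_test[OF assms(1,2,3)] integrable_Lp_test[OF assms(1,2,4)]
  show "pair_int M u (\<lambda>x. f x + g x) = pair_int M u f + pair_int M u g"
    unfolding pair_int_def distrib_left by (rule Bochner_Integration.integral_add[OF i])
  show "pair_int M u (\<lambda>x. f x - g x) = pair_int M u f - pair_int M u g"
    unfolding pair_int_def right_diff_distrib by (rule Bochner_Integration.integral_diff[OF i])
  show "pair_int M u (\<lambda>x. c * f x) = c * pair_int M u f"
    unfolding pair_int_def mult.left_commute[of _ c] by (rule integral_mult_right_zero)
qed

lemma pair_int_sum:
  assumes "1 \<le> p" "u \<in> Lp_space p M" "\<And>i. i \<in> I \<Longrightarrow> f i \<in> L1_Linfty M"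
  shows "pair_int M u (\<lambda>x. \<Sum>i\<in>I. c i * f i x) = (\<Sum>i\<in>I. c i * pair_int M u (f i))"
proof -
  have i: "integrable M (\<lambda>x. c i * (u x * f i x))" if "i \<in> I" for i
    using integrable_Lp_test[OF assms(1,2) assms(3)[OF that]] by simp
  have "pair_int M u (\<lambda>x. \<Sum>i\<in>I. c i * f i x) = (LINT x|M. (\<Sum>i\<in>I. c i * (u x * f i x)))"
    unfolding pair_int_def by (simp add: sum_distrib_left mult.left_commute)
  also have "\<dots> = (\<Sum>i\<in>I. LINT x|M. c i * (u x * f i x))"
    using i by (rule Bochner_Integration.integral_sum)
  finally show ?thesis by (simp add: pair_int_def)
qed

lemma pair_int_commute: "pair_int M f g = pair_int M g f"
  by (simp add: pair_int_def mult.commute)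

lemma pair_int_cnj_self: "pair_int M f (\<lambda>x. cnj (f x)) = of_real ((Lp_norm 2 M f)\<^sup>2)"
  unfolding pair_int_def L2_norm_sq complex_norm_square[symmetric] by (simp flip: of_real_power)

lemma pair_int_cnj_swap: "pair_int M f (\<lambda>x. cnj (g x)) = cnj (pair_int M g (\<lambda>x. cnj (f x)))"
proof -
  have "cnj (pair_int M g (\<lambda>x. cnj (f x))) = (LINT x|M. cnj (g x * cnj (f x)))"
    unfolding pair_int_def by (rule Bochner_Integration.integral_cnj[symmetric])
  then show ?thesis by (simp add: pair_int_def mult.commute)
qed

context symmetric_kernel
begin

lemma compact_operator_on_Lp:
  assumes c: "Lp_compact_operator top M T" and p: "1 \<le> p"
  shows "compact_operator_on (Lp_space p M) (Lp_norm p M) (\<lambda>f x. a * T f x)"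
proof
  note cp = Lp_compact[OF c p]
  show "subspace (Lp_space p M)"
    by (rule subspaceI) (auto simp: fun_arith_defs Lp_space_zero intro: Lp_space_add Lp_space_scale p)
  fix f g :: "'a \<Rightarrow> complex" and s :: real
  assume f: "f \<in> Lp_space p M"
  show "Lp_norm p M (s *\<^sub>R f) = \<bar>s\<bar> * Lp_norm p M f"
    using Lp_norm_scale[OF p f, of "of_real s"] by (simp add: fun_arith_defs)
  show af: "(\<lambda>x. a * T f x) \<in> Lp_space p M" if "f \<in> Lp_space p M" for f
    by (intro Lp_space_scale T_Lp p that)
  have sf: "(\<lambda>x. of_real s * f x) \<in> Lp_space p M" by (intro Lp_space_scale f)
  show "Lp_norm p M ((\<lambda>x. a * T (s *\<^sub>R f) x) - s *\<^sub>R (\<lambda>x. a * T f x)) = 0"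
  proof (subst Lp_norm_eq_0_iff[OF p])
    show "(\<lambda>x. a * T (s *\<^sub>R f) x) - s *\<^sub>R (\<lambda>x. a * T f x) \<in> Lp_space p M"
      unfolding fun_arith_defs by (intro Lp_space_diff Lp_space_scale T_Lp p f)
  qed (simp add: fun_arith_defs T_scale)
  assume g: "g \<in> Lp_space p M"
  show "Lp_norm p M (f + g) \<le> Lp_norm p M f + Lp_norm p M g"
    using Lp_norm_triangle[OF p f g] by (simp add: fun_arith_defs)
  show "Lp_norm p M ((\<lambda>x. a * T (f + g) x) - ((\<lambda>x. a * T f x) + (\<lambda>x. a * T g x))) = 0"
  proof (subst Lp_norm_eq_0_iff[OF p])
    show "(\<lambda>x. a * T (f + g) x) - ((\<lambda>x. a * T f x) + (\<lambda>x. a * T g x)) \<in> Lp_space p M"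
      unfolding fun_arith_defs by (intro Lp_space_diff Lp_space_add Lp_space_scale T_Lp p f g)
    show "AE x in M. ((\<lambda>x. a * T (f + g) x) - ((\<lambda>x. a * T f x) + (\<lambda>x. a * T g x))) x = 0"
      using T_add[OF p f g] by eventually_elim (simp add: fun_arith_defs algebra_simps)
  qed
next
  note cp = Lp_compact[OF c p]
  fix f :: "nat \<Rightarrow> 'a \<Rightarrow> complex" assume f: "\<And>n. f n \<in> Lp_space p M" "\<And>n. Lp_norm p M (f n) \<le> 1"
  obtain g r where g: "g \<in> Lp_space p M" "strict_mono (r::nat \<Rightarrow> nat)"
    "(\<lambda>n. Lp_norm p M (\<lambda>x. T (f (r n)) x - g x)) \<longlonglongrightarrow> 0"
    by (rule Lp_compact_operatorE[OF cp f])
  have "Lp_norm p M (\<lambda>x. a * T (f (r n)) x - a * g x) = norm a * Lp_norm p M (\<lambda>x. T (f (r n)) x - g x)" for n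
    using Lp_norm_scale[OF p Lp_space_diff[OF p T_Lp(1)[OF p f(1)[of "r n"]] g(1)], of a]
    by (simp add: algebra_simps)
  then have "(\<lambda>n. Lp_norm p M ((\<lambda>x. a * T (f (r n)) x) - (\<lambda>x. a * g x))) \<longlonglongrightarrow> 0"
    using tendsto_mult_left[OF g(3), of "norm a"] by (simp add: fun_arith_defs)
  then show "\<exists>g\<in>Lp_space p M. \<exists>r::nat \<Rightarrow> nat. strict_mono r \<and>
      (\<lambda>n. Lp_norm p M ((\<lambda>x. a * T (f (r n)) x) - g)) \<longlonglongrightarrow> 0"
    using g(1,2) by (intro bexI[of _ "\<lambda>x. a * g x"] exI[of _ r] conjI Lp_space_scale)
qed

lemma fredholm_Lp:
  assumes c: "Lp_compact_operator top M T" and p: "1 \<le> p"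
    and inj: "\<And>w. w \<in> Lp_space p M \<Longrightarrow> (AE x in M. w x = a * T w x) \<Longrightarrow> AE x in M. w x = 0"
  shows "\<exists>C\<ge>0. \<forall>w\<in>Lp_space p M. Lp_norm p M w \<le> C * Lp_norm p M (\<lambda>x. w x - a * T w x)"
    and "f \<in> Lp_space p M \<Longrightarrow> \<exists>w\<in>Lp_space p M. AE x in M. w x - a * T w x = f x"
proof -
  interpret compact_operator_on "Lp_space p M" "Lp_norm p M" "\<lambda>f x. a * T f x"
    by (rule compact_operator_on_Lp[OF c p])
  have d: "(\<lambda>x. w x - a * T w x) \<in> Lp_space p M" if "w \<in> Lp_space p M" for w
    by (intro Lp_space_diff Lp_space_scale T_Lp p that)
  have inj': "Lp_norm p M w = 0" if "w \<in> Lp_space p M" "Lp_norm p M (w - (\<lambda>x. a * T w x)) = 0" for w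
    using that inj[of w] Lp_norm_eq_0_iff[OF p d[OF that(1)]]
    by (simp add: Lp_norm_eq_0_iff[OF p] fun_diff_def)
  show "\<exists>C\<ge>0. \<forall>w\<in>Lp_space p M. Lp_norm p M w \<le> C * Lp_norm p M (\<lambda>x. w x - a * T w x)"
    using fredholm_alternative(1)[OF inj'] by (simp add: fun_diff_def)
  assume f: "f \<in> Lp_space p M"
  from fredholm_alternative(2)[OF inj' f] obtain w where
    w: "w \<in> Lp_space p M" "Lp_norm p M (\<lambda>x. w x - a * T w x - f x) = 0"
    by (auto simp: fun_diff_def)
  then have "AE x in M. w x - a * T w x - f x = 0"
    using Lp_norm_eq_0_iff[OF p Lp_space_diff[OF p d[OF w(1)] f]] by simp
  with w(1) show "\<exists>w\<in>Lp_space p M. AE x in M. w x - a * T w x = f x"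
    by (intro bexI[of _ w]) auto
qed

section \<open>Eigenfunctions are integrable and bounded\<close>

lemma pair_int_T:
  "1 \<le> p \<Longrightarrow> f \<in> Lp_space p M \<Longrightarrow> g \<in> L1_Linfty M \<Longrightarrow> pair_int M (T f) g = pair_int M f (T g)"
  unfolding pair_int_def by (rule pairing_Lp_test)

text \<open>With the conjugates of some eigenfunctions as \<open>F\<close> this is the orthogonal
  complement of their span, within the test functions.\<close>

definition annihilated :: "('a \<Rightarrow> complex) set \<Rightarrow> ('a \<Rightarrow> complex) set" where
  "annihilated F = {f \<in> L1_Linfty M. \<forall>e\<in>F. pair_int M f e = 0}"

text \<open>Symmetry and the eigenvalue equation make the annihilator invariant. For the sum of the
  two norms, images have a subsequence that converges both in \<open>L^1\<close> and in
  \<open>L^\<infinity>\<close>; the two limits agree almost everywhere, and continuity of the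
  pairings with \<open>F\<close> keeps the limit in the annihilator.\<close>

lemma compact_operator_on_annihilated:
  assumes c: "Lp_compact_operator top M T"
    and F: "\<And>e. e \<in> F \<Longrightarrow> e \<in> L1_Linfty M" "\<And>e. e \<in> F \<Longrightarrow> AE x in M. T e x = l * e x"
  shows "compact_operator_on (annihilated F) (\<lambda>f. Lp_norm 1 M f + Lp_norm top M f) (\<lambda>f x. a * T f x)"
proof -
  interpret L1: compact_operator_on "Lp_space 1 M" "Lp_norm 1 M" "\<lambda>f x. a * T f x"
    by (rule compact_operator_on_Lp[OF c]) simp
  interpret Linf: compact_operator_on "Lp_space top M" "Lp_norm top M" "\<lambda>f x. a * T f x"
    by (rule compact_operator_on_Lp[OF c]) simp
  have Y: "f \<in> Lp_space 1 M" "f \<in> Lp_space top M" "f \<in> L1_Linfty M" if "f \<in> annihilated F" for f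
    using that by (auto simp: annihilated_def L1_Linfty_def)
  have lin: "pair_int M (\<lambda>x. f x + g x) e = pair_int M f e + pair_int M g e"
    "pair_int M (\<lambda>x. k * f x) e = k * pair_int M f e"
    if "f \<in> L1_Linfty M" "g \<in> L1_Linfty M" "e \<in> F" for f g e k
    using pair_int_linear[of 1 e M f g] that F(1)[OF that(3)]
    by (simp_all add: pair_int_commute[of M _ e] L1_Linfty_def)
  have KY: "(\<lambda>x. a * T f x) \<in> annihilated F" if f: "f \<in> annihilated F" for f
    proof -
      have "pair_int M (T f) e = 0" if e: "e \<in> F" for e
      proof -
        have "pair_int M (T f) e = pair_int M f (T e)"
          by (rule pair_int_T[of 1]) (use Y[OF f] F(1)[OF e] in auto)
        also have "\<dots> = (LINT x|M. l * (f x * e x))"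
          unfolding pair_int_def
          using F(2)[OF e] Y[OF f] L1_Linfty_measurable[OF F(1)[OF e]]
          by (intro integral_cong_AE) (auto dest!: L1_Linfty_measurable intro: T_measurable elim!: eventually_mono)
        also have "\<dots> = l * pair_int M f e" by (simp add: pair_int_def)
        finally show ?thesis using f e by (simp add: annihilated_def)
      qed
      then show ?thesis
        using T_test[OF Y(3)[OF f]] by (auto simp: annihilated_def lin L1_Linfty_scale)
    qed
  show ?thesis
  proof
    show "subspace (annihilated F)"
    proof (rule subspaceI)
      show "0 \<in> annihilated F"
        by (auto simp: annihilated_def L1_Linfty_def zero_fun_def Lp_space_zero pair_int_def)
      show "f + g \<in> annihilated F" if "f \<in> annihilated F" "g \<in> annihilated F" for f g
        using that by (auto simp: annihilated_def plus_fun_def lin L1_Linfty_add)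
      show "s *\<^sub>R f \<in> annihilated F" if "f \<in> annihilated F" for f s
        using that by (auto simp: annihilated_def scaleR_fun_def scaleR_conv_of_real lin L1_Linfty_scale)
    qed
    fix f g :: "'a \<Rightarrow> complex" and s :: real
    assume f: "f \<in> annihilated F"
    show "Lp_norm 1 M (s *\<^sub>R f) + Lp_norm top M (s *\<^sub>R f) = \<bar>s\<bar> * (Lp_norm 1 M f + Lp_norm top M f)"
      using Y[OF f] by (simp add: L1.q_scale Linf.q_scale distrib_left)
    show "(\<lambda>x. a * T f x) \<in> annihilated F" by (rule KY[OF f])
    show "Lp_norm 1 M ((\<lambda>x. a * T (s *\<^sub>R f) x) - s *\<^sub>R (\<lambda>x. a * T f x)) +
        Lp_norm top M ((\<lambda>x. a * T (s *\<^sub>R f) x) - s *\<^sub>R (\<lambda>x. a * T f x)) = 0"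
      using L1.K_scale Linf.K_scale Y[OF f] by simp
    assume g: "g \<in> annihilated F"
    show "Lp_norm 1 M (f + g) + Lp_norm top M (f + g)
        \<le> Lp_norm 1 M f + Lp_norm top M f + (Lp_norm 1 M g + Lp_norm top M g)"
      using L1.q_triangle[of f g] Linf.q_triangle[of f g] Y[OF f] Y[OF g] by simp
    show "Lp_norm 1 M ((\<lambda>x. a * T (f + g) x) - ((\<lambda>x. a * T f x) + (\<lambda>x. a * T g x))) +
        Lp_norm top M ((\<lambda>x. a * T (f + g) x) - ((\<lambda>x. a * T f x) + (\<lambda>x. a * T g x))) = 0"
      using L1.K_add Linf.K_add Y[OF f] Y[OF g] by simp
  next
    fix f :: "nat \<Rightarrow> 'a \<Rightarrow> complex"
    assume f: "\<And>n. f n \<in> annihilated F" "\<And>n. Lp_norm 1 M (f n) + Lp_norm top M (f n) \<le> 1"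
    have n1: "Lp_norm 1 M (f n) \<le> 1" and n2: "Lp_norm top M (f n) \<le> 1" for n
      using f(2)[of n] Lp_norm_nonneg[of 1 M "f n"] Lp_norm_nonneg[of top M "f n"] by linarith+
    obtain g1 r1 where g1: "g1 \<in> Lp_space 1 M" "strict_mono (r1::nat \<Rightarrow> nat)"
      "(\<lambda>n. Lp_norm 1 M ((\<lambda>x. a * T (f (r1 n)) x) - g1)) \<longlonglongrightarrow> 0"
      by (rule L1.K_compactE[OF Y(1)[OF f(1)] n1])
    obtain g2 r2 where g2: "g2 \<in> Lp_space top M" "strict_mono (r2::nat \<Rightarrow> nat)"
      "(\<lambda>n. Lp_norm top M ((\<lambda>x. a * T (f (r1 (r2 n))) x) - g2)) \<longlonglongrightarrow> 0"
      by (rule Linf.K_compactE[OF Y(2)[OF f(1)] n2])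
    define k where "k n = (\<lambda>x. a * T (f (r1 (r2 n))) x)" for n
    have kY: "k n \<in> annihilated F" for n unfolding k_def by (rule KY[OF f(1)])
    have k1: "(\<lambda>n. Lp_norm 1 M (k n - g1)) \<longlonglongrightarrow> 0"
      using LIMSEQ_subseq_LIMSEQ[OF g1(3) g2(2)] by (simp add: o_def k_def)
    have k2: "(\<lambda>n. Lp_norm top M (k n - g2)) \<longlonglongrightarrow> 0" using g2(3) by (simp add: k_def)
    note [measurable] = Lp_space_measurable[OF g1(1)] Lp_space_measurable[OF g2(1)]
    \<comment> \<open>A subsequence tends to \<open>g1\<close> almost everywhere, while the
      essential bounds force pointwise convergence to \<open>g2\<close>.\<close>
    have "AE x in M. g1 x = g2 x"
    proof -
      obtain s :: "nat \<Rightarrow> nat" and h where s: "strict_mono s" "integrable M h"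
        "\<And>n. AE x in M. norm (k (s n) x) \<le> h x" "AE x in M. (\<lambda>n. k (s n) x) \<longlonglongrightarrow> g1 x"
        by (rule L1_convergent_subseq[OF Y(1)[OF kY] g1(1) k1[unfolded fun_diff_def]]) (rule that)
      have "AE x in M. \<forall>n. norm (k n x - g2 x) \<le> Lp_norm top M (k n - g2)"
      proof -
        have "AE x in M. norm (k n x - g2 x) \<le> Lp_norm top M (k n - g2)" for n
          unfolding fun_diff_def by (rule Lp_norm_infinity_AE) (use Y[OF kY] g2 in \<open>auto intro: Lp_space_diff\<close>)
        then show ?thesis by (simp add: AE_all_countable)
      qed
      then show ?thesis using s(4)
      proof eventually_elim
        case (elim x)
        have "(\<lambda>n. norm (k n x - g2 x)) \<longlonglongrightarrow> 0"
          by (rule tendsto_zero_squeeze[OF k2]) (use elim in auto)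
        then have "(\<lambda>n. k n x) \<longlonglongrightarrow> g2 x" by (simp add: tendsto_norm_zero_iff LIM_zero_iff)
        from LIMSEQ_subseq_LIMSEQ[OF this s(1)] have "(\<lambda>n. k (s n) x) \<longlonglongrightarrow> g2 x" by (simp add: o_def)
        with elim(2) show ?case by (rule LIMSEQ_unique)
      qed
    qed
    then have ae: "AE x in M. g2 x = g1 x" by eventually_elim simp
    have g2Y: "g2 \<in> L1_Linfty M"
      using Lp_space_cong_AE(1)[OF _ g1(1) _ ae] g2(1) by (simp add: L1_Linfty_def)
    have k1': "Lp_norm 1 M (k n - g2) = Lp_norm 1 M (k n - g1)" for n
      unfolding fun_diff_def using ae Y[OF kY[of n]] g1 Lp_space_measurable[OF Y(1)[OF kY[of n]]]
      by (intro Lp_space_cong_AE(2) Lp_space_diff) auto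
    have "pair_int M g2 e = 0" if e: "e \<in> F" for e
    proof -
      have eY: "e \<in> Lp_space top M" using F(1)[OF e] by (simp add: L1_Linfty_def)
      have "norm (pair_int M g2 e) \<le> Lp_norm 1 M (k n - g2) * Lp_norm top M e" for n
      proof -
        have "pair_int M (\<lambda>x. k n x + (-1) * g2 x) e = pair_int M (k n) e + (-1) * pair_int M g2 e"
          using Y(3)[OF kY[of n]] g2Y e by (simp only: lin L1_Linfty_scale)
        then have "pair_int M (\<lambda>x. k n x - g2 x) e = - pair_int M g2 e"
          using kY[of n] e by (simp add: annihilated_def)
        moreover have "norm (pair_int M (\<lambda>x. k n x - g2 x) e) \<le> Lp_norm 1 M (\<lambda>x. k n x - g2 x) * Lp_norm top M e"
          unfolding pair_int_def using Y[OF kY[of n]] g2Y eY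
          by (intro integrable_L1_Linfty(2) Lp_space_diff) (auto simp: L1_Linfty_def)
        ultimately show ?thesis by (simp add: fun_diff_def)
      qed
      moreover have "(\<lambda>n. Lp_norm 1 M (k n - g2) * Lp_norm top M e) \<longlonglongrightarrow> 0"
        using tendsto_mult_right[OF k1, of "Lp_norm top M e"] by (simp add: k1')
      ultimately have "norm (pair_int M g2 e) \<le> 0" by (intro tendsto_lowerbound) auto
      then show ?thesis by simp
    qed
    then have "g2 \<in> annihilated F" using g2Y by (simp add: annihilated_def)
    moreover have "strict_mono (r1 \<circ> r2)" using g1(2) g2(2) by (rule strict_mono_o)
    moreover have "(\<lambda>n. Lp_norm 1 M (k n - g2) + Lp_norm top M (k n - g2)) \<longlonglongrightarrow> 0"
      using tendsto_add[OF k1 k2] by (simp add: k1')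
    ultimately show "\<exists>g\<in>annihilated F. \<exists>r::nat \<Rightarrow> nat. strict_mono r \<and>
        (\<lambda>n. Lp_norm 1 M ((\<lambda>x. a * T (f (r n)) x) - g) + Lp_norm top M ((\<lambda>x. a * T (f (r n)) x) - g)) \<longlonglongrightarrow> 0"
      by (intro bexI[of _ g2] exI[of _ "r1 \<circ> r2"]) (auto simp only: k_def o_def)
  qed
qed


text \<open>An infinite orthonormal system of eigenfunctions for \<open>l \<noteq> 0\<close> would contradict compactness on
  \<open>L\<^sup>2\<close>.\<close>

lemma finite_orthonormal_eigenbasis:
  assumes c: "Lp_compact_operator top M T" and l: "l \<noteq> 0"
  obtains (basis) F where "finite F" "F \<subseteq> {f \<in> L1_Linfty M. AE x in M. T f x = l * f x}"
    "\<And>e e'. e \<in> F \<Longrightarrow> e' \<in> F \<Longrightarrow> pair_int M e (\<lambda>x. cnj (e' x)) = (if e = e' then 1 else 0)"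
    "\<And>f. f \<in> L1_Linfty M \<Longrightarrow> (AE x in M. T f x = l * f x) \<Longrightarrow>
      (\<forall>e\<in>F. pair_int M f (\<lambda>x. cnj (e x)) = 0) \<Longrightarrow> AE x in M. f x = 0"
proof (rule ccontr)
  assume no: "\<not> thesis"
  define N where "N = {f \<in> L1_Linfty M. AE x in M. T f x = l * f x}"
  define A where "A = {f \<in> N. Lp_norm 2 M f = 1}"
  define ON where "ON F \<longleftrightarrow> (\<forall>e\<in>F. \<forall>e'\<in>F. e \<noteq> e' \<longrightarrow> pair_int M e (\<lambda>x. cnj (e' x)) = 0)" for F
  have L2: "f \<in> Lp_space 2 M" if "f \<in> L1_Linfty M" for f
    by (rule L1_Linfty_subset_Lp[OF _ that]) simp
  have step: "\<exists>a\<in>A. (\<forall>b\<in>F. pair_int M a (\<lambda>x. cnj (b x)) = 0) \<and> ON (insert a F)"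
    if F: "finite F" "F \<subseteq> A" "ON F" for F
  proof -
    have "pair_int M e (\<lambda>x. cnj (e' x)) = (if e = e' then 1 else 0)" if "e \<in> F" "e' \<in> F" for e e'
      using F that by (auto simp: ON_def A_def pair_int_cnj_self)
    with no basis[of F] F have "\<exists>f. f \<in> N \<and> (\<forall>e\<in>F. pair_int M f (\<lambda>x. cnj (e x)) = 0) \<and> \<not> (AE x in M. f x = 0)"
      unfolding N_def A_def by blast
    then obtain f where f: "f \<in> N" "\<And>e. e \<in> F \<Longrightarrow> pair_int M f (\<lambda>x. cnj (e x)) = 0" "\<not> (AE x in M. f x = 0)"
      by blast
    have fY: "f \<in> L1_Linfty M" and fT: "AE x in M. T f x = l * f x" using f(1) by (auto simp: N_def)
    have n: "Lp_norm 2 M f > 0"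
      using f(3) Lp_norm_eq_0_iff[OF _ L2[OF fY]] Lp_norm_nonneg[of 2 M f] by fastforce
    define k where "k = complex_of_real (1 / Lp_norm 2 M f)"
    define a where "a x = k * f x" for x
    have aY: "a \<in> L1_Linfty M" unfolding a_def[abs_def] by (rule L1_Linfty_scale[OF fY])
    have "AE x in M. T a x = l * a x"
      using fT unfolding a_def[abs_def] by eventually_elim (simp add: T_scale)
    moreover have "Lp_norm 2 M a = 1"
      unfolding a_def[abs_def] using n by (subst Lp_norm_scale[OF _ L2[OF fY]]) (auto simp: k_def norm_divide)
    ultimately have aA: "a \<in> A" using aY by (simp add: A_def N_def)
    have orth: "pair_int M a (\<lambda>x. cnj (b x)) = 0" if "b \<in> F" for b
      using f(2)[OF that] by (simp add: pair_int_def a_def mult.assoc)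
    then have orth': "pair_int M b (\<lambda>x. cnj (a x)) = 0" if "b \<in> F" for b
      using that by (subst pair_int_cnj_swap) simp
    have "ON (insert a F)" using F(3) orth orth' by (auto simp: ON_def)
    with aA orth show ?thesis by blast
  qed
  obtain (chain) s :: "nat \<Rightarrow> 'a \<Rightarrow> complex" where s: "\<And>n. s n \<in> A"
    "\<And>i j. i < j \<Longrightarrow> pair_int M (s j) (\<lambda>x. cnj (s i x)) = 0"
  proof (rule infinite_chain[of ON A "\<lambda>b a. pair_int M a (\<lambda>x. cnj (b x)) = 0"])
    show "ON {}" by (simp add: ON_def)
    show "\<exists>a\<in>A. (\<forall>b\<in>F. pair_int M a (\<lambda>x. cnj (b x)) = 0) \<and> ON (insert a F)"
      if "finite F" "F \<subseteq> A" "ON F" for F using step[OF that] .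
    show thesis if "\<And>n. s n \<in> A" "\<And>i j. i < j \<Longrightarrow> pair_int M (s j) (\<lambda>x. cnj (s i x)) = 0"
      for s :: "nat \<Rightarrow> 'a \<Rightarrow> complex" using that by (rule chain)
  qed
  have sY: "s n \<in> L1_Linfty M" and sT: "AE x in M. T (s n) x = l * s n x" and s1: "Lp_norm 2 M (s n) = 1" for n
    using s(1)[of n] by (auto simp: A_def N_def)
  \<comment> \<open>Orthonormal vectors are at distance \<open>sqrt 2\<close>. The eigenvalue
    equation scales this by \<open>norm l\<close>, so images under \<open>T\<close> closer than
    \<open>norm l\<close> are impossible.\<close>
  have sep: "(Lp_norm 2 M (\<lambda>x. s i x - s j x))\<^sup>2 = 2" if "i < j" for i j
  proof -
    have o: "pair_int M (s j) (\<lambda>x. cnj (s i x)) = 0" "pair_int M (s i) (\<lambda>x. cnj (s j x)) = 0"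
      using s(2)[OF that] by (simp, subst pair_int_cnj_swap, simp)
    have dY: "(\<lambda>x. s i x - s j x) \<in> L1_Linfty M" by (intro L1_Linfty_diff sY)
    note lin = pair_int_linear(2)[OF _ L2 L1_Linfty_cnj L1_Linfty_cnj]
    have "complex_of_real ((Lp_norm 2 M (\<lambda>x. s i x - s j x))\<^sup>2)
        = pair_int M (\<lambda>x. s i x - s j x) (\<lambda>x. cnj (s i x) - cnj (s j x))"
      using pair_int_cnj_self[of M "\<lambda>x. s i x - s j x"] by simp
    also have "\<dots> = pair_int M (\<lambda>x. s i x - s j x) (\<lambda>x. cnj (s i x)) - pair_int M (\<lambda>x. s i x - s j x) (\<lambda>x. cnj (s j x))"
      by (rule lin) (use dY sY in auto)
    also have "pair_int M (\<lambda>x. s i x - s j x) (\<lambda>x. cnj (s i x)) = 1"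
      using pair_int_linear(2)[OF _ L2[OF L1_Linfty_cnj[OF sY[of i]]] sY[of i] sY[of j]] o
      by (simp add: pair_int_commute[of M "\<lambda>x. cnj (s i x)"] pair_int_cnj_self s1 del: complex_cnj_cnj)
    also have "pair_int M (\<lambda>x. s i x - s j x) (\<lambda>x. cnj (s j x)) = -1"
      using pair_int_linear(2)[OF _ L2[OF L1_Linfty_cnj[OF sY[of j]]] sY[of i] sY[of j]] o
      by (simp add: pair_int_commute[of M "\<lambda>x. cnj (s j x)"] pair_int_cnj_self s1)
    finally have "complex_of_real ((Lp_norm 2 M (\<lambda>x. s i x - s j x))\<^sup>2) = complex_of_real 2" by simp
    then show ?thesis by (simp only: of_real_eq_iff)
  qed
  have c2: "Lp_compact_operator 2 M T" by (rule Lp_compact[OF c]) simp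
  have s1': "Lp_norm 2 M (s n) \<le> 1" for n using s1[of n] by simp
  obtain g r where g: "g \<in> Lp_space 2 M" "strict_mono (r::nat \<Rightarrow> nat)"
    "(\<lambda>n. Lp_norm 2 M (\<lambda>x. T (s (r n)) x - g x)) \<longlonglongrightarrow> 0"
    by (rule Lp_compact_operatorE[OF c2 L2[OF sY] s1'])
  have "eventually (\<lambda>n. Lp_norm 2 M (\<lambda>x. T (s (r n)) x - g x) < norm l / 2) sequentially"
    using order_tendstoD(2)[OF g(3), of "norm l / 2"] l by simp
  then obtain n where n: "\<And>i. i \<ge> n \<Longrightarrow> Lp_norm 2 M (\<lambda>x. T (s (r i)) x - g x) < norm l / 2"
    by (auto simp: eventually_sequentially)
  let ?i = "r n" and ?j = "r (Suc n)"
  have ij: "?i < ?j" using g(2) by (simp add: strict_mono_def)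
  have TL: "T (s i) \<in> Lp_space 2 M" for i by (intro T_Lp L2 sY) simp
  have "norm l * Lp_norm 2 M (\<lambda>x. s ?i x - s ?j x) = Lp_norm 2 M (\<lambda>x. l * (s ?i x - s ?j x))"
    by (rule Lp_norm_scale[symmetric]) (auto intro!: L2 L1_Linfty_diff sY)
  also have "\<dots> = Lp_norm 2 M (\<lambda>x. T (s ?i) x - T (s ?j) x)"
  proof (rule Lp_space_cong_AE(2))
    show "(\<lambda>x. T (s ?i) x - T (s ?j) x) \<in> Lp_space 2 M" by (intro Lp_space_diff TL) simp
    show "AE x in M. l * (s ?i x - s ?j x) = T (s ?i) x - T (s ?j) x"
      using sT[of ?i] sT[of ?j] by eventually_elim (simp add: right_diff_distrib)
    show "(\<lambda>x. l * (s ?i x - s ?j x)) \<in> borel_measurable M"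
      using L1_Linfty_measurable[OF sY[of ?i]] L1_Linfty_measurable[OF sY[of ?j]] by measurable
  qed simp
  also have "\<dots> \<le> Lp_norm 2 M (\<lambda>x. T (s ?i) x - g x) + Lp_norm 2 M (\<lambda>x. g x - T (s ?j) x)"
    by (rule Lp_norm_diff_triangle) (use TL g in auto)
  also have "\<dots> < norm l"
    using n[of n] n[of "Suc n"] Lp_norm_minus_commute[of 2 M g "T (s ?j)"] by simp
  finally have "Lp_norm 2 M (\<lambda>x. s ?i x - s ?j x) < 1" using l by simp
  then have "(Lp_norm 2 M (\<lambda>x. s ?i x - s ?j x))\<^sup>2 < 1"
    using Lp_norm_nonneg[of 2 M "\<lambda>x. s ?i x - s ?j x"] by (simp add: power_less_one_iff)
  with sep[OF ij] show False by simp
qed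

text \<open>Let \<open>F\<close> be an orthonormal basis of the eigenspace in \<open>L\<^sup>1 \<inter> L\<^sup>\<infinity>\<close>. By the Fredholm alternative
  \<open>l - T\<close> is onto on the orthogonal complement of \<open>F\<close> there, so by symmetry an eigenfunction in \<open>L\<^sup>p\<close>
  annihilates this complement and hence is a combination of \<open>F\<close>.\<close>

theorem eigenfunction_L1_Linfty:
  assumes c: "Lp_compact_operator top M T" and l: "l \<noteq> 0" and p: "1 \<le> p"
    and u: "u \<in> Lp_space p M" "AE x in M. T u x = l * u x"
  shows "u \<in> L1_Linfty M"
proof -
  obtain F where F: "finite F" "F \<subseteq> {f \<in> L1_Linfty M. AE x in M. T f x = l * f x}"
    "\<And>e e'. e \<in> F \<Longrightarrow> e' \<in> F \<Longrightarrow> pair_int M e (\<lambda>x. cnj (e' x)) = (if e = e' then 1 else 0)"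
    "\<And>f. f \<in> L1_Linfty M \<Longrightarrow> (AE x in M. T f x = l * f x) \<Longrightarrow>
      (\<forall>e\<in>F. pair_int M f (\<lambda>x. cnj (e x)) = 0) \<Longrightarrow> AE x in M. f x = 0"
    by (rule finite_orthonormal_eigenbasis[OF c l]) (rule that)
  have FY: "e \<in> L1_Linfty M" if "e \<in> F" for e using F(2) that by auto
  \<comment> \<open>As the pairing is bilinear, orthogonality to \<open>F\<close> means being
    annihilated by the conjugates, which are eigenfunctions for \<open>cnj l\<close> because the
    kernel is a real measure.\<close>
  define G where "G = (\<lambda>e x. cnj (e x)) ` F"
  have GT: "AE x in M. T e x = cnj l * e x" if e: "e \<in> G" for e
  proof -
    from e obtain e' where e': "e' \<in> F" "e = (\<lambda>x. cnj (e' x))" by (auto simp: G_def)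
    then have "AE x in M. T e' x = l * e' x" using F(2) by auto
    then show ?thesis unfolding e'(2)
      by eventually_elim (simp add: kernel_op_def flip: complex_cnj_mult)
  qed
  interpret compact_operator_on "annihilated G" "\<lambda>f. Lp_norm 1 M f + Lp_norm top M f" "\<lambda>f x. (1/l) * T f x"
    by (rule compact_operator_on_annihilated[OF c, where l="cnj l"])
      (use FY GT in \<open>auto simp: G_def L1_Linfty_cnj\<close>)
  have L1: "f \<in> Lp_space 1 M" if "f \<in> L1_Linfty M" for f using that by (simp add: L1_Linfty_def)
  have sub: "f \<in> L1_Linfty M" if "f \<in> annihilated G" for f using that by (simp add: annihilated_def)
  have dY: "(\<lambda>x. f x - (1/l) * T f x) \<in> L1_Linfty M" if "f \<in> L1_Linfty M" for f
    by (intro L1_Linfty_diff L1_Linfty_scale T_test that)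
  have inj: "Lp_norm 1 M f + Lp_norm top M f = 0"
    if f: "f \<in> annihilated G"
      and 0: "Lp_norm 1 M (f - (\<lambda>x. (1/l) * T f x)) + Lp_norm top M (f - (\<lambda>x. (1/l) * T f x)) = 0" for f
  proof -
    have "Lp_norm 1 M (\<lambda>x. f x - (1/l) * T f x) = 0"
      using 0 Lp_norm_nonneg[of 1 M "f - (\<lambda>x. (1/l) * T f x)"] Lp_norm_nonneg[of top M "f - (\<lambda>x. (1/l) * T f x)"]
      unfolding fun_diff_def by linarith
    then have "AE x in M. f x - (1/l) * T f x = 0"
      using Lp_norm_eq_0_iff[OF order_refl L1[OF dY[OF sub[OF f]]]] by simp
    then have Tf: "AE x in M. T f x = l * f x" by eventually_elim (use l in \<open>simp add: field_simps\<close>)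
    have "AE x in M. f x = 0"
      by (rule F(4)[OF sub[OF f] Tf]) (use f in \<open>auto simp: annihilated_def G_def\<close>)
    then show ?thesis
      using Lp_norm_eq_0_iff[of 1 f M] Lp_norm_eq_0_iff[of top f M] sub[OF f] by (simp add: L1_Linfty_def)
  qed
  \<comment> \<open>Such an \<open>f\<close> has the form \<open>g - (1/l) * T g\<close>, and
    symmetry moves \<open>T\<close> to \<open>u\<close>, on which it acts as multiplication by
    \<open>l\<close>.\<close>
  have ann: "pair_int M u f = 0" if f: "f \<in> annihilated G" for f
  proof -
    from fredholm_alternative(2)[OF inj f] obtain g where g: "g \<in> annihilated G"
      and 0: "Lp_norm 1 M (g - (\<lambda>x. (1/l) * T g x) - f) + Lp_norm top M (g - (\<lambda>x. (1/l) * T g x) - f) = 0"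
      by blast
    note gY = sub[OF g] and fY = sub[OF f]
    have "Lp_norm 1 M (\<lambda>x. (g x - (1/l) * T g x) - f x) = 0"
      using 0 Lp_norm_nonneg[of 1 M "g - (\<lambda>x. (1/l) * T g x) - f"]
        Lp_norm_nonneg[of top M "g - (\<lambda>x. (1/l) * T g x) - f"]
      unfolding fun_diff_def by linarith
    then have ae: "AE x in M. (g x - (1/l) * T g x) - f x = 0"
      using Lp_norm_eq_0_iff[OF order_refl L1[OF L1_Linfty_diff[OF dY[OF gY] fY]]] by simp
    have um: "u \<in> borel_measurable M" using Lp_space_measurable[OF u(1)] .
    note m [measurable] = um L1_Linfty_measurable[OF gY] L1_Linfty_measurable[OF fY]
    have "pair_int M u f = pair_int M u (\<lambda>x. g x - (1/l) * T g x)"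
      unfolding pair_int_def by (rule integral_cong_AE) (use ae in \<open>auto elim!: eventually_mono\<close>)
    also have "\<dots> = pair_int M u g - (1/l) * pair_int M u (T g)"
      using pair_int_linear(2)[OF p u(1) gY L1_Linfty_scale[OF T_test[OF gY], of "1/l"]]
        pair_int_linear(3)[OF p u(1) T_test[OF gY] gY, of "1/l"] by simp
    also have "pair_int M u (T g) = pair_int M (T u) g" by (rule pair_int_T[OF p u(1) gY, symmetric])
    also have "\<dots> = (LINT x|M. l * (u x * g x))"
      unfolding pair_int_def by (rule integral_cong_AE) (use u(2) in \<open>auto elim!: eventually_mono\<close>)
    also have "\<dots> = l * pair_int M u g" by (simp add: pair_int_def)
    finally show ?thesis using l by simp
  qed
  \<comment> \<open>By orthonormality of \<open>F\<close> this combination of conjugates has the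
    same bilinear pairing as \<open>u\<close> with every member of \<open>F\<close>.\<close>
  define w where "w x = (\<Sum>e\<in>F. pair_int M u e * cnj (e x))" for x
  have wY: "w \<in> L1_Linfty M"
    unfolding w_def[abs_def] using FY by (intro L1_Linfty_sum L1_Linfty_scale L1_Linfty_cnj)
  have wL: "w \<in> Lp_space p M" using L1_Linfty_subset_Lp[OF p wY] .
  have eq: "pair_int M u f = pair_int M w f" if fY: "f \<in> L1_Linfty M" for f
  proof -
    define c where "c e = pair_int M f (\<lambda>x. cnj (e x))" for e
    \<comment> \<open>The orthogonal projection of \<open>f\<close> onto the span of
      \<open>F\<close>; the remainder lies in \<open>annihilated G\<close>, where the pairing with
      \<open>u\<close> vanishes.\<close>
    define h where "h x = (\<Sum>e\<in>F. c e * e x)" for x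
    have hY: "h \<in> L1_Linfty M"
      unfolding h_def[abs_def] using FY by (intro L1_Linfty_sum L1_Linfty_scale)
    have "pair_int M (\<lambda>x. f x - h x) e = 0" if "e \<in> G" for e
    proof -
      from that obtain e' where e': "e' \<in> F" "e = (\<lambda>x. cnj (e' x))" by (auto simp: G_def)
      have eL: "e \<in> Lp_space 1 M" unfolding e'(2) by (rule L1[OF L1_Linfty_cnj[OF FY[OF e'(1)]]])
      have "pair_int M h e = (\<Sum>d\<in>F. c d * pair_int M e d)"
        unfolding h_def[abs_def] by (subst pair_int_commute) (rule pair_int_sum[OF order_refl eL FY])
      also have "\<dots> = (\<Sum>d\<in>F. if d = e' then c d else 0)"
      proof (rule sum.cong[OF refl])
        fix d assume d: "d \<in> F"
        show "c d * pair_int M e d = (if d = e' then c d else 0)"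
          by (subst pair_int_commute) (simp add: F(3)[OF d e'(1)] e'(2))
      qed
      also have "\<dots> = c e'" using F(1) e'(1) by simp
      finally have "pair_int M h e = c e'" .
      moreover have "pair_int M (\<lambda>x. f x - h x) e = pair_int M f e - pair_int M h e"
        using pair_int_linear(2)[OF order_refl eL fY hY] by (simp add: pair_int_commute[of M e])
      ultimately show ?thesis by (simp add: c_def e'(2))
    qed
    then have "(\<lambda>x. f x - h x) \<in> annihilated G"
      using L1_Linfty_diff[OF fY hY] by (simp add: annihilated_def)
    then have "pair_int M u f = pair_int M u h"
      using ann pair_int_linear(2)[OF p u(1) fY hY] by simp
    also have "\<dots> = (\<Sum>e\<in>F. c e * pair_int M u e)"
      unfolding h_def[abs_def] by (rule pair_int_sum[OF p u(1) FY])
    also have "\<dots> = (\<Sum>e\<in>F. pair_int M u e * pair_int M f (\<lambda>x. cnj (e x)))"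
      by (simp add: c_def mult.commute)
    also have "\<dots> = pair_int M f w"
      unfolding w_def[abs_def] by (rule pair_int_sum[OF order_refl L1[OF fY], symmetric]) (use FY L1_Linfty_cnj in auto)
    finally show ?thesis by (simp add: pair_int_commute)
  qed
  have "AE x in M. u x - w x = 0"
  proof (rule test_functions_separate[OF p Lp_space_diff[OF p u(1) wL]])
    fix f assume f: "f \<in> L1_Linfty M"
    have "(LINT x|M. (u x - w x) * f x) = pair_int M u f - pair_int M w f"
      unfolding pair_int_def left_diff_distrib
      by (rule Bochner_Integration.integral_diff) (use integrable_Lp_test[OF p _ f] u(1) wL in auto)
    then show "(LINT x|M. (u x - w x) * f x) = 0" using eq[OF f] by simp
  qed
  then have ae: "AE x in M. u x = w x" by eventually_elim simp
  show ?thesis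
    using Lp_space_cong_AE(1)[OF _ _ Lp_space_measurable[OF u(1)] ae] wY by (simp add: L1_Linfty_def)
qed

end

declare not_None_eq [simp del]

section \<open>The one-point compactification\<close>

lemma openin_cemetery_Some: "open U \<Longrightarrow> openin cemetery_topology (Some ` U)"
  by (auto simp: openin_Alexandroff_compactification)

lemma openin_cemetery_compl:
  fixes K :: "'a::t2_space set"
  shows "compact K \<Longrightarrow> openin cemetery_topology (insert None (Some ` (- K)))"
  by (auto simp: openin_Alexandroff_compactification Compl_eq_Diff_UNIV compact_imp_closed)

lemma openin_cemetery_None:
  fixes V :: "'a::topological_space option set"
  assumes "openin cemetery_topology V" "None \<in> V"
  obtains K where "compact K" "V = insert None (Some ` (- K))"
  using assms by (auto simp: openin_Alexandroff_compactification Compl_eq_Diff_UNIV)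

lemma space_cemetery_borel [simp]: "space cemetery_borel = UNIV"
  by (simp add: cemetery_borel_def)

lemma sets_cemetery_borel_openin: "openin cemetery_topology V \<Longrightarrow> V \<in> sets cemetery_borel"
  by (simp add: cemetery_borel_def)

lemma Some_image_sets:
  assumes "B \<in> sets (borel :: 'a::topological_space measure)"
  shows "Some ` B \<in> sets cemetery_borel"
proof -
  have U: "Some ` (UNIV :: 'a set) \<in> sets cemetery_borel"
    by (intro sets_cemetery_borel_openin openin_cemetery_Some) simp
  have "B \<in> sigma_sets UNIV {S. open S}" using assms by (simp add: sets_borel)
  then show ?thesis
  proof induction
    case (Basic a)
    then show ?case by (intro sets_cemetery_borel_openin openin_cemetery_Some) simp
  next
    case (Compl a)
    have "Some ` (UNIV - a) = Some ` UNIV - Some ` a" by auto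
    with Compl U show ?case by auto
  next
    case (Union a)
    then show ?case by (simp add: image_UN)
  qed simp
qed

lemma not_None_eq_range: "{y. y \<noteq> None} = range Some"
  by (auto simp: image_iff not_None_eq)

lemma extend_zero_simps [simp]: "extend_zero f None = 0" "extend_zero f (Some x) = f x"
  by (simp_all add: extend_zero_def)

lemma extend_zero_measurable [measurable]:
  fixes f :: "'a::topological_space \<Rightarrow> 'b::{topological_space, zero}"
  assumes [measurable]: "f \<in> borel_measurable borel"
  shows "extend_zero f \<in> cemetery_borel \<rightarrow>\<^sub>M borel"
proof (rule measurableI)
  fix B :: "'b set" assume B: "B \<in> sets borel"
  have m: "Some ` (f -` B) \<in> sets cemetery_borel"
    using measurable_sets[OF assms B] by (intro Some_image_sets) simp
  have u: "Some ` (UNIV :: 'a set) \<in> sets cemetery_borel"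
    by (intro Some_image_sets) simp
  have n: "{None} \<in> sets (cemetery_borel :: 'a option measure)"
  proof -
    have "{None :: 'a option} = space cemetery_borel - Some ` UNIV" by (auto simp: not_None_eq[symmetric] not_None_eq_range[symmetric])
    then show ?thesis using u by (metis sets.compl_sets)
  qed
  have "extend_zero f -` B \<inter> space cemetery_borel = Some ` (f -` B) \<union> (if 0 \<in> B then {None} else {})"
    by (auto simp: extend_zero_def split: option.splits)
  moreover have "Some ` (f -` B) \<union> (if 0 \<in> B then {None} else {}) \<in> sets cemetery_borel"
    by (intro sets.Un m) (use n in simp)
  ultimately show "extend_zero f -` B \<inter> space cemetery_borel \<in> sets cemetery_borel"
    by (simp only:)
qed simp

lemma the_measurable:
  "the \<in> restrict_space cemetery_borel (range Some) \<rightarrow>\<^sub>M (borel :: 'a::topological_space measure)"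
proof (rule measurableI)
  fix B :: "'a set" assume B: "B \<in> sets borel"
  have "the -` B \<inter> space (restrict_space cemetery_borel (range Some)) = Some ` B"
    by (auto simp: space_restrict_space)
  moreover have "Some ` B \<in> sets (restrict_space cemetery_borel (range Some))"
    using Some_image_sets[OF B] Some_image_sets[of "UNIV :: 'a set"]
    by (subst sets_restrict_space_iff) auto
  ultimately show "the -` B \<inter> space (restrict_space cemetery_borel (range Some)) \<in> sets (restrict_space cemetery_borel (range Some))"
    by simp
qed simp

section \<open>Locally compact second countable spaces\<close>

lemma locally_compact_ball:
  fixes x :: "'a::metric_space"
  assumes lc: "locally_compact_space (euclidean :: 'a topology)" and U: "open U" "x \<in> U"
  obtains e where "0 < e" "compact (cball x e)" "cball x e \<subseteq> U"
proof -
  from lc obtain V K where V: "open V" "compact K" "x \<in> V" "V \<subseteq> K"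
    unfolding locally_compact_space_def by (simp, metis)
  have "open (U \<inter> V)" "x \<in> U \<inter> V" using U V by auto
  then obtain e where e: "0 < e" "cball x e \<subseteq> U \<inter> V" by (meson open_contains_cball)
  then have "cball x e = K \<inter> cball x e" using V by auto
  then have "compact (cball x e)" using V(2) by (metis closed_cball compact_Int_closed)
  with e show thesis by (intro that) auto
qed

text \<open>By Lindelof, countably many balls with compact closure inside \<open>U\<close> cover
  \<open>U\<close>; take finite unions of the closures. The clause on interiors later traps
  convergent positions of a path in one fixed compact set.\<close>

lemma compact_exhaustion:
  fixes U :: "'a::{metric_space, second_countable_topology} set"
  assumes lc: "locally_compact_space (euclidean :: 'a topology)" and U: "open U"
  obtains K :: "nat \<Rightarrow> 'a set" where "\<And>n. compact (K n)" "\<And>n. K n \<subseteq> U" "incseq K"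
    "\<And>x. x \<in> U \<Longrightarrow> \<exists>n. x \<in> interior (K n)"
proof -
  define \<F> where "\<F> = {ball x e | x e. compact (cball x e) \<and> cball x e \<subseteq> U}"
  have op: "open S" if "S \<in> \<F>" for S using that by (auto simp: \<F>_def)
  obtain \<G> where G: "\<G> \<subseteq> \<F>" "countable \<G>" "\<Union>\<G> = \<Union>\<F>"
    using Lindelof[OF op] by blast
  have cov: "x \<in> \<Union>\<F>" if "x \<in> U" for x
  proof -
    from locally_compact_ball[OF lc U that] obtain e where "0 < e" "compact (cball x e)" "cball x e \<subseteq> U" by blast
    then show ?thesis by (auto simp: \<F>_def intro!: exI[of _ "ball x e"])
  qed
  have cl: "compact (closure S) \<and> closure S \<subseteq> U" if "S \<in> \<F>" for S
  proof -
    from that obtain x e where S: "S = ball x e" "compact (cball x e)" "cball x e \<subseteq> U" by (auto simp: \<F>_def)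
    have "closure S \<subseteq> cball x e" unfolding S(1) by (intro closure_minimal ball_subset_cball closed_cball)
    moreover then have "compact (closure S)"
      using S(2) by (metis closed_closure compact_Int_closed inf.absorb_iff2)
    ultimately show ?thesis using S(3) by auto
  qed
  \<comment> \<open>Keeps the family to be enumerated nonempty even for empty \<open>U\<close>; a
    ball of negative radius supplies the empty member.\<close>
  have em: "{} \<in> \<F>"
  proof -
    have "ball (undefined :: 'a) (-1) = {}" "cball (undefined :: 'a) (-1) = {}" by simp_all
    then have "{} = ball (undefined :: 'a) (-1) \<and> compact (cball (undefined :: 'a) (-1)) \<and> cball (undefined :: 'a) (-1) \<subseteq> U"
      by (simp add: ball_empty cball_empty)
    then show ?thesis unfolding \<F>_def by blast
  qed
  define B where "B = from_nat_into (insert {} \<G>)"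
  have rB: "range B = insert {} \<G>" unfolding B_def using G(2) by (intro range_from_nat_into) auto
  have BF: "B n \<in> \<F>" for n using rB G(1) em by (metis insertE rangeI subsetD)
  define K where "K n = (\<Union>i\<le>n. closure (B i))" for n
  show thesis
  proof
    show "compact (K n)" for n unfolding K_def using cl[OF BF] by (intro compact_UN) auto
    show "K n \<subseteq> U" for n unfolding K_def using cl[OF BF] by auto
    show "incseq K" unfolding K_def by (intro monoI UN_mono) auto
    fix x assume "x \<in> U"
    then obtain S where S: "S \<in> \<G>" "x \<in> S" using cov G(3) by blast
    then obtain n where n: "S = B n" using rB by (metis insertI2 rangeE)
    have "B n \<subseteq> K n" unfolding K_def using closure_subset by blast
    then have "B n \<subseteq> interior (K n)" using op[OF BF] by (rule interior_maximal)
    then show "\<exists>n. x \<in> interior (K n)" using S n by auto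
  qed
qed

lemma compact_neighbourhood:
  fixes C :: "'a::metric_space set"
  assumes lc: "locally_compact_space (euclidean :: 'a topology)" and C: "compact C"
  obtains K where "compact K" "C \<subseteq> interior K"
proof -
  have "\<exists>e. 0 < e \<and> compact (cball x e)" for x :: 'a
  proof -
    obtain e where "0 < e" "compact (cball x e)" "cball x e \<subseteq> UNIV"
      by (rule locally_compact_ball[OF lc open_UNIV UNIV_I])
    then show ?thesis by blast
  qed
  then obtain e where e: "\<And>x::'a. 0 < e x" "\<And>x::'a. compact (cball x (e x))" by metis
  have cov: "C \<subseteq> (\<Union>x\<in>C. ball x (e x))" using e(1) by force
  obtain D where D: "D \<subseteq> C" "finite D" "C \<subseteq> (\<Union>x\<in>D. ball x (e x))"
    by (rule compactE_image[OF C _ cov]) (rule open_ball, rule that)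
  define K where "K = (\<Union>x\<in>D. cball x (e x))"
  have "compact K" unfolding K_def using D e by (intro compact_UN) auto
  moreover have "(\<Union>x\<in>D. ball x (e x)) \<subseteq> interior K"
    unfolding K_def by (intro interior_maximal open_UN ballI open_ball UN_mono ball_subset_cball) auto
  ultimately show thesis using D(3) by (intro that) auto
qed

lemma radon_sigma_finite:
  fixes \<mu> :: "'a::{metric_space, second_countable_topology} measure"
  assumes lc: "locally_compact_space (euclidean :: 'a topology)" and r: "radon_measure \<mu>"
  shows "sigma_finite_measure \<mu>"
proof -
  obtain K :: "nat \<Rightarrow> 'a set" where K: "\<And>n. compact (K n)" "\<And>x. \<exists>n. x \<in> interior (K n)"
    using compact_exhaustion[OF lc open_UNIV] by (metis UNIV_I)
  have s: "sets \<mu> = sets borel" using r by (simp add: radon_measure_def)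
  show ?thesis
  proof (rule sigma_finite_measure.intro, intro exI[of _ "range K"] conjI ballI)
    show "range K \<subseteq> sets \<mu>" using K(1) by (auto simp: s borel_compact)
    show "\<Union> (range K) = space \<mu>"
      using K(2) interior_subset sets_eq_imp_space_eq[OF s] by fastforce
    show "emeasure \<mu> a \<noteq> \<infinity>" if "a \<in> range K" for a
      using that K(1) r unfolding radon_measure_def by (metis less_irrefl rangeE)
  qed auto
qed

section \<open>Transition kernels of a Hunt process\<close>

text \<open>The law of the process at time \<open>t\<close> on the paths still alive, viewed on the
  state space itself. The missing mass is the probability of death, so in general this is only a
  subprobability.\<close>

definition transition_kernel ::
    "'w measure \<Rightarrow> (ennreal \<Rightarrow> 'w \<Rightarrow> 'a::topological_space option) \<Rightarrow> ('a option \<Rightarrow> 'w measure)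
      \<Rightarrow> real \<Rightarrow> 'a \<Rightarrow> 'a measure" where
  "transition_kernel M X P t x =
     distr (restrict_space (P (Some x)) {\<omega> \<in> space M. X (ennreal t) \<omega> \<noteq> None}) borel (\<lambda>\<omega>. the (X (ennreal t) \<omega>))"

context hunt_process
begin

abbreviation "K \<equiv> transition_kernel M X P"

lemma space_P [simp]: "space (P y) = space M"
  using sets_eq_imp_space_eq[OF sets_P] .

lemma X_measurable_P [measurable]: "X t \<in> P y \<rightarrow>\<^sub>M cemetery_borel"
  using X_measurable[of t] measurable_cong_sets[OF sets_P refl] by blast

lemma alive_sets: "{\<omega> \<in> space M. X t \<omega> \<noteq> None} \<in> sets (P y)"
proof -
  have "X t -` range Some \<inter> space (P y) \<in> sets (P y)"
    by (rule measurable_sets[OF X_measurable_P]) (auto intro: Some_image_sets)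
  moreover have "X t -` range Some \<inter> space (P y) = {\<omega> \<in> space M. X t \<omega> \<noteq> None}"
    by (auto simp: image_iff)
  ultimately show ?thesis by simp
qed

lemma alive_sets_Int: "{\<omega> \<in> space M. X t \<omega> \<noteq> None} \<inter> space M \<in> sets (P y)"
  using alive_sets[of t y] by (simp add: Int_absorb2)

lemma the_X_measurable [measurable]:
  "(\<lambda>\<omega>. the (X t \<omega>)) \<in> restrict_space (P y) {\<omega> \<in> space M. X t \<omega> \<noteq> None} \<rightarrow>\<^sub>M borel"
proof (rule measurable_compose[OF _ the_measurable])
  show "X t \<in> restrict_space (P y) {\<omega> \<in> space M. X t \<omega> \<noteq> None} \<rightarrow>\<^sub>M restrict_space cemetery_borel (range Some)"
    by (rule measurable_restrict_space2[OF _ measurable_restrict_space1[OF X_measurable_P]])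
      (auto simp: space_restrict_space)
qed

lemma space_K [simp]: "space (K t x) = UNIV" and sets_K [simp]: "sets (K t x) = sets borel"
  by (simp_all add: transition_kernel_def)

lemma nn_integral_K:
  assumes [measurable]: "f \<in> borel_measurable borel"
  shows "(\<integral>\<^sup>+y. f y \<partial>K t x) = (\<integral>\<^sup>+\<omega>. extend_zero f (X (ennreal t) \<omega>) \<partial>P (Some x))"
proof -
  have "(\<integral>\<^sup>+y. f y \<partial>K t x) = (\<integral>\<^sup>+\<omega>. f (the (X (ennreal t) \<omega>)) * indicator {\<omega> \<in> space M. X (ennreal t) \<omega> \<noteq> None} \<omega> \<partial>P (Some x))"
    unfolding transition_kernel_def
    by (subst nn_integral_distr) (auto simp: nn_integral_restrict_space alive_sets_Int)
  also have "\<dots> = (\<integral>\<^sup>+\<omega>. extend_zero f (X (ennreal t) \<omega>) \<partial>P (Some x))"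
    by (intro nn_integral_cong) (auto simp: extend_zero_def indicator_def split: option.splits)
  finally show ?thesis .
qed

lemma kernel_op_K:
  assumes [measurable]: "f \<in> borel_measurable borel"
  shows "kernel_op (K t) f x = transition_op X P t f x"
proof -
  have "kernel_op (K t) f x = (LINT \<omega>|P (Some x). indicator {\<omega> \<in> space M. X (ennreal t) \<omega> \<noteq> None} \<omega> *\<^sub>R f (the (X (ennreal t) \<omega>)))"
    unfolding kernel_op_def transition_kernel_def
    by (subst integral_distr) (auto simp: integral_restrict_space alive_sets_Int)
  also have "\<dots> = (LINT \<omega>|P (Some x). extend_zero f (X (ennreal t) \<omega>))"
    by (intro Bochner_Integration.integral_cong) (auto simp: extend_zero_def indicator_def split: option.splits)
  finally show ?thesis by (simp add: transition_op_def)
qed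

lemma emeasure_K:
  assumes "B \<in> sets borel"
  shows "emeasure (K t x) B = emeasure (P (Some x)) {\<omega> \<in> space M. X (ennreal t) \<omega> \<in> Some ` B}"
proof -
  have "emeasure (K t x) B = (\<integral>\<^sup>+y. indicator B y \<partial>K t x)" using assms by simp
  also have "\<dots> = (\<integral>\<^sup>+\<omega>. extend_zero (indicator B) (X (ennreal t) \<omega>) \<partial>P (Some x))"
    using assms by (intro nn_integral_K) simp
  also have "\<dots> = (\<integral>\<^sup>+\<omega>. indicator {\<omega> \<in> space M. X (ennreal t) \<omega> \<in> Some ` B} \<omega> \<partial>P (Some x))"
    by (intro nn_integral_cong) (auto simp: extend_zero_def indicator_def split: option.splits)
  also have "\<dots> = emeasure (P (Some x)) {\<omega> \<in> space M. X (ennreal t) \<omega> \<in> Some ` B}"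
  proof (rule nn_integral_indicator)
    have "X (ennreal t) -` (Some ` B) \<inter> space (P (Some x)) \<in> sets (P (Some x))"
      by (rule measurable_sets[OF X_measurable_P Some_image_sets[OF assms]])
    then show "{\<omega> \<in> space M. X (ennreal t) \<omega> \<in> Some ` B} \<in> sets (P (Some x))"
      by (simp add: vimage_def Int_def conj_commute)
  qed
  finally show ?thesis .
qed

lemma subprob_K: "subprob_space (K t x)"
proof
  interpret prob_space "P (Some x)" by (rule prob_space_P)
  show "emeasure (K t x) (space (K t x)) \<le> 1"
    by (simp add: emeasure_K emeasure_le_1)
qed simp

lemma measure_K: "B \<in> sets borel \<Longrightarrow> measure (K t x) B = measure (P (Some x)) {\<omega> \<in> space M. X (ennreal t) \<omega> \<in> Some ` B}"
  by (simp add: measure_def emeasure_K)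

lemma K_measurable [measurable]: "K t \<in> borel \<rightarrow>\<^sub>M subprob_algebra borel"
proof (rule measurable_subprob_algebra)
  fix B :: "'a set" assume B: "B \<in> sets borel"
  have "(\<lambda>x. ennreal (measure (K t x) B)) \<in> borel_measurable borel"
    using transition_measurable[OF B, of "ennreal t"] by (simp add: measure_K[OF B])
  then show "(\<lambda>x. emeasure (K t x) B) \<in> borel_measurable borel"
    using subprob_K by (simp add: finite_measure.emeasure_eq_measure subprob_space.axioms)
qed (auto intro: subprob_K)

lemma K_measurable': "K t \<in> K s x \<rightarrow>\<^sub>M subprob_algebra borel"
  unfolding measurable_cong_sets[OF sets_K refl] by (rule K_measurable)

lemma K_0: "K 0 x = return borel x"
proof (rule measure_eqI)
  fix B assume "B \<in> sets (K 0 x)"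
  then have B: "B \<in> sets borel" by simp
  interpret prob_space "P (Some x)" by (rule prob_space_P)
  have m: "{\<omega> \<in> space M. X 0 \<omega> \<in> Some ` B} \<in> sets (P (Some x))"
    using measurable_sets[OF X_measurable_P Some_image_sets[OF B], of 0 "Some x"] by (simp add: vimage_def Int_def conj_commute)
  have "emeasure (K 0 x) B = emeasure (P (Some x)) {\<omega> \<in> space M. X 0 \<omega> \<in> Some ` B}"
    by (simp add: emeasure_K[OF B])
  also have "\<dots> = (\<integral>\<^sup>+\<omega>. indicator {\<omega> \<in> space M. X 0 \<omega> \<in> Some ` B} \<omega> \<partial>P (Some x))"
    using m by simp
  also have "\<dots> = (\<integral>\<^sup>+\<omega>. indicator B x \<partial>P (Some x))"
    using normal[of x] AE_space by (intro nn_integral_cong_AE) (auto elim!: eventually_elim2 simp: indicator_def)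
  also have "\<dots> = indicator B x" by (simp add: emeasure_space_1[simplified])
  finally show "emeasure (K 0 x) B = emeasure (return borel x) B" using B by simp
qed simp

text \<open>\<open>dead_after_lifetime\<close> makes the infimum in \<open>lifetime\<close>
  attained, so death by time \<open>t\<close> can be read off from \<open>X t\<close> alone.
  Measurability of the lifetime and persistence of death rest on this.\<close>

lemma lifetime_le_iff:
  assumes "\<omega> \<in> space M"
  shows "lifetime X \<omega> \<le> t \<longleftrightarrow> X t \<omega> = None"
  using dead_after_lifetime[OF assms] by (auto simp: lifetime_def intro: Inf_lower)

lemma lifetime_measurable: "lifetime X \<in> P y \<rightarrow>\<^sub>M borel"
proof (rule borel_measurableI_le)
  fix t
  have "{\<omega> \<in> space (P y). lifetime X \<omega> \<le> t} = space (P y) - {\<omega> \<in> space M. X t \<omega> \<noteq> None}"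
    using lifetime_le_iff by auto
  then show "{\<omega> \<in> space (P y). lifetime X \<omega> \<le> t} \<in> sets (P y)"
    by (simp only: sets.compl_sets[OF alive_sets])
qed

lemma X_alive_antimono: "\<omega> \<in> space M \<Longrightarrow> s \<le> t \<Longrightarrow> X t \<omega> \<noteq> None \<Longrightarrow> X s \<omega> \<noteq> None"
  using lifetime_le_iff[of \<omega> s] lifetime_le_iff[of \<omega> t] by (metis order_trans)

subsection \<open>The strong Markov property in integrated form\<close>

context
  fixes F assumes F: "admissible_filtration M X F" "strong_markov M X P F"
begin

lemma filtration_F: "filtration (space M) F"
  using F(1) by (simp add: admissible_filtration_def)

lemma pre_sigma_subalgebra:
  assumes "stopping_time F \<sigma>"
  shows "subalgebra (P y) (filtration.pre_sigma (space M) F \<sigma>)"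
proof -
  interpret filtration "space M" F by (rule filtration_F)
  have "A \<in> sets M" if A: "A \<in> sets (pre_sigma \<sigma>)" for A
  proof -
    have "{\<omega> \<in> A. \<sigma> \<omega> \<le> \<infinity>} \<in> sets (F \<infinity>)" using sets_pre_sigmaD[OF assms A] .
    then show ?thesis using F(1) by (auto simp: admissible_filtration_def)
  qed
  then show ?thesis by (auto simp: subalgebra_def space_pre_sigma sets_P)
qed

text \<open>The conditional expectation integrated over \<open>A\<close>. Measurability of the event
  at the random time \<open>\<sigma> \<omega> + s\<close> is a premise, since the measurability
  assumptions on the process concern fixed times. The witness \<open>g\<close> carries
  integrability, as the strong Markov property determines the transition probability only almost
  everywhere.\<close>

lemma strong_markov_integral:
  assumes \<sigma>: "stopping_time F \<sigma>" and A: "A \<in> sets (filtration.pre_sigma (space M) F \<sigma>)"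
    and B: "B \<in> sets cemetery_borel" and m: "{\<omega> \<in> space M. X (\<sigma> \<omega> + s) \<omega> \<in> B} \<in> sets M"
  obtains g where "integrable (P y) g"
    "AE \<omega> in P y. g \<omega> = measure (P (X (\<sigma> \<omega>) \<omega>)) {\<omega>'\<in>space M. X s \<omega>' \<in> B}"
    "measure (P y) {\<omega> \<in> A. X (\<sigma> \<omega> + s) \<omega> \<in> B} = (LINT \<omega>:A|P y. g \<omega>)"
proof -
  interpret prob_space "P y" by (rule prob_space_P)
  let ?G = "filtration.pre_sigma (space M) F \<sigma>"
  interpret finite_measure_subalgebra "P y" ?G
    by unfold_locales (rule pre_sigma_subalgebra[OF \<sigma>])
  let ?f = "\<lambda>\<omega>'. indicator B (X (\<sigma> \<omega>' + s) \<omega>') :: real"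
  have fm: "?f \<in> borel_measurable (P y)"
  proof -
    have "(\<lambda>\<omega>. indicator {\<omega> \<in> space M. X (\<sigma> \<omega> + s) \<omega> \<in> B} \<omega> :: real) \<in> borel_measurable (P y)"
      using m by (intro borel_measurable_indicator) (simp add: sets_P)
    moreover have "\<omega> \<in> space (P y) \<Longrightarrow> ?f \<omega> = indicator {\<omega> \<in> space M. X (\<sigma> \<omega> + s) \<omega> \<in> B} \<omega>" for \<omega>
      by (auto simp: indicator_def)
    ultimately show ?thesis by (subst measurable_cong)
  qed
  have fi: "integrable (P y) ?f" using fm by (intro integrable_const_bound[of _ 1]) (auto simp: indicator_def)
  have AM: "A \<in> sets (P y)" using A subalg by (auto simp: subalgebra_def)
  have AS: "A \<subseteq> space M" using sets.sets_into_space[OF AM] by simp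
  show thesis
  proof (rule that[of "real_cond_exp (P y) ?G ?f"])
    show "integrable (P y) (real_cond_exp (P y) ?G ?f)" using real_cond_exp_int(1)[OF fi] .
    show "AE \<omega> in P y. real_cond_exp (P y) ?G ?f \<omega> = measure (P (X (\<sigma> \<omega>) \<omega>)) {\<omega>'\<in>space M. X s \<omega>' \<in> B}"
      using F(2) \<sigma> B unfolding strong_markov_def by blast
    have "measure (P y) {\<omega> \<in> A. X (\<sigma> \<omega> + s) \<omega> \<in> B} = measure (P y) (A \<inter> {\<omega> \<in> space M. X (\<sigma> \<omega> + s) \<omega> \<in> B})"
      using AS by (intro arg_cong[where f="measure (P y)"]) auto
    also have "\<dots> = (LINT \<omega>|P y. indicator (A \<inter> {\<omega> \<in> space M. X (\<sigma> \<omega> + s) \<omega> \<in> B}) \<omega>)"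
      using AM m by (simp add: sets_P)
    also have "\<dots> = (LINT \<omega>:A|P y. ?f \<omega>)"
      unfolding set_lebesgue_integral_def
      by (intro Bochner_Integration.integral_cong) (auto simp: indicator_def)
    also have "\<dots> = (LINT \<omega>:A|P y. real_cond_exp (P y) ?G ?f \<omega>)"
      by (rule real_cond_exp_intA[OF fi A])
    finally show "measure (P y) {\<omega> \<in> A. X (\<sigma> \<omega> + s) \<omega> \<in> B} = (LINT \<omega>:A|P y. real_cond_exp (P y) ?G ?f \<omega>)" .
  qed
qed

lemma measure_P_X:
  assumes "B \<in> sets borel"
  shows "measure (P y) {\<omega> \<in> space M. X (ennreal t) \<omega> \<in> Some ` B} = extend_zero (\<lambda>x. measure (K t x) B) y"
proof (cases y)
  case None
  interpret prob_space "P None" by (rule prob_space_P)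
  have "measure (P None) {\<omega> \<in> space M. X (ennreal t) \<omega> \<in> Some ` B} = 0"
  proof (rule measure_eq_0_null_sets, rule null_setsI)
    have m: "{\<omega> \<in> space M. X (ennreal t) \<omega> \<in> Some ` B} \<in> sets (P None)"
      using measurable_sets[OF X_measurable_P Some_image_sets[OF assms], of "ennreal t" None] by (simp add: vimage_def Int_def conj_commute)
    then show "{\<omega> \<in> space M. X (ennreal t) \<omega> \<in> Some ` B} \<in> sets (P None)" .
    have "AE \<omega> in P None. \<not> (X (ennreal t) \<omega> \<in> Some ` B)"
      using cemetery_trap[of "ennreal t"] by eventually_elim auto
    then show "emeasure (P None) {\<omega> \<in> space M. X (ennreal t) \<omega> \<in> Some ` B} = 0"
      using m by (subst (asm) AE_iff_measurable) auto
  qed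
  then show ?thesis by (simp add: None)
qed (simp add: measure_K assms)

lemma markov_event:
  assumes A: "A \<in> sets (F (ennreal s))" and B: "B \<in> sets borel" and st: "0 \<le> s" "0 \<le> t"
  shows "measure (P y) {\<omega> \<in> A. X (ennreal (s + t)) \<omega> \<in> Some ` B}
    = (LINT \<omega>:A|P y. extend_zero (\<lambda>x. measure (K t x) B) (X (ennreal s) \<omega>))"
proof -
  interpret filtration "space M" F by (rule filtration_F)
  have c: "stopping_time F (\<lambda>_. ennreal s)" by (rule stopping_time_const)
  have A': "A \<in> sets (pre_sigma (\<lambda>_. ennreal s))"
  proof (rule sets_pre_sigmaI[OF c])
    fix u :: ennreal
    show "{\<omega> \<in> A. ennreal s \<le> u} \<in> sets (F u)"
      using sets_F_mono[of "ennreal s" u] A by (cases "ennreal s \<le> u") auto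
  qed
  have m: "{\<omega> \<in> space M. X (ennreal s + ennreal t) \<omega> \<in> Some ` B} \<in> sets M"
    using measurable_sets[OF X_measurable Some_image_sets[OF B]] by (simp add: vimage_def Int_def conj_commute)
  obtain g where g: "integrable (P y) g"
    "AE \<omega> in P y. g \<omega> = measure (P (X (ennreal s) \<omega>)) {\<omega>'\<in>space M. X (ennreal t) \<omega>' \<in> Some ` B}"
    "measure (P y) {\<omega> \<in> A. X (ennreal s + ennreal t) \<omega> \<in> Some ` B} = (LINT \<omega>:A|P y. g \<omega>)"
    by (rule strong_markov_integral[OF c A' Some_image_sets[OF B] m])
  have "sets (F (ennreal s)) \<subseteq> sets M" using F(1) unfolding admissible_filtration_def by blast
  with A have AM: "A \<in> sets (P y)" by (auto simp: sets_P)
  have [measurable]: "(\<lambda>x. measure (K t x) B) \<in> borel_measurable borel"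
    using measure_measurable_subprob_algebra2[of borel "\<lambda>_. B"] B
    by (intro measurable_compose[OF K_measurable measurable_measure_subprob_algebra])
  have "(LINT \<omega>:A|P y. g \<omega>) = (LINT \<omega>:A|P y. extend_zero (\<lambda>x. measure (K t x) B) (X (ennreal s) \<omega>))"
    unfolding set_lebesgue_integral_def
    using g(2) AM borel_measurable_integrable[OF g(1)] measurable_compose[OF X_measurable_P extend_zero_measurable]
    by (intro integral_cong_AE) (auto simp: measure_P_X[OF B] elim!: eventually_mono)
  with g(3) show ?thesis using st by (simp add: ennreal_plus)
qed

end

lemma chapman_kolmogorov:
  assumes st: "0 \<le> s" "0 \<le> t"
  shows "K (s + t) x = K s x \<bind> K t"
proof (rule measure_eqI)
  have [simp]: "sets (K s x \<bind> K t) = sets borel" by (rule sets_bind[where N=borel]) auto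
  then show "sets (K (s + t) x) = sets (K s x \<bind> K t)" by simp
  fix B assume "B \<in> sets (K (s + t) x)"
  then have B: "B \<in> sets borel" by simp
  obtain F where F: "admissible_filtration M X F" "strong_markov M X P F"
    using strong_markov_quasi_left_continuous by blast
  have [measurable]: "(\<lambda>x. measure (K t x) B) \<in> borel_measurable borel" "(\<lambda>x. emeasure (K t x) B) \<in> borel_measurable borel"
    using B by (auto intro: measurable_compose[OF K_measurable measurable_measure_subprob_algebra]
      measurable_compose[OF K_measurable measurable_emeasure_subprob_algebra])
  have em: "emeasure (K t y) B = ennreal (measure (K t y) B)" for y
    using subprob_K by (simp add: finite_measure.emeasure_eq_measure subprob_space.axioms)
  interpret Px: prob_space "P (Some x)" by (rule prob_space_P)
  interpret filtration "space M" F using F(1) by (simp add: admissible_filtration_def)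
  have sp: "space M \<in> sets (F (ennreal s))" using sets.top[of "F (ennreal s)"] by (simp add: space_F)
  have "emeasure (K (s + t) x) B = ennreal (measure (P (Some x)) {\<omega> \<in> space M. X (ennreal (s + t)) \<omega> \<in> Some ` B})"
    by (simp add: emeasure_K[OF B] Px.emeasure_eq_measure)
  also have "measure (P (Some x)) {\<omega> \<in> space M. X (ennreal (s + t)) \<omega> \<in> Some ` B}
      = (LINT \<omega>:space M|P (Some x). extend_zero (\<lambda>x. measure (K t x) B) (X (ennreal s) \<omega>))"
    by (rule markov_event[OF F sp B st])
  also have "\<dots> = (LINT \<omega>|P (Some x). extend_zero (\<lambda>x. measure (K t x) B) (X (ennreal s) \<omega>))"
    unfolding set_lebesgue_integral_def by (intro Bochner_Integration.integral_cong) auto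
  also have "ennreal \<dots> = (\<integral>\<^sup>+\<omega>. ennreal (extend_zero (\<lambda>x. measure (K t x) B) (X (ennreal s) \<omega>)) \<partial>P (Some x))"
  proof (rule nn_integral_eq_integral[symmetric])
    show "AE \<omega> in P (Some x). 0 \<le> extend_zero (\<lambda>x. measure (K t x) B) (X (ennreal s) \<omega>)"
      by (auto simp: extend_zero_def split: option.splits)
    show "integrable (P (Some x)) (\<lambda>\<omega>. extend_zero (\<lambda>x. measure (K t x) B) (X (ennreal s) \<omega>))"
      using subprob_space.subprob_measure_le_1[OF subprob_K]
      by (intro Px.integrable_const_bound[of _ 1])
        (auto simp: extend_zero_def split: option.splits intro: measurable_compose[OF X_measurable_P extend_zero_measurable, unfolded extend_zero_def])
  qed
  also have "\<dots> = (\<integral>\<^sup>+\<omega>. extend_zero (\<lambda>x. emeasure (K t x) B) (X (ennreal s) \<omega>) \<partial>P (Some x))"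
    by (intro nn_integral_cong) (auto simp: extend_zero_def em split: option.splits)
  also have "\<dots> = (\<integral>\<^sup>+y. emeasure (K t y) B \<partial>K s x)" by (rule nn_integral_K[symmetric]) simp
  also have "\<dots> = emeasure (K s x \<bind> K t) B" using B by (subst emeasure_bind[where N=borel]) (auto intro: K_measurable')
  finally show "emeasure (K (s + t) x) B = emeasure (K s x \<bind> K t) B" .
qed

end

section \<open>Integration against mixtures of kernels\<close>

text \<open>Tonelli for the mixture; finiteness makes almost every inner integral finite, so that
  Bochner and extended integrals can be exchanged.\<close>

lemma integral_bind_nonneg:
  fixes f :: "'b \<Rightarrow> real"
  assumes N [measurable]: "N \<in> M \<rightarrow>\<^sub>M subprob_algebra B" and f [measurable]: "f \<in> borel_measurable B"
    and M: "space M \<noteq> {}"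
    and nn: "\<And>y. 0 \<le> f y" and i: "(\<integral>\<^sup>+y. f y \<partial>(M \<bind> N)) < \<infinity>"
  shows "AE x in M. integrable (N x) f" and "integrable M (\<lambda>x. LINT y|N x. f y)"
    and "(LINT y|(M \<bind> N). f y) = (LINT x|M. LINT y|N x. f y)"
proof -
  have sN: "x \<in> space M \<Longrightarrow> sets (N x) = sets B" for x using sets_kernel[OF N] .
  have mN: "x \<in> space M \<Longrightarrow> borel_measurable (N x) = (borel_measurable B :: ('b \<Rightarrow> real) set)" for x
    by (rule measurable_cong_sets) (auto simp: sN)
  have eq: "(\<integral>\<^sup>+y. f y \<partial>(M \<bind> N)) = (\<integral>\<^sup>+x. (\<integral>\<^sup>+y. f y \<partial>N x) \<partial>M)"
    by (rule nn_integral_bind[OF _ N]) simp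
  have m1 [measurable]: "(\<lambda>x. \<integral>\<^sup>+y. f y \<partial>N x) \<in> borel_measurable M"
    by (rule measurable_compose[OF N nn_integral_measurable_subprob_algebra]) simp
  have m2 [measurable]: "(\<lambda>x. LINT y|N x. f y) \<in> borel_measurable M"
    by (rule measurable_compose[OF N integral_measurable_subprob_algebra]) simp
  have "AE x in M. (\<integral>\<^sup>+y. f y \<partial>N x) \<noteq> \<infinity>"
    by (rule nn_integral_PInf_AE) (use i eq in \<open>auto simp: less_top\<close>)
  then show ae: "AE x in M. integrable (N x) f"
    using AE_space by eventually_elim (intro integrableI_nonneg, auto simp: mN nn less_top)
  have eq2: "(\<integral>\<^sup>+x. ennreal (LINT y|N x. f y) \<partial>M) = (\<integral>\<^sup>+x. (\<integral>\<^sup>+y. f y \<partial>N x) \<partial>M)"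
    using ae by (intro nn_integral_cong_AE) (auto elim!: eventually_mono simp: nn_integral_eq_integral nn)
  show "integrable M (\<lambda>x. LINT y|N x. f y)"
    using i eq eq2 by (intro integrableI_nonneg) (auto simp: nn)
  have sb: "sets (M \<bind> N) = sets B" by (rule sets_bind) (use sN M in auto)
  have fb: "f \<in> borel_measurable (M \<bind> N)"
    using measurable_cong_sets[OF sb refl] f by blast
  show "(LINT y|(M \<bind> N). f y) = (LINT x|M. LINT y|N x. f y)"
    using eq eq2 nn fb by (simp add: integral_eq_nn_integral)
qed

lemma integral_bind_complex:
  fixes f :: "'b \<Rightarrow> complex"
  assumes N [measurable]: "N \<in> M \<rightarrow>\<^sub>M subprob_algebra B" and f [measurable]: "f \<in> borel_measurable B"
    and M: "space M \<noteq> {}" and i: "(\<integral>\<^sup>+y. norm (f y) \<partial>(M \<bind> N)) < \<infinity>"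
  shows "AE x in M. integrable (N x) f" and "integrable M (\<lambda>x. LINT y|N x. f y)"
    and "(LINT y|(M \<bind> N). f y) = (LINT x|M. LINT y|N x. f y)"
proof -
  have sN: "x \<in> space M \<Longrightarrow> sets (N x) = sets B" for x using sets_kernel[OF N] .
  have mN: "x \<in> space M \<Longrightarrow> borel_measurable (N x) = (borel_measurable B :: ('b \<Rightarrow> complex) set)" for x
    by (rule measurable_cong_sets) (auto simp: sN)
  have sb: "sets (M \<bind> N) = sets B" by (rule sets_bind) (use sN M in auto)
  have fb: "f \<in> borel_measurable (M \<bind> N)"
    using measurable_cong_sets[OF sb refl] f by blast
  define F where "F c y = quadrant_part c (f y)" for c y
  have [measurable]: "F c \<in> borel_measurable B" for c by (simp add: F_def[abs_def])
  have fin: "(\<integral>\<^sup>+y. F c y \<partial>(M \<bind> N)) < \<infinity>" if "c \<in> unit4" for c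
    using i quadrant_part_bound[OF that]
    by (intro le_less_trans[OF nn_integral_mono i]) (auto simp: F_def ennreal_leI)
  have fF: "f y = (\<Sum>c\<in>unit4. c * of_real (F c y))" for y
    unfolding F_def by (rule quadrant_decomp)
  have fin4: "finite unit4" by (simp add: unit4_def)
  have kF: "AE x in M. integrable (N x) (F c)" "integrable M (\<lambda>x. LINT y|N x. F c y)"
    "(LINT y|(M \<bind> N). F c y) = (LINT x|M. LINT y|N x. F c y)" if "c \<in> unit4" for c
    by (rule integral_bind_nonneg[OF N _ M _ fin[OF that]]; simp add: F_def quadrant_part_nonneg)+
  have ae4: "AE x in M. \<forall>c\<in>unit4. integrable (N x) (F c)"
    using kF(1) fin4 by (simp add: AE_ball_countable countable_finite)
  show "AE x in M. integrable (N x) f"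
    using ae4
  proof eventually_elim
    case (elim x)
    show ?case unfolding fF[abs_def] using elim
      by (intro Bochner_Integration.integrable_sum integrable_mult_right integrable_of_real) auto
  qed
  have ae: "AE x in M. (LINT y|N x. f y) = (\<Sum>c\<in>unit4. c * of_real (LINT y|N x. F c y))"
    using ae4
  proof eventually_elim
    case (elim x)
    have "(LINT y|N x. f y) = (\<Sum>c\<in>unit4. LINT y|N x. c * of_real (F c y))"
      unfolding fF using elim by (intro Bochner_Integration.integral_sum integrable_mult_right integrable_of_real) auto
    then show ?case by simp
  qed
  have m2 [measurable]: "(\<lambda>x. LINT y|N x. f y) \<in> borel_measurable M"
    by (rule measurable_compose[OF N integral_measurable_subprob_algebra]) simp
  have j: "integrable M (\<lambda>x. c * complex_of_real (LINT y|N x. F c y))" if "c \<in> unit4" for c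
    using kF(2)[OF that] by (intro integrable_mult_right integrable_of_real)
  have j2: "integrable M (\<lambda>x. (\<Sum>c\<in>unit4. c * complex_of_real (LINT y|N x. F c y)))"
    by (intro Bochner_Integration.integrable_sum j)
  show "integrable M (\<lambda>x. LINT y|N x. f y)"
    by (rule integrable_cong_AE_imp[OF j2]) (use ae in auto)
  have Fb: "integrable (M \<bind> N) (F c)" if "c \<in> unit4" for c
  proof (rule integrableI_nonneg)
    show "F c \<in> borel_measurable (M \<bind> N)" unfolding F_def[abs_def] using fb by measurable
  qed (use fin[OF that] in \<open>auto simp: F_def quadrant_part_nonneg\<close>)
  have "(LINT y|(M \<bind> N). f y) = (\<Sum>c\<in>unit4. LINT y|(M \<bind> N). c * of_real (F c y))"
    unfolding fF using Fb by (intro Bochner_Integration.integral_sum integrable_mult_right integrable_of_real) auto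
  also have "\<dots> = (\<Sum>c\<in>unit4. LINT x|M. c * of_real (LINT y|N x. F c y))"
    by (intro sum.cong refl) (simp add: kF(3))
  also have "\<dots> = (LINT x|M. (\<Sum>c\<in>unit4. c * of_real (LINT y|N x. F c y)))"
    by (rule Bochner_Integration.integral_sum[symmetric]) (rule j)
  also have "\<dots> = (LINT x|M. LINT y|N x. f y)"
    by (rule integral_cong_AE) (use ae j2 in auto)
  finally show "(LINT y|(M \<bind> N). f y) = (LINT x|M. LINT y|N x. f y)" .
qed

section \<open>Exit times\<close>

text \<open>Off the null set \<open>N\<close> the two sets agree, and what \<open>A\<close> contains
  inside \<open>N\<close> is a subset of a null set.\<close>

lemma AE_eq_sets_completion:
  assumes ae: "AE x in M. x \<in> A \<longleftrightarrow> x \<in> B" and A: "A \<subseteq> space M" and B: "B \<in> sets M"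
  shows "A \<in> sets (completion M)"
proof -
  from ae obtain N where N: "{x \<in> space M. \<not> (x \<in> A \<longleftrightarrow> x \<in> B)} \<subseteq> N" "emeasure M N = 0" "N \<in> sets M"
    by (rule AE_E)
  show ?thesis
  proof (rule sets_completionI[of A "B - N" "A \<inter> N" N])
    show "A = (B - N) \<union> (A \<inter> N)"
      using N(1) A sets.sets_into_space[OF B] by blast
  qed (use N B in auto)
qed

context hunt_process
begin

text \<open>Unlike in \<open>exit_time\<close>, time 0 counts. For compact \<open>C\<close> the
  target set is open in the compactification, which makes this a stopping time of a right-continuous
  filtration.\<close>

definition hit :: "'a set \<Rightarrow> 'w \<Rightarrow> ennreal" where
  "hit C \<omega> = Inf {s. X s \<omega> \<in> insert None (Some ` (- C))}"

lemma right_continuous_open: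
  assumes "\<omega> \<in> space M" "t < top" "openin cemetery_topology V" "X t \<omega> \<in> V"
  obtains b where "t < b" "\<And>s. t \<le> s \<Longrightarrow> s < b \<Longrightarrow> X s \<omega> \<in> V"
proof -
  have "eventually (\<lambda>s. X s \<omega> \<in> V) (at_right t)"
    using right_continuous[of \<omega> t] assms by (auto simp: limitin_def)
  then obtain b where b: "b > t" "\<And>s. s > t \<Longrightarrow> s < b \<Longrightarrow> X s \<omega> \<in> V"
    using eventually_at_right[OF assms(2)] by auto
  show thesis
    by (rule that[OF b(1)]) (use b(2) assms(4) in \<open>auto simp: le_less\<close>)
qed

lemma hit_less_iff: "hit C \<omega> < r \<longleftrightarrow> (\<exists>s<r. X s \<omega> \<in> insert None (Some ` (- C)))"
  unfolding hit_def Inf_less_iff by auto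

lemma hit_le: "X s \<omega> \<in> insert None (Some ` (- C)) \<Longrightarrow> hit C \<omega> \<le> s"
  unfolding hit_def by (rule Inf_lower) simp

text \<open>A path in the interior of \<open>C\<close> at that time would stay in \<open>C\<close> a
  while longer by right continuity, contradicting the infimum. It may still sit on the boundary,
  hence the interior in the conclusion.\<close>

lemma X_hit_notin_interior:
  assumes "\<omega> \<in> space M" "hit C \<omega> < top"
  shows "X (hit C \<omega>) \<omega> \<notin> Some ` interior C"
proof
  assume "X (hit C \<omega>) \<omega> \<in> Some ` interior C"
  then obtain b where b: "hit C \<omega> < b" "\<And>s. hit C \<omega> \<le> s \<Longrightarrow> s < b \<Longrightarrow> X s \<omega> \<in> Some ` interior C"
    using right_continuous_open[OF assms openin_cemetery_Some[OF open_interior]] by blast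
  from b(1) obtain s where s: "s < b" "X s \<omega> \<in> insert None (Some ` (- C))"
    unfolding hit_less_iff by blast
  have "X s \<omega> \<in> Some ` interior C" using b(2)[OF hit_le[OF s(2)] s(1)] .
  with s(2) show False using interior_subset[of C] by auto
qed

lemma hit_le_exit_time: "C \<subseteq> U \<Longrightarrow> hit C \<omega> \<le> exit_time X U \<omega>"
  unfolding hit_def exit_time_def
proof (rule Inf_superset_mono)
  assume "C \<subseteq> U"
  show "{t. 0 < t \<and> X t \<omega> \<notin> Some ` U} \<subseteq> {s. X s \<omega> \<in> insert None (Some ` (- C))}"
  proof
    fix t assume t: "t \<in> {t. 0 < t \<and> X t \<omega> \<notin> Some ` U}"
    with \<open>C \<subseteq> U\<close> show "t \<in> {s. X s \<omega> \<in> insert None (Some ` (- C))}"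
      by (cases "X t \<omega>") auto
  qed
qed

lemma hit_mono: "C \<subseteq> D \<Longrightarrow> hit C \<omega> \<le> hit D \<omega>"
  unfolding hit_def by (rule Inf_superset_mono) auto

context
  fixes F assumes F: "admissible_filtration M X F" "strong_markov M X P F" "quasi_left_continuous M X P F"
begin

lemma F_sets: "sets (F t) \<subseteq> sets M" and F_X: "s \<le> t \<Longrightarrow> X s \<in> F t \<rightarrow>\<^sub>M cemetery_borel"
  and F_right: "t < top \<Longrightarrow> sets (F t) = (\<Inter>u\<in>{t<..}. sets (F u))"
  using F(1) unfolding admissible_filtration_def by auto

text \<open>The target set is open, so by right continuity of paths the event
  \<open>hit C \<omega> < r\<close> is decided by countably many times below \<open>r\<close>. Right
  continuity of the filtration then passes from strict to weak inequality.\<close>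

lemma stopping_time_hit:
  assumes C: "compact C"
  shows "stopping_time F (hit C)"
proof
  interpret filtration "space M" F by (rule filtration_F[OF F(1,2)])
  let ?V = "insert None (Some ` (- C))"
  have V: "openin cemetery_topology ?V" by (rule openin_cemetery_compl[OF C])
  obtain D :: "ennreal set" where D: "countable D" "\<And>S. open S \<Longrightarrow> S \<noteq> {} \<Longrightarrow> \<exists>d\<in>D. d \<in> S"
    by (rule countable_dense_setE) blast
  have dense: "\<exists>d\<in>D. a < d \<and> d < b" if ab: "a < b" for a b
  proof -
    obtain c where "a < c" "c < b" using dense[OF ab] by blast
    then show ?thesis using D(2)[of "{a<..<b}"] by auto
  qed
  have less: "{\<omega> \<in> space M. hit C \<omega> < r} \<in> sets (F r)" for r
  proof -
    have "{\<omega> \<in> space M. hit C \<omega> < r} = (\<Union>q\<in>{q\<in>D. q < r}. X q -` ?V \<inter> space (F r))"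
    proof (intro equalityI subsetI)
      fix \<omega> assume "\<omega> \<in> {\<omega> \<in> space M. hit C \<omega> < r}"
      then obtain s where \<omega>: "\<omega> \<in> space M" and s: "s < r" "X s \<omega> \<in> ?V" by (auto simp: hit_less_iff)
      have "s < top" using s(1) by (simp add: order_less_le_trans)
      then obtain b where b: "s < b" "\<And>q. s \<le> q \<Longrightarrow> q < b \<Longrightarrow> X q \<omega> \<in> ?V"
        using right_continuous_open[OF \<omega> _ V s(2)] by blast
      obtain q where "q \<in> D" "s < q" "q < min b r" using dense[of s "min b r"] b(1) s(1) by auto
      then have "q \<in> {q\<in>D. q < r}" "\<omega> \<in> X q -` ?V \<inter> space (F r)" using b(2)[of q] \<omega> by (auto simp: space_F)
      then show "\<omega> \<in> (\<Union>q\<in>{q\<in>D. q < r}. X q -` ?V \<inter> space (F r))" by blast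
    qed (auto simp: hit_less_iff space_F)
    also have "\<dots> \<in> sets (F r)"
      using D(1) by (intro sets.countable_UN') (auto intro!: measurable_sets[OF F_X] sets_cemetery_borel_openin V)
    finally show ?thesis .
  qed
  show "Measurable.pred (F t) (\<lambda>\<omega>. hit C \<omega> \<le> t)" for t
  proof (cases "t = top")
    case False
    have "{\<omega> \<in> space M. hit C \<omega> \<le> t} \<in> sets (F u)" if u: "t < u" for u
    proof -
      have "{\<omega> \<in> space M. hit C \<omega> \<le> t} = (\<Inter>r\<in>{r\<in>D. t < r \<and> r < u}. {\<omega> \<in> space M. hit C \<omega> < r})"
      proof (intro equalityI subsetI)
        fix \<omega> assume \<omega>: "\<omega> \<in> (\<Inter>r\<in>{r\<in>D. t < r \<and> r < u}. {\<omega> \<in> space M. hit C \<omega> < r})"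
        obtain r where "r \<in> D" "t < r" "r < u" using dense[OF u] by blast
        then have sp: "\<omega> \<in> space M" using \<omega> by auto
        have "hit C \<omega> \<le> t"
        proof (rule ccontr)
          assume "\<not> hit C \<omega> \<le> t"
          then have "t < min (hit C \<omega>) u" using u by (simp add: not_le)
          from dense[OF this] obtain r where "r \<in> D" "t < r" "r < min (hit C \<omega>) u" by blast
          with \<omega> show False by (auto dest: less_asym)
        qed
        with sp show "\<omega> \<in> {\<omega> \<in> space M. hit C \<omega> \<le> t}" by simp
      qed auto
      also have "\<dots> \<in> sets (F u)"
      proof (rule sets.countable_INT')
        show "{r \<in> D. t < r \<and> r < u} \<noteq> {}" using dense[OF u] by auto
        show "countable {r \<in> D. t < r \<and> r < u}" using D(1) by simp
        show "(\<lambda>r. {\<omega> \<in> space M. hit C \<omega> < r}) ` {r \<in> D. t < r \<and> r < u} \<subseteq> sets (F u)"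
        proof safe
          fix r assume "r < u"
          then show "{\<omega> \<in> space M. hit C \<omega> < r} \<in> sets (F u)"
            using subsetD[OF sets_F_mono[of r u] less[of r]] by simp
        qed
      qed
      finally show ?thesis .
    qed
    then have "{\<omega> \<in> space M. hit C \<omega> \<le> t} \<in> sets (F t)"
      using F_right[of t] False by (auto simp: less_top)
    then show ?thesis by (simp add: pred_def space_F)
  qed simp
qed

lemma hit_measurable:
  assumes C: "compact C"
  shows "hit C \<in> P y \<rightarrow>\<^sub>M borel"
proof -
  interpret filtration "space M" F by (rule filtration_F[OF F(1,2)])
  show ?thesis
    by (rule measurable_stopping_time[OF stopping_time_hit[OF C]]) (use F_sets in \<open>auto simp: sets_P space_F\<close>)
qed

text \<open>For a compact exhaustion of \<open>U\<close> the times \<open>hit (C n)\<close> increase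
  to some \<open>S\<close> not exceeding the exit time, and by quasi-left continuity the positions
  at these times converge to the position at \<open>S\<close>. If that lay in \<open>U\<close>, the
  positions would eventually be in the interior of a fixed \<open>C m\<close>, which
  \<open>X_hit_notin_interior\<close> excludes; so \<open>S\<close> is the exit time. This is the
  source of the measurability of exit events up to null sets.\<close>

lemma exit_time_AE_eq:
  assumes lc: "locally_compact_space (euclidean :: 'a topology)" and U: "open U" and x: "x \<in> U"
  obtains S where "S \<in> P (Some x) \<rightarrow>\<^sub>M borel" "AE \<omega> in P (Some x). exit_time X U \<omega> = S \<omega>"
proof -
  obtain C :: "nat \<Rightarrow> 'a set" where C: "\<And>n. compact (C n)" "\<And>n. C n \<subseteq> U" "incseq C"
    "\<And>x. x \<in> U \<Longrightarrow> \<exists>n. x \<in> interior (C n)"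
    by (rule compact_exhaustion[OF lc U]) (rule that)
  define \<sigma> where "\<sigma> n = hit (C n)" for n
  define S where "S \<omega> = (SUP n. \<sigma> n \<omega>)" for \<omega>
  have \<sigma>inc: "incseq (\<lambda>n. \<sigma> n \<omega>)" for \<omega>
    unfolding \<sigma>_def by (rule incseq_SucI, rule hit_mono, rule incseqD[OF C(3)]) simp
  have [measurable]: "\<sigma> n \<in> P (Some x) \<rightarrow>\<^sub>M borel" for n unfolding \<sigma>_def by (rule hit_measurable[OF C(1)])
  have Sm: "S \<in> P (Some x) \<rightarrow>\<^sub>M borel" unfolding S_def by measurable
  have qlc: "AE \<omega> in P (Some x). S \<omega> < \<infinity> \<longrightarrow>
      limitin cemetery_topology (\<lambda>n. X (\<sigma> n \<omega>) \<omega>) (X (S \<omega>) \<omega>) sequentially"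
    using F(3) stopping_time_hit[OF C(1)] \<sigma>inc unfolding quasi_left_continuous_def S_def \<sigma>_def by simp
  have "AE \<omega> in P (Some x). exit_time X U \<omega> = S \<omega>"
    using qlc normal[of x] AE_space
  proof eventually_elim
    case (elim \<omega>)
    then have \<omega>: "\<omega> \<in> space M" by simp
    have le: "S \<omega> \<le> exit_time X U \<omega>"
      unfolding S_def \<sigma>_def by (intro SUP_least hit_le_exit_time C(2))
    show ?case
    proof (cases "S \<omega> = top")
      case True
      with le show ?thesis by (simp add: top_unique)
    next
      case False
      then have fin: "S \<omega> < top" by (simp add: less_top)
      have \<sigma>S: "\<sigma> n \<omega> \<le> S \<omega>" for n unfolding S_def by (rule SUP_upper) simp
      have out: "X (S \<omega>) \<omega> \<notin> Some ` U"
      proof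
        assume "X (S \<omega>) \<omega> \<in> Some ` U"
        then obtain y where y: "X (S \<omega>) \<omega> = Some y" "y \<in> U" by auto
        from C(4)[OF y(2)] obtain m where m: "y \<in> interior (C m)" ..
        have "eventually (\<lambda>n. X (\<sigma> n \<omega>) \<omega> \<in> Some ` interior (C m)) sequentially"
          using elim(1) fin openin_cemetery_Some[OF open_interior[of "C m"]] m y(1) by (auto simp: limitin_def)
        then obtain N where N: "\<And>n. n \<ge> N \<Longrightarrow> X (\<sigma> n \<omega>) \<omega> \<in> Some ` interior (C m)"
          by (auto simp: eventually_sequentially)
        let ?n = "max N m"
        have "C m \<subseteq> C ?n" by (rule incseqD[OF C(3)]) simp
        then have "X (\<sigma> ?n \<omega>) \<omega> \<in> Some ` interior (C ?n)" using N[of ?n] interior_mono[of "C m" "C ?n"] by auto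
        moreover have "\<sigma> ?n \<omega> < top" using \<sigma>S[of ?n] fin by (rule le_less_trans)
        ultimately show False using X_hit_notin_interior[OF \<omega>, of "C ?n"] by (simp add: \<sigma>_def)
      qed
      \<comment> \<open>\<open>exit_time\<close> ignores time 0, so \<open>S\<close> must be
        positive: the path starts at \<open>x\<close> in \<open>U\<close>, but is outside
        \<open>U\<close> at time \<open>S\<close>.\<close>
      have pos: "0 < S \<omega>"
      proof -
        have "S \<omega> \<noteq> 0"
        proof
          assume "S \<omega> = 0"
          then have "X (S \<omega>) \<omega> = Some x" using elim(2) by simp
          with out x show False by auto
        qed
        then show ?thesis by (simp add: zero_less_iff_neq_zero)
      qed
      have "exit_time X U \<omega> \<le> S \<omega>"
        unfolding exit_time_def by (rule Inf_lower) (use out pos in auto)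
      with le show ?thesis by simp
    qed
  qed
  with Sm show thesis by (rule that)
qed

lemma exit_event_completion:
  assumes lc: "locally_compact_space (euclidean :: 'a topology)" and U: "open U" and x: "x \<in> U"
  shows "{\<omega> \<in> space M. t < exit_time X U \<omega>} \<in> sets (completion (P (Some x)))"
proof -
  obtain S where S [measurable]: "S \<in> P (Some x) \<rightarrow>\<^sub>M borel" and ae: "AE \<omega> in P (Some x). exit_time X U \<omega> = S \<omega>"
    by (rule exit_time_AE_eq[OF assms])
  have "{\<omega> \<in> space (P (Some x)). t < S \<omega>} \<in> sets (P (Some x))" by measurable
  then show ?thesis
    by (intro AE_eq_sets_completion[where B="{\<omega> \<in> space (P (Some x)). t < S \<omega>}"])
      (use ae in \<open>auto elim!: eventually_mono\<close>)
qed

text \<open>The process cannot leave \<open>C\<close> before time \<open>t\<close> and still be alive at time \<open>2 t\<close>, except with the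
  small probability that a path started outside the interior of \<open>C\<close> survives for the time \<open>t\<close>.\<close>

lemma exit_survival_bound:
  assumes C: "compact C" and t: "0 \<le> t" and e: "0 \<le> e" "\<And>y. y \<notin> interior C \<Longrightarrow> measure (K t y) UNIV \<le> e"
  shows "measure (P y) {\<omega> \<in> space M. hit C \<omega> \<le> ennreal t \<and> X (ennreal (t + t)) \<omega> \<in> range Some} \<le> e"
proof -
  interpret filtration "space M" F by (rule filtration_F[OF F(1,2)])
  interpret Py: prob_space "P y" by (rule prob_space_P)
  note st = stopping_time_hit[OF C]
  define A where "A = {\<omega> \<in> space M. hit C \<omega> \<le> ennreal t}"
  have A: "A \<in> sets (pre_sigma (hit C))"
  proof (rule sets_pre_sigmaI[OF st])
    fix u
    have "{\<omega> \<in> A. hit C \<omega> \<le> u} = {\<omega> \<in> space (F (min u (ennreal t))). hit C \<omega> \<le> min u (ennreal t)}"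
      by (auto simp: A_def space_F)
    also have "\<dots> \<in> sets (F (min u (ennreal t)))"
      using stopping_timeD[OF st, of "min u (ennreal t)"] by (simp add: pred_def)
    also have "\<dots> \<subseteq> sets (F u)" by (rule sets_F_mono) simp
    finally show "{\<omega> \<in> A. hit C \<omega> \<le> u} \<in> sets (F u)" .
  qed
  have AP: "A \<in> sets (P y)"
    using A pre_sigma_subalgebra[OF F(1,2) st, of y] by (auto simp: subalgebra_def)
  have hm: "hit C \<in> M \<rightarrow>\<^sub>M borel"
    using hit_measurable[OF C, of y] measurable_cong_sets[OF sets_P refl] by blast
  have lm: "lifetime X \<in> M \<rightarrow>\<^sub>M borel"
    using lifetime_measurable[of y] measurable_cong_sets[OF sets_P refl] by blast
  \<comment> \<open>Survival at the random time is rewritten through the lifetime, so that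
    measurability of \<open>hit C\<close> and \<open>lifetime X\<close> suffices.\<close>
  have alive: "{\<omega> \<in> space M. X (hit C \<omega> + ennreal t) \<omega> \<in> range Some} = {\<omega> \<in> space M. hit C \<omega> + ennreal t < lifetime X \<omega>}"
    using lifetime_le_iff by (auto simp: not_le[symmetric] not_None_eq_range[symmetric])
  have m: "{\<omega> \<in> space M. X (hit C \<omega> + ennreal t) \<omega> \<in> range Some} \<in> sets M"
    unfolding alive using hm lm by measurable
  obtain g where g: "integrable (P y) g"
    "AE \<omega> in P y. g \<omega> = measure (P (X (hit C \<omega>) \<omega>)) {\<omega>'\<in>space M. X (ennreal t) \<omega>' \<in> range Some}"
    "measure (P y) {\<omega> \<in> A. X (hit C \<omega> + ennreal t) \<omega> \<in> range Some} = (LINT \<omega>:A|P y. g \<omega>)"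
    by (rule strong_markov_integral[OF F(1,2) st A Some_image_sets m]) simp
  have "{\<omega> \<in> space M. hit C \<omega> \<le> ennreal t \<and> X (ennreal (t + t)) \<omega> \<in> range Some}
      \<subseteq> {\<omega> \<in> A. X (hit C \<omega> + ennreal t) \<omega> \<in> range Some}"
  proof clarify
    fix \<omega> z assume \<omega>: "\<omega> \<in> space M" "hit C \<omega> \<le> ennreal t" "X (ennreal (t + t)) \<omega> = Some z"
    have "hit C \<omega> + ennreal t \<le> ennreal (t + t)"
      unfolding ennreal_plus[OF t t] using \<omega>(2) by (rule add_right_mono)
    from X_alive_antimono[OF \<omega>(1) this] \<omega>
    show "\<omega> \<in> A \<and> X (hit C \<omega> + ennreal t) \<omega> \<in> range Some"
      by (auto simp: A_def not_None_eq_range[symmetric])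
  qed
  moreover have "{\<omega> \<in> A. X (hit C \<omega> + ennreal t) \<omega> \<in> range Some} \<in> sets (P y)"
  proof -
    have "{\<omega> \<in> A. X (hit C \<omega> + ennreal t) \<omega> \<in> range Some} = A \<inter> {\<omega> \<in> space M. X (hit C \<omega> + ennreal t) \<omega> \<in> range Some}"
      by (auto simp: A_def)
    with AP m show ?thesis by (auto simp: sets_P)
  qed
  ultimately have "measure (P y) {\<omega> \<in> space M. hit C \<omega> \<le> ennreal t \<and> X (ennreal (t + t)) \<omega> \<in> range Some}
      \<le> (LINT \<omega>:A|P y. g \<omega>)"
    unfolding g(3)[symmetric] by (rule Py.finite_measure_mono)
  also have "\<dots> \<le> (LINT \<omega>|P y. e)"
    unfolding set_lebesgue_integral_def
  proof (rule integral_mono_AE)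
    show "integrable (P y) (\<lambda>\<omega>. indicator A \<omega> *\<^sub>R g \<omega>)" using g(1) AP by (rule integrable_mult_indicator[rotated])
    show "AE \<omega> in P y. indicator A \<omega> *\<^sub>R g \<omega> \<le> e"
      using g(2) AE_space
    proof eventually_elim
      case (elim \<omega>)
      show ?case
      proof (cases "\<omega> \<in> A")
        case True
        then have "\<omega> \<in> space M" "hit C \<omega> < top" by (auto simp: A_def intro: le_less_trans)
        then have ni: "X (hit C \<omega>) \<omega> \<notin> Some ` interior C" by (rule X_hit_notin_interior)
        have "measure (P (X (hit C \<omega>) \<omega>)) {\<omega>'\<in>space M. X (ennreal t) \<omega>' \<in> range Some}
            = extend_zero (\<lambda>x. measure (K t x) UNIV) (X (hit C \<omega>) \<omega>)"
          by (rule measure_P_X[OF F(1,2)]) simp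
        also have "\<dots> \<le> e" using ni e by (cases "X (hit C \<omega>) \<omega>") auto
        finally show ?thesis using elim(1) True by simp
      qed (use e in simp)
    qed
  qed simp
  also have "\<dots> = e" by (simp add: Py.prob_space[simplified])
  finally show ?thesis .
qed

end

lemma kernel_op_K_add:
  assumes st: "0 \<le> s" "0 \<le> t" and f: "f \<in> borel_measurable borel"
    and i: "(\<integral>\<^sup>+y. norm (f y) \<partial>K (s + t) x) < \<infinity>"
  shows "AE y in K s x. integrable (K t y) f"
    and "integrable (K s x) (kernel_op (K t) f)"
    and "kernel_op (K (s + t)) f x = kernel_op (K s) (kernel_op (K t) f) x"
  using integral_bind_complex[OF K_measurable' f, of s x t] i
  unfolding chapman_kolmogorov[OF st] kernel_op_def by auto

lemma kernel_op_K_norm_le: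
  assumes f: "\<And>y. norm (f y) \<le> 1"
  shows "norm (kernel_op (K t) f x) \<le> measure (K t x) UNIV"
proof (cases "integrable (K t x) f")
  case True
  interpret subprob_space "K t x" by (rule subprob_K)
  have "norm (kernel_op (K t) f x) \<le> (LINT y|K t x. norm (f y))" unfolding kernel_op_def by (rule integral_norm_bound)
  also have "\<dots> \<le> (LINT y|K t x. 1)" using f True by (intro integral_mono) auto
  finally show ?thesis by simp
qed (simp add: kernel_op_def not_integrable_integral_eq)

lemma kernel_op_K_measurable [measurable]:
  "f \<in> borel_measurable borel \<Longrightarrow> kernel_op (K t) f \<in> borel_measurable borel"
  unfolding kernel_op_def by (rule measurable_compose[OF K_measurable integral_measurable_subprob_algebra])

text \<open>By Chapman-Kolmogorov the difference is the expectation of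
  \<open>kernel_op (K t) f\<close> at time \<open>t\<close> over paths that have left
  \<open>U\<close> by then. Such paths have left \<open>C\<close>, and
  \<open>kernel_op (K t) f\<close> is bounded by the survival probability \<open>m\<close>; so the
  Markov property bounds the difference by the probability of leaving \<open>C\<close> by time
  \<open>t\<close> and still being alive at \<open>t + t\<close>.\<close>

lemma part_transition_estimate:
  assumes lc: "locally_compact_space (euclidean :: 'a topology)" and U: "open U" and x: "x \<in> U"
    and C: "compact C" "C \<subseteq> U" and t: "0 \<le> t"
    and e: "0 \<le> e" "\<And>y. y \<notin> interior C \<Longrightarrow> measure (K t y) UNIV \<le> e"
    and f [measurable]: "f \<in> borel_measurable borel" and f1: "\<And>y. norm (f y) \<le> 1"
  shows "norm (kernel_op (K (t + t)) f x - part_transition_op X P U t (kernel_op (K t) f) x) \<le> e"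
proof -
  obtain F where F: "admissible_filtration M X F" "strong_markov M X P F" "quasi_left_continuous M X P F"
    using strong_markov_quasi_left_continuous by blast
  interpret Px: prob_space "P (Some x)" by (rule prob_space_P)
  interpret Pc: prob_space "completion (P (Some x))" by (rule Px.prob_space_completion)
  interpret filtration "space M" F by (rule filtration_F[OF F(1,2)])
  define h where "h = kernel_op (K t) f"
  define m where "m y = measure (K t y) UNIV" for y
  have [measurable]: "h \<in> borel_measurable borel" unfolding h_def by measurable
  have [measurable]: "m \<in> borel_measurable borel" unfolding m_def
    by (rule measurable_compose[OF K_measurable measurable_measure_subprob_algebra]) simp
  have hm: "norm (h y) \<le> m y" for y unfolding h_def m_def by (rule kernel_op_K_norm_le[OF f1])
  have m1: "0 \<le> m y" "m y \<le> 1" for y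
    unfolding m_def using subprob_space.subprob_measure_le_1[OF subprob_K] by auto
  define Y where "Y \<omega> = extend_zero h (X (ennreal t) \<omega>)" for \<omega>
  define Z where "Z \<omega> = extend_zero m (X (ennreal t) \<omega>)" for \<omega>
  have Y [measurable]: "Y \<in> borel_measurable (P (Some x))"
    unfolding Y_def by (rule measurable_compose[OF X_measurable_P]) measurable
  have Z [measurable]: "Z \<in> borel_measurable (P (Some x))"
    unfolding Z_def by (rule measurable_compose[OF X_measurable_P]) measurable
  have YZ: "norm (Y \<omega>) \<le> Z \<omega>" "0 \<le> Z \<omega>" "Z \<omega> \<le> 1" for \<omega>
    using hm m1 by (auto simp: Y_def Z_def extend_zero_def split: option.splits)
  define E where "E = {\<omega> \<in> space M. ennreal t < exit_time X U \<omega>}"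
  have E: "E \<in> sets (completion (P (Some x)))"
    unfolding E_def by (rule exit_event_completion[OF F lc U x])
  define A where "A = {\<omega> \<in> space M. hit C \<omega> \<le> ennreal t}"
  have AF: "A \<in> sets (F (ennreal t))"
    using stopping_timeD[OF stopping_time_hit[OF F C(1)], of "ennreal t"] by (simp add: pred_def A_def space_F)
  have A: "A \<in> sets (P (Some x))"
    using AF F_sets[OF F, of "ennreal t"] by (auto simp: sets_P)
  have Yi: "integrable (P (Some x)) Y" using YZ by (intro Px.integrable_const_bound[of _ 1]) (auto intro!: always_eventually intro: order_trans)
  have Zi: "integrable (P (Some x)) Z" using YZ by (intro Px.integrable_const_bound[of _ 1]) auto
  have Yc: "integrable (completion (P (Some x))) Y" using Yi Y by (simp add: integrable_completion)
  have "(\<integral>\<^sup>+y. norm (f y) \<partial>K (t + t) x) \<le> (\<integral>\<^sup>+y. 1 \<partial>K (t + t) x)"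
    using f1 by (intro nn_integral_mono) (simp add: ennreal_le_1)
  also have "\<dots> < \<infinity>"
    using subprob_space.emeasure_subprob_space_less_top[OF subprob_K] by (simp add: less_top)
  finally have "kernel_op (K (t + t)) f x = kernel_op (K t) h x"
    unfolding h_def by (rule kernel_op_K_add(3)[OF t t f])
  also have "\<dots> = (LINT \<omega>|P (Some x). Y \<omega>)"
    by (subst kernel_op_K) (auto simp: transition_op_def Y_def[abs_def])
  also have "\<dots> = (LINT \<omega>|completion (P (Some x)). Y \<omega>)" using Y by (simp add: integral_completion)
  finally have T: "kernel_op (K (t + t)) f x = (LINT \<omega>|completion (P (Some x)). Y \<omega>)" .
  have part: "part_transition_op X P U t h x = (LINT \<omega>|completion (P (Some x)). indicator E \<omega> *\<^sub>R Y \<omega>)"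
    unfolding part_transition_op_def set_lebesgue_integral_def Y_def
    by (intro Bochner_Integration.integral_cong) (auto simp: E_def indicator_def)
  have Ei: "integrable (completion (P (Some x))) (\<lambda>\<omega>. indicator E \<omega> *\<^sub>R Y \<omega>)"
    by (rule integrable_mult_indicator[OF E Yc])
  have ZA: "integrable (P (Some x)) (\<lambda>\<omega>. indicator A \<omega> *\<^sub>R Z \<omega>)" by (rule integrable_mult_indicator[OF A Zi])
  then have ZAc: "integrable (completion (P (Some x))) (\<lambda>\<omega>. indicator A \<omega> *\<^sub>R Z \<omega>)"
    by (subst integrable_completion) auto
  have "norm (kernel_op (K (t + t)) f x - part_transition_op X P U t h x)
      = norm (LINT \<omega>|completion (P (Some x)). Y \<omega> - indicator E \<omega> *\<^sub>R Y \<omega>)"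
    unfolding T part using Yc Ei by simp
  also have "\<dots> \<le> (LINT \<omega>|completion (P (Some x)). norm (Y \<omega> - indicator E \<omega> *\<^sub>R Y \<omega>))"
    by (rule integral_norm_bound)
  also have "\<dots> \<le> (LINT \<omega>|completion (P (Some x)). indicator A \<omega> *\<^sub>R Z \<omega>)"
  proof (rule integral_mono)
    fix \<omega> assume "\<omega> \<in> space (completion (P (Some x)))"
    then have \<omega>: "\<omega> \<in> space M" by simp
    \<comment> \<open>Replaces the exit event, measurable only for the completion, by the event
      \<open>A\<close> from the filtration, to which the Markov property applies.\<close>
    have "\<omega> \<in> E \<or> \<omega> \<in> A"
      using hit_le_exit_time[OF C(2), of \<omega>] \<omega> by (auto simp: E_def A_def intro: order_trans)
    then show "norm (Y \<omega> - indicator E \<omega> *\<^sub>R Y \<omega>) \<le> indicator A \<omega> *\<^sub>R Z \<omega>"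
      using YZ[of \<omega>] by (auto simp: indicator_def)
  qed (use Yc Ei ZAc in auto)
  also have "\<dots> = (LINT \<omega>:A|P (Some x). extend_zero m (X (ennreal t) \<omega>))"
    unfolding set_lebesgue_integral_def Z_def[symmetric] using ZA
    by (intro integral_completion) (auto dest: borel_measurable_integrable)
  also have "\<dots> = measure (P (Some x)) {\<omega> \<in> A. X (ennreal (t + t)) \<omega> \<in> range Some}"
    unfolding m_def by (rule markov_event[OF F(1,2) AF _ t t, symmetric]) simp
  also have "{\<omega> \<in> A. X (ennreal (t + t)) \<omega> \<in> range Some}
      = {\<omega> \<in> space M. hit C \<omega> \<le> ennreal t \<and> X (ennreal (t + t)) \<omega> \<in> range Some}"
    by (auto simp: A_def)
  also have "measure (P (Some x)) \<dots> \<le> e" by (rule exit_survival_bound[OF F C(1) t e])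
  finally show ?thesis by (simp add: h_def)
qed

end

section \<open>Compactness of the semigroup on \<open>L^\<infinity>\<close>\<close>

lemma (in symmetric_kernel) Linfty_compactI:
  assumes "\<And>e f. 0 < e \<Longrightarrow> (\<And>n::nat. f n \<in> Lp_space top M) \<Longrightarrow> (\<And>n. Lp_norm top M (f n) \<le> 1) \<Longrightarrow>
    \<exists>s::nat \<Rightarrow> nat. strict_mono s \<and>
      (\<exists>N. \<forall>i\<ge>N. \<forall>j\<ge>N. Lp_norm top M (\<lambda>x. T (f (s i)) x - T (f (s j)) x) \<le> e)"
  shows "Lp_compact_operator top M T"
proof (rule Lp_compact_operatorI)
  show "Lp_operator top M T" by (rule Lp_operator_T) simp
  fix f :: "nat \<Rightarrow> 'a \<Rightarrow> complex"
  assume f: "\<And>n. f n \<in> Lp_space top M" "\<And>n. Lp_norm top M (f n) \<le> 1"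
  define D where "D i j = Lp_norm top M (\<lambda>x. T (f i) x - T (f j) x)" for i j
  obtain r :: "nat \<Rightarrow> nat" where r: "strict_mono r" "\<And>e. 0 < e \<Longrightarrow> \<exists>N. \<forall>i\<ge>N. \<forall>j\<ge>N. D (r i) (r j) \<le> e"
  proof (rule diagonal_cauchy)
    fix e :: real and r :: "nat \<Rightarrow> nat" assume "0 < e"
    then show "\<exists>s::nat \<Rightarrow> nat. strict_mono s \<and> (\<exists>N. \<forall>i\<ge>N. \<forall>j\<ge>N. D (r (s i)) (r (s j)) \<le> e)"
      unfolding D_def by (rule assms[of e "\<lambda>n. f (r n)"]) (rule f)+
  next
    fix r :: "nat \<Rightarrow> nat"
    assume "strict_mono r" "\<And>e. 0 < e \<Longrightarrow> \<exists>N. \<forall>i\<ge>N. \<forall>j\<ge>N. D (r i) (r j) \<le> e"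
    then show thesis by (rule that)
  qed
  obtain g where g: "g \<in> Lp_space top M" "(\<lambda>n. Lp_norm top M (\<lambda>x. T (f (r n)) x - g x)) \<longlonglongrightarrow> 0"
  proof (rule Linfty_complete)
    show "T (f (r n)) \<in> Lp_space top M" for n by (intro T_Lp f) simp
    show "\<exists>N. \<forall>i\<ge>N. \<forall>j\<ge>N. Lp_norm top M (\<lambda>x. T (f (r i)) x - T (f (r j)) x) \<le> e" if "0 < e" for e
      using r(2)[OF that] by (simp add: D_def)
  qed (rule that)
  show "\<exists>g r. g \<in> Lp_space top M \<and> strict_mono (r::nat \<Rightarrow> nat) \<and> (\<lambda>n. Lp_norm top M (\<lambda>x. T (f (r n)) x - g x)) \<longlonglongrightarrow> 0"
    using g r(1) by (intro exI[of _ g] exI[of _ r] conjI)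
qed

abbreviation exp_measure :: "real measure" where
  "exp_measure \<equiv> density lborel (exponential_density 1)"

lemma prob_space_exp_measure: "prob_space exp_measure"
  by (rule prob_space_exponential_density) simp

text \<open>The density is at least \<open>exp (- t)\<close> on \<open>{0..t}\<close>, an interval
  of length \<open>t\<close>.\<close>

lemma exp_measure_pos:
  assumes t: "0 < t"
  shows "t * exp (- t) \<le> measure exp_measure {..t}"
proof -
  interpret prob_space exp_measure by (rule prob_space_exp_measure)
  have "ennreal (t * exp (- t)) = (\<integral>\<^sup>+s. ennreal (exp (- t)) * indicator {0..t} s \<partial>lborel)"
    using t by (subst nn_integral_cmult_indicator) (auto simp: ennreal_mult mult.commute)
  also have "\<dots> \<le> (\<integral>\<^sup>+s. ennreal (exponential_density 1 s) * indicator {..t} s \<partial>lborel)"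
    using t by (intro nn_integral_mono) (auto simp: exponential_density_def indicator_def)
  also have "\<dots> = emeasure exp_measure {..t}"
    by (subst emeasure_density) auto
  finally show ?thesis by (simp add: emeasure_eq_measure)
qed

locale symmetric_hunt_process = hunt_process M X P
  for M :: "'w measure"
    and X :: "ennreal \<Rightarrow> 'w \<Rightarrow> 'a::{metric_space, second_countable_topology} option"
    and P :: "'a option \<Rightarrow> 'w measure" +
  fixes \<mu> :: "'a measure"
  assumes locally_compact: "locally_compact_space (euclidean :: 'a topology)"
    and radon: "radon_measure \<mu>"
    and symmetric: "symmetric_process \<mu> X P"
    and tight: "tightness_property X P"
    and local_compact: "local_Linfty_compactness \<mu> X P"
begin

lemma sets_mu [simp, measurable_cong]: "sets \<mu> = sets borel"
  using radon by (simp add: radon_measure_def)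

lemma space_mu [simp]: "space \<mu> = UNIV"
  using sets_eq_imp_space_eq[OF sets_mu] by simp

lemma sigma_finite_mu: "sigma_finite_measure \<mu>"
  by (rule radon_sigma_finite[OF locally_compact radon])

lemma measurable_mu: "borel_measurable \<mu> = borel_measurable borel"
  by (rule measurable_cong_sets) auto

lemma subprob_algebra_mu: "subprob_algebra \<mu> = subprob_algebra borel"
  by (rule subprob_algebra_cong) simp

lemma symmetric_kernel_K:
  assumes t: "0 \<le> t"
  shows "symmetric_kernel \<mu> (K t)"
proof -
  interpret sigma_finite_measure \<mu> by (rule sigma_finite_mu)
  show ?thesis
  proof
    show "K t \<in> \<mu> \<rightarrow>\<^sub>M subprob_algebra \<mu>"
      unfolding subprob_algebra_mu measurable_cong_sets[OF sets_mu refl] by (rule K_measurable)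
    fix f g :: "'a \<Rightarrow> ennreal" assume f: "f \<in> borel_measurable \<mu>" and g: "g \<in> borel_measurable \<mu>"
    then have fg [measurable]: "f \<in> borel_measurable borel" "g \<in> borel_measurable borel" by (simp_all add: measurable_mu)
    show "(\<integral>\<^sup>+x. (\<integral>\<^sup>+y. f y \<partial>K t x) * g x \<partial>\<mu>) = (\<integral>\<^sup>+x. f x * (\<integral>\<^sup>+y. g y \<partial>K t x) \<partial>\<mu>)"
    proof (cases "t = 0")
      case True
      then show ?thesis by (simp add: K_0 nn_integral_return)
    next
      case False
      with t symmetric fg show ?thesis
        unfolding symmetric_process_def by (simp add: nn_integral_K)
    qed
  qed
qed

text \<open>A path alive at time \<open>t\<close> contributes to the resolvent at least the mass
  that the exponential law gives to times up to \<open>t\<close>, which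
  \<open>exp_measure_pos\<close> bounds from below.\<close>

lemma survival_le_resolvent:
  assumes t: "0 < t"
  shows "t * exp (- t) * measure (K t x) UNIV \<le> resolvent_op X P 1 (\<lambda>_. 1) x"
proof -
  interpret Px: prob_space "P (Some x)" by (rule prob_space_P)
  interpret E: prob_space exp_measure by (rule prob_space_exp_measure)
  define I where "I \<omega> = measure exp_measure {s. ennreal s < lifetime X \<omega>}" for \<omega>
  have inner: "(LINT s:{s. 0 \<le> s \<and> ennreal s < lifetime X \<omega>}|lborel. exp (- 1 * s) * extend_zero (\<lambda>_. 1) (X (ennreal s) \<omega>)) = I \<omega>"
    if \<omega>: "\<omega> \<in> space M" for \<omega>
  proof -
    have m: "{s. ennreal s < lifetime X \<omega>} \<in> sets borel" by measurable
    have "(LINT s:{s. 0 \<le> s \<and> ennreal s < lifetime X \<omega>}|lborel. exp (- 1 * s) * extend_zero (\<lambda>_. 1) (X (ennreal s) \<omega>))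
        = (LINT s|lborel. exponential_density 1 s *\<^sub>R indicator {s. ennreal s < lifetime X \<omega>} s)"
      unfolding set_lebesgue_integral_def
    proof (intro Bochner_Integration.integral_cong refl)
      fix s :: real
      have "X (ennreal s) \<omega> \<noteq> None" if "ennreal s < lifetime X \<omega>"
        using that lifetime_le_iff[OF \<omega>, of "ennreal s"] by auto
      then have "extend_zero (\<lambda>_. 1::real) (X (ennreal s) \<omega>) = 1" if "ennreal s < lifetime X \<omega>"
        using that by (auto simp: extend_zero_def split: option.splits)
      then show "indicator {s. 0 \<le> s \<and> ennreal s < lifetime X \<omega>} s *\<^sub>R (exp (- 1 * s) * extend_zero (\<lambda>_. 1) (X (ennreal s) \<omega>))
          = exponential_density 1 s *\<^sub>R indicator {s. ennreal s < lifetime X \<omega>} s"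
        by (auto simp: indicator_def exponential_density_def)
    qed
    also have "\<dots> = (LINT s|exp_measure. indicator {s. ennreal s < lifetime X \<omega>} s)"
      using m by (intro integral_density[symmetric]) (auto simp: exponential_density_nonneg)
    also have "\<dots> = I \<omega>" using m by (simp add: I_def)
    finally show ?thesis .
  qed
  have R: "resolvent_op X P 1 (\<lambda>_. 1) x = (LINT \<omega>|P (Some x). I \<omega>)"
    unfolding resolvent_op_def by (intro Bochner_Integration.integral_cong refl, rule inner) simp
  have [measurable]: "lifetime X \<in> P (Some x) \<rightarrow>\<^sub>M borel" by (rule lifetime_measurable)
  have Im: "I \<in> borel_measurable (P (Some x))"
  proof -
    have "I \<omega> = (LINT s|exp_measure. indicator {s. ennreal s < lifetime X \<omega>} s)" for \<omega>
      by (simp add: I_def)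
    moreover have "(\<lambda>\<omega>. LINT s|exp_measure. indicator {s. ennreal s < lifetime X \<omega>} s :: real) \<in> borel_measurable (P (Some x))"
      unfolding indicator_def mem_Collect_eq
      by (rule E.borel_measurable_lebesgue_integral) measurable
    ultimately show ?thesis by (simp cong: measurable_cong)
  qed
  have Ii: "integrable (P (Some x)) I"
    using Im by (intro Px.integrable_const_bound[of _ 1]) (auto simp: I_def)
  have a: "{\<omega> \<in> space M. X (ennreal t) \<omega> \<in> Some ` UNIV} \<in> sets (P (Some x))"
    using alive_sets[of "ennreal t" "Some x"] by (simp add: not_None_eq_range[symmetric] image_iff not_None_eq)
  have "t * exp (- t) * measure (K t x) UNIV
      = (LINT \<omega>|P (Some x). t * exp (- t) * indicator {\<omega> \<in> space M. X (ennreal t) \<omega> \<in> Some ` UNIV} \<omega>)"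
    using a sets.Int_space_eq2[OF a] by (simp add: measure_K)
  also have "\<dots> \<le> (LINT \<omega>|P (Some x). I \<omega>)"
  proof (rule integral_mono[OF _ Ii])
    show "integrable (P (Some x)) (\<lambda>\<omega>. t * exp (- t) * indicator {\<omega> \<in> space M. X (ennreal t) \<omega> \<in> Some ` UNIV} \<omega>)"
      using a by (intro integrable_mult_right integrable_real_indicator) (auto simp: Px.emeasure_eq_measure)
    fix \<omega> assume "\<omega> \<in> space (P (Some x))"
    then have \<omega>: "\<omega> \<in> space M" by simp
    show "t * exp (- t) * indicator {\<omega> \<in> space M. X (ennreal t) \<omega> \<in> Some ` UNIV} \<omega> \<le> I \<omega>"
    proof (cases "X (ennreal t) \<omega> \<in> Some ` UNIV")
      case True
      then have lt: "ennreal t < lifetime X \<omega>" using lifetime_le_iff[OF \<omega>, of "ennreal t"] by (auto simp: not_le[symmetric])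
      have "t * exp (- t) \<le> measure exp_measure {..t}" by (rule exp_measure_pos[OF t])
      also have "\<dots> \<le> I \<omega>"
        unfolding I_def using lt
        by (intro E.finite_measure_mono) (auto intro: le_less_trans ennreal_leI)
      finally show ?thesis using True \<omega> by simp
    qed (simp add: I_def)
  qed
  finally show ?thesis by (simp only: R)
qed

text \<open>Neighbourhoods of the cemetery are complements of compact sets, so tightness makes the
  resolvent of 1 smaller than \<open>t * exp (- t) * e\<close> off a compact set;
  \<open>survival_le_resolvent\<close> lets the factor cancel.\<close>

lemma survival_small:
  assumes t: "0 < t" and e: "0 < e"
  obtains C where "compact C" "\<And>y. y \<notin> C \<Longrightarrow> measure (K t y) UNIV \<le> e"
proof -
  define c where "c = t * exp (- t)"
  have c: "0 < c" using t by (simp add: c_def)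
  have "eventually (\<lambda>y. extend_zero (resolvent_op X P 1 (\<lambda>_. 1)) y < c * e) (atin cemetery_topology None)"
    using tight c e unfolding tightness_property_def by (intro order_tendstoD(2)) auto
  then obtain V where V: "openin cemetery_topology V" "None \<in> V"
    "\<And>y. y \<in> V \<Longrightarrow> y \<noteq> None \<Longrightarrow> extend_zero (resolvent_op X P 1 (\<lambda>_. 1)) y < c * e"
    unfolding eventually_atin by auto
  obtain C where C: "compact C" "V = insert None (Some ` (- C))"
    by (rule openin_cemetery_None[OF V(1,2)])
  show thesis
  proof (rule that[OF C(1)])
    fix y assume "y \<notin> C"
    then have "resolvent_op X P 1 (\<lambda>_. 1) y < c * e" using V(3)[of "Some y"] C(2) by auto
    with survival_le_resolvent[OF t, of y] have "c * measure (K t y) UNIV \<le> c * e" by (simp add: c_def)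
    then show "measure (K t y) UNIV \<le> e" using c by simp
  qed
qed

lemma survival_antimono:
  assumes "0 \<le> s" "s \<le> t"
  shows "measure (K t x) UNIV \<le> measure (K s x) UNIV"
proof -
  interpret Px: prob_space "P (Some x)" by (rule prob_space_P)
  have "{\<omega> \<in> space M. X (ennreal t) \<omega> \<in> range Some} \<subseteq> {\<omega> \<in> space M. X (ennreal s) \<omega> \<in> range Some}"
    using X_alive_antimono[OF _ ennreal_leI[OF assms(2)]] by (auto simp: not_None_eq_range[symmetric])
  then show ?thesis
    using alive_sets[of "ennreal s" "Some x"]
    by (simp add: measure_K not_None_eq_range[symmetric] Px.finite_measure_mono)
qed

theorem K_compact_Linfty:
  assumes t: "0 < t"
  shows "Lp_compact_operator top \<mu> (kernel_op (K t))"
proof -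
  interpret symmetric_kernel \<mu> "K t" by (rule symmetric_kernel_K) (use t in simp)
  define s where "s = t / 2"
  have s: "0 < s" "t = s + s" using t by (simp_all add: s_def)
  show ?thesis
  proof (rule Linfty_compactI)
    fix e :: real and f :: "nat \<Rightarrow> 'a \<Rightarrow> complex"
    assume e: "0 < e" and f: "\<And>n. f n \<in> Lp_space top \<mu>" "\<And>n. Lp_norm top \<mu> (f n) \<le> 1"
    note [measurable] = Lp_space_measurable[OF f(1), unfolded measurable_mu]
    \<comment> \<open>Modified on a null set so that the bound 1 holds everywhere, as the pointwise
      estimate \<open>part_transition_estimate\<close> demands.\<close>
    define f' where "f' n x = (if norm (f n x) \<le> 1 then f n x else 0)" for n x
    have f'm [measurable]: "f' n \<in> borel_measurable borel" for n unfolding f'_def[abs_def] by measurable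
    have f'1: "norm (f' n x) \<le> 1" for n x by (simp add: f'_def)
    have ff': "AE x in \<mu>. kernel_op (K t) (f n) x = kernel_op (K t) (f' n) x" for n
    proof (rule T_cong)
      show "AE x in \<mu>. f n x = f' n x"
        using Lp_norm_infinity_AE[OF f(1)[of n]] by eventually_elim (use f(2)[of n] in \<open>simp add: f'_def\<close>)
    qed (simp_all add: measurable_mu)
    \<comment> \<open>Four errors of this size occur on \<open>U\<close> and two outside it, which
      stays below \<open>e\<close>.\<close>
    have e8: "0 < e/8" using e by simp
    obtain C0 where C0: "compact C0" "\<And>y. y \<notin> C0 \<Longrightarrow> measure (K s y) UNIV \<le> e/8"
      by (rule survival_small[OF s(1) e8]) (rule that)
    obtain C where C: "compact C" "C0 \<subseteq> interior C"
      by (rule compact_neighbourhood[OF locally_compact C0(1)])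
    \<comment> \<open>A second neighbourhood, because \<open>U\<close> must be an open set around
      \<open>C\<close>; it lies inside the compact \<open>C'\<close> and so has finite
      measure.\<close>
    obtain C' where C': "compact C'" "C \<subseteq> interior C'"
      by (rule compact_neighbourhood[OF locally_compact C(1)])
    define U where "U = interior C'"
    have U: "open U" "C \<subseteq> U" using C' by (simp_all add: U_def)
    have "emeasure \<mu> U \<le> emeasure \<mu> C'"
      unfolding U_def by (rule emeasure_mono[OF interior_subset]) (use C' in \<open>simp add: borel_compact\<close>)
    also have "\<dots> < \<infinity>" using radon C'(1) by (simp add: radon_measure_def)
    finally have Ufin: "emeasure \<mu> U < \<infinity>" .
    have small: "measure (K s y) UNIV \<le> e/8" if "y \<notin> interior C" for y
      using C0(2)[of y] C(2) that by auto
    define h where "h n = kernel_op (K s) (f' n)" for n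
    have hm [measurable]: "h n \<in> borel_measurable borel" for n unfolding h_def by measurable
    have h1: "norm (h n x) \<le> 1" for n x
      unfolding h_def
      by (rule order_trans[OF kernel_op_K_norm_le[OF f'1] subprob_space.subprob_measure_le_1[OF subprob_K]])
    define \<nu> where "\<nu> = restrict_space \<mu> U"
    have hL: "h n \<in> Lp_space top \<nu>" "Lp_norm top \<nu> (h n) \<le> 1" for n
    proof -
      have "h n \<in> borel_measurable \<nu>" unfolding \<nu>_def
        by (rule measurable_restrict_space1) (simp add: measurable_mu)
      moreover have "AE x in \<nu>. norm (h n x) \<le> 1" using h1 by simp
      ultimately show "h n \<in> Lp_space top \<nu>" "Lp_norm top \<nu> (h n) \<le> 1"
        by (auto simp: Lp_space_infinity_iff intro!: exI[of _ 1] Lp_norm_infinity_le)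
    qed
    define A :: "('a \<Rightarrow> complex) \<Rightarrow> 'a \<Rightarrow> complex" where "A = part_transition_op X P U s"
    have cA: "Lp_compact_operator top \<nu> A"
      using local_compact s(1) U(1) Ufin unfolding local_Linfty_compactness_def \<nu>_def A_def by simp
    obtain g and q :: "nat \<Rightarrow> nat" where g: "g \<in> Lp_space top \<nu>" "strict_mono q"
      "(\<lambda>n. Lp_norm top \<nu> (\<lambda>x. A (h (q n)) x - g x)) \<longlonglongrightarrow> 0"
      by (rule Lp_compact_operatorE[OF cA hL])
    have AL: "A (h n) \<in> Lp_space top \<nu>" for n
      using cA hL(1) unfolding Lp_compact_operator_def Lp_operator_def by blast
    have "eventually (\<lambda>n. Lp_norm top \<nu> (\<lambda>x. A (h (q n)) x - g x) < e/8) sequentially"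
      using order_tendstoD(2)[OF g(3) e8] .
    then obtain N where N: "\<And>n. n \<ge> N \<Longrightarrow> Lp_norm top \<nu> (\<lambda>x. A (h (q n)) x - g x) < e/8"
      by (auto simp: eventually_sequentially)
    have est: "norm (kernel_op (K t) (f' n) x - A (h n) x) \<le> e/8" if "x \<in> U" for n x
      unfolding s(2) A_def h_def
      by (rule part_transition_estimate[OF locally_compact U(1) that C(1) U(2) _ _ small f'm f'1])
        (use s e in auto)
    have out: "norm (kernel_op (K t) (f' n) x) \<le> e/8" if "x \<notin> U" for n x
    proof -
      have "x \<notin> interior C" using that U(2) interior_subset by blast
      then have "measure (K t x) UNIV \<le> e/8"
        using survival_antimono[of s t x] small[of x] s by simp
      then show ?thesis by (rule order_trans[OF kernel_op_K_norm_le[OF f'1]])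
    qed
    have gA: "AE x in \<mu>. x \<in> U \<longrightarrow> norm (A (h (q n)) x - g x) \<le> e/8" if "n \<ge> N" for n
    proof -
      have "AE x in \<nu>. norm (A (h (q n)) x - g x) \<le> Lp_norm top \<nu> (\<lambda>x. A (h (q n)) x - g x)"
        by (intro Lp_norm_infinity_AE Lp_space_diff AL g) simp
      then have "AE x in \<nu>. norm (A (h (q n)) x - g x) \<le> e/8"
        by eventually_elim (use N[OF that] in simp)
      then show ?thesis unfolding \<nu>_def by (subst (asm) AE_restrict_space_iff) (use U in auto)
    qed
    have "Lp_norm top \<mu> (\<lambda>x. kernel_op (K t) (f (q i)) x - kernel_op (K t) (f (q j)) x) \<le> e" if ij: "i \<ge> N" "j \<ge> N" for i j
    proof (rule Lp_norm_infinity_le)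
      show "(\<lambda>x. kernel_op (K t) (f (q i)) x - kernel_op (K t) (f (q j)) x) \<in> borel_measurable \<mu>"
        unfolding measurable_mu by measurable
      show "AE x in \<mu>. norm (kernel_op (K t) (f (q i)) x - kernel_op (K t) (f (q j)) x) \<le> e"
        using ff'[of "q i"] ff'[of "q j"] gA[OF ij(1)] gA[OF ij(2)]
      proof eventually_elim
        case (elim x)
        let ?a = "kernel_op (K t) (f' (q i)) x" and ?b = "kernel_op (K t) (f' (q j)) x"
        have "norm (?a - ?b) \<le> e"
        proof (cases "x \<in> U")
          case True
          have "?a - ?b = (?a - A (h (q i)) x) + (A (h (q i)) x - g x) - (A (h (q j)) x - g x) - (?b - A (h (q j)) x)"
            by simp
          also have "norm \<dots> \<le> norm (?a - A (h (q i)) x) + norm (A (h (q i)) x - g x)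
              + norm (A (h (q j)) x - g x) + norm (?b - A (h (q j)) x)"
          proof -
            have "norm (a + b - c - d) \<le> norm a + norm b + norm c + norm d" for a b c d :: complex
              using norm_triangle_ineq4[of "a + b - c" d] norm_triangle_ineq4[of "a + b" c] norm_triangle_ineq[of a b]
              by linarith
            then show ?thesis .
          qed
          also have "\<dots> \<le> e/8 + e/8 + e/8 + e/8"
            using elim(3,4) True by (intro add_mono est) auto
          finally show ?thesis using e by simp
        next
          case False
          have "norm (?a - ?b) \<le> e/8 + e/8"
            using out[OF False] by (intro order_trans[OF norm_triangle_ineq4] add_mono)
          then show ?thesis using e by simp
        qed
        then show ?case using elim(1,2) by simp
      qed
    qed (use e in simp)
    then show "\<exists>s::nat \<Rightarrow> nat. strict_mono s \<and> (\<exists>N. \<forall>i\<ge>N. \<forall>j\<ge>N.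
        Lp_norm top \<mu> (\<lambda>x. kernel_op (K t) (f (s i)) x - kernel_op (K t) (f (s j)) x) \<le> e)"
      using g(2) by (intro exI[of _ q] conjI exI[of _ N]) auto
  qed
qed

end

section \<open>Strong convergence of symmetric kernels\<close>

lemma infdist_indicator_tendsto:
  fixes C :: "'a::metric_space set"
  assumes "closed C" "C \<noteq> {}"
  shows "(\<lambda>n. max 0 (1 - real n * infdist x C)) \<longlonglongrightarrow> indicator C x"
proof (cases "x \<in> C")
  case False
  then have d: "0 < infdist x C" using assms infdist_pos_not_in_closed by blast
  obtain N :: nat where "1 / infdist x C < real N" using reals_Archimedean2 by blast
  then have "max 0 (1 - real n * infdist x C) = 0" if "n \<ge> N" for n
  proof -
    have "1 < real N * infdist x C" using \<open>1 / infdist x C < real N\<close> d by (simp add: field_simps)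
    also have "\<dots> \<le> real n * infdist x C" using that d by (intro mult_right_mono) auto
    finally show ?thesis by simp
  qed
  then have "eventually (\<lambda>n. max 0 (1 - real n * infdist x C) = indicator C x) sequentially"
    using False by (auto simp: eventually_sequentially)
  then show ?thesis by (rule tendsto_eventually)
qed simp

lemma compact_infdist_subset:
  fixes C :: "'a::metric_space set"
  assumes C: "compact C" "C \<noteq> {}" and U: "open U" "C \<subseteq> U"
  obtains e where "0 < e" "\<And>x. infdist x C < e \<Longrightarrow> x \<in> U"
proof (cases "U = UNIV")
  case True
  then show ?thesis by (intro that[of 1]) auto
next
  case False
  then have ne: "- U \<noteq> {}" by auto
  have "continuous_on C (\<lambda>x. infdist x (- U))" by (intro continuous_intros)
  then obtain a where a: "a \<in> C" "\<And>x. x \<in> C \<Longrightarrow> infdist a (- U) \<le> infdist x (- U)"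
    using continuous_attains_inf[OF C] by blast
  have pos: "0 < infdist a (- U)"
    using a(1) U ne by (intro infdist_pos_not_in_closed) auto
  show ?thesis
  proof (rule that[OF pos])
    fix x assume x: "infdist x C < infdist a (- U)"
    show "x \<in> U"
    proof (rule ccontr)
      assume "x \<notin> U"
      have "infdist a (- U) \<le> dist x y" if "y \<in> C" for y
        using a(2)[OF that] infdist_le[of x "- U" y] \<open>x \<notin> U\<close> by (simp add: dist_commute)
      then have "infdist a (- U) \<le> infdist x C"
        unfolding infdist_def[of x C] using C(2) by (auto intro: cINF_greatest)
      with x show False by simp
    qed
  qed
qed

lemma indicator_L1:
  assumes "A \<in> sets M" "emeasure M A < \<infinity>"
  shows "(indicator A :: 'a \<Rightarrow> complex) \<in> Lp_space 1 M"
proof -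
  have "integrable M (\<lambda>x. complex_of_real (indicator A x))"
    by (intro integrable_of_real integrable_real_indicator assms)
  moreover have "(\<lambda>x. complex_of_real (indicator A x)) = indicator A" by (auto simp: indicator_def)
  ultimately show ?thesis by (simp add: Lp_space_1_iff)
qed

text \<open>Pointwise convergence is asked only for continuous functions with values in
  \<open>[0,1]\<close>, which is what right-continuous paths provide. Inner regularity of the
  measure and contractivity of the kernels extend it to norm convergence for finite
  exponents.\<close>

locale approximate_identity =
  fixes \<mu> :: "'a::{metric_space, second_countable_topology} measure"
    and Q :: "nat \<Rightarrow> 'a \<Rightarrow> 'a measure"
  assumes lc: "locally_compact_space (euclidean :: 'a topology)"
    and radon: "radon_measure \<mu>"
    and kernel: "\<And>n. symmetric_kernel \<mu> (Q n)"
    and pointwise: "\<And>\<phi> x. continuous_on UNIV \<phi> \<Longrightarrow> (\<And>y. 0 \<le> \<phi> y) \<Longrightarrow> (\<And>y. \<phi> y \<le> (1::real)) \<Longrightarrow>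
      (\<lambda>n. LINT y|Q n x. \<phi> y) \<longlonglongrightarrow> \<phi> x"
begin

lemma sets_mu: "sets \<mu> = sets borel"
  using radon by (simp add: radon_measure_def)

lemma space_mu: "space \<mu> = UNIV"
  using sets_eq_imp_space_eq[OF sets_mu] by simp

lemma measurable_mu: "borel_measurable \<mu> = borel_measurable borel"
  by (rule measurable_cong_sets) (auto simp: sets_mu)

definition converges :: "('a \<Rightarrow> complex) \<Rightarrow> bool" where
  "converges f \<longleftrightarrow> f \<in> Lp_space 1 \<mu> \<and> (\<lambda>n. Lp_norm 1 \<mu> (\<lambda>x. kernel_op (Q n) f x - f x)) \<longlonglongrightarrow> 0"

text \<open>Scheffe's argument: the integrals of \<open>T\<^sub>n \<phi>\<close> do not exceed that of \<open>\<phi>\<close>, so pointwise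
  convergence of nonnegative functions upgrades to convergence in \<open>L\<^sup>1\<close>.\<close>

lemma converges_continuous:
  fixes \<phi> :: "'a \<Rightarrow> real"
  assumes c: "continuous_on UNIV \<phi>" and \<phi>: "\<And>y. 0 \<le> \<phi> y" "\<And>y. \<phi> y \<le> 1" and i: "integrable \<mu> \<phi>"
  shows "converges (\<lambda>x. complex_of_real (\<phi> x))"
proof -
  have [measurable]: "\<phi> \<in> borel_measurable borel" using c by (rule borel_measurable_continuous_onI)
  define v where "v n x = (LINT y|Q n x. \<phi> y)" for n x
  have op: "kernel_op (Q n) (\<lambda>x. complex_of_real (\<phi> x)) x = complex_of_real (v n x)" for n x
    by (simp add: kernel_op_def v_def)
  have v: "integrable \<mu> (v n)" "(LINT x|\<mu>. v n x) \<le> (LINT x|\<mu>. \<phi> x)" "0 \<le> v n x" for n x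
  proof -
    interpret symmetric_kernel \<mu> "Q n" by (rule kernel)
    show "integrable \<mu> (v n)" "(LINT x|\<mu>. v n x) \<le> (LINT x|\<mu>. \<phi> x)"
      using nn_norm_kernel_finite(2,3)[OF i] \<phi> by (simp_all add: v_def[abs_def])
    show "0 \<le> v n x" using \<phi> by (simp add: v_def)
  qed
  define w where "w n x = max 0 (\<phi> x - v n x)" for n x
  have wi: "integrable \<mu> (w n)" for n unfolding w_def using i v(1)[of n] by auto
  have "(\<lambda>n. LINT x|\<mu>. w n x) \<longlonglongrightarrow> (LINT x|\<mu>. 0)"
  proof (rule integral_dominated_convergence[OF _ _ i])
    show "AE x in \<mu>. (\<lambda>n. w n x) \<longlonglongrightarrow> 0"
    proof (rule AE_I2)
      fix x
      have "(\<lambda>n. v n x) \<longlonglongrightarrow> \<phi> x" unfolding v_def by (rule pointwise[OF c \<phi>])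
      then have "(\<lambda>n. max 0 (\<phi> x - v n x)) \<longlonglongrightarrow> max 0 (\<phi> x - \<phi> x)" by (intro tendsto_intros)
      then show "(\<lambda>n. w n x) \<longlonglongrightarrow> 0" by (simp add: w_def)
    qed
    show "AE x in \<mu>. norm (w n x) \<le> \<phi> x" for n
      using v(3) \<phi> by (simp add: w_def)
  qed (use wi in \<open>auto dest: borel_measurable_integrable\<close>)
  then have lim: "(\<lambda>n. 2 * (LINT x|\<mu>. w n x)) \<longlonglongrightarrow> 0" using tendsto_mult_left[of _ 0 sequentially 2] by simp
  have "(\<lambda>n. LINT x|\<mu>. norm (v n x - \<phi> x)) \<longlonglongrightarrow> 0"
  proof (rule tendsto_zero_squeeze[OF lim])
    fix n
    \<comment> \<open>For real \<open>a\<close>, the absolute value is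
      \<open>2 * max 0 (- a) + a\<close>; here \<open>a = v n x - \<phi> x\<close>, with
      \<open>w\<close> as its negative part.\<close>
    have "(LINT x|\<mu>. norm (v n x - \<phi> x)) = (LINT x|\<mu>. 2 * w n x + (v n x - \<phi> x))"
      by (intro Bochner_Integration.integral_cong refl) (auto simp: w_def max_def)
    also have "\<dots> = 2 * (LINT x|\<mu>. w n x) + ((LINT x|\<mu>. v n x) - (LINT x|\<mu>. \<phi> x))"
      using wi[of n] v(1)[of n] i by simp
    also have "\<dots> \<le> 2 * (LINT x|\<mu>. w n x)" using v(2)[of n] by simp
    finally show "(LINT x|\<mu>. norm (v n x - \<phi> x)) \<le> 2 * (LINT x|\<mu>. w n x)" .
  qed simp
  then show ?thesis
    using i by (simp add: converges_def Lp_space_1_iff Lp_norm_1 op norm_of_real flip: of_real_diff)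
qed

text \<open>A three-term estimate: the kernels are contractions, so the error of replacing
  \<open>f\<close> by \<open>g\<close> is not amplified.\<close>

lemma converges_approx:
  assumes f: "f \<in> Lp_space 1 \<mu>" and approx: "\<And>e. 0 < e \<Longrightarrow> \<exists>g. converges g \<and> Lp_norm 1 \<mu> (\<lambda>x. f x - g x) \<le> e"
  shows "converges f"
  unfolding converges_def
proof (intro conjI f LIMSEQ_I)
  fix e :: real assume e: "0 < e"
  obtain g where g: "converges g" "Lp_norm 1 \<mu> (\<lambda>x. f x - g x) \<le> e/4" using approx[of "e/4"] e by auto
  then have gL: "g \<in> Lp_space 1 \<mu>" and lim: "(\<lambda>n. Lp_norm 1 \<mu> (\<lambda>x. kernel_op (Q n) g x - g x)) \<longlonglongrightarrow> 0"
    by (auto simp: converges_def)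
  from order_tendstoD(2)[OF lim, of "e/4"] e
  obtain N where N: "\<And>n. n \<ge> N \<Longrightarrow> Lp_norm 1 \<mu> (\<lambda>x. kernel_op (Q n) g x - g x) < e/4"
    by (auto simp: eventually_sequentially)
  have "Lp_norm 1 \<mu> (\<lambda>x. kernel_op (Q n) f x - f x) < e" if n: "n \<ge> N" for n
  proof -
    interpret symmetric_kernel \<mu> "Q n" by (rule kernel)
    have Tf: "T f \<in> Lp_space 1 \<mu>" and Tg: "T g \<in> Lp_space 1 \<mu>" by (intro T_Lp f gL; simp)+
    have "Lp_norm 1 \<mu> (\<lambda>x. T f x - f x) \<le> Lp_norm 1 \<mu> (\<lambda>x. T f x - T g x) + Lp_norm 1 \<mu> (\<lambda>x. T g x - f x)"
      by (rule Lp_norm_diff_triangle[OF order_refl Tf Tg f])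
    also have "Lp_norm 1 \<mu> (\<lambda>x. T g x - f x) \<le> Lp_norm 1 \<mu> (\<lambda>x. T g x - g x) + Lp_norm 1 \<mu> (\<lambda>x. g x - f x)"
      by (rule Lp_norm_diff_triangle[OF order_refl Tg gL f])
    also have "Lp_norm 1 \<mu> (\<lambda>x. T f x - T g x) \<le> Lp_norm 1 \<mu> (\<lambda>x. f x - g x)"
      by (rule T_diff_Lp_norm[OF order_refl f gL])
    finally show ?thesis
      using N[OF n] g(2) Lp_norm_minus_commute[of 1 \<mu> g f] e by simp
  qed
  then show "\<exists>N. \<forall>n\<ge>N. norm (Lp_norm 1 \<mu> (\<lambda>x. kernel_op (Q n) f x - f x) - 0) < e"
    by (intro exI[of _ N]) (simp add: Lp_norm_nonneg)
qed

lemma converges_scale: "converges f \<Longrightarrow> converges (\<lambda>x. c * f x)"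
proof -
  assume f: "converges f"
  then have fL: "f \<in> Lp_space 1 \<mu>" by (simp add: converges_def)
  have "Lp_norm 1 \<mu> (\<lambda>x. kernel_op (Q n) (\<lambda>y. c * f y) x - c * f x)
      = norm c * Lp_norm 1 \<mu> (\<lambda>x. kernel_op (Q n) f x - f x)" for n
  proof -
    interpret symmetric_kernel \<mu> "Q n" by (rule kernel)
    show ?thesis
      using Lp_norm_scale[OF order_refl Lp_space_diff[OF order_refl T_Lp(1)[OF order_refl fL] fL], of c]
      by (simp add: T_scale right_diff_distrib)
  qed
  then show ?thesis
    using f fL tendsto_mult_left[of "\<lambda>n. Lp_norm 1 \<mu> (\<lambda>x. kernel_op (Q n) f x - f x)" 0 sequentially "norm c"]
    by (simp add: converges_def Lp_space_scale)
qed

lemma converges_add: "converges f \<Longrightarrow> converges g \<Longrightarrow> converges (\<lambda>x. f x + g x)"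
proof -
  assume f: "converges f" and g: "converges g"
  then have fL: "f \<in> Lp_space 1 \<mu>" and gL: "g \<in> Lp_space 1 \<mu>" by (simp_all add: converges_def)
  have le: "Lp_norm 1 \<mu> (\<lambda>x. kernel_op (Q n) (\<lambda>y. f y + g y) x - (f x + g x))
      \<le> Lp_norm 1 \<mu> (\<lambda>x. kernel_op (Q n) f x - f x) + Lp_norm 1 \<mu> (\<lambda>x. kernel_op (Q n) g x - g x)" for n
  proof -
    interpret symmetric_kernel \<mu> "Q n" by (rule kernel)
    note a = Lp_space_diff[OF order_refl T_Lp(1)[OF order_refl fL] fL]
      Lp_space_diff[OF order_refl T_Lp(1)[OF order_refl gL] gL]
    note [measurable] = Lp_space_measurable[OF fL] Lp_space_measurable[OF gL]
    have "Lp_norm 1 \<mu> (\<lambda>x. T (\<lambda>y. f y + g y) x - (f x + g x))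
        = Lp_norm 1 \<mu> (\<lambda>x. (T f x - f x) + (T g x - g x))"
      using T_add[OF order_refl fL gL]
      by (intro Lp_space_cong_AE(2)[OF order_refl] Lp_space_add[OF order_refl a]) (auto elim!: eventually_mono)
    then show ?thesis using Lp_norm_triangle[OF order_refl a] by simp
  qed
  have lim: "(\<lambda>n. Lp_norm 1 \<mu> (\<lambda>x. kernel_op (Q n) f x - f x) + Lp_norm 1 \<mu> (\<lambda>x. kernel_op (Q n) g x - g x)) \<longlonglongrightarrow> 0"
    by (rule tendsto_add_zero) (use f g in \<open>simp_all add: converges_def\<close>)
  have "(\<lambda>n. Lp_norm 1 \<mu> (\<lambda>x. kernel_op (Q n) (\<lambda>y. f y + g y) x - (f x + g x))) \<longlonglongrightarrow> 0"
    by (rule tendsto_zero_squeeze[OF lim Lp_norm_nonneg le])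
  then show ?thesis using Lp_space_add[OF order_refl fL gL] by (simp add: converges_def)
qed

text \<open>Tent functions of the distance to \<open>C\<close> tend to the indicator of
  \<open>C\<close> and are dominated by the indicator of a compact neighbourhood, hence approximate
  it in \<open>L^1\<close>.\<close>

lemma converges_compact:
  assumes C: "compact C"
  shows "converges (indicator C)"
proof (cases "C = {}")
  case True
  have "converges (\<lambda>x. complex_of_real 0)"
    by (rule converges_continuous) auto
  then show ?thesis using True by (simp add: indicator_def[abs_def])
next
  case False
  have cl: "closed C" using C by (rule compact_imp_closed)
  have Cb: "C \<in> sets \<mu>" using cl by (simp add: sets_mu)
  have Cfin: "emeasure \<mu> C < \<infinity>" using radon C by (simp add: radon_measure_def)
  obtain C' where C': "compact C'" "C \<subseteq> interior C'"
    by (rule compact_neighbourhood[OF lc C])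
  obtain d where d: "0 < d" "\<And>x. infdist x C < d \<Longrightarrow> x \<in> interior C'"
    by (rule compact_infdist_subset[OF C False open_interior C'(2)]) (rule that)
  \<comment> \<open>With \<open>m > 1 / d\<close> every \<open>\<phi> n\<close>, from
    \<open>n = 0\<close> on, vanishes at distance \<open>d\<close> or more from \<open>C\<close>,
    hence outside \<open>C'\<close>.\<close>
  obtain m :: nat where m: "1 / d < real m" using reals_Archimedean2 by blast
  define \<phi> where "\<phi> n x = max 0 (1 - real (n + m) * infdist x C)" for n x
  have cont: "continuous_on UNIV (\<phi> n)" for n unfolding \<phi>_def by (intro continuous_intros)
  have [measurable]: "\<phi> n \<in> borel_measurable \<mu>" for n
    unfolding measurable_mu by (rule borel_measurable_continuous_onI[OF cont])
  have \<phi>1: "0 \<le> \<phi> n x" "\<phi> n x \<le> 1" for n x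
    using infdist_nonneg[of x C] by (auto simp: \<phi>_def)
  have \<phi>C': "\<phi> n x \<le> indicator C' x" for n x
  proof (cases "infdist x C < d")
    case True
    then have "x \<in> C'" using d(2) interior_subset by blast
    then show ?thesis using \<phi>1 by simp
  next
    case False
    have "1 \<le> real m * d" using m d(1) by (simp add: field_simps)
    also have "\<dots> \<le> real (n + m) * infdist x C" using False d(1) by (intro mult_mono) auto
    finally show ?thesis by (simp add: \<phi>_def)
  qed
  have C'i: "integrable \<mu> (indicator C' :: 'a \<Rightarrow> real)"
    using C' radon by (intro integrable_real_indicator) (auto simp: sets_mu radon_measure_def borel_compact)
  have \<phi>i: "integrable \<mu> (\<phi> n)" for n
    by (rule Bochner_Integration.integrable_bound[OF C'i]) (use \<phi>1 \<phi>C' in auto)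
  have Ci: "integrable \<mu> (indicator C :: 'a \<Rightarrow> real)"
    using Cb Cfin by (rule integrable_real_indicator)
  have "(\<lambda>n. LINT x|\<mu>. norm (indicator C x - \<phi> n x)) \<longlonglongrightarrow> (LINT x|\<mu>. 0)"
  proof (rule integral_dominated_convergence[where w="\<lambda>x. indicator C x + indicator C' x"])
    show "AE x in \<mu>. (\<lambda>n. norm (indicator C x - \<phi> n x)) \<longlonglongrightarrow> 0"
    proof (rule AE_I2)
      fix x
      have "(\<lambda>n. \<phi> n x) \<longlonglongrightarrow> indicator C x"
        unfolding \<phi>_def by (rule LIMSEQ_ignore_initial_segment[OF infdist_indicator_tendsto[OF cl False]])
      then have "(\<lambda>n. norm (indicator C x - \<phi> n x)) \<longlonglongrightarrow> norm (indicator C x - indicator C x :: real)"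
        by (intro tendsto_intros)
      then show "(\<lambda>n. norm (indicator C x - \<phi> n x)) \<longlonglongrightarrow> 0" by simp
    qed
    show "AE x in \<mu>. norm (norm (indicator C x - \<phi> n x)) \<le> indicator C x + indicator C' x" for n
    proof (rule AE_I2)
      fix x
      have "norm (indicator C x - \<phi> n x) \<le> norm (indicator C x :: real) + norm (\<phi> n x)" by (rule norm_triangle_ineq4)
      also have "\<dots> \<le> indicator C x + indicator C' x" using \<phi>1[of n x] \<phi>C'[of n x] by simp
      finally show "norm (norm (indicator C x - \<phi> n x)) \<le> indicator C x + indicator C' x" by simp
    qed
  qed (use Ci C'i Cb in \<open>auto intro: borel_measurable_integrable\<close>)
  then have lim: "(\<lambda>n. LINT x|\<mu>. norm (indicator C x - \<phi> n x)) \<longlonglongrightarrow> 0" by simp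
  show ?thesis
  proof (rule converges_approx)
    show "indicator C \<in> Lp_space 1 \<mu>" by (rule indicator_L1[OF Cb Cfin])
    fix e :: real assume "0 < e"
    then obtain n where n: "(LINT x|\<mu>. norm (indicator C x - \<phi> n x)) < e"
      using order_tendstoD(2)[OF lim, of e] by (auto simp: eventually_sequentially)
    have "norm (indicator C x - complex_of_real (\<phi> n x)) = norm (indicator C x - \<phi> n x)" for x
    proof -
      have "indicator C x - complex_of_real (\<phi> n x) = complex_of_real (indicator C x - \<phi> n x)"
        by (simp add: indicator_def)
      then show ?thesis by (simp only: norm_of_real real_norm_def)
    qed
    then have "Lp_norm 1 \<mu> (\<lambda>x. indicator C x - complex_of_real (\<phi> n x)) \<le> e"
      using n by (simp add: Lp_norm_1)
    with converges_continuous[OF cont \<phi>1 \<phi>i]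
    show "\<exists>g. converges g \<and> Lp_norm 1 \<mu> (\<lambda>x. indicator C x - g x) \<le> e" by blast
  qed
qed

text \<open>Inner regularity supplies a compact subset that misses at most measure
  \<open>e\<close>.\<close>

lemma converges_set:
  assumes A: "A \<in> sets \<mu>" "emeasure \<mu> A < \<infinity>"
  shows "converges (indicator A)"
proof (rule converges_approx)
  show "indicator A \<in> Lp_space 1 \<mu>" by (rule indicator_L1[OF A])
  fix e :: real assume e: "0 < e"
  have A': "A \<in> sets borel" using A by (simp add: sets_mu)
  obtain C where C: "compact C" "C \<subseteq> A" "measure \<mu> (A - C) \<le> e"
  proof -
    have sup: "emeasure \<mu> A = (SUP K\<in>{K. compact K \<and> K \<subseteq> A \<and> K \<in> sets borel}. emeasure \<mu> K)"
      using radon A' by (simp add: radon_measure_def)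
    have "\<exists>C. compact C \<and> C \<subseteq> A \<and> emeasure \<mu> A \<le> emeasure \<mu> C + ennreal e"
    proof (cases "emeasure \<mu> A = 0")
      case True
      then show ?thesis by (intro exI[of _ "{}"]) auto
    next
      case False
      have "emeasure \<mu> A - ennreal e < emeasure \<mu> A"
        using False A(2) e by (intro ennreal_between) (auto simp: zero_less_iff_neq_zero)
      then obtain C where C: "compact C" "C \<subseteq> A" "emeasure \<mu> A - ennreal e < emeasure \<mu> C"
        unfolding sup less_SUP_iff by auto
      from less_imp_le[OF C(3)] have "emeasure \<mu> A \<le> emeasure \<mu> C + ennreal e"
        by (simp add: ennreal_minus_le_iff add.commute)
      with C show ?thesis by blast
    qed
    then obtain C where C: "compact C" "C \<subseteq> A" "emeasure \<mu> A \<le> emeasure \<mu> C + ennreal e" by blast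
    have Cb: "C \<in> sets \<mu>" using C(1) by (simp add: sets_mu borel_compact)
    have Cf: "emeasure \<mu> C \<noteq> \<infinity>" using emeasure_mono[OF C(2) A(1)] A(2) by (auto simp: top_unique)
    have "emeasure \<mu> (A - C) = emeasure \<mu> A - emeasure \<mu> C"
      using Cf A Cb C(2) by (intro emeasure_Diff) auto
    also have "\<dots> \<le> ennreal e" using C(3) Cf by (simp add: ennreal_minus_le_iff)
    finally have "measure \<mu> (A - C) \<le> e" using e by (simp add: measure_def enn2real_leI)
    with C show ?thesis by (intro that) auto
  qed
  have D: "A - C \<in> sets \<mu>" by (intro sets.Diff A) (use C(1) in \<open>simp add: sets_mu borel_compact\<close>)
  have "Lp_norm 1 \<mu> (\<lambda>x. indicator A x - indicator C x) = (LINT x|\<mu>. indicator (A - C) x)"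
    unfolding Lp_norm_1 using C(2) by (intro Bochner_Integration.integral_cong) (auto simp: indicator_def)
  also have "\<dots> = measure \<mu> (A - C)" using D by (simp add: space_mu)
  finally show "\<exists>g. converges g \<and> Lp_norm 1 \<mu> (\<lambda>x. indicator A x - g x) \<le> e"
    using converges_compact[OF C(1)] C(3) by auto
qed

lemma converges_L1:
  assumes "f \<in> Lp_space 1 \<mu>"
  shows "converges f"
proof -
  from assms have "integrable \<mu> f" by (simp add: Lp_space_1_iff)
  then show ?thesis
  proof (induct rule: integrable_induct)
    case (base A c)
    have "(\<lambda>x. indicator A x *\<^sub>R c) = (\<lambda>x. c * indicator A x)" by (auto simp: indicator_def)
    with converges_scale[OF converges_set[OF base(1)], of c] base(2) show ?case by simp
  next
    case (add f g)
    then show ?case by (intro converges_add)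
  next
    case (lim f s)
    note [measurable] = borel_measurable_integrable[OF lim(1)] borel_measurable_integrable[OF lim(5)]
    have "(\<lambda>n. LINT x|\<mu>. norm (f x - s n x)) \<longlonglongrightarrow> (LINT x|\<mu>. 0)"
    proof (rule integral_dominated_convergence[where w="\<lambda>x. 3 * norm (f x)"])
      show "AE x in \<mu>. (\<lambda>n. norm (f x - s n x)) \<longlonglongrightarrow> 0"
      proof (rule AE_I2)
        fix x assume x: "x \<in> space \<mu>"
        have "(\<lambda>n. norm (f x - s n x)) \<longlonglongrightarrow> norm (f x - f x)"
          using lim(3)[OF x] by (intro tendsto_intros)
        then show "(\<lambda>n. norm (f x - s n x)) \<longlonglongrightarrow> 0" by simp
      qed
      show "AE x in \<mu>. norm (norm (f x - s n x)) \<le> 3 * norm (f x)" for n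
      proof (rule AE_I2)
        fix x assume x: "x \<in> space \<mu>"
        have "norm (f x - s n x) \<le> norm (f x) + norm (s n x)" by (rule norm_triangle_ineq4)
        also have "norm (s n x) \<le> 2 * norm (f x)" by (rule lim(4)[OF x])
        finally show "norm (norm (f x - s n x)) \<le> 3 * norm (f x)" by simp
      qed
    qed (use lim(5) in auto)
    then have l: "(\<lambda>n. LINT x|\<mu>. norm (f x - s n x)) \<longlonglongrightarrow> 0" by simp
    show ?case
    proof (rule converges_approx)
      show "f \<in> Lp_space 1 \<mu>" using lim(5) by (simp add: Lp_space_1_iff)
      fix e :: real assume "0 < e"
      then obtain n where "(LINT x|\<mu>. norm (f x - s n x)) < e"
        using order_tendstoD(2)[OF l, of e] by (auto simp: eventually_sequentially)
      then show "\<exists>g. converges g \<and> Lp_norm 1 \<mu> (\<lambda>x. f x - g x) \<le> e"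
        using lim(2)[of n] by (intro exI[of _ "s n"]) (simp add: Lp_norm_1)
    qed
  qed
qed

text \<open>The differences \<open>d n\<close> are bounded uniformly by \<open>C\<close>, so
  \<open>norm (d n x) powr r \<le> C powr (r - 1) * norm (d n x)\<close> lifts convergence from
  \<open>L^1\<close> to \<open>L^p\<close>.\<close>

lemma converges_test:
  assumes p: "1 \<le> p" "p \<noteq> top" and f: "f \<in> L1_Linfty \<mu>"
  shows "(\<lambda>n. Lp_norm p \<mu> (\<lambda>x. kernel_op (Q n) f x - f x)) \<longlonglongrightarrow> 0"
proof -
  define r where "r = enn2real p"
  have r: "1 \<le> r" using enn2real_ge_1[OF p(1)] p(2) by (simp add: r_def)
  have f1: "f \<in> Lp_space 1 \<mu>" and fi: "f \<in> Lp_space top \<mu>" using f by (auto simp: L1_Linfty_def)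
  define C where "C = 2 * Lp_norm top \<mu> f"
  have C: "0 \<le> C" by (simp add: C_def Lp_norm_nonneg)
  define d where "d n x = kernel_op (Q n) f x - f x" for n x
  have dY: "d n \<in> L1_Linfty \<mu>" for n
  proof -
    interpret symmetric_kernel \<mu> "Q n" by (rule kernel)
    show ?thesis unfolding d_def[abs_def] by (intro L1_Linfty_diff T_test f)
  qed
  have dC: "AE x in \<mu>. norm (d n x) \<le> C" for n
  proof -
    interpret symmetric_kernel \<mu> "Q n" by (rule kernel)
    have "AE x in \<mu>. norm (T f x) \<le> Lp_norm top \<mu> f"
      using Lp_norm_infinity_AE[OF T_Lp(1)[OF _ fi]] T_Lp(2)[OF _ fi] by (auto elim!: eventually_mono)
    then show ?thesis using Lp_norm_infinity_AE[OF fi]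
    proof eventually_elim
      case (elim x)
      then show ?case unfolding d_def C_def using norm_triangle_ineq4[of "T f x" "f x"] by linarith
    qed
  qed
  have lim1: "(\<lambda>n. Lp_norm 1 \<mu> (d n)) \<longlonglongrightarrow> 0"
    using converges_L1[OF f1] by (simp add: converges_def d_def[abs_def])
  have bound: "(LINT x|\<mu>. norm (d n x) powr r) \<le> C powr (r - 1) * Lp_norm 1 \<mu> (d n)" for n
  proof -
    have i1: "integrable \<mu> (\<lambda>x. norm (d n x) powr r)"
      using L1_Linfty_subset_Lp[OF p(1) dY[of n]] p(2) by (simp add: Lp_space_finite_iff r_def)
    have i2: "integrable \<mu> (\<lambda>x. C powr (r - 1) * norm (d n x))"
      using dY[of n] by (auto simp: L1_Linfty_iff)
    have "(LINT x|\<mu>. norm (d n x) powr r) \<le> (LINT x|\<mu>. C powr (r - 1) * norm (d n x))"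
    proof (rule integral_mono_AE[OF i1 i2])
      show "AE x in \<mu>. norm (d n x) powr r \<le> C powr (r - 1) * norm (d n x)"
        using dC[of n]
      proof eventually_elim
        case (elim x)
        have "norm (d n x) powr r = norm (d n x) powr (r - 1) * norm (d n x)"
          by (cases "d n x = 0") (simp_all add: powr_diff)
        also have "\<dots> \<le> C powr (r - 1) * norm (d n x)"
          using elim r by (intro mult_right_mono powr_mono2) auto
        finally show ?case .
      qed
    qed
    then show ?thesis by (simp add: Lp_norm_1)
  qed
  have "(\<lambda>n. C powr (r - 1) * Lp_norm 1 \<mu> (d n)) \<longlonglongrightarrow> 0"
    using tendsto_mult_left[OF lim1] by simp
  then have "(\<lambda>n. LINT x|\<mu>. norm (d n x) powr r) \<longlonglongrightarrow> 0"
    by (rule tendsto_zero_squeeze) (auto simp: bound)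
  then have "(\<lambda>n. (LINT x|\<mu>. norm (d n x) powr r) powr (1/r)) \<longlonglongrightarrow> 0 powr (1/r)"
    using r by (intro tendsto_powr' tendsto_const) (auto simp: integral_nonneg)
  then show ?thesis using p r by (simp add: Lp_norm_def r_def d_def)
qed

text \<open>Values of \<open>f\<close> are cut off from above for boundedness and from below for
  integrability: where \<open>norm (f x)\<close> is at least \<open>1 / (n + 1)\<close>, it is at
  most \<open>(n + 1) powr (r - 1) * norm (f x) powr r\<close>.\<close>

lemma L1_Linfty_dense:
  assumes p: "1 \<le> p" "p \<noteq> top" and f: "f \<in> Lp_space p \<mu>" and e: "0 < e"
  obtains g where "g \<in> L1_Linfty \<mu>" "Lp_norm p \<mu> (\<lambda>x. f x - g x) < e"
proof -
  define r where "r = enn2real p"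
  have r: "1 \<le> r" using enn2real_ge_1[OF p(1)] p(2) by (simp add: r_def)
  have [measurable]: "f \<in> borel_measurable \<mu>" and fi: "integrable \<mu> (\<lambda>x. norm (f x) powr r)"
    using f p by (auto simp: Lp_space_finite_iff r_def)
  define g where "g n x = (if inverse (real (Suc n)) \<le> norm (f x) \<and> norm (f x) \<le> real (Suc n) then f x else 0)" for n x
  have [measurable]: "g n \<in> borel_measurable \<mu>" for n unfolding g_def[abs_def] by measurable
  have gY: "g n \<in> L1_Linfty \<mu>" for n
  proof -
    have i: "integrable \<mu> (\<lambda>x. real (Suc n) powr (r - 1) * norm (f x) powr r)" using fi by simp
    have "integrable \<mu> (g n)"
    proof (rule Bochner_Integration.integrable_bound[OF i])
      show "AE x in \<mu>. norm (g n x) \<le> norm (real (Suc n) powr (r - 1) * norm (f x) powr r)"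
      proof (rule AE_I2)
        fix x
        show "norm (g n x) \<le> norm (real (Suc n) powr (r - 1) * norm (f x) powr r)"
        proof (cases "inverse (real (Suc n)) \<le> norm (f x)")
          case True
          then have pos: "0 < norm (f x)" by (rule less_le_trans[rotated]) simp
          have "1 \<le> real (Suc n) * norm (f x)" using True by (simp add: field_simps)
          then have "1 \<le> (real (Suc n) * norm (f x)) powr (r - 1)" using r by (intro ge_one_powr_ge_zero) auto
          then have "norm (f x) * 1 \<le> norm (f x) * (real (Suc n) * norm (f x)) powr (r - 1)"
            by (intro mult_left_mono) auto
          also have "\<dots> = real (Suc n) powr (r - 1) * norm (f x) powr r"
            using pos by (simp add: powr_mult powr_diff del: of_nat_Suc)
          finally show ?thesis by (simp add: g_def)
        qed (simp add: g_def)
      qed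
    qed measurable
    moreover have "norm (g n x) \<le> real (Suc n)" for x by (simp add: g_def)
    ultimately show ?thesis by (auto simp: L1_Linfty_iff intro!: exI[of _ "real (Suc n)"])
  qed
  have "(\<lambda>n. LINT x|\<mu>. norm (f x - g n x) powr r) \<longlonglongrightarrow> (LINT x|\<mu>. 0)"
  proof (rule integral_dominated_convergence[where w="\<lambda>x. norm (f x) powr r"])
    show "AE x in \<mu>. (\<lambda>n. norm (f x - g n x) powr r) \<longlonglongrightarrow> 0"
    proof (rule AE_I2)
      fix x
      have "eventually (\<lambda>n. norm (f x - g n x) powr r = 0) sequentially"
      proof (cases "f x = 0")
        case True
        then show ?thesis by (simp add: g_def)
      next
        case False
        obtain n1 :: nat where n1: "norm (f x) < real n1" using reals_Archimedean2 by blast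
        obtain n2 where n2: "inverse (real (Suc n2)) < norm (f x)" using False reals_Archimedean[of "norm (f x)"] by auto
        have "g n x = f x" if "n \<ge> max n1 n2" for n
        proof -
          have "inverse (real (Suc n)) \<le> inverse (real (Suc n2))" using that by (intro le_imp_inverse_le) auto
          moreover have "real n1 \<le> real (Suc n)" using that by simp
          ultimately have "inverse (real (Suc n)) \<le> norm (f x)" "norm (f x) \<le> real (Suc n)"
            using n1 n2 by linarith+
          then show ?thesis by (simp add: g_def)
        qed
        then show ?thesis by (auto simp: eventually_sequentially intro!: exI[of _ "max n1 n2"])
      qed
      then show "(\<lambda>n. norm (f x - g n x) powr r) \<longlonglongrightarrow> 0" by (rule tendsto_eventually)
    qed
    show "AE x in \<mu>. norm (norm (f x - g n x) powr r) \<le> norm (f x) powr r" for n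
      using r by (intro AE_I2) (auto simp: g_def)
  qed (use fi in auto)
  then have "(\<lambda>n. (LINT x|\<mu>. norm (f x - g n x) powr r) powr (1/r)) \<longlonglongrightarrow> 0 powr (1/r)"
    using r by (intro tendsto_powr' tendsto_const) (auto simp: integral_nonneg)
  then have "(\<lambda>n. Lp_norm p \<mu> (\<lambda>x. f x - g n x)) \<longlonglongrightarrow> 0" using p r by (simp add: Lp_norm_def r_def)
  from order_tendstoD(2)[OF this e] obtain n where "Lp_norm p \<mu> (\<lambda>x. f x - g n x) < e"
    by (auto simp: eventually_sequentially)
  with gY[of n] show thesis by (rule that)
qed

theorem strong_convergence:
  assumes p: "1 \<le> p" "p \<noteq> top" and f: "f \<in> Lp_space p \<mu>"
  shows "(\<lambda>n. Lp_norm p \<mu> (\<lambda>x. kernel_op (Q n) f x - f x)) \<longlonglongrightarrow> 0"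
proof (rule LIMSEQ_I)
  fix e :: real assume e: "0 < e"
  then have "0 < e/4" by simp
  obtain g where gY: "g \<in> L1_Linfty \<mu>" and fg: "Lp_norm p \<mu> (\<lambda>x. f x - g x) < e/4"
    by (rule L1_Linfty_dense[OF p f \<open>0 < e/4\<close>])
  have gL: "g \<in> Lp_space p \<mu>" by (rule L1_Linfty_subset_Lp[OF p(1) gY])
  from order_tendstoD(2)[OF converges_test[OF p gY] \<open>0 < e/4\<close>]
  obtain N where N: "\<And>n. n \<ge> N \<Longrightarrow> Lp_norm p \<mu> (\<lambda>x. kernel_op (Q n) g x - g x) < e/4"
    by (auto simp: eventually_sequentially)
  have "Lp_norm p \<mu> (\<lambda>x. kernel_op (Q n) f x - f x) < e" if n: "n \<ge> N" for n
  proof -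
    interpret symmetric_kernel \<mu> "Q n" by (rule kernel)
    have Tf: "T f \<in> Lp_space p \<mu>" and Tg: "T g \<in> Lp_space p \<mu>" by (intro T_Lp f gL p)+
    have "Lp_norm p \<mu> (\<lambda>x. T f x - f x) \<le> Lp_norm p \<mu> (\<lambda>x. T f x - T g x) + Lp_norm p \<mu> (\<lambda>x. T g x - f x)"
      by (rule Lp_norm_diff_triangle[OF p(1) Tf Tg f])
    also have "Lp_norm p \<mu> (\<lambda>x. T g x - f x) \<le> Lp_norm p \<mu> (\<lambda>x. T g x - g x) + Lp_norm p \<mu> (\<lambda>x. g x - f x)"
      by (rule Lp_norm_diff_triangle[OF p(1) Tg gL f])
    also have "Lp_norm p \<mu> (\<lambda>x. T f x - T g x) \<le> Lp_norm p \<mu> (\<lambda>x. f x - g x)"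
      by (rule T_diff_Lp_norm[OF p(1) f gL])
    finally show ?thesis
      using N[OF n] fg Lp_norm_minus_commute[of p \<mu> g f] e by simp
  qed
  then show "\<exists>N. \<forall>n\<ge>N. norm (Lp_norm p \<mu> (\<lambda>x. kernel_op (Q n) f x - f x) - 0) < e"
    by (intro exI[of _ N]) (simp add: Lp_norm_nonneg)
qed

end

section \<open>Time mixtures and the resolvent kernel\<close>

context hunt_process
begin

text \<open>\<open>extend_zero \<phi>\<close> need not be continuous at the cemetery; there
  persistence of death replaces right continuity.\<close>

lemma path_right_continuous:
  fixes \<phi> :: "'a \<Rightarrow> real"
  assumes \<omega>: "\<omega> \<in> space M" and c: "continuous_on UNIV \<phi>"
    and u: "\<And>n::nat. s \<le> u n" "u \<longlonglongrightarrow> s"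
  shows "(\<lambda>n. extend_zero \<phi> (X (ennreal (u n)) \<omega>)) \<longlonglongrightarrow> extend_zero \<phi> (X (ennreal s) \<omega>)"
proof (cases "X (ennreal s) \<omega>")
  case None
  have "X (ennreal (u n)) \<omega> = None" for n
    using X_alive_antimono[OF \<omega> ennreal_leI[OF u(1)]] None by blast
  then show ?thesis by (simp add: None)
next
  case (Some y)
  show ?thesis
  proof (rule LIMSEQ_I)
    fix e :: real assume e: "0 < e"
    define V where "V = {z. \<bar>\<phi> z - \<phi> y\<bar> < e}"
    have V: "open V" unfolding V_def using c by (intro open_Collect_less continuous_intros)
    have "X (ennreal s) \<omega> \<in> Some ` V" using Some e by (simp add: V_def)
    then obtain b where b: "ennreal s < b" "\<And>q. ennreal s \<le> q \<Longrightarrow> q < b \<Longrightarrow> X q \<omega> \<in> Some ` V"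
      using right_continuous_open[OF \<omega> ennreal_less_top openin_cemetery_Some[OF V]] by blast
    have "(\<lambda>n. ennreal (u n)) \<longlonglongrightarrow> ennreal s" using u(2) by (rule tendsto_ennrealI)
    from order_tendstoD(2)[OF this b(1)] obtain N where N: "\<And>n. n \<ge> N \<Longrightarrow> ennreal (u n) < b"
      by (auto simp: eventually_sequentially)
    have "norm (extend_zero \<phi> (X (ennreal (u n)) \<omega>) - extend_zero \<phi> (X (ennreal s) \<omega>)) < e" if "n \<ge> N" for n
      using b(2)[OF ennreal_leI[OF u(1)] N[OF that]] Some by (auto simp: V_def)
    then show "\<exists>N. \<forall>n\<ge>N. norm (extend_zero \<phi> (X (ennreal (u n)) \<omega>) - extend_zero \<phi> (X (ennreal s) \<omega>)) < e"
      by blast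
  qed
qed

lemma integral_K: 
  fixes \<phi> :: "'a \<Rightarrow> real"
  assumes [measurable]: "\<phi> \<in> borel_measurable borel"
  shows "(LINT y|K t x. \<phi> y) = (LINT \<omega>|P (Some x). extend_zero \<phi> (X (ennreal t) \<omega>))"
proof -
  have "(LINT y|K t x. \<phi> y) = (LINT \<omega>|P (Some x). indicator {\<omega> \<in> space M. X (ennreal t) \<omega> \<noteq> None} \<omega> *\<^sub>R \<phi> (the (X (ennreal t) \<omega>)))"
    unfolding transition_kernel_def
    by (subst integral_distr) (auto simp: integral_restrict_space alive_sets_Int)
  also have "\<dots> = (LINT \<omega>|P (Some x). extend_zero \<phi> (X (ennreal t) \<omega>))"
    by (intro Bochner_Integration.integral_cong) (auto simp: extend_zero_def indicator_def split: option.splits)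
  finally show ?thesis .
qed

lemma integral_K_right_continuous:
  fixes \<phi> :: "'a \<Rightarrow> real"
  assumes c: "continuous_on UNIV \<phi>" and \<phi>: "\<And>y. 0 \<le> \<phi> y" "\<And>y. \<phi> y \<le> 1"
    and u: "\<And>n::nat. s \<le> u n" "u \<longlonglongrightarrow> s"
  shows "(\<lambda>n. LINT y|K (u n) x. \<phi> y) \<longlonglongrightarrow> (LINT y|K s x. \<phi> y)"
proof -
  interpret Px: prob_space "P (Some x)" by (rule prob_space_P)
  have [measurable]: "\<phi> \<in> borel_measurable borel" using c by (rule borel_measurable_continuous_onI)
  have m [measurable]: "(\<lambda>\<omega>. extend_zero \<phi> (X t \<omega>)) \<in> borel_measurable (P (Some x))" for t
    by (rule measurable_compose[OF X_measurable_P extend_zero_measurable]) simp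
  have b: "norm (extend_zero \<phi> y) \<le> 1" for y using \<phi> by (auto simp: extend_zero_def split: option.splits)
  show ?thesis
    unfolding integral_K[OF \<open>\<phi> \<in> borel_measurable borel\<close>]
  proof (rule integral_dominated_convergence[where w="\<lambda>_. 1"])
    show "AE \<omega> in P (Some x). (\<lambda>n. extend_zero \<phi> (X (ennreal (u n)) \<omega>)) \<longlonglongrightarrow> extend_zero \<phi> (X (ennreal s) \<omega>)"
      by (rule AE_I2) (simp add: path_right_continuous[OF _ c u])
  qed (use m b in auto)
qed

text \<open>Right-continuity in time gives joint measurability, by approximating the time from above
  by multiples of \<open>1 / n\<close>.\<close>

lemma K_jointly_measurable: "(\<lambda>(x, s). K s x) \<in> borel \<Otimes>\<^sub>M borel \<rightarrow>\<^sub>M subprob_algebra borel"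
proof -
  have cont: "(\<lambda>z. LINT y|K (snd z) (fst z). \<phi> y) \<in> borel_measurable (borel \<Otimes>\<^sub>M borel)"
    if c: "continuous_on UNIV \<phi>" and \<phi>: "\<And>y. 0 \<le> \<phi> y" "\<And>y. \<phi> y \<le> 1" for \<phi> :: "'a \<Rightarrow> real"
  proof -
    have [measurable]: "\<phi> \<in> borel_measurable borel" using c by (rule borel_measurable_continuous_onI)
    \<comment> \<open>Rounding up to a multiple of \<open>1 / (n + 1)\<close> keeps the
      approximating times above \<open>s\<close>, the side from which paths are continuous.\<close>
    define u where "u n s = (of_int \<lfloor>real (Suc n) * s\<rfloor> + 1) / real (Suc n)" for n and s :: real
    have us: "s \<le> u n s" "u n s \<le> s + inverse (real (Suc n))" for n s
    proof -
      have "real (Suc n) * s \<le> of_int \<lfloor>real (Suc n) * s\<rfloor> + 1" by linarith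
      then show "s \<le> u n s" by (simp add: u_def pos_le_divide_eq mult.commute del: of_nat_Suc)
      have "u n s \<le> (real (Suc n) * s + 1) / real (Suc n)"
        unfolding u_def by (intro divide_right_mono add_mono) auto
      also have "\<dots> = s + inverse (real (Suc n))" by (simp add: field_simps del: of_nat_Suc)
      finally show "u n s \<le> s + inverse (real (Suc n))" .
    qed
    have ul: "(\<lambda>n. u n s) \<longlonglongrightarrow> s" for s
    proof (rule real_tendsto_sandwich[OF _ _ tendsto_const])
      show "eventually (\<lambda>n. s \<le> u n s) sequentially" using us(1) by simp
      show "eventually (\<lambda>n. u n s \<le> s + inverse (real (Suc n))) sequentially" using us(2) by simp
      show "(\<lambda>n. s + inverse (real (Suc n))) \<longlonglongrightarrow> s"
        using tendsto_add[OF tendsto_const LIMSEQ_inverse_real_of_nat, of s] by simp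
    qed
    have fix_time: "(\<lambda>x. LINT y|K t x. \<phi> y) \<in> borel_measurable borel" for t
      by (rule measurable_compose[OF K_measurable integral_measurable_subprob_algebra]) simp
    have step: "(\<lambda>z. LINT y|K (u n (snd z)) (fst z). \<phi> y) \<in> borel_measurable (borel \<Otimes>\<^sub>M borel)" for n
    proof -
      have "(\<lambda>z. (\<lambda>i z. LINT y|K ((of_int i + 1) / real (Suc n)) (fst z). \<phi> y) \<lfloor>real (Suc n) * snd z\<rfloor> z)
          \<in> borel_measurable (borel \<Otimes>\<^sub>M borel)"
      proof (rule measurable_compose_countable[where f="\<lambda>i z. LINT y|K ((of_int i + 1) / real (Suc n)) (fst z). \<phi> y"])
        show "(\<lambda>z. LINT y|K ((of_int i + 1) / real (Suc n)) (fst z). \<phi> y) \<in> borel_measurable (borel \<Otimes>\<^sub>M borel)" for i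
          by (rule measurable_compose[OF measurable_fst fix_time])
        show "(\<lambda>z. \<lfloor>real (Suc n) * snd z\<rfloor>) \<in> borel \<Otimes>\<^sub>M borel \<rightarrow>\<^sub>M count_space UNIV" by measurable
      qed
      then show ?thesis by (simp add: u_def)
    qed
    show ?thesis
    proof (rule borel_measurable_LIMSEQ_metric[OF step])
      fix z :: "'a \<times> real"
      show "(\<lambda>n. LINT y|K (u n (snd z)) (fst z). \<phi> y) \<longlonglongrightarrow> (LINT y|K (snd z) (fst z). \<phi> y)"
        by (rule integral_K_right_continuous[OF c \<phi> us(1) ul])
    qed
  qed
  have em: "(\<lambda>z. emeasure (K (snd z) (fst z)) U) \<in> borel_measurable (borel \<Otimes>\<^sub>M borel)" if U: "open U" for U
  \<comment> \<open>The whole space is treated separately because \<open>infdist\<close> to the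
    empty complement is 0, which would make the functions \<open>\<phi> n\<close> below
    vanish.\<close>
  proof (cases "U = UNIV")
    case True
    have "emeasure (K t x) UNIV = ennreal (LINT y|K t x. 1)" for t x
    proof -
      interpret subprob_space "K t x" by (rule subprob_K)
      show ?thesis by (simp add: emeasure_eq_measure)
    qed
    then show ?thesis using cont[of "\<lambda>_. 1"] True by simp
  next
    case False
    \<comment> \<open>Continuous functions increasing to the indicator of \<open>U\<close>; by
      dominated convergence the measure of an open set inherits joint measurability, and open sets
      generate.\<close>
    define \<phi> where "\<phi> n y = 1 - max 0 (1 - real n * infdist y (- U))" for n y
    have c: "continuous_on UNIV (\<phi> n)" for n unfolding \<phi>_def by (intro continuous_intros)
    have \<phi>1: "0 \<le> \<phi> n y" "\<phi> n y \<le> 1" for n y using infdist_nonneg[of y "- U"] by (auto simp: \<phi>_def)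
    have lim: "(\<lambda>n. LINT y|K t x. \<phi> n y) \<longlonglongrightarrow> measure (K t x) U" for t x
    proof -
      interpret subprob_space "K t x" by (rule subprob_K)
      have "(\<lambda>n. LINT y|K t x. \<phi> n y) \<longlonglongrightarrow> (LINT y|K t x. indicator U y)"
      proof (rule integral_dominated_convergence[where w="\<lambda>_. 1"])
        show "AE y in K t x. (\<lambda>n. \<phi> n y) \<longlonglongrightarrow> indicator U y"
        proof (rule AE_I2)
          fix y
          have "(\<lambda>n. \<phi> n y) \<longlonglongrightarrow> 1 - indicator (- U) y"
            unfolding \<phi>_def using U False by (intro tendsto_intros infdist_indicator_tendsto) auto
          moreover have "1 - indicator (- U) y = (indicator U y :: real)" by (simp add: indicator_def)
          ultimately show "(\<lambda>n. \<phi> n y) \<longlonglongrightarrow> indicator U y" by simp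
        qed
        show "\<phi> n \<in> borel_measurable (K t x)" for n
          unfolding measurable_cong_sets[OF sets_K refl] by (rule borel_measurable_continuous_onI[OF c])
      qed (use \<phi>1 U in \<open>auto simp: measurable_cong_sets[OF sets_K refl]\<close>)
      then show ?thesis using U by simp
    qed
    have "(\<lambda>z. measure (K (snd z) (fst z)) U) \<in> borel_measurable (borel \<Otimes>\<^sub>M borel)"
      by (rule borel_measurable_LIMSEQ_metric[OF cont[OF c \<phi>1]]) (rule lim)
    then have "(\<lambda>z. ennreal (measure (K (snd z) (fst z)) U)) \<in> borel_measurable (borel \<Otimes>\<^sub>M borel)" by measurable
    moreover have "emeasure (K t x) U = ennreal (measure (K t x) U)" for t x
      using subprob_K by (simp add: finite_measure.emeasure_eq_measure subprob_space.axioms)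
    ultimately show ?thesis by simp
  qed
  show ?thesis
  proof (rule measurable_subprob_algebra_generated[where \<Omega>=UNIV and G="{S. open S}"])
    show "sets borel = sigma_sets UNIV {S. open S}" by (rule sets_borel)
    show "Int_stable {S. open S}" by (auto simp: Int_stable_def)
  qed (use em subprob_K in \<open>auto simp: case_prod_beta\<close>)
qed

lemma K_time_measurable: "(\<lambda>s. K s x) \<in> borel \<rightarrow>\<^sub>M subprob_algebra borel"
  using measurable_compose[OF measurable_Pair1' K_jointly_measurable, of x] by simp

text \<open>A time average of the semigroup under the law \<open>\<nu>\<close>. The resolvent and
  the short-time averages both have this form, so measurability and symmetry are settled
  once.\<close>

definition mixture :: "real measure \<Rightarrow> 'a \<Rightarrow> 'a measure" where
  "mixture \<nu> x = \<nu> \<bind> (\<lambda>s. K s x)"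

context
  fixes \<nu> :: "real measure"
  assumes \<nu>: "subprob_space \<nu>" "sets \<nu> = sets borel"
begin

lemma space_nu: "space \<nu> = UNIV"
  using sets_eq_imp_space_eq[OF \<nu>(2)] by simp

lemma K_time_measurable': "(\<lambda>s. K s x) \<in> \<nu> \<rightarrow>\<^sub>M subprob_algebra borel"
  unfolding measurable_cong_sets[OF \<nu>(2) refl] by (rule K_time_measurable)

lemma mixture_measurable: "mixture \<nu> \<in> borel \<rightarrow>\<^sub>M subprob_algebra borel"
  unfolding mixture_def[abs_def]
proof (rule measurable_bind'[where N=borel])
  show "(\<lambda>x. \<nu>) \<in> borel \<rightarrow>\<^sub>M subprob_algebra borel"
    using \<nu> by (intro measurable_const) (simp add: space_subprob_algebra)
  show "(\<lambda>(x, s). K s x) \<in> borel \<Otimes>\<^sub>M borel \<rightarrow>\<^sub>M subprob_algebra borel" by (rule K_jointly_measurable)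
qed

lemma nn_integral_mixture:
  assumes "f \<in> borel_measurable borel"
  shows "(\<integral>\<^sup>+y. f y \<partial>mixture \<nu> x) = (\<integral>\<^sup>+s. (\<integral>\<^sup>+y. f y \<partial>K s x) \<partial>\<nu>)"
  unfolding mixture_def by (rule nn_integral_bind[OF assms K_time_measurable'])

lemma kernel_op_mixture:
  assumes f: "f \<in> borel_measurable borel" and i: "(\<integral>\<^sup>+y. norm (f y) \<partial>mixture \<nu> x) < \<infinity>"
  shows "AE s in \<nu>. integrable (K s x) f"
    and "integrable \<nu> (\<lambda>s. kernel_op (K s) f x)"
    and "kernel_op (mixture \<nu>) f x = (LINT s|\<nu>. kernel_op (K s) f x)"
  using integral_bind_complex[OF K_time_measurable' f _ i[unfolded mixture_def]]
  by (auto simp: space_nu mixture_def kernel_op_def)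

end

end

text \<open>On \<open>{0..h}\<close> this is the weight of the resolvent divided by
  \<open>h\<close>, so that splitting the resolvent at time \<open>h\<close> produces exactly
  \<open>h\<close> times this average. The total mass \<open>(1 - exp (- h)) / h\<close> is at most
  1.\<close>

definition short_measure :: "real \<Rightarrow> real measure" where
  "short_measure h = density lborel (\<lambda>s. ennreal (indicator {0..h} s * (exp (- s) / h)))"

lemma short_measure_props:
  assumes h: "0 < h"
  shows "subprob_space (short_measure h)" "sets (short_measure h) = sets borel"
proof -
  show "subprob_space (short_measure h)"
  proof
    have "emeasure (short_measure h) (space (short_measure h)) = (\<integral>\<^sup>+s. ennreal (indicator {0..h} s * (exp (- s) / h)) \<partial>lborel)"
      by (simp add: short_measure_def emeasure_density)
    also have "\<dots> \<le> (\<integral>\<^sup>+s. ennreal (1 / h) * indicator {0..h} s \<partial>lborel)"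
      using h by (intro nn_integral_mono) (auto simp: indicator_def ennreal_leI divide_right_mono)
    also have "\<dots> = 1" using h by (subst nn_integral_cmult_indicator) (auto simp flip: ennreal_mult)
    finally show "emeasure (short_measure h) (space (short_measure h)) \<le> 1" .
  qed (simp add: short_measure_def)
  show "sets (short_measure h) = sets borel" by (simp add: short_measure_def)
qed

section \<open>Resolvent and short-time averages as symmetric kernels\<close>

context symmetric_hunt_process
begin

lemma K_neg: "s \<le> 0 \<Longrightarrow> K s x = K 0 x"
  by (simp add: transition_kernel_def ennreal_neg)

text \<open>Fubini over a law on all of \<open>real\<close> calls for symmetry at every
  \<open>s\<close>; \<open>ennreal\<close> reads negative times as 0.\<close>

lemma K_symmetric:
  assumes "f \<in> borel_measurable borel" "g \<in> borel_measurable borel"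
  shows "(\<integral>\<^sup>+x. (\<integral>\<^sup>+y. f y \<partial>K s x) * g x \<partial>\<mu>) = (\<integral>\<^sup>+x. f x * (\<integral>\<^sup>+y. g y \<partial>K s x) \<partial>\<mu>)"
proof -
  interpret symmetric_kernel \<mu> "K (max 0 s)" by (rule symmetric_kernel_K) simp
  have "K s x = K (max 0 s) x" for x using K_neg[of s] by (auto simp: max_def)
  then show ?thesis using Q_symmetric[of f g] assms by (simp add: measurable_mu)
qed

lemma symmetric_kernel_mixture:
  assumes \<nu>: "subprob_space \<nu>" "sets \<nu> = sets borel"
  shows "symmetric_kernel \<mu> (mixture \<nu>)"
proof -
  interpret \<mu>: sigma_finite_measure \<mu> by (rule sigma_finite_mu)
  interpret \<nu>: subprob_space \<nu> by (rule \<nu>(1))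
  interpret pair_sigma_finite \<mu> \<nu> ..
  show ?thesis
  proof
    show "mixture \<nu> \<in> \<mu> \<rightarrow>\<^sub>M subprob_algebra \<mu>"
      unfolding subprob_algebra_mu measurable_cong_sets[OF sets_mu refl] by (rule mixture_measurable[OF \<nu>])
    fix f g :: "'a \<Rightarrow> ennreal" assume "f \<in> borel_measurable \<mu>" and "g \<in> borel_measurable \<mu>"
    then have f [measurable]: "f \<in> borel_measurable borel" and g [measurable]: "g \<in> borel_measurable borel"
      by (simp_all add: measurable_mu)
    have sp: "sets (\<mu> \<Otimes>\<^sub>M \<nu>) = sets (borel \<Otimes>\<^sub>M borel)" by (rule sets_pair_measure_cong[OF sets_mu \<nu>(2)])
    have m: "(\<lambda>z. \<integral>\<^sup>+y. h y \<partial>K (snd z) (fst z)) \<in> borel_measurable (\<mu> \<Otimes>\<^sub>M \<nu>)"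
      if "h \<in> borel_measurable borel" for h :: "'a \<Rightarrow> ennreal"
      unfolding measurable_cong_sets[OF sp refl]
      using measurable_compose[OF K_jointly_measurable nn_integral_measurable_subprob_algebra[OF that]]
      by (simp add: case_prod_beta)
    have mf: "(\<lambda>s. \<integral>\<^sup>+y. h y \<partial>K s x) \<in> borel_measurable \<nu>" if "h \<in> borel_measurable borel" for h :: "'a \<Rightarrow> ennreal" and x
      by (rule measurable_compose[OF K_time_measurable'[OF \<nu>] nn_integral_measurable_subprob_algebra[OF that]])
    have gm: "(\<lambda>z. h (fst z)) \<in> borel_measurable (\<mu> \<Otimes>\<^sub>M \<nu>)" if "h \<in> borel_measurable borel" for h :: "'a \<Rightarrow> ennreal"
      by (rule measurable_compose[OF measurable_fst]) (use that in \<open>simp add: measurable_mu\<close>)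
    have "(\<integral>\<^sup>+x. (\<integral>\<^sup>+y. f y \<partial>mixture \<nu> x) * g x \<partial>\<mu>) = (\<integral>\<^sup>+x. (\<integral>\<^sup>+s. (\<integral>\<^sup>+y. f y \<partial>K s x) * g x \<partial>\<nu>) \<partial>\<mu>)"
      by (simp add: nn_integral_mixture[OF \<nu> f] nn_integral_multc mf f)
    also have "\<dots> = (\<integral>\<^sup>+s. (\<integral>\<^sup>+x. (\<integral>\<^sup>+y. f y \<partial>K s x) * g x \<partial>\<mu>) \<partial>\<nu>)"
      by (rule Fubini'[symmetric]) (use m[OF f] gm[OF g] in \<open>simp add: case_prod_beta\<close>)
    also have "\<dots> = (\<integral>\<^sup>+s. (\<integral>\<^sup>+x. f x * (\<integral>\<^sup>+y. g y \<partial>K s x) \<partial>\<mu>) \<partial>\<nu>)"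
      by (simp add: K_symmetric)
    also have "\<dots> = (\<integral>\<^sup>+x. (\<integral>\<^sup>+s. f x * (\<integral>\<^sup>+y. g y \<partial>K s x) \<partial>\<nu>) \<partial>\<mu>)"
      by (rule Fubini') (use m[OF g] gm[OF f] in \<open>simp add: case_prod_beta\<close>)
    also have "\<dots> = (\<integral>\<^sup>+x. f x * (\<integral>\<^sup>+y. g y \<partial>mixture \<nu> x) \<partial>\<mu>)"
      by (simp add: nn_integral_mixture[OF \<nu> g] nn_integral_cmult mf g)
    finally show "(\<integral>\<^sup>+x. (\<integral>\<^sup>+y. f y \<partial>mixture \<nu> x) * g x \<partial>\<mu>) = (\<integral>\<^sup>+x. f x * (\<integral>\<^sup>+y. g y \<partial>mixture \<nu> x) \<partial>\<mu>)" .
  qed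
qed

text \<open>The average over an independent exponential time, that is, the kernel of the resolvent
  with parameter 1.\<close>

abbreviation "G \<equiv> mixture exp_measure"

lemma exp_measure_props: "subprob_space exp_measure" "sets exp_measure = sets borel"
  by (simp_all add: prob_space_imp_subprob_space[OF prob_space_exp_measure])

lemma symmetric_kernel_G: "symmetric_kernel \<mu> G"
  by (rule symmetric_kernel_mixture[OF exp_measure_props])

abbreviation "A h \<equiv> mixture (short_measure h)"

lemma symmetric_kernel_A: "0 < h \<Longrightarrow> symmetric_kernel \<mu> (A h)"
  by (rule symmetric_kernel_mixture[OF short_measure_props])

text \<open>Substituting \<open>s = h * u\<close> turns the average into an integral over
  \<open>{0..1}\<close> of \<open>exp (- (h * u)) * q (h * u)\<close>, where \<open>q s\<close> is
  the semigroup at time \<open>s\<close> applied to \<open>\<phi>\<close> at \<open>x\<close>. Right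
  continuity of \<open>q\<close> at 0 together with \<open>K_0\<close> gives the limit by dominated
  convergence.\<close>

lemma approximate_identity_A:
  assumes h: "\<And>n. 0 < h n" "h \<longlonglongrightarrow> 0"
  shows "approximate_identity \<mu> (\<lambda>n. A (h n))"
proof (rule approximate_identity.intro[OF locally_compact radon])
  show "symmetric_kernel \<mu> (A (h n))" for n by (rule symmetric_kernel_A[OF h(1)])
  fix \<phi> :: "'a \<Rightarrow> real" and x
  assume c: "continuous_on UNIV \<phi>" and \<phi>: "\<And>y. 0 \<le> \<phi> y" "\<And>y. \<phi> y \<le> 1"
  have [measurable]: "\<phi> \<in> borel_measurable borel" using c by (rule borel_measurable_continuous_onI)
  define q where "q s = (LINT y|K s x. \<phi> y)" for s
  have q: "0 \<le> q s" "q s \<le> 1" for s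
  proof -
    interpret subprob_space "K s x" by (rule subprob_K)
    show "0 \<le> q s" using \<phi> by (simp add: q_def)
    have m: "\<phi> \<in> borel_measurable (K s x)" unfolding measurable_cong_sets[OF sets_K refl] by simp
    have "q s \<le> (LINT y|K s x. 1)" unfolding q_def
      using \<phi> m by (intro integral_mono integrable_const_bound[of _ 1]) auto
    also have "\<dots> \<le> 1" using subprob_measure_le_1 by simp
    finally show "q s \<le> 1" .
  qed
  have qm [measurable]: "q \<in> borel_measurable borel"
    unfolding q_def by (rule measurable_compose[OF K_time_measurable integral_measurable_subprob_algebra]) simp
  have mix: "(LINT y|A k x. \<phi> y) = (LINT u|lborel. indicator {0..1} u * (exp (- (k * u)) * q (k * u)))" if k: "0 < k" for k
  proof -
    interpret subprob_space "A k x"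
      using subprob_space_kernel[OF mixture_measurable[OF short_measure_props[OF k]], of x] by simp
    have sA: "sets (A k x) = sets borel"
      using sets_kernel[OF mixture_measurable[OF short_measure_props[OF k]], of x] by simp
    have i: "(\<integral>\<^sup>+y. \<phi> y \<partial>A k x) < \<infinity>"
    proof -
      have "(\<integral>\<^sup>+y. \<phi> y \<partial>A k x) \<le> (\<integral>\<^sup>+y. 1 \<partial>A k x)" using \<phi> by (intro nn_integral_mono) (simp add: ennreal_le_1)
      also have "\<dots> < \<infinity>" using emeasure_finite[of "space (A k x)"] by (simp add: less_top del: emeasure_finite)
      finally show ?thesis .
    qed
    have "(LINT y|A k x. \<phi> y) = (LINT s|short_measure k. q s)"
      unfolding mixture_def q_def
      by (rule integral_bind_nonneg(3)[OF K_time_measurable'[OF short_measure_props[OF k]]])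
        (use \<phi> i in \<open>auto simp: space_nu[OF short_measure_props[OF k]] mixture_def\<close>)
    also have "\<dots> = (LINT s|lborel. (indicator {0..k} s * (exp (- s) / k)) *\<^sub>R q s)"
      unfolding short_measure_def using k by (intro integral_density) auto
    also have "\<dots> = \<bar>k\<bar> *\<^sub>R (LINT u|lborel. (indicator {0..k} (0 + k * u) * (exp (- (0 + k * u)) / k)) *\<^sub>R q (0 + k * u))"
      using k by (intro lborel_integral_real_affine) auto
    also have "\<dots> = (LINT u|lborel. k * ((indicator {0..k} (0 + k * u) * (exp (- (0 + k * u)) / k)) * q (0 + k * u)))"
      using k by simp
    also have "\<dots> = (LINT u|lborel. indicator {0..1} u * (exp (- (k * u)) * q (k * u)))"
    proof (intro Bochner_Integration.integral_cong refl)
      fix u :: real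
      have "k * u \<in> {0..k} \<longleftrightarrow> u \<in> {0..1}" using k by (simp add: zero_le_mult_iff)
      then have "indicator {0..k} (k * u) = (indicator {0..1} u :: real)" by (simp add: indicator_def)
      then show "k * ((indicator {0..k} (0 + k * u) * (exp (- (0 + k * u)) / k)) * q (0 + k * u))
          = indicator {0..1} u * (exp (- (k * u)) * q (k * u))" using k by simp
    qed
    finally show ?thesis .
  qed
  have I: "integrable lborel (indicator {0..1} :: real \<Rightarrow> real)" by simp
  have "(\<lambda>n. LINT u|lborel. indicator {0..1} u * (exp (- (h n * u)) * q (h n * u)))
      \<longlonglongrightarrow> (LINT u|lborel. indicator {0..1::real} u * (exp 0 * \<phi> x))"
  proof (rule integral_dominated_convergence[OF _ _ I])
    show "AE u in lborel. (\<lambda>n. indicator {0..1} u * (exp (- (h n * u)) * q (h n * u))) \<longlonglongrightarrow> indicator {0..1} u * (exp 0 * \<phi> x)"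
    proof (rule AE_I2)
      fix u :: real
      show "(\<lambda>n. indicator {0..1} u * (exp (- (h n * u)) * q (h n * u))) \<longlonglongrightarrow> indicator {0..1} u * (exp 0 * \<phi> x)"
      proof (cases "0 \<le> u")
        case True
        have hu: "(\<lambda>n. h n * u) \<longlonglongrightarrow> 0" using tendsto_mult_right[OF h(2), of u] by simp
        have "(\<lambda>n. q (h n * u)) \<longlonglongrightarrow> (LINT y|K 0 x. \<phi> y)"
          unfolding q_def by (rule integral_K_right_continuous[OF c \<phi> _ hu]) (use h(1) True in \<open>simp add: less_imp_le\<close>)
        then have ql: "(\<lambda>n. q (h n * u)) \<longlonglongrightarrow> \<phi> x" by (simp add: K_0 integral_return)
        have "(\<lambda>n. exp (- (h n * u))) \<longlonglongrightarrow> exp (- 0)" by (intro tendsto_intros hu)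
        then show ?thesis using ql by (intro tendsto_mult tendsto_const) simp_all
      qed simp
    qed
    show "AE u in lborel. norm (indicator {0..1} u * (exp (- (h n * u)) * q (h n * u))) \<le> indicator {0..1} u" for n
    proof (rule AE_I2)
      fix u :: real
      show "norm (indicator {0..1} u * (exp (- (h n * u)) * q (h n * u))) \<le> indicator {0..1} u"
      proof (cases "u \<in> {0..1}")
        case True
        then have "exp (- (h n * u)) \<le> 1" using h(1)[of n] by simp
        then have "exp (- (h n * u)) * q (h n * u) \<le> 1 * 1" using q by (intro mult_mono) auto
        then show ?thesis using True q by simp
      qed simp
    qed
  qed (auto simp: integrable_indicator_iff)
  then show "(\<lambda>n. LINT y|A (h n) x. \<phi> y) \<longlonglongrightarrow> \<phi> x" by (simp add: mix[OF h(1)])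
qed

end

section \<open>The generator and its spectrum\<close>

text \<open>Split the exponential law at \<open>h\<close>: the part on \<open>{0..h}\<close> is
  \<open>h\<close> times \<open>short_measure h\<close>, and by lack of memory the rest is the same
  law shifted by \<open>h\<close>, with factor \<open>exp (- h)\<close>.\<close>

lemma integral_exp_measure_shift:
  fixes \<phi> :: "real \<Rightarrow> complex"
  assumes i: "integrable exp_measure \<phi>" and h: "0 < h"
  shows "(LINT s|exp_measure. \<phi> s)
    = of_real h * (LINT s|short_measure h. \<phi> s) + of_real (exp (- h)) * (LINT s|exp_measure. \<phi> (h + s))"
proof -
  have [measurable]: "\<phi> \<in> borel_measurable borel"
    using borel_measurable_integrable[OF i] by simp
  define \<psi> where "\<psi> s = exponential_density 1 s *\<^sub>R \<phi> s" for s
  have \<psi>i: "integrable lborel \<psi>"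
    using i unfolding \<psi>_def by (subst (asm) integrable_density) (auto simp: exponential_density_nonneg)
  have \<psi>1: "integrable lborel (\<lambda>s. indicator {0..h} s *\<^sub>R \<psi> s)" and \<psi>2: "integrable lborel (\<lambda>s. indicator {h..} s *\<^sub>R \<psi> s)"
    by (intro integrable_mult_indicator \<psi>i; simp)+
  have "(LINT s|exp_measure. \<phi> s) = (LINT s|lborel. \<psi> s)"
    unfolding \<psi>_def by (rule integral_density) (auto simp: exponential_density_nonneg)
  also have "\<dots> = (LINT s|lborel. indicator {0..h} s *\<^sub>R \<psi> s + indicator {h..} s *\<^sub>R \<psi> s)"
  proof (rule integral_cong_AE)
    show "AE s in lborel. \<psi> s = indicator {0..h} s *\<^sub>R \<psi> s + indicator {h..} s *\<^sub>R \<psi> s"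
      using AE_lborel_singleton[of h]
      by eventually_elim (auto simp: \<psi>_def indicator_def exponential_density_def)
  qed (use \<psi>i \<psi>1 \<psi>2 in auto)
  also have "\<dots> = (LINT s|lborel. indicator {0..h} s *\<^sub>R \<psi> s) + (LINT s|lborel. indicator {h..} s *\<^sub>R \<psi> s)"
    by (rule Bochner_Integration.integral_add[OF \<psi>1 \<psi>2])
  also have "(LINT s|lborel. indicator {0..h} s *\<^sub>R \<psi> s)
      = (LINT s|lborel. of_real h * ((indicator {0..h} s * (exp (- s) / h)) *\<^sub>R \<phi> s))"
    using h by (intro Bochner_Integration.integral_cong refl)
      (auto simp: \<psi>_def indicator_def exponential_density_def scaleR_conv_of_real)
  also have "\<dots> = of_real h * (LINT s|lborel. (indicator {0..h} s * (exp (- s) / h)) *\<^sub>R \<phi> s)"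
    by (rule integral_mult_right_zero)
  also have "(LINT s|lborel. (indicator {0..h} s * (exp (- s) / h)) *\<^sub>R \<phi> s) = (LINT s|short_measure h. \<phi> s)"
    unfolding short_measure_def using h by (intro integral_density[symmetric]) auto
  also have "(LINT s|lborel. indicator {h..} s *\<^sub>R \<psi> s)
      = \<bar>1\<bar> *\<^sub>R (LINT s|lborel. indicator {h..} (h + 1 * s) *\<^sub>R \<psi> (h + 1 * s))"
    by (rule lborel_integral_real_affine) simp
  also have "\<dots> = (LINT s|lborel. of_real (exp (- h)) * (exponential_density 1 s *\<^sub>R \<phi> (h + s)))"
    using h by (simp, intro Bochner_Integration.integral_cong refl)
      (auto simp: \<psi>_def indicator_def exponential_density_def scaleR_conv_of_real mult_exp_exp add.commute simp flip: of_real_mult)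
  also have "\<dots> = of_real (exp (- h)) * (LINT s|lborel. exponential_density 1 s *\<^sub>R \<phi> (h + s))"
    by (rule integral_mult_right_zero)
  also have "(LINT s|lborel. exponential_density 1 s *\<^sub>R \<phi> (h + s)) = (LINT s|exp_measure. \<phi> (h + s))"
    by (rule integral_density[symmetric]) (auto simp: exponential_density_nonneg)
  finally show ?thesis .
qed

context symmetric_hunt_process
begin

abbreviation "R \<equiv> kernel_op G"

lemma Lp_measurable: "f \<in> Lp_space p \<mu> \<Longrightarrow> f \<in> borel_measurable borel"
  using Lp_space_measurable[of f p \<mu>] by (simp add: measurable_mu)

lemma K_Lp:
  assumes "0 \<le> t" "1 \<le> p" "f \<in> Lp_space p \<mu>"
  shows "kernel_op (K t) f \<in> Lp_space p \<mu>"
proof -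
  interpret symmetric_kernel \<mu> "K t" by (rule symmetric_kernel_K[OF assms(1)])
  show ?thesis by (rule T_Lp(1)[OF assms(2,3)])
qed

lemma A_Lp:
  assumes "0 < h" "1 \<le> p" "f \<in> Lp_space p \<mu>"
  shows "kernel_op (A h) f \<in> Lp_space p \<mu>"
    and "Lp_norm p \<mu> (kernel_op (A h) f) \<le> Lp_norm p \<mu> f"
proof -
  interpret symmetric_kernel \<mu> "A h" by (rule symmetric_kernel_A[OF assms(1)])
  show "kernel_op (A h) f \<in> Lp_space p \<mu>" "Lp_norm p \<mu> (kernel_op (A h) f) \<le> Lp_norm p \<mu> f"
    by (rule T_Lp[OF assms(2,3)])+
qed

text \<open>\<open>integral_exp_measure_shift\<close> applied to
  \<open>\<lambda>s. kernel_op (K s) f x\<close>; Chapman-Kolmogorov then rewrites the semigroup at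
  time \<open>h + s\<close> under the integral.\<close>

lemma resolvent_shift:
  assumes p: "1 \<le> p" and f: "f \<in> Lp_space p \<mu>" and h: "0 < h"
  shows "AE x in \<mu>. R f x = of_real h * kernel_op (A h) f x + of_real (exp (- h)) * R (kernel_op (K h) f) x"
proof -
  note [measurable] = Lp_measurable[OF f]
  note Kf = K_Lp[OF less_imp_le[OF h] p f]
  have G: "AE x in \<mu>. integrable (G x) g" if "g \<in> Lp_space p \<mu>" for g
    by (rule symmetric_kernel.Lp_kernel_integrable[OF symmetric_kernel_G p that])
  have A: "AE x in \<mu>. integrable (A h x) f"
    by (rule symmetric_kernel.Lp_kernel_integrable[OF symmetric_kernel_A[OF h] p f])
  from G[OF f] G[OF Kf] A show ?thesis
  proof eventually_elim
    case (elim x)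
    have fin: "(\<integral>\<^sup>+y. norm (f y) \<partial>G x) < \<infinity>" "(\<integral>\<^sup>+y. norm (kernel_op (K h) f y) \<partial>G x) < \<infinity>"
      "(\<integral>\<^sup>+y. norm (f y) \<partial>A h x) < \<infinity>"
      using elim by (simp_all add: integrable_iff_bounded)
    note mf = kernel_op_mixture[OF exp_measure_props _ fin(1)]
    have em: "(\<lambda>s. ennreal (exponential_density 1 s)) \<in> borel_measurable lborel" by measurable
    have "AE s in exp_measure. integrable (K s x) f" by (rule mf(1)) simp
    then have "AE s in lborel. 0 < exponential_density 1 s \<longrightarrow> integrable (K s x) f"
      by (subst (asm) AE_density) auto
    \<comment> \<open>Integrability is known for almost every time \<open>s\<close>; translation
      invariance of Lebesgue measure makes it available at \<open>h + s\<close>.\<close>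
    then have "AE s in distr lborel borel ((+) h). 0 < exponential_density 1 s \<longrightarrow> integrable (K s x) f"
      unfolding lborel_distr_plus .
    then have "AE s in lborel. 0 < exponential_density 1 (h + s) \<longrightarrow> integrable (K (h + s) x) f"
      by (rule AE_distrD[rotated]) simp
    then have ae: "AE s in exp_measure. kernel_op (K (h + s)) f x = kernel_op (K s) (kernel_op (K h) f) x"
      unfolding AE_density[OF em]
    proof eventually_elim
      case (elim s)
      show ?case
      proof
        assume "0 < ennreal (exponential_density 1 s)"
        then have s: "0 \<le> s" by (auto simp: exponential_density_def split: if_splits)
        with elim h have "integrable (K (s + h) x) f" by (simp add: exponential_density_def add.commute)
        then have "(\<integral>\<^sup>+y. norm (f y) \<partial>K (s + h) x) < \<infinity>" by (simp add: integrable_iff_bounded)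
        then show "kernel_op (K (h + s)) f x = kernel_op (K s) (kernel_op (K h) f) x"
          using kernel_op_K_add(3)[OF s less_imp_le[OF h]] by (simp add: add.commute)
      qed
    qed
    have m: "(\<lambda>s. kernel_op (K s) g x) \<in> borel_measurable borel" if "g \<in> borel_measurable borel" for g
      unfolding kernel_op_def by (rule measurable_compose[OF K_time_measurable integral_measurable_subprob_algebra[OF that]])
    have "R f x = (LINT s|exp_measure. kernel_op (K s) f x)" by (rule mf(3)) simp
    also have "\<dots> = of_real h * (LINT s|short_measure h. kernel_op (K s) f x)
        + of_real (exp (- h)) * (LINT s|exp_measure. kernel_op (K (h + s)) f x)"
      by (rule integral_exp_measure_shift[OF mf(2) h]) simp
    also have "(LINT s|short_measure h. kernel_op (K s) f x) = kernel_op (A h) f x"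
      by (rule kernel_op_mixture(3)[OF short_measure_props[OF h] _ fin(3), symmetric]) simp
    also have "(LINT s|exp_measure. kernel_op (K (h + s)) f x) = (LINT s|exp_measure. kernel_op (K s) (kernel_op (K h) f) x)"
    proof (rule integral_cong_AE[OF _ _ ae])
      show "(\<lambda>s. kernel_op (K (h + s)) f x) \<in> borel_measurable exp_measure"
        using measurable_compose[OF _ m[of f], of "\<lambda>s. h + s" exp_measure] by simp
      show "(\<lambda>s. kernel_op (K s) (kernel_op (K h) f) x) \<in> borel_measurable exp_measure"
        using m[of "kernel_op (K h) f"] by simp
    qed
    also have "\<dots> = R (kernel_op (K h) f) x"
      by (rule kernel_op_mixture(3)[OF exp_measure_props _ fin(2), symmetric]) simp
    finally show ?case .
  qed
qed

text \<open>\<open>h\<close> is fixed small first. The averages then contribute at most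
  \<open>2 * h\<close> to any difference, while the other term inherits convergent subsequences from
  the compact semigroup at time \<open>h\<close>.\<close>

lemma G_compact: "Lp_compact_operator top \<mu> R"
proof -
  interpret symmetric_kernel \<mu> G by (rule symmetric_kernel_G)
  have p: "1 \<le> (top::ennreal)" by simp
  show ?thesis
  proof (rule Linfty_compactI)
    fix e :: real and f :: "nat \<Rightarrow> 'a \<Rightarrow> complex"
    assume e: "0 < e" and f: "\<And>n. f n \<in> Lp_space top \<mu>" "\<And>n. Lp_norm top \<mu> (f n) \<le> 1"
    \<comment> \<open>Of the tolerance \<open>e\<close>, the averages use
      \<open>2 * h = e / 2\<close>, and the distances to the limit \<open>g\<close> use
      \<open>e / 4\<close> each.\<close>
    define h where "h = e / 4"
    have h: "0 < h" using e by (simp add: h_def)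
    let ?K = "kernel_op (K h)" and ?A = "kernel_op (A h)"
    note Kf = K_Lp[OF less_imp_le[OF h] p f(1)]
    note Af = A_Lp(1)[OF h p f(1)]
    obtain g r where g: "g \<in> Lp_space top \<mu>" and r: "strict_mono (r::nat \<Rightarrow> nat)"
      and lim: "(\<lambda>n. Lp_norm top \<mu> (\<lambda>x. ?K (f (r n)) x - g x)) \<longlonglongrightarrow> 0"
      by (rule Lp_compact_operatorE[OF K_compact_Linfty[OF h] f])
    from order_tendstoD(2)[OF lim, of "e/4"] e
    obtain N where N: "\<And>n. n \<ge> N \<Longrightarrow> Lp_norm top \<mu> (\<lambda>x. ?K (f (r n)) x - g x) < e/4"
      by (auto simp: eventually_sequentially)
    have "Lp_norm top \<mu> (\<lambda>x. R (f (r i)) x - R (f (r j)) x) \<le> e" if ij: "i \<ge> N" "j \<ge> N" for i j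
    proof -
      let ?u = "\<lambda>x. ?A (f (r i)) x - ?A (f (r j)) x"
      let ?v = "\<lambda>x. R (?K (f (r i))) x - R (?K (f (r j))) x"
      have u: "?u \<in> Lp_space top \<mu>" by (rule Lp_space_diff[OF p Af Af])
      have v: "?v \<in> Lp_space top \<mu>" by (rule Lp_space_diff[OF p T_Lp(1)[OF p Kf] T_Lp(1)[OF p Kf]])
      have un: "Lp_norm top \<mu> ?u \<le> 2"
      proof -
        have "Lp_norm top \<mu> ?u \<le> Lp_norm top \<mu> (\<lambda>x. ?A (f (r i)) x - 0) + Lp_norm top \<mu> (\<lambda>x. 0 - ?A (f (r j)) x)"
          by (rule Lp_norm_diff_triangle[OF p Af Lp_space_zero Af])
        also have "\<dots> = Lp_norm top \<mu> (?A (f (r i))) + Lp_norm top \<mu> (?A (f (r j)))"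
          using Lp_norm_minus_commute[of top \<mu> "\<lambda>_. 0" "?A (f (r j))"] by simp
        also have "\<dots> \<le> 1 + 1"
          by (intro add_mono order_trans[OF A_Lp(2)[OF h p f(1)] f(2)])
        finally show ?thesis by simp
      qed
      have vn: "Lp_norm top \<mu> ?v \<le> e / 2"
      proof -
        have "Lp_norm top \<mu> ?v \<le> Lp_norm top \<mu> (\<lambda>x. ?K (f (r i)) x - ?K (f (r j)) x)"
          by (rule T_diff_Lp_norm[OF p Kf Kf])
        also have "\<dots> \<le> Lp_norm top \<mu> (\<lambda>x. ?K (f (r i)) x - g x) + Lp_norm top \<mu> (\<lambda>x. g x - ?K (f (r j)) x)"
          by (rule Lp_norm_diff_triangle[OF p Kf g Kf])
        also have "\<dots> \<le> e / 2"
          using N[OF ij(1)] N[OF ij(2)] Lp_norm_minus_commute[of top \<mu> g "?K (f (r j))"] by simp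
        finally show ?thesis .
      qed
      have "AE x in \<mu>. R (f (r i)) x - R (f (r j)) x = of_real h * ?u x + of_real (exp (- h)) * ?v x"
        using resolvent_shift[OF p f(1) h, of "r i"] resolvent_shift[OF p f(1) h, of "r j"]
        by eventually_elim (simp add: algebra_simps)
      then have "Lp_norm top \<mu> (\<lambda>x. R (f (r i)) x - R (f (r j)) x)
          = Lp_norm top \<mu> (\<lambda>x. of_real h * ?u x + of_real (exp (- h)) * ?v x)"
        by (intro Lp_space_cong_AE(2)[OF p] Lp_space_add[OF p] Lp_space_scale u v
            Lp_space_measurable[OF Lp_space_diff[OF p T_Lp(1)[OF p f(1)] T_Lp(1)[OF p f(1)]]])
      also have "\<dots> \<le> Lp_norm top \<mu> (\<lambda>x. of_real h * ?u x) + Lp_norm top \<mu> (\<lambda>x. of_real (exp (- h)) * ?v x)"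
        by (rule Lp_norm_triangle[OF p Lp_space_scale[OF u] Lp_space_scale[OF v]])
      also have "\<dots> = h * Lp_norm top \<mu> ?u + exp (- h) * Lp_norm top \<mu> ?v"
        using h by (simp only: Lp_norm_scale[OF p u] Lp_norm_scale[OF p v] norm_of_real) simp
      also have "\<dots> \<le> h * 2 + 1 * (e / 2)"
        using h un vn e by (intro add_mono mult_mono) (auto simp: Lp_norm_nonneg)
      finally show ?thesis by (simp add: h_def)
    qed
    with r show "\<exists>s::nat \<Rightarrow> nat. strict_mono s \<and>
      (\<exists>N. \<forall>i\<ge>N. \<forall>j\<ge>N. Lp_norm top \<mu> (\<lambda>x. R (f (s i)) x - R (f (s j)) x) \<le> e)"
      by (intro exI[of _ r] conjI exI[of _ N]) simp_all
  qed
qed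

text \<open>The commuted form of the shift identity follows from the first one by duality.\<close>

lemma resolvent_shift':
  assumes p: "1 \<le> p" and f: "f \<in> Lp_space p \<mu>" and h: "0 < h"
  shows "AE x in \<mu>. R f x = of_real h * kernel_op (A h) f x + of_real (exp (- h)) * kernel_op (K h) (R f) x"
proof -
  interpret G: symmetric_kernel \<mu> G by (rule symmetric_kernel_G)
  interpret A: symmetric_kernel \<mu> "A h" by (rule symmetric_kernel_A[OF h])
  interpret K: symmetric_kernel \<mu> "K h" by (rule symmetric_kernel_K[OF less_imp_le[OF h]])
  note Rf = G.T_Lp(1)[OF p f] and Af = A.T_Lp(1)[OF p f]
  note KRf = K.T_Lp(1)[OF p Rf]
  note sA = Lp_space_scale[OF Af, of "of_real h"] and sK = Lp_space_scale[OF KRf, of "of_real (exp (- h))"]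
  let ?d = "\<lambda>x. R f x - (of_real h * kernel_op (A h) f x + of_real (exp (- h)) * kernel_op (K h) (R f) x)"
  have "AE x in \<mu>. ?d x = 0"
  proof (rule G.test_functions_separate[OF p])
    show "?d \<in> Lp_space p \<mu>" by (intro Lp_space_diff Lp_space_add p Rf sA sK)
    fix g assume g: "g \<in> L1_Linfty \<mu>"
    have g1: "g \<in> Lp_space 1 \<mu>" using g by (simp add: L1_Linfty_iff Lp_space_1_iff)
    have Kg: "kernel_op (K h) g \<in> L1_Linfty \<mu>" by (rule K.T_test[OF g])
    have fA: "integrable \<mu> (\<lambda>x. f x * kernel_op (A h) g x)" and fG: "integrable \<mu> (\<lambda>x. f x * R (kernel_op (K h) g) x)"
      by (intro integrable_Lp_test[OF p f] A.T_test G.T_test g Kg)+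
    have "(LINT x|\<mu>. ?d x * g x) = (LINT x|\<mu>. R f x * g x)
        - (of_real h * (LINT x|\<mu>. kernel_op (A h) f x * g x) + of_real (exp (- h)) * (LINT x|\<mu>. kernel_op (K h) (R f) x * g x))"
      using integrable_Lp_test[OF p Rf g] integrable_Lp_test[OF p Af g] integrable_Lp_test[OF p KRf g]
      by (simp add: left_diff_distrib distrib_right mult.assoc)
    also have "(LINT x|\<mu>. kernel_op (K h) (R f) x * g x) = (LINT x|\<mu>. f x * R (kernel_op (K h) g) x)"
      by (simp add: K.pairing_Lp_test[OF p Rf g] G.pairing_Lp_test[OF p f Kg])
    also have "(LINT x|\<mu>. R f x * g x) = (LINT x|\<mu>. f x * R g x)" by (rule G.pairing_Lp_test[OF p f g])
    also have "(LINT x|\<mu>. kernel_op (A h) f x * g x) = (LINT x|\<mu>. f x * kernel_op (A h) g x)"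
      by (rule A.pairing_Lp_test[OF p f g])
    also have "(LINT x|\<mu>. f x * R g x)
        = (LINT x|\<mu>. of_real h * (f x * kernel_op (A h) g x) + of_real (exp (- h)) * (f x * R (kernel_op (K h) g) x))"
    proof (rule integral_cong_AE)
      show "AE x in \<mu>. f x * R g x = of_real h * (f x * kernel_op (A h) g x) + of_real (exp (- h)) * (f x * R (kernel_op (K h) g) x)"
        using resolvent_shift[OF order_refl g1 h] by eventually_elim (simp add: algebra_simps)
      show "(\<lambda>x. f x * R g x) \<in> borel_measurable \<mu>"
        using integrable_Lp_test[OF p f G.T_test[OF g]] by (rule borel_measurable_integrable)
    qed (use fA fG in \<open>auto dest!: borel_measurable_integrable\<close>)
    finally show "(LINT x|\<mu>. ?d x * g x) = 0" using fA fG by simp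
  qed
  then show ?thesis by eventually_elim simp
qed

end

text \<open>Solves the shift identity for \<open>k\<close> and inserts the result into the
  difference quotient. The same algebra serves \<open>resolvent_shift\<close> and
  \<open>resolvent_shift'\<close>, where \<open>k\<close> is \<open>R\<close> after the semigroup or
  the semigroup after \<open>R\<close>.\<close>

lemma shift_quotient:
  fixes r a k :: complex
  assumes h: "0 < h" and r: "r = of_real h * a + of_real (exp (- h)) * k"
  shows "(k - r) / of_real h = of_real ((exp h - 1) / h) * r - of_real (exp h) * a"
proof -
  have E: "complex_of_real (exp h) * of_real (exp (- h)) = 1"
    by (simp add: exp_minus flip: of_real_mult)
  have "of_real (exp h) * r = of_real (exp h) * of_real h * a + (of_real (exp h) * of_real (exp (- h))) * k"
    unfolding r by (simp only: distrib_left mult.assoc)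
  then have k: "k = of_real (exp h) * r - of_real (exp h) * of_real h * a"
    unfolding E by simp
  show ?thesis using h unfolding k by (simp add: field_simps)
qed

lemma exp_quotient_tendsto: "((\<lambda>t. (exp t - 1) / t) \<longlongrightarrow> (1::real)) (at_right 0)"
  using lim_exp_minus_1[where 'a=real] by (rule tendsto_within_subset) simp

lemma exp_tendsto_1: "((\<lambda>t. exp t) \<longlongrightarrow> (1::real)) (at_right 0)"
proof -
  have "((\<lambda>t. exp t) \<longlongrightarrow> exp (0::real)) (at_right 0)" by (intro tendsto_intros)
  then show ?thesis by simp
qed

section \<open>Difference quotients and the graph of the generator\<close>

context symmetric_hunt_process
begin

lemma R_Lp: "1 \<le> p \<Longrightarrow> f \<in> Lp_space p \<mu> \<Longrightarrow> R f \<in> Lp_space p \<mu>"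
  by (rule symmetric_kernel.T_Lp(1)[OF symmetric_kernel_G])

lemma R_diff:
  assumes "1 \<le> p" "f \<in> Lp_space p \<mu>" "g \<in> Lp_space p \<mu>"
  shows "AE x in \<mu>. R (\<lambda>y. f y - g y) x = R f x - R g x"
  by (rule symmetric_kernel.T_diff[OF symmetric_kernel_G assms])

lemma R_cong:
  assumes "f \<in> Lp_space p \<mu>" "g \<in> Lp_space p \<mu>" "AE x in \<mu>. f x = g x"
  shows "AE x in \<mu>. R f x = R g x"
  by (rule symmetric_kernel.T_cong[OF symmetric_kernel_G Lp_space_measurable[OF assms(1)] Lp_space_measurable[OF assms(2)] assms(3)])

lemma R_scale: "R (\<lambda>y. c * f y) x = c * R f x"
  by (simp add: kernel_op_def)

abbreviation quotient :: "real \<Rightarrow> ('a \<Rightarrow> complex) \<Rightarrow> 'a \<Rightarrow> complex" where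
  "quotient t u \<equiv> \<lambda>x. (kernel_op (K t) u x - u x) / of_real t"

lemma quotient_Lp:
  assumes t: "0 < t" and p: "1 \<le> p" and u: "u \<in> Lp_space p \<mu>"
  shows "quotient t u \<in> Lp_space p \<mu>"
  using Lp_space_scale[OF Lp_space_diff[OF p K_Lp[OF less_imp_le[OF t] p u] u], of "1 / of_real t"] by simp

text \<open>The difference quotients of \<open>R w\<close> and the images under \<open>R\<close> of those of \<open>w\<close> have the same
  closed form, which converges to \<open>R w - w\<close>.\<close>

definition smoothed :: "real \<Rightarrow> ('a \<Rightarrow> complex) \<Rightarrow> 'a \<Rightarrow> complex" where
  "smoothed t w x = of_real ((exp t - 1) / t) * R w x - of_real (exp t) * kernel_op (A t) w x"

lemma quotient_R:
  assumes "1 \<le> p" "w \<in> Lp_space p \<mu>" "0 < t"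
  shows "AE x in \<mu>. quotient t (R w) x = smoothed t w x"
  using resolvent_shift'[OF assms] unfolding smoothed_def
  by eventually_elim (rule shift_quotient[OF assms(3)])

lemma R_quotient:
  assumes p: "1 \<le> p" and w: "w \<in> Lp_space p \<mu>" and t: "0 < t"
  shows "AE x in \<mu>. R (quotient t w) x = smoothed t w x"
proof -
  have e: "R (quotient t w) x = R (\<lambda>y. kernel_op (K t) w y - w y) x / of_real t" for x
    using R_scale[of "1 / of_real t" "\<lambda>y. kernel_op (K t) w y - w y" x] by simp
  show ?thesis
    using resolvent_shift[OF p w t] R_diff[OF p K_Lp[OF less_imp_le[OF t] p w] w]
    unfolding smoothed_def e
    by eventually_elim (simp only: shift_quotient[OF t])
qed

lemma smoothed_Lp:
  assumes "0 < t" "1 \<le> p" "w \<in> Lp_space p \<mu>"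
  shows "smoothed t w \<in> Lp_space p \<mu>"
  unfolding smoothed_def[abs_def]
  by (intro Lp_space_diff Lp_space_scale R_Lp A_Lp(1) assms)

lemma A_tendsto:
  assumes "1 \<le> p" "p \<noteq> top" "w \<in> Lp_space p \<mu>"
  shows "((\<lambda>t. Lp_norm p \<mu> (\<lambda>x. kernel_op (A t) w x - w x)) \<longlongrightarrow> 0) (at_right 0)"
proof (rule tendsto_at_right_sequentially[of 0 1])
  fix S :: "nat \<Rightarrow> real" assume S: "\<And>n. 0 < S n" "S \<longlonglongrightarrow> 0"
  interpret approximate_identity \<mu> "\<lambda>n. A (S n)" by (rule approximate_identity_A[OF S])
  show "(\<lambda>n. Lp_norm p \<mu> (\<lambda>x. kernel_op (A (S n)) w x - w x)) \<longlonglongrightarrow> 0"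
    by (rule strong_convergence[OF assms])
qed simp

lemma at_right_0_pos: "eventually (\<lambda>t. 0 < t) (at_right (0::real))"
  by (rule eventually_at_right_less)

lemma smoothed_tendsto:
  assumes p: "1 \<le> p" "p \<noteq> top" and w: "w \<in> Lp_space p \<mu>"
  shows "((\<lambda>t. Lp_norm p \<mu> (\<lambda>x. smoothed t w x - (R w x - w x))) \<longlongrightarrow> 0) (at_right 0)"
proof (rule Lim_null_comparison)
  note Rw = R_Lp[OF p(1) w]
  \<comment> \<open>One error term each for \<open>(exp t - 1) / t\<close>, for \<open>exp t\<close>
    and for the average \<open>A t\<close>.\<close>
  let ?b = "\<lambda>t. \<bar>(exp t - 1) / t - 1\<bar> * Lp_norm p \<mu> (R w) + (\<bar>1 - exp t\<bar> * Lp_norm p \<mu> w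
      + Lp_norm p \<mu> (\<lambda>x. kernel_op (A t) w x - w x))"
  have "(?b \<longlongrightarrow> \<bar>1 - 1\<bar> * Lp_norm p \<mu> (R w) + (\<bar>1 - 1\<bar> * Lp_norm p \<mu> w + 0)) (at_right 0)"
    by (intro tendsto_intros exp_quotient_tendsto exp_tendsto_1 A_tendsto p w)
  then show "(?b \<longlongrightarrow> 0) (at_right 0)" by simp
  show "eventually (\<lambda>t. norm (Lp_norm p \<mu> (\<lambda>x. smoothed t w x - (R w x - w x))) \<le> ?b t) (at_right 0)"
    using at_right_0_pos
  proof eventually_elim
    case (elim t)
    let ?A = "kernel_op (A t) w"
    note Aw = A_Lp[OF elim p(1) w]
    let ?f1 = "\<lambda>x. of_real ((exp t - 1) / t - 1) * R w x" and ?f2 = "\<lambda>x. of_real (1 - exp t) * ?A x"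
    have f: "?f1 \<in> Lp_space p \<mu>" "?f2 \<in> Lp_space p \<mu>" "(\<lambda>x. w x - ?A x) \<in> Lp_space p \<mu>"
      by (intro Lp_space_scale Lp_space_diff Rw Aw w p)+
    have "(\<lambda>x. smoothed t w x - (R w x - w x)) = (\<lambda>x. ?f1 x + (?f2 x + (w x - ?A x)))"
      by (simp add: smoothed_def algebra_simps)
    then have "Lp_norm p \<mu> (\<lambda>x. smoothed t w x - (R w x - w x))
        \<le> Lp_norm p \<mu> ?f1 + Lp_norm p \<mu> (\<lambda>x. ?f2 x + (w x - ?A x))"
      using Lp_norm_triangle[OF p(1) f(1) Lp_space_add[OF p(1) f(2,3)]] by simp
    also have "Lp_norm p \<mu> (\<lambda>x. ?f2 x + (w x - ?A x)) \<le> Lp_norm p \<mu> ?f2 + Lp_norm p \<mu> (\<lambda>x. w x - ?A x)"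
      by (rule Lp_norm_triangle[OF p(1) f(2,3)])
    also have "Lp_norm p \<mu> ?f1 = \<bar>(exp t - 1) / t - 1\<bar> * Lp_norm p \<mu> (R w)"
      by (simp only: Lp_norm_scale[OF p(1) Rw] norm_of_real)
    also have "Lp_norm p \<mu> ?f2 = \<bar>1 - exp t\<bar> * Lp_norm p \<mu> ?A"
      by (simp only: Lp_norm_scale[OF p(1) Aw(1)] norm_of_real)
    also have "\<bar>1 - exp t\<bar> * Lp_norm p \<mu> ?A \<le> \<bar>1 - exp t\<bar> * Lp_norm p \<mu> w"
      by (intro mult_left_mono Aw) simp
    also have "Lp_norm p \<mu> (\<lambda>x. w x - ?A x) = Lp_norm p \<mu> (\<lambda>x. ?A x - w x)"
      by (rule Lp_norm_minus_commute)
    finally show ?case by (simp add: Lp_norm_nonneg)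
  qed
qed

text \<open>On \<open>L^\<infinity>\<close> the averages need not converge in norm; symmetry moves
  them onto \<open>g\<close>, and on \<open>L^1\<close> they do.\<close>

lemma smoothed_tendsto_weak:
  assumes w: "w \<in> Lp_space top \<mu>" and g: "g \<in> Lp_space 1 \<mu>"
  shows "((\<lambda>t. LINT x|\<mu>. smoothed t w x * g x) \<longlongrightarrow> (LINT x|\<mu>. (R w x - w x) * g x)) (at_right 0)"
proof -
  have top: "1 \<le> (top::ennreal)" by simp
  note Rw = R_Lp[OF top w]
  have i: "integrable \<mu> (\<lambda>x. f x * g x)" if "f \<in> Lp_space top \<mu>" for f
    using integrable_L1_Linfty(1)[OF g that] by (simp add: mult.commute)
  have lim: "((\<lambda>t. LINT x|\<mu>. kernel_op (A t) g x * w x) \<longlongrightarrow> (LINT x|\<mu>. g x * w x)) (at_right 0)"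
  proof (rule LIM_zero_cancel, rule Lim_null_comparison)
    show "((\<lambda>t. Lp_norm 1 \<mu> (\<lambda>x. kernel_op (A t) g x - g x) * Lp_norm top \<mu> w) \<longlongrightarrow> 0) (at_right 0)"
      by (rule tendsto_mult_left_zero[OF A_tendsto]) (use g in auto)
    show "eventually (\<lambda>t. norm ((LINT x|\<mu>. kernel_op (A t) g x * w x) - (LINT x|\<mu>. g x * w x))
        \<le> Lp_norm 1 \<mu> (\<lambda>x. kernel_op (A t) g x - g x) * Lp_norm top \<mu> w) (at_right 0)"
      using at_right_0_pos
    proof eventually_elim
      case (elim t)
      note Ag = A_Lp(1)[OF elim order_refl g]
      have "(LINT x|\<mu>. kernel_op (A t) g x * w x) - (LINT x|\<mu>. g x * w x) = (LINT x|\<mu>. (kernel_op (A t) g x - g x) * w x)"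
        using integrable_L1_Linfty(1)[OF Ag w] integrable_L1_Linfty(1)[OF g w] by (simp add: left_diff_distrib)
      then show ?case
        using integrable_L1_Linfty(2)[OF Lp_space_diff[OF order_refl Ag g] w] by simp
    qed
  qed
  have "((\<lambda>t. of_real ((exp t - 1) / t) * (LINT x|\<mu>. R w x * g x) - of_real (exp t) * (LINT x|\<mu>. kernel_op (A t) g x * w x))
      \<longlongrightarrow> of_real 1 * (LINT x|\<mu>. R w x * g x) - of_real 1 * (LINT x|\<mu>. g x * w x)) (at_right 0)"
    by (intro tendsto_diff tendsto_mult tendsto_of_real exp_quotient_tendsto exp_tendsto_1 lim tendsto_const)
  moreover have "eventually (\<lambda>t. of_real ((exp t - 1) / t) * (LINT x|\<mu>. R w x * g x)
      - of_real (exp t) * (LINT x|\<mu>. kernel_op (A t) g x * w x) = (LINT x|\<mu>. smoothed t w x * g x)) (at_right 0)"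
    using at_right_0_pos
  proof eventually_elim
    case (elim t)
    interpret symmetric_kernel \<mu> "A t" by (rule symmetric_kernel_A[OF elim])
    have e: "smoothed t w x * g x = of_real ((exp t - 1) / t) * (R w x * g x) - of_real (exp t) * (kernel_op (A t) w x * g x)" for x
      by (simp add: smoothed_def algebra_simps)
    have "(LINT x|\<mu>. smoothed t w x * g x)
        = of_real ((exp t - 1) / t) * (LINT x|\<mu>. R w x * g x) - of_real (exp t) * (LINT x|\<mu>. kernel_op (A t) w x * g x)"
      unfolding e
      by (simp only: integral_mult_right_zero Bochner_Integration.integral_diff integrable_mult_right i Rw A_Lp(1)[OF elim top w])
    also have "(LINT x|\<mu>. kernel_op (A t) w x * g x) = (LINT x|\<mu>. kernel_op (A t) g x * w x)"
      using pairing_L1_Linfty[OF g w] by (simp add: mult.commute)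
    finally show ?case by simp
  qed
  ultimately have "((\<lambda>t. LINT x|\<mu>. smoothed t w x * g x)
      \<longlongrightarrow> of_real 1 * (LINT x|\<mu>. R w x * g x) - of_real 1 * (LINT x|\<mu>. g x * w x)) (at_right 0)"
    by (rule Lim_transform_eventually)
  moreover have "(LINT x|\<mu>. (R w x - w x) * g x) = (LINT x|\<mu>. R w x * g x) - (LINT x|\<mu>. g x * w x)"
    using i[OF Rw] i[OF w] by (simp add: left_diff_distrib mult.commute[of "g _"])
  ultimately show ?thesis by simp
qed

text \<open>For a generator \<open>L\<close> with \<open>v = L u\<close> this reads
  \<open>u = (1 - L)\<inverse> (u - v)\<close>: only a bounded operator occurs, and the form is the
  same for all exponents.\<close>

definition resolvent_graph :: "ennreal \<Rightarrow> (('a \<Rightarrow> complex) \<times> ('a \<Rightarrow> complex)) set" where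
  "resolvent_graph p = {(u, v). u \<in> Lp_space p \<mu> \<and> v \<in> Lp_space p \<mu> \<and> (AE x in \<mu>. u x = R (\<lambda>y. u y - v y) x)}"

lemma transition_op_Lp: "f \<in> Lp_space p \<mu> \<Longrightarrow> transition_op X P t f = kernel_op (K t) f"
  using kernel_op_K[OF Lp_measurable] by (intro ext) simp

lemma Lp_generator_finite_iff:
  "p \<noteq> top \<Longrightarrow> (u, v) \<in> Lp_generator p \<mu> (transition_op X P) \<longleftrightarrow>
    u \<in> Lp_space p \<mu> \<and> v \<in> Lp_space p \<mu> \<and> ((\<lambda>t. Lp_norm p \<mu> (\<lambda>x. quotient t u x - v x)) \<longlongrightarrow> 0) (at_right 0)"
  by (auto simp: Lp_generator_def transition_op_Lp)

lemma Lp_generator_top_iff: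
  "(u, v) \<in> Lp_generator top \<mu> (transition_op X P) \<longleftrightarrow> u \<in> Lp_space top \<mu> \<and> v \<in> Lp_space top \<mu> \<and>
    (\<forall>g\<in>Lp_space 1 \<mu>. ((\<lambda>t. LINT x|\<mu>. quotient t u x * g x) \<longlongrightarrow> (LINT x|\<mu>. v x * g x)) (at_right 0))"
  by (auto simp: Lp_generator_def transition_op_Lp)

lemma resolvent_graph_quotient:
  assumes p: "1 \<le> p" and uv: "(u, v) \<in> resolvent_graph p" and t: "0 < t"
  shows "AE x in \<mu>. quotient t u x = smoothed t (\<lambda>y. u y - v y) x"
    and "AE x in \<mu>. v x = R (\<lambda>y. u y - v y) x - (u x - v x)"
proof -
  have u: "u \<in> Lp_space p \<mu>" and v: "v \<in> Lp_space p \<mu>" and eq: "AE x in \<mu>. u x = R (\<lambda>y. u y - v y) x"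
    using uv by (auto simp: resolvent_graph_def)
  note w = Lp_space_diff[OF p u v]
  interpret symmetric_kernel \<mu> "K t" by (rule symmetric_kernel_K[OF less_imp_le[OF t]])
  have "AE x in \<mu>. T u x = T (R (\<lambda>y. u y - v y)) x"
    by (rule T_cong[OF Lp_space_measurable[OF u] Lp_space_measurable[OF R_Lp[OF p w]] eq])
  with eq quotient_R[OF p w t] show "AE x in \<mu>. quotient t u x = smoothed t (\<lambda>y. u y - v y) x"
    by eventually_elim simp
  from eq show "AE x in \<mu>. v x = R (\<lambda>y. u y - v y) x - (u x - v x)"
    by eventually_elim simp
qed

text \<open>For \<open>u = R w\<close> with \<open>w = u - v\<close> the difference quotients equal
  \<open>smoothed t w\<close>, which tends to \<open>R w - w = v\<close>. Conversely,
  \<open>R\<close> applied to the difference quotients of \<open>u\<close> equals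
  \<open>smoothed t u\<close>; its limits \<open>R v\<close> and \<open>R u - u\<close> must agree,
  which is \<open>u = R (u - v)\<close>. For \<open>p = \<infinity>\<close> both limits are taken
  against test functions.\<close>

theorem Lp_generator_eq_resolvent_graph:
  assumes p: "1 \<le> p"
  shows "Lp_generator p \<mu> (transition_op X P) = resolvent_graph p"
proof -
  have "(u, v) \<in> Lp_generator p \<mu> (transition_op X P) \<longleftrightarrow> (u, v) \<in> resolvent_graph p" for u v
  proof
    assume uv: "(u, v) \<in> resolvent_graph p"
    then have u: "u \<in> Lp_space p \<mu>" and v: "v \<in> Lp_space p \<mu>" by (auto simp: resolvent_graph_def)
    let ?w = "\<lambda>y. u y - v y"
    note w = Lp_space_diff[OF p u v]
    note Rw = Lp_space_diff[OF p R_Lp[OF p w] w]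
    show "(u, v) \<in> Lp_generator p \<mu> (transition_op X P)"
    proof (cases "p = top")
      case False
      have ev: "eventually (\<lambda>t. Lp_norm p \<mu> (\<lambda>x. smoothed t ?w x - (R ?w x - ?w x))
          = Lp_norm p \<mu> (\<lambda>x. quotient t u x - v x)) (at_right 0)"
        using at_right_0_pos
      proof eventually_elim
        case (elim t)
        show ?case
        proof (rule Lp_space_cong_AE(2)[OF p])
          show "(\<lambda>x. quotient t u x - v x) \<in> Lp_space p \<mu>"
            by (rule Lp_space_diff[OF p quotient_Lp[OF elim p u] v])
          show "(\<lambda>x. smoothed t ?w x - (R ?w x - ?w x)) \<in> borel_measurable \<mu>"
            by (rule Lp_space_measurable[OF Lp_space_diff[OF p smoothed_Lp[OF elim p w] Rw]])
          show "AE x in \<mu>. smoothed t ?w x - (R ?w x - ?w x) = quotient t u x - v x"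
            using resolvent_graph_quotient[OF p uv elim] by eventually_elim simp
        qed
      qed
      show ?thesis
        unfolding Lp_generator_finite_iff[OF False]
        by (intro conjI u v Lim_transform_eventually[OF smoothed_tendsto[OF p False w] ev])
    next
      case True
      have "((\<lambda>t. LINT x|\<mu>. quotient t u x * g x) \<longlongrightarrow> (LINT x|\<mu>. v x * g x)) (at_right 0)" if g: "g \<in> Lp_space 1 \<mu>" for g
      proof -
        have [measurable]: "g \<in> borel_measurable \<mu>" "u \<in> borel_measurable \<mu>" "v \<in> borel_measurable \<mu>" "R ?w \<in> borel_measurable \<mu>"
          by (rule Lp_space_measurable, rule g u v R_Lp[OF p w])+
        have "eventually (\<lambda>t. (LINT x|\<mu>. smoothed t ?w x * g x) = (LINT x|\<mu>. quotient t u x * g x)) (at_right 0)"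
          using at_right_0_pos
        proof eventually_elim
          case (elim t)
          note [measurable] = Lp_space_measurable[OF quotient_Lp[OF elim p u]] Lp_space_measurable[OF smoothed_Lp[OF elim p w]]
          have "AE x in \<mu>. smoothed t ?w x * g x = quotient t u x * g x"
            using resolvent_graph_quotient(1)[OF p uv elim] by eventually_elim (simp only:)
          then show ?case by (intro integral_cong_AE) simp_all
        qed
        from Lim_transform_eventually[OF smoothed_tendsto_weak[OF w[unfolded True] g] this]
        have "((\<lambda>t. LINT x|\<mu>. quotient t u x * g x) \<longlongrightarrow> (LINT x|\<mu>. (R ?w x - ?w x) * g x)) (at_right 0)" .
        moreover have "(LINT x|\<mu>. (R ?w x - ?w x) * g x) = (LINT x|\<mu>. v x * g x)"
          by (rule integral_cong_AE)
            (use resolvent_graph_quotient(2)[OF p uv zero_less_one] in \<open>auto elim!: eventually_mono\<close>)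
        ultimately show ?thesis by simp
      qed
      then show ?thesis using u v unfolding True Lp_generator_top_iff by simp
    qed
  next
    assume gen: "(u, v) \<in> Lp_generator p \<mu> (transition_op X P)"
    then have u: "u \<in> Lp_space p \<mu>" and v: "v \<in> Lp_space p \<mu>" by (auto simp: Lp_generator_def)
    interpret symmetric_kernel \<mu> G by (rule symmetric_kernel_G)
    note Ru = R_Lp[OF p u] and Rv = R_Lp[OF p v]
    note Ruu = Lp_space_diff[OF p Ru u]
    note d = Lp_space_diff[OF p Rv Ruu]
    have "AE x in \<mu>. R v x - (R u x - u x) = 0"
    proof (cases "p = top")
      case False
      let ?b = "\<lambda>t. Lp_norm p \<mu> (\<lambda>x. quotient t u x - v x) + Lp_norm p \<mu> (\<lambda>x. smoothed t u x - (R u x - u x))"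
      have "(?b \<longlongrightarrow> 0) (at_right 0)"
        by (rule tendsto_add_zero[OF _ smoothed_tendsto[OF p False u]])
          (use gen in \<open>simp add: Lp_generator_finite_iff[OF False]\<close>)
      moreover have "eventually (\<lambda>t. Lp_norm p \<mu> (\<lambda>x. R v x - (R u x - u x)) \<le> ?b t) (at_right 0)"
        using at_right_0_pos
      proof eventually_elim
        case (elim t)
        note q = quotient_Lp[OF elim p u] and s = smoothed_Lp[OF elim p u]
        have "Lp_norm p \<mu> (\<lambda>x. R v x - (R u x - u x))
            \<le> Lp_norm p \<mu> (\<lambda>x. R v x - R (quotient t u) x) + Lp_norm p \<mu> (\<lambda>x. R (quotient t u) x - (R u x - u x))"
          by (rule Lp_norm_diff_triangle[OF p Rv R_Lp[OF p q] Ruu])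
        also have "Lp_norm p \<mu> (\<lambda>x. R v x - R (quotient t u) x) \<le> Lp_norm p \<mu> (\<lambda>x. v x - quotient t u x)"
          by (rule T_diff_Lp_norm[OF p v q])
        also have "\<dots> = Lp_norm p \<mu> (\<lambda>x. quotient t u x - v x)" by (rule Lp_norm_minus_commute)
        also have "Lp_norm p \<mu> (\<lambda>x. R (quotient t u) x - (R u x - u x)) = Lp_norm p \<mu> (\<lambda>x. smoothed t u x - (R u x - u x))"
        proof (rule Lp_space_cong_AE(2)[OF p Lp_space_diff[OF p s Ruu]])
          show "(\<lambda>x. R (quotient t u) x - (R u x - u x)) \<in> borel_measurable \<mu>"
            by (rule Lp_space_measurable[OF Lp_space_diff[OF p R_Lp[OF p q] Ruu]])
          show "AE x in \<mu>. R (quotient t u) x - (R u x - u x) = smoothed t u x - (R u x - u x)"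
            using R_quotient[OF p u elim] by eventually_elim simp
        qed
        finally show ?case by simp
      qed
      ultimately have "Lp_norm p \<mu> (\<lambda>x. R v x - (R u x - u x)) \<le> 0"
        by (rule tendsto_lowerbound) simp
      then show ?thesis
        using Lp_norm_eq_0_iff[OF p d] Lp_norm_nonneg[of p \<mu> "\<lambda>x. R v x - (R u x - u x)"] by linarith
    next
      case True
      show ?thesis
      proof (rule test_functions_separate[OF p d])
        fix g assume g: "g \<in> L1_Linfty \<mu>"
        have g1: "g \<in> Lp_space 1 \<mu>" using g by (simp add: L1_Linfty_iff Lp_space_1_iff)
        note Rg = R_Lp[OF order_refl g1]
        \<comment> \<open>Testing against \<open>R g\<close> rather than \<open>g\<close>: symmetry
          moves \<open>R\<close> onto the quotient of \<open>u\<close>, which turns it into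
          \<open>smoothed t u\<close>.\<close>
        have "((\<lambda>t. LINT x|\<mu>. quotient t u x * R g x) \<longlongrightarrow> (LINT x|\<mu>. v x * R g x)) (at_right 0)"
          using gen Rg unfolding True Lp_generator_top_iff by blast
        moreover have "eventually (\<lambda>t. (LINT x|\<mu>. quotient t u x * R g x) = (LINT x|\<mu>. smoothed t u x * g x)) (at_right 0)"
          using at_right_0_pos
        proof eventually_elim
          case (elim t)
          note q = quotient_Lp[OF elim p u] and s = smoothed_Lp[OF elim p u]
          note [measurable] = Lp_space_measurable[OF R_Lp[OF p q]] Lp_space_measurable[OF s] Lp_space_measurable[OF g1]
          have "(LINT x|\<mu>. quotient t u x * R g x) = (LINT x|\<mu>. R (quotient t u) x * g x)"
            by (rule pairing_Lp_test[OF p q g, symmetric])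
          also have "\<dots> = (LINT x|\<mu>. smoothed t u x * g x)"
            by (rule integral_cong_AE) (use R_quotient[OF p u elim] in \<open>auto elim!: eventually_mono\<close>)
          finally show ?case .
        qed
        ultimately have "((\<lambda>t. LINT x|\<mu>. smoothed t u x * g x) \<longlongrightarrow> (LINT x|\<mu>. v x * R g x)) (at_right 0)"
          by (rule Lim_transform_eventually)
        from tendsto_unique[OF _ this smoothed_tendsto_weak[OF u[unfolded True] g1]]
        have "(LINT x|\<mu>. v x * R g x) = (LINT x|\<mu>. (R u x - u x) * g x)" by simp
        then have "(LINT x|\<mu>. R v x * g x) = (LINT x|\<mu>. (R u x - u x) * g x)"
          by (simp add: pairing_Lp_test[OF p v g])
        then show "(LINT x|\<mu>. (R v x - (R u x - u x)) * g x) = 0"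
          using integrable_Lp_test[OF p Rv g] integrable_Lp_test[OF p Ruu g] by (simp add: left_diff_distrib[of "R v _"])
      qed
    qed
    with R_diff[OF p u v] have "AE x in \<mu>. u x = R (\<lambda>y. u y - v y) x"
    proof eventually_elim
      case (elim x)
      from elim(2) have "u x = R u x - R v x" by (simp add: algebra_simps)
      with elim(1) show ?case by simp
    qed
    with u v show "(u, v) \<in> resolvent_graph p" by (simp add: resolvent_graph_def)
  qed
  then show ?thesis by auto
qed

section \<open>Spectrum, eigenfunctions and the final theorem\<close>

definition no_eigenfunction :: "('a \<Rightarrow> complex) set \<Rightarrow> complex \<Rightarrow> bool" where
  "no_eigenfunction S a \<longleftrightarrow> (\<forall>w\<in>S. (AE x in \<mu>. w x = a * R w x) \<longrightarrow> (AE x in \<mu>. w x = 0))"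

text \<open>For \<open>a \<noteq> 0\<close> such a \<open>w\<close> satisfies
  \<open>R w = inverse a * w\<close>, so compactness of \<open>R\<close> places it among the test
  functions, whatever the exponent; for \<open>a = 0\<close> it vanishes.\<close>

lemma no_eigenfunction_Lp_iff:
  assumes p: "1 \<le> p"
  shows "no_eigenfunction (Lp_space p \<mu>) a \<longleftrightarrow> no_eigenfunction (L1_Linfty \<mu>) a"
proof
  assume "no_eigenfunction (Lp_space p \<mu>) a"
  then show "no_eigenfunction (L1_Linfty \<mu>) a"
    unfolding no_eigenfunction_def using L1_Linfty_subset_Lp[OF p] by blast
next
  assume Y: "no_eigenfunction (L1_Linfty \<mu>) a"
  show "no_eigenfunction (Lp_space p \<mu>) a"
    unfolding no_eigenfunction_def
  proof (intro ballI impI)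
    fix w assume w: "w \<in> Lp_space p \<mu>" and eq: "AE x in \<mu>. w x = a * R w x"
    show "AE x in \<mu>. w x = 0"
    proof (cases "a = 0")
      case False
      have "AE x in \<mu>. R w x = inverse a * w x" using eq by eventually_elim (use False in \<open>simp add: field_simps\<close>)
      from symmetric_kernel.eigenfunction_L1_Linfty[OF symmetric_kernel_G G_compact _ p w this] False
      have "w \<in> L1_Linfty \<mu>" by simp
      with Y eq show ?thesis by (simp add: no_eigenfunction_def)
    qed (use eq in simp)
  qed
qed

text \<open>With \<open>v = z * u - f\<close> the graph relation becomes
  \<open>u - (1 - z) * R u = R f\<close>. The Fredholm alternative for \<open>(1 - z) * R\<close>
  therefore gives solvability and, as \<open>R\<close> is a contraction, the bound. Conversely a
  solution of \<open>w = (1 - z) * R w\<close> puts \<open>(w, z * w)\<close> into the graph, so it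
  must vanish when \<open>z\<close> is in the resolvent set.\<close>

lemma Lp_resolvent_set_iff:
  assumes p: "1 \<le> p"
  shows "z \<in> Lp_resolvent_set p \<mu> (resolvent_graph p) \<longleftrightarrow> no_eigenfunction (Lp_space p \<mu>) (1 - z)"
proof
  assume z: "z \<in> Lp_resolvent_set p \<mu> (resolvent_graph p)"
  show "no_eigenfunction (Lp_space p \<mu>) (1 - z)"
    unfolding no_eigenfunction_def
  proof (intro ballI impI)
    fix w assume w: "w \<in> Lp_space p \<mu>" and eq: "AE x in \<mu>. w x = (1 - z) * R w x"
    have "(\<lambda>y. w y - z * w y) = (\<lambda>y. (1 - z) * w y)" by (simp add: algebra_simps)
    then have "(w, \<lambda>x. z * w x) \<in> resolvent_graph p"
      using w eq Lp_space_scale[OF w, of z] by (simp add: resolvent_graph_def R_scale)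
    with z show "AE x in \<mu>. w x = 0" unfolding Lp_resolvent_set_def by fastforce
  qed
next
  assume N: "no_eigenfunction (Lp_space p \<mu>) (1 - z)"
  interpret symmetric_kernel \<mu> G by (rule symmetric_kernel_G)
  have inj: "AE x in \<mu>. w x = 0" if "w \<in> Lp_space p \<mu>" "AE x in \<mu>. w x = (1 - z) * R w x" for w
    using N that by (simp add: no_eigenfunction_def)
  note F = fredholm_Lp[OF G_compact p inj]
  have graph: "AE x in \<mu>. u x - (1 - z) * R u x = R (\<lambda>y. z * u y - v y) x"
    if u: "u \<in> Lp_space p \<mu>" and v: "v \<in> Lp_space p \<mu>" and eq: "AE x in \<mu>. u x = R (\<lambda>y. u y - v y) x" for u v
  proof -
    have e: "(\<lambda>y. (1 - z) * u y - (u y - v y)) = (\<lambda>y. - 1 * (z * u y - v y))" by (simp add: algebra_simps)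
    have "AE x in \<mu>. R (\<lambda>y. (1 - z) * u y - (u y - v y)) x = R (\<lambda>y. (1 - z) * u y) x - R (\<lambda>y. u y - v y) x"
      by (intro R_diff[OF p] Lp_space_scale Lp_space_diff[OF p] u v)
    with eq show ?thesis
      unfolding e R_scale by eventually_elim (simp add: algebra_simps)
  qed
  show "z \<in> Lp_resolvent_set p \<mu> (resolvent_graph p)"
    unfolding Lp_resolvent_set_def mem_Collect_eq
  proof (intro conjI ballI)
    fix q assume q: "q \<in> resolvent_graph p"
    obtain u v where uv: "q = (u, v)" by (cases q)
    have u: "u \<in> Lp_space p \<mu>" and v: "v \<in> Lp_space p \<mu>" and eq: "AE x in \<mu>. u x = R (\<lambda>y. u y - v y) x"
      using q by (auto simp: uv resolvent_graph_def)
    have "AE x in \<mu>. u x = 0" if zero: "AE x in \<mu>. z * u x - v x = 0"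
    proof (rule inj[OF u])
      have "AE x in \<mu>. R (\<lambda>y. z * u y - v y) x = R (\<lambda>_. 0) x"
        by (rule R_cong[OF Lp_space_diff[OF p Lp_space_scale[OF u] v] Lp_space_zero zero])
      with graph[OF u v eq] show "AE x in \<mu>. u x = (1 - z) * R u x"
        by eventually_elim (simp add: kernel_op_def)
    qed
    then show "case q of (u, v) \<Rightarrow> (AE x in \<mu>. z * u x - v x = 0) \<longrightarrow> (AE x in \<mu>. u x = 0)"
      by (simp add: uv)
  next
    fix f assume f: "f \<in> Lp_space p \<mu>"
    obtain u where u: "u \<in> Lp_space p \<mu>" and eq: "AE x in \<mu>. u x - (1 - z) * R u x = R f x"
      using F(2)[OF _ _ R_Lp[OF p f]] by blast
    \<comment> \<open>Forced by the requirement \<open>z * u - v = f\<close>.\<close>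
    let ?v = "\<lambda>x. z * u x - f x"
    have v: "?v \<in> Lp_space p \<mu>" by (intro Lp_space_diff[OF p] Lp_space_scale u f)
    have e: "(\<lambda>y. u y - ?v y) = (\<lambda>y. (1 - z) * u y - (- 1 * f y))" by (simp add: algebra_simps)
    have "AE x in \<mu>. R (\<lambda>y. (1 - z) * u y - (- 1 * f y)) x = R (\<lambda>y. (1 - z) * u y) x - R (\<lambda>y. - 1 * f y) x"
      by (intro R_diff[OF p] Lp_space_scale u f)
    with eq have "AE x in \<mu>. u x = R (\<lambda>y. u y - ?v y) x"
      unfolding e R_scale by eventually_elim (simp only: diff_eq_eq, simp)
    then have "(u, ?v) \<in> resolvent_graph p" using u v by (simp add: resolvent_graph_def)
    then show "\<exists>(u, v)\<in>resolvent_graph p. AE x in \<mu>. z * u x - v x = f x"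
      by (rule rev_bexI) simp
  next
    obtain C where C: "0 \<le> C" "\<And>w. w \<in> Lp_space p \<mu> \<Longrightarrow> Lp_norm p \<mu> w \<le> C * Lp_norm p \<mu> (\<lambda>x. w x - (1 - z) * R w x)"
      using F(1) by blast
    have "Lp_norm p \<mu> u \<le> C * Lp_norm p \<mu> (\<lambda>x. z * u x - v x)" if q: "(u, v) \<in> resolvent_graph p" for u v
    proof -
      have u: "u \<in> Lp_space p \<mu>" and v: "v \<in> Lp_space p \<mu>" and eq: "AE x in \<mu>. u x = R (\<lambda>y. u y - v y) x"
        using q by (auto simp: resolvent_graph_def)
      note f = Lp_space_diff[OF p Lp_space_scale[OF u, of z] v]
      have "Lp_norm p \<mu> (\<lambda>x. u x - (1 - z) * R u x) = Lp_norm p \<mu> (R (\<lambda>x. z * u x - v x))"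
        by (rule Lp_space_cong_AE(2)[OF p R_Lp[OF p f] _ graph[OF u v eq]])
          (rule Lp_space_measurable[OF Lp_space_diff[OF p u Lp_space_scale[OF R_Lp[OF p u]]]])
      also have "\<dots> \<le> Lp_norm p \<mu> (\<lambda>x. z * u x - v x)" by (rule T_Lp(2)[OF p f])
      finally show ?thesis using C(2)[OF u] mult_left_mono[OF _ C(1)] by (meson order_trans)
    qed
    then show "\<exists>C. \<forall>(u, v)\<in>resolvent_graph p. Lp_norm p \<mu> u \<le> C * Lp_norm p \<mu> (\<lambda>x. z * u x - v x)"
      by (intro exI[of _ C]) auto
  qed
qed

theorem Lp_spectrum_independent:
  assumes "1 \<le> p" "1 \<le> q"
  shows "Lp_spectrum p \<mu> (Lp_generator p \<mu> (transition_op X P)) = Lp_spectrum q \<mu> (Lp_generator q \<mu> (transition_op X P))"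
  using assms
  by (auto simp: Lp_spectrum_def Lp_generator_eq_resolvent_graph Lp_resolvent_set_iff no_eigenfunction_Lp_iff)

text \<open>\<open>v = z * u\<close> turns the graph relation into \<open>u = (1 - z) * R u\<close>.
  Here \<open>z = 1\<close> would make \<open>u\<close> vanish, so \<open>u\<close> is an
  eigenfunction of the compact operator \<open>R\<close> for a nonzero eigenvalue.\<close>

theorem Lp_eigenfunction_L1_Linfty:
  assumes p: "1 \<le> p" and u: "Lp_eigenfunction \<mu> (Lp_generator p \<mu> (transition_op X P)) u"
  shows "u \<in> L1_Linfty \<mu>"
proof -
  obtain z v where nz: "\<not> (AE x in \<mu>. u x = 0)" and uv: "(u, v) \<in> resolvent_graph p" and vz: "AE x in \<mu>. v x = z * u x"
    using u by (auto simp: Lp_eigenfunction_def Lp_generator_eq_resolvent_graph[OF p])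
  have uL: "u \<in> Lp_space p \<mu>" and vL: "v \<in> Lp_space p \<mu>" and eq: "AE x in \<mu>. u x = R (\<lambda>y. u y - v y) x"
    using uv by (auto simp: resolvent_graph_def)
  have "AE x in \<mu>. u x - v x = (1 - z) * u x" using vz by eventually_elim (simp add: algebra_simps)
  from R_cong[OF Lp_space_diff[OF p uL vL] Lp_space_scale[OF uL] this] eq
  have eq': "AE x in \<mu>. u x = (1 - z) * R u x" unfolding R_scale by eventually_elim simp
  have z: "1 - z \<noteq> 0"
  proof
    assume "1 - z = 0"
    with eq' nz show False by simp
  qed
  have "AE x in \<mu>. R u x = inverse (1 - z) * u x"
    using eq' by eventually_elim (use z in \<open>simp add: field_simps\<close>)
  from symmetric_kernel.eigenfunction_L1_Linfty[OF symmetric_kernel_G G_compact _ p uL this] z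
  show ?thesis by simp
qed

theorem transition_op_Lp_compact:
  assumes p: "1 \<le> p" and t: "0 < t"
  shows "Lp_compact_operator p \<mu> (transition_op X P t)"
proof -
  interpret symmetric_kernel \<mu> "K t" by (rule symmetric_kernel_K[OF less_imp_le[OF t]])
  have c: "Lp_compact_operator p \<mu> (kernel_op (K t))" by (rule Lp_compact[OF K_compact_Linfty[OF t] p])
  show ?thesis
  proof (rule Lp_compact_operatorI)
    have "transition_op X P t f = kernel_op (K t) f" if "f \<in> Lp_space p \<mu>" for f by (rule transition_op_Lp[OF that])
    with Lp_operator_T[OF p] show "Lp_operator p \<mu> (transition_op X P t)"
      unfolding Lp_operator_def by (simp add: Lp_space_add[OF p] Lp_space_scale)
  next
    fix f :: "nat \<Rightarrow> 'a \<Rightarrow> complex"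
    assume f: "\<And>n. f n \<in> Lp_space p \<mu>" "\<And>n. Lp_norm p \<mu> (f n) \<le> 1"
    obtain g r where g: "g \<in> Lp_space p \<mu>" "strict_mono (r::nat \<Rightarrow> nat)"
      "(\<lambda>n. Lp_norm p \<mu> (\<lambda>x. kernel_op (K t) (f (r n)) x - g x)) \<longlonglongrightarrow> 0"
      by (rule Lp_compact_operatorE[OF c f])
    then show "\<exists>g r. g \<in> Lp_space p \<mu> \<and> strict_mono (r::nat \<Rightarrow> nat) \<and>
        (\<lambda>n. Lp_norm p \<mu> (\<lambda>x. transition_op X P t (f (r n)) x - g x)) \<longlonglongrightarrow> 0"
      by (intro exI[of _ g] exI[of _ r] conjI) (simp_all add: transition_op_Lp[OF f(1)])
  qed
qed

end

theorem theorem2p4: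
  fixes \<mu> :: "'a::{metric_space, second_countable_topology} measure"
    and M :: "'w measure"
    and X :: "ennreal \<Rightarrow> 'w \<Rightarrow> 'a option"
    and P :: "'a option \<Rightarrow> 'w measure"
  assumes "locally_compact_space (euclidean :: 'a topology)"
    and "radon_measure \<mu>" and "full_support \<mu>"
    and "hunt_process M X P" and "symmetric_process \<mu> X P"
    and "strong_feller X P"
    and "tightness_property X P"
    and "local_Linfty_compactness \<mu> X P"
  shows "(\<forall>p\<ge>1. \<forall>t>0. Lp_compact_operator p \<mu> (transition_op X P t)) \<and>
    (\<forall>p\<ge>1. \<forall>q\<ge>1.
       Lp_spectrum p \<mu> (Lp_generator p \<mu> (transition_op X P))
         = Lp_spectrum q \<mu> (Lp_generator q \<mu> (transition_op X P))) \<and>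
    (\<forall>u. Lp_eigenfunction \<mu> (Lp_generator 2 \<mu> (transition_op X P)) u \<longrightarrow>
       (\<forall>p\<ge>1. u \<in> Lp_space p \<mu>))"
proof -
  interpret symmetric_hunt_process M X P \<mu>
    using assms by (intro symmetric_hunt_process.intro symmetric_hunt_process_axioms.intro)
  have two: "1 \<le> (2::ennreal)" by simp
  show ?thesis
  proof (intro conjI allI impI)
    fix p :: ennreal and t :: real assume "1 \<le> p" "0 < t"
    then show "Lp_compact_operator p \<mu> (transition_op X P t)" by (rule transition_op_Lp_compact)
  next
    fix p q :: ennreal assume "1 \<le> p" "1 \<le> q"
    then show "Lp_spectrum p \<mu> (Lp_generator p \<mu> (transition_op X P))
         = Lp_spectrum q \<mu> (Lp_generator q \<mu> (transition_op X P))" by (rule Lp_spectrum_independent)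
  next
    fix u p assume "Lp_eigenfunction \<mu> (Lp_generator 2 \<mu> (transition_op X P)) u" "1 \<le> (p::ennreal)"
    then show "u \<in> Lp_space p \<mu>"
      using L1_Linfty_subset_Lp[OF _ Lp_eigenfunction_L1_Linfty[OF two]] by blast
  qed
qed

end
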